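(* Let $\mathbf{p}$, $\mu$, $\nu$ be the infinite word and morphisms defined in the context. (a) The word $\mu(\mathbf{p})$ is $\tfrac{28}{11}^+$-free and contains $18$ palindromes. Every bi-infinite $\tfrac{13}{5}$-free binary word containing at most $18$ palindromes has the same set of factors as one of $\mu(\mathbf{p})$, $\overline{\mu(\mathbf{p})}$, $\mu(\mathbf{p})^R$, $\overline{\mu(\mathbf{p})^R}$. (b) The word $\nu(\mathbf{p})$ is $\tfrac{5}{2}^+$-free and contains $20$ palindromes. Every recurrent $\tfrac{28}{11}$-free binary word containing at most $20$ palindromes has the same set of factors as one of $\nu(\mathbf{p})$, $\overline{\nu(\mathbf{p})}$, $\nu(\mathbf{p})^R$, $\overline{\nu(\mathbf{p})^R}$.
   Context: The word $\mathbf{p}=\varphi^\omega(\mathtt{0})$ is the infinite (right-infinite) fixed point, starting with $\mathtt{0}$, of the morphism $\varphi$ on $\{\mathtt{0},\mathtt{1},\mathtt{2}\}^*$ given by $\varphi(\mathtt{0})=\mathtt{01}$, $\varphi(\mathtt{1})=\mathtt{21}$, $\varphi(\mathtt{2})=\mathtt{0}$. The morphisms $\mu,\nu:\{\mathtt{0},\mathtt{1},\mathtt{2}\}^*\to\{\mathtt{0},\mathtt{1}\}^*$ are given by $\mu(\mathtt{0})=\mathtt{011001}$, $\mu(\mathtt{1})=\mathtt{1001}$, $\mu(\mathtt{2})=\mathtt{0}$ and $\nu(\mathtt{0})=\mathtt{011}$, $\nu(\mathtt{1})=\mathtt{0}$, $\nu(\mathtt{2})=\mathtt{01}$; morphisms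 extend letterwise to infinite words. A binary word is a word over $\{\mathtt{0},\mathtt{1}\}$; its bit complement $\overline{w}$ is obtained by exchanging $\mathtt{0}$ and $\mathtt{1}$, and $w^R$ denotes the reversal (the reversal of a right-infinite word is a left-infinite word, whose factors are exactly the reversals of the factors of the original word). A palindrome is a finite word $w$ with $w=w^R$; the number of palindromes contained in a word is the number of distinct palindromes among its finite factors, including the empty word. A repetition with (non-empty) period $u$ and exponent $e$ is a prefix $v$ of $u^\omega$ with $e=|v|/|u|$. A word is $\alpha^+$-free (resp. $\alpha$-free) if it has no factor that is a repetition of exponent $>\alpha$ (resp. $\ge\alpha$). An infinite (right-infinite or bi-infinite) word is recurrent if each of its factors occurs infinitely many times in it. *)

theory Defs
  imports Complex_Main "HOL-Library.Omega_Words_Fun"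
begin

text \<open>
  Finite words are lists. Right-infinite words are functions on \<open>nat\<close> (type \<open>'a word\<close>),
  bi-infinite words are functions on \<open>int\<close>. A left-infinite word is also given by a function
  on \<open>nat\<close>, read from right to left: \<open>w n\<close> is the letter with \<open>n\<close> letters to its right.
  With this encoding the reversal of the right-infinite word \<open>w\<close> is the left-infinite word given
  by the same function \<open>w\<close>, and bit complementation is the same operation in both cases.
\<close>

datatype letter = T0 | T1 | T2

text \<open>The binary alphabet is \<open>bool\<close>; the bit complement of a letter is negation.\<close>

abbreviation (input) bit_zero :: bool ("\<zero>") where "\<zero> \<equiv> False"
abbreviation (input) bit_one :: bool ("\<one>") where "\<one> \<equiv> True"

definition complement :: "bool word \<Rightarrow> bool word" where
  "complement w = (\<lambda>n. \<not> w n)"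


subsection \<open>Factors\<close>

definition factors :: "'a word \<Rightarrow> 'a list set" where
  "factors w = {w [i \<rightarrow> j] | i j. True}"

definition left_factors :: "'a word \<Rightarrow> 'a list set" where
  "left_factors w = {rev (w [i \<rightarrow> j]) | i j. True}"

definition bi_subword :: "(int \<Rightarrow> 'a) \<Rightarrow> int \<Rightarrow> nat \<Rightarrow> 'a list" where
  "bi_subword w i n = map (\<lambda>k. w (i + int k)) [0..<n]"

definition bi_factors :: "(int \<Rightarrow> 'a) \<Rightarrow> 'a list set" where
  "bi_factors w = {bi_subword w i n | i n. True}"

definition recurrent :: "'a word \<Rightarrow> bool" where
  "recurrent w \<longleftrightarrow> (\<forall>v \<in> factors w. infinite {i. w [i \<rightarrow> i + length v] = v})"

definition bi_recurrent :: "(int \<Rightarrow> 'a) \<Rightarrow> bool" where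
  "bi_recurrent w \<longleftrightarrow> (\<forall>v \<in> bi_factors w. infinite {i. bi_subword w i (length v) = v})"


subsection \<open>Palindromes and repetitions\<close>

text \<open>The following notions depend only on the set \<open>F\<close> of factors of a word.\<close>

definition palindromes :: "'a list set \<Rightarrow> 'a list set" where
  "palindromes F = {v \<in> F. rev v = v}"

definition repetition :: "'a list \<Rightarrow> real \<Rightarrow> 'a list \<Rightarrow> bool" where
  "repetition u e v \<longleftrightarrow>
     u \<noteq> [] \<and> v = prefix (length v) (u\<^sup>\<omega>) \<and> e = real (length v) / real (length u)"

definition power_free :: "real \<Rightarrow> 'a list set \<Rightarrow> bool" where
  "power_free \<alpha> F \<longleftrightarrow> \<not> (\<exists>v \<in> F. \<exists>u e. repetition u e v \<and> e \<ge> \<alpha>)"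

definition power_plus_free :: "real \<Rightarrow> 'a list set \<Rightarrow> bool" where
  "power_plus_free \<alpha> F \<longleftrightarrow> \<not> (\<exists>v \<in> F. \<exists>u e. repetition u e v \<and> e > \<alpha>)"


subsection \<open>Morphisms\<close>

text \<open>A morphism is given by the images of the letters.\<close>

definition morph :: "('a \<Rightarrow> 'b list) \<Rightarrow> 'a list \<Rightarrow> 'b list" where
  "morph h w = concat (map h w)"

text \<open>
  For non-erasing \<open>h\<close>, the image of a prefix of length \<open>n + 1\<close> has length at least \<open>n + 1\<close>, so it
  determines the letter at position \<open>n\<close> of the image of the infinite word.
\<close>

definition morph_word :: "('a \<Rightarrow> 'b list) \<Rightarrow> 'a word \<Rightarrow> 'b word" where
  "morph_word h w = (\<lambda>n. morph h (prefix (Suc n) w) ! n)"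

fun phi :: "letter \<Rightarrow> letter list" where
  "phi T0 = [T0, T1]"
| "phi T1 = [T2, T1]"
| "phi T2 = [T0]"

fun mu :: "letter \<Rightarrow> bool list" where
  "mu T0 = [\<zero>, \<one>, \<one>, \<zero>, \<zero>, \<one>]"
| "mu T1 = [\<one>, \<zero>, \<zero>, \<one>]"
| "mu T2 = [\<zero>]"

fun nu :: "letter \<Rightarrow> bool list" where
  "nu T0 = [\<zero>, \<one>, \<one>]"
| "nu T1 = [\<zero>]"
| "nu T2 = [\<zero>, \<one>]"

text \<open>
  The limit of the iterates of \<open>phi\<close> on \<open>T0\<close>, each of which is a prefix of the next; the \<open>n\<close>-th
  iterate has length greater than \<open>n\<close>. It is the unique fixed point starting with \<open>T0\<close>
  (theorem \<open>p_unique_fixed_point\<close> below).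
\<close>

definition p :: "letter word" where
  "p = (\<lambda>n. (morph phi ^^ n) [T0] ! n)"


subsection \<open>Adequacy of the definitions\<close>

lemma morph_append: "morph h (u @ v) = morph h u @ morph h v"
  by (simp add: morph_def)

lemma length_morph_ge:
  assumes "\<And>a. h a \<noteq> []"
  shows "length w \<le> length (morph h w)"
proof (induction w)
  case (Cons a w)
  have "length (h a) \<ge> 1" using assms[of a] by (cases "h a") auto
  with Cons show ?case by (simp add: morph_def)
qed (simp add: morph_def)

lemma morph_word_nth:
  assumes h: "\<And>a. h a \<noteq> []" and i: "i < length (morph h (prefix m w))"
  shows "morph_word h w i = morph h (prefix m w) ! i"
proof -
  have i': "i < length (morph h (prefix (Suc i) w))"
    using length_morph_ge[of h "prefix (Suc i) w"] h by (simp del: subseq_to_Suc)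
  show ?thesis
  proof (cases "m \<le> Suc i")
    case True
    then obtain d where "Suc i = m + d" using le_Suc_ex by blast
    then have "prefix (Suc i) w = prefix m w @ w [m \<rightarrow> m + d]"
      by (simp only: subsequence_append)
    then show ?thesis using i by (simp add: morph_word_def morph_append nth_append del: subseq_to_Suc)
  next
    case False
    then obtain d where "m = Suc i + d" using le_Suc_ex nat_le_linear by blast
    then have "prefix m w = prefix (Suc i) w @ w [Suc i \<rightarrow> Suc i + d]"
      by (simp only: subsequence_append)
    then show ?thesis using i'
      by (simp add: morph_word_def morph_append nth_append del: subseq_to_Suc)
  qed
qed

lemma phi_nonerasing: "phi a \<noteq> []"
  by (cases a) auto

lemma mu_nonerasing: "mu a \<noteq> []"
  by (cases a) auto

lemma nu_nonerasing: "nu a \<noteq> []"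
  by (cases a) auto

lemma morph_pow_append:
  fixes h :: "'a \<Rightarrow> 'a list"
  shows "(morph h ^^ n) (u @ v) = (morph h ^^ n) u @ (morph h ^^ n) v"
  by (induction n) (simp_all add: morph_append)

lemma phi_pow_Suc: "(morph phi ^^ Suc n) [T0] = (morph phi ^^ n) [T0] @ (morph phi ^^ n) [T1]"
proof -
  have "(morph phi ^^ Suc n) [T0] = (morph phi ^^ n) ([T0] @ [T1])"
    by (simp add: funpow_swap1 morph_def)
  then show ?thesis by (simp only: morph_pow_append)
qed

lemma length_phi_pow_ge: "length w \<le> length ((morph phi ^^ n) w)"
proof (induction n)
  case (Suc n)
  then show ?case
    using length_morph_ge[of phi "(morph phi ^^ n) w"] phi_nonerasing by (auto intro: order_trans)
qed simp

lemma length_phi_pow: "n < length ((morph phi ^^ n) [T0])"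
proof (induction n)
  case (Suc n)
  then show ?case using length_phi_pow_ge[of "[T1]" n] by (simp only: phi_pow_Suc) simp
qed simp

lemma phi_pow_prefix: "\<exists>t. (morph phi ^^ (n + d)) [T0] = (morph phi ^^ n) [T0] @ t"
proof (induction d)
  case (Suc d)
  then show ?case using phi_pow_Suc[of "n + d"] by auto
qed simp

lemma p_nth:
  assumes "i < length ((morph phi ^^ n) [T0])"
  shows "p i = (morph phi ^^ n) [T0] ! i"
proof (cases "i \<le> n")
  case True
  then obtain d where "n = i + d" using le_Suc_ex by blast
  then show ?thesis using phi_pow_prefix[of i d] length_phi_pow[of i]
    by (auto simp: p_def nth_append)
next
  case False
  then obtain d where "i = n + d" using le_Suc_ex nat_le_linear by blast
  then show ?thesis using phi_pow_prefix[of n d] assms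
    by (auto simp: p_def nth_append)
qed

lemma p_prefix: "prefix (length ((morph phi ^^ n) [T0])) p = (morph phi ^^ n) [T0]"
  by (rule nth_equalityI) (simp_all add: p_nth)

theorem p_unique_fixed_point: "w 0 = T0 \<and> morph_word phi w = w \<longleftrightarrow> w = p"
proof
  assume w: "w 0 = T0 \<and> morph_word phi w = w"
  have pre: "prefix (length ((morph phi ^^ n) [T0])) w = (morph phi ^^ n) [T0]" for n
  proof (induction n)
    case 0
    then show ?case using w by simp
  next
    case (Suc n)
    let ?L = "(morph phi ^^ n) [T0]"
    have "w i = morph phi ?L ! i" if "i < length (morph phi ?L)" for i
      using morph_word_nth[where h = phi and i = i and w = w and m = "length ?L"] that w Suc phi_nonerasing by simp
    then show ?case by (intro nth_equalityI) simp_all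
  qed
  show "w = p"
  proof
    fix i
    have "w i = (morph phi ^^ i) [T0] ! i"
      using pre[of i] length_phi_pow[of i]
      by (metis add_0 diff_zero subsequence_nth)
    then show "w i = p i" by (simp add: p_def)
  qed
next
  assume "w = p"
  moreover have "p 0 = T0" by (simp add: p_def)
  moreover have "morph_word phi p i = p i" for i
  proof -
    let ?L = "(morph phi ^^ i) [T0]"
    have i: "i < length (morph phi ?L)"
      using length_phi_pow[of "Suc i"] by simp
    then have "morph_word phi p i = morph phi ?L ! i"
      using morph_word_nth[where h = phi and i = i and w = p and m = "length ?L"] phi_nonerasing by (simp add: p_prefix)
    also have "\<dots> = p i" using p_nth[of i "Suc i"] i by simp
    finally show ?thesis .
  qed
  ultimately show "w 0 = T0 \<and> morph_word phi w = w" by auto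
qed

lemma left_factors_eq: "left_factors w = rev ` factors w"
  by (auto simp: left_factors_def factors_def)

end

theory Submission
  imports Defs
begin

text \<open>
  Classification. Let \<open>L\<close> be the set of factors of a bi-infinite or recurrent word that satisfies
  the hypotheses. Bounded search trees, whose leaves exhibit a long power or too many palindromes,
  show that certain words cannot occur in \<open>L\<close>; since any two factors occur jointly, it follows that,
  up to complement and reversal, \<open>L\<close> avoids a short list of words. This list forces every word of
  \<open>L\<close> to factor into the blocks of \<open>nu\<close>, or into those of a conjugate of \<open>mu \<circ> phi\<close> whose blocks
  are marked by 0101. The preimage avoids a list of ternary words that is preserved when \<open>phi\<close> is
  inverted twice, so by descent on the length it is the set of factors of \<open>p\<close>.

  Exponents. A maximal repetition of positive excess in \<open>p\<close> is the image under \<open>phi\<close> of a shorter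
  one, extended at both ends by at most one letter; the number of letters depends only on the pairs
  of letters that break the period, and these pairs alternate under \<open>phi\<close>. Adding up the extensions
  over all levels gives two potentials that are linear in the lengths of the images of the letters.
  The exponent is thereby bounded by a condition on the repetitions without excess, where it follows
  from the linear recurrence of these lengths. The palindromes are found by inspection, because none
  of those of maximal length extends to a longer one.
\<close>

text \<open>Two obstacles shape the argument. A trap excludes only one order of two words. For 13/5
  both orders get excluded, so a common occurrence, which every bi-infinite word provides, is
  contradictory. For 28/11 the choice between a language and its reversal rests on one excluded
  order, and recurrence must supply that order; reversal is of no help, because it exchanges the two
  lists of words and their order at once. Desubstitution, in turn, needs blocks with a common
  beginning by which all cuts are recognized. The blocks of \<open>phi\<close> have none, but those
  of its square all start with \<open>T0\<close> and contain it nowhere else, whence the inversion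
  in steps of two. The blocks of \<open>mu\<close> have none either; they acquire one only after
  composition with \<open>phi\<close> and conjugation. A repetition with period \<open>q\<close>
  that continues for \<open>e\<close> letters beyond its first period has exponent
  \<open>1 + e / q\<close>. The bounds 5/2 and 28/11 are therefore treated as the bounds 3/2 and
  17/11 for the quotient of this excess by the period.\<close>

section \<open>Extendable languages, periods, and the symmetries of the problem\<close>

text \<open>The factor sets of bi-infinite words and of recurrent right-infinite words are both of
  this kind. Such sets can be reversed, complemented and desubstituted without reference to
  positions.\<close>

definition bi_extendable :: "'a list set \<Rightarrow> bool" where
  "bi_extendable L \<longleftrightarrow> [] \<in> L \<and> (\<forall>u v w. u @ v @ w \<in> L \<longrightarrow> v \<in> L) \<and>
     (\<forall>w \<in> L. \<exists>a. a # w \<in> L) \<and> (\<forall>w \<in> L. \<exists>a. w @ [a] \<in> L)"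

lemma bi_extendable_infix: "bi_extendable L \<Longrightarrow> u @ v @ w \<in> L \<Longrightarrow> v \<in> L"
  unfolding bi_extendable_def by blast

lemma bi_extendable_prefix: "bi_extendable L \<Longrightarrow> u @ v \<in> L \<Longrightarrow> u \<in> L"
  using bi_extendable_infix[of L "[]" u v] by simp

lemma bi_extendable_suffix: "bi_extendable L \<Longrightarrow> u @ v \<in> L \<Longrightarrow> v \<in> L"
  using bi_extendable_infix[of L u v "[]"] by simp

lemma bi_extendable_rev:
  assumes "bi_extendable L" shows "bi_extendable (rev ` L)"
proof -
  have mem: "v \<in> rev ` L \<longleftrightarrow> rev v \<in> L" for v by (metis image_iff rev_rev_ident)
  have "rev v \<in> L" if "rev w @ rev v @ rev u \<in> L" for u v w
    using assms that by (rule bi_extendable_infix)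
  then show ?thesis
    using assms unfolding bi_extendable_def mem by (auto simp: mem)
qed

lemma bi_extendable_map:
  assumes "bi_extendable L" shows "bi_extendable (map f ` L)"
  unfolding bi_extendable_def
proof (intro conjI allI impI ballI)
  show "[] \<in> map f ` L" using assms unfolding bi_extendable_def by force
next
  fix u v w assume "u @ v @ w \<in> map f ` L"
  then obtain x where "x \<in> L" "map f x = u @ v @ w" by auto
  then have "v = map f (take (length v) (drop (length u) x))"
    by (metis append_eq_conv_conj drop_map take_map)
  moreover have "x = take (length u) x @ take (length v) (drop (length u) x)
      @ drop (length v) (drop (length u) x)" by (metis append_take_drop_id)
  ultimately obtain u' v' w' where "x = u' @ v' @ w'" "map f v' = v" by metis
  with \<open>x \<in> L\<close> have "v' \<in> L" using bi_extendable_infix[OF assms] by simp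
  with \<open>map f v' = v\<close> show "v \<in> map f ` L" by blast
next
  fix w assume "w \<in> map f ` L"
  then obtain x where x: "x \<in> L" "w = map f x" by auto
  then obtain a b where "a # x \<in> L" "x @ [b] \<in> L" using assms unfolding bi_extendable_def by blast
  then have "map f (a # x) \<in> map f ` L" "map f (x @ [b]) \<in> map f ` L" by blast+
  then have *: "f a # w \<in> map f ` L" "w @ [f b] \<in> map f ` L" using x(2) by simp_all
  show "\<exists>a. a # w \<in> map f ` L" using *(1) by (rule exI)
  show "\<exists>a. w @ [a] \<in> map f ` L" using *(2) by (rule exI)
qed

text \<open>Replaces the period word by its length, after which exponents are a matter of comparing
  letters at a fixed distance. The predicate \<open>Q\<close> covers \<open>\<ge>\<close> and
  \<open>>\<close> alike.\<close>

lemma repetition_iff: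
  "(\<exists>u e. repetition u e v \<and> Q e \<and> length u = q) \<longleftrightarrow>
     0 < q \<and> (\<forall>i. i + q < length v \<longrightarrow> v ! i = v ! (i + q)) \<and> Q (length v / q)"
proof
  assume "\<exists>u e. repetition u e v \<and> Q e \<and> length u = q"
  then obtain u where u: "u \<noteq> []" "v = prefix (length v) (u\<^sup>\<omega>)" "Q (length v / q)" "length u = q"
    unfolding repetition_def by auto
  have nth: "v ! i = u ! (i mod q)" if "i < length v" for i
  proof -
    have "v ! i = prefix (length v) (u\<^sup>\<omega>) ! i" using u(2) by simp
    then show ?thesis using that u(1,4) by (simp add: iter_def)
  qed
  have "v ! i = v ! (i + q)" if "i + q < length v" for i
    using nth[of i] nth[of "i + q"] that by simp
  with u show "0 < q \<and> (\<forall>i. i + q < length v \<longrightarrow> v ! i = v ! (i + q)) \<and> Q (length v / q)"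
    by auto
next
  assume q: "0 < q \<and> (\<forall>i. i + q < length v \<longrightarrow> v ! i = v ! (i + q)) \<and> Q (length v / q)"
  \<comment> \<open>If \<open>v\<close> is shorter than the period, the remaining letters of
    \<open>u\<close> are arbitrary.\<close>
  define u where "u = map (\<lambda>i. if i < length v then v ! i else undefined) [0..<q]"
  have len: "length u = q" by (simp add: u_def)
  have "v ! i = v ! (i mod q)" if "i < length v" for i
    using that
  proof (induction i rule: less_induct)
    case (less i)
    show ?case
    proof (cases "i < q")
      case False
      then have "v ! (i - q) = v ! i" using q less.prems by auto
      then show ?thesis using less.IH[of "i - q"] less.prems False q by (simp add: le_mod_geq)
    qed simp
  qed
  moreover have "i mod q < q" for i using q by simp
  moreover have "u ! j = v ! j" if "j < q" "j < length v" for j using that by (simp add: u_def)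
  ultimately have "v ! i = u ! (i mod q)" if "i < length v" for i
    using that by (metis mod_less_eq_dividend order.strict_trans1)
  moreover have "u \<noteq> []" using len q by auto
  ultimately have "v = prefix (length v) (u\<^sup>\<omega>)"
    using len by (intro nth_equalityI) (auto simp: iter_def)
  with \<open>u \<noteq> []\<close> show "\<exists>u e. repetition u e v \<and> Q e \<and> length u = q"
    using len q unfolding repetition_def by (intro exI[of _ u]) auto
qed

lemma power_free_iff:
  "power_free \<alpha> F \<longleftrightarrow>
     (\<forall>v \<in> F. \<forall>q > 0. (\<forall>i. i + q < length v \<longrightarrow> v ! i = v ! (i + q)) \<longrightarrow> length v / q < \<alpha>)"
  unfolding power_free_def using repetition_iff[where Q = "\<lambda>e. e \<ge> \<alpha>"] by (metis not_le)

lemma power_plus_free_iff: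
  "power_plus_free \<alpha> F \<longleftrightarrow>
     (\<forall>v \<in> F. \<forall>q > 0. (\<forall>i. i + q < length v \<longrightarrow> v ! i = v ! (i + q)) \<longrightarrow> length v / q \<le> \<alpha>)"
  unfolding power_plus_free_def using repetition_iff[where Q = "\<lambda>e. e > \<alpha>"] by (metis not_le)

text \<open>The exponent is a quotient of natural numbers so that long powers can be recognized by
  integer arithmetic. Finiteness is demanded separately because \<open>card\<close> of an infinite
  set is 0.\<close>

definition candidates :: "nat \<Rightarrow> nat \<Rightarrow> nat \<Rightarrow> bool list set set" where
  "candidates num den N = {L. bi_extendable L \<and> power_free (num / den) L \<and>
     finite (palindromes L) \<and> card (palindromes L) \<le> N}"

text \<open>All candidates are treated at once. As reversal and complement map candidates to
  candidates, each refutation of a word also refutes its variants.\<close>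

definition avoided :: "nat \<Rightarrow> nat \<Rightarrow> nat \<Rightarrow> bool list \<Rightarrow> bool" where
  "avoided num den N w \<longleftrightarrow> (\<forall>L \<in> candidates num den N. w \<notin> L)"

lemma power_free_image:
  assumes "power_free \<alpha> L"
    and f: "\<And>v. length (f v) = length v"
    and g: "\<And>v q. \<forall>i. i + q < length (f v) \<longrightarrow> f v ! i = f v ! (i + q) \<Longrightarrow>
                 \<forall>i. i + q < length v \<longrightarrow> v ! i = v ! (i + q)"
  shows "power_free \<alpha> (f ` L)"
  using assms unfolding power_free_iff by (metis (no_types, lifting) imageE)

lemma rev_periodic:
  assumes "\<forall>i. i + q < length (rev v) \<longrightarrow> rev v ! i = rev v ! (i + q)"
  shows "\<forall>i. i + q < length v \<longrightarrow> v ! i = v ! (i + q)"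
proof (intro allI impI)
  fix i assume i: "i + q < length v"
  have "rev v ! (length v - 1 - (i + q)) = rev v ! (length v - 1 - (i + q) + q)"
    using i by (intro assms[rule_format]) auto
  then show "v ! i = v ! (i + q)" using i by (simp add: rev_nth)
qed

lemma map_Not_inj: "map Not u = map Not v \<longleftrightarrow> u = v"
  by (simp add: inj_map_eq_map inj_def)

lemma map_Not_Not [simp]: "map Not (map Not v) = v"
  by (induction v) auto

lemma palindromes_rev: "palindromes (rev ` L) = palindromes L"
proof -
  have "v \<in> rev ` L \<longleftrightarrow> v \<in> L" if "rev v = v" for v :: "'a list"
    using that by (metis image_iff rev_rev_ident)
  then show ?thesis unfolding palindromes_def by blast
qed

lemma palindromes_map_Not: "palindromes (map Not ` L) = map Not ` palindromes L"
  unfolding palindromes_def by (auto simp: rev_map map_Not_inj)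

lemma candidates_rev: "L \<in> candidates num den N \<Longrightarrow> rev ` L \<in> candidates num den N"
  unfolding candidates_def
  by (auto simp: palindromes_rev intro!: bi_extendable_rev power_free_image[where f = rev] rev_periodic)

lemma candidates_map_Not: "L \<in> candidates num den N \<Longrightarrow> map Not ` L \<in> candidates num den N"
  unfolding candidates_def
  by (auto simp: palindromes_map_Not card_image inj_on_def map_Not_inj
      intro!: bi_extendable_map power_free_image[where f = "map Not"])

lemma avoided_rev: "avoided num den N (rev w) \<Longrightarrow> avoided num den N w"
  unfolding avoided_def using candidates_rev by (metis image_eqI)

lemma avoided_map_Not: "avoided num den N (map Not w) \<Longrightarrow> avoided num den N w"
  unfolding avoided_def using candidates_map_Not by (metis image_eqI)

lemma avoided_append:
  assumes "avoided num den N w" shows "avoided num den N (u @ w @ v)"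
  using assms unfolding avoided_def candidates_def by (blast dest: bi_extendable_infix)

text \<open>One letter to the left must exist, and there are only two choices. Extension to the
  right is reduced to this by reversal.\<close>

lemma avoided_extend:
  assumes "avoided num den N (False # w)" "avoided num den N (True # w)"
  shows "avoided num den N w"
  unfolding avoided_def
proof
  fix L assume L: "L \<in> candidates num den N"
  then have "\<exists>a. a # w \<in> L" if "w \<in> L" using that unfolding candidates_def bi_extendable_def by blast
  then show "w \<notin> L" using assms L unfolding avoided_def by (metis (full_types))
qed

text \<open>Structural recursion lets rewriting decide this on explicit lists; a list shorter than
  \<open>n\<close> counts as a disagreement.\<close>

fun agree :: "nat \<Rightarrow> 'a list \<Rightarrow> 'a list \<Rightarrow> bool" where
  "agree n (x # xs) (y # ys) \<longleftrightarrow> n = 0 \<or> x = y \<and> agree (n - 1) xs ys"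
| "agree n _ _ \<longleftrightarrow> n = 0"

lemma agree_iff: "agree n xs ys \<longleftrightarrow> n \<le> length xs \<and> n \<le> length ys \<and> take n xs = take n ys"
proof (induction n xs ys rule: agree.induct)
  case (1 n x xs y ys)
  then show ?case by (cases n) auto
qed auto

lemma take_periodic:
  assumes "agree e w (drop q w)"
  shows "\<forall>i. i + q < length (take (e + q) w) \<longrightarrow> take (e + q) w ! i = take (e + q) w ! (i + q)"
proof (intro allI impI)
  fix i assume i: "i + q < length (take (e + q) w)"
  have "take e w ! i = take e (drop q w) ! i" using assms by (simp add: agree_iff)
  then show "take (e + q) w ! i = take (e + q) w ! (i + q)" using i by (simp add: add.commute)
qed

text \<open>Here \<open>e\<close> is the excess: the power has length \<open>e + q\<close>, and the
  integer inequality says that its exponent is at least \<open>num / den\<close>.\<close>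

lemma avoided_power:
  assumes "agree e w (drop q w)" "num * q \<le> den * (e + q)" "0 < den" "0 < q" "0 < e"
  shows "avoided num den N w"
  unfolding avoided_def
proof
  fix L assume L: "L \<in> candidates num den N"
  show "w \<notin> L"
  proof
    assume "w \<in> L"
    then have "take (e + q) w \<in> L"
      using L bi_extendable_prefix[of L "take (e + q) w" "drop (e + q) w"]
      unfolding candidates_def by simp
    moreover have "power_free (num / den) L" using L by (simp add: candidates_def)
    ultimately have *: "length (take (e + q) w) / q < num / den"
      using take_periodic[OF assms(1)] \<open>0 < q\<close> unfolding power_free_iff by blast
    have len: "length (take (e + q) w) = e + q"
      using assms(1) \<open>0 < e\<close> by (auto simp: agree_iff)
    have "real (num * q) \<le> real (den * (e + q))" using assms(2) of_nat_le_iff by blast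
    with * \<open>0 < den\<close> \<open>0 < q\<close> show False unfolding len by (simp add: field_simps)
  qed
qed

subsection \<open>Refuting words\<close>

text \<open>
  A palindrome is coded by its right half, read from the centre, and a flag that tells whether its
  length is odd; the halves of the odd palindromes start with the central letter. The central
  factors of a palindrome are then the prefixes of its half, and the palindromes that are forced
  by a given set of palindromes are counted as the nodes of two tries.
\<close>

definition palindrome :: "bool \<times> 'a list \<Rightarrow> 'a list" where
  "palindrome c = rev (snd c) @ (if fst c then tl (snd c) else snd c)"

lemma rev_palindrome: "rev (palindrome c) = palindrome c"
  by (cases "snd c") (auto simp: palindrome_def)

lemma palindrome_centre:
  assumes "bi_extendable L" "palindrome (b, u @ v) \<in> L"
  shows "palindrome (b, u) \<in> palindromes L"
proof -
  have "\<exists>w. palindrome (b, u @ v) = rev v @ palindrome (b, u) @ w"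
    by (cases u; cases b) (auto simp: palindrome_def)
  then show ?thesis using assms bi_extendable_infix
    unfolding palindromes_def mem_Collect_eq by (metis rev_palindrome)
qed

datatype trie = Leaf | Node trie trie

fun grow :: "bool list \<Rightarrow> trie \<Rightarrow> trie" where
  "grow [] Leaf = Node Leaf Leaf"
| "grow [] (Node s t) = Node s t"
| "grow (False # xs) Leaf = Node (grow xs Leaf) Leaf"
| "grow (True # xs) Leaf = Node Leaf (grow xs Leaf)"
| "grow (False # xs) (Node s t) = Node (grow xs s) t"
| "grow (True # xs) (Node s t) = Node s (grow xs t)"

primrec paths :: "trie \<Rightarrow> bool list set" where
  "paths Leaf = {}"
| "paths (Node s t) = insert [] ((#) False ` paths s \<union> (#) True ` paths t)"

primrec nodes :: "trie \<Rightarrow> nat" where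
  "nodes Leaf = 0"
| "nodes (Node s t) = Suc (nodes s + nodes t)"

lemma paths_grow: "paths (grow xs t) = paths t \<union> {ys. \<exists>zs. xs = ys @ zs}"
proof -
  have "{ys. \<exists>zs. x # xs = ys @ zs} = insert [] ((#) x ` {ys. \<exists>zs. xs = ys @ zs})" for x :: bool and xs
    by (auto simp: Cons_eq_append_conv)
  then show ?thesis by (induction xs t rule: grow.induct) auto
qed

lemma finite_paths: "finite (paths t)"
  by (induction t) auto

lemma card_paths: "card (paths t) = nodes t"
proof (induction t)
  case (Node s t)
  have "card ((#) False ` paths s \<union> (#) True ` paths t) = nodes s + nodes t"
    using Node by (subst card_Un_disjoint) (auto simp: finite_paths card_image)
  then show ?case by (subst paths.simps, subst card_insert_disjoint) (auto simp: finite_paths)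
qed simp

text \<open>The roots of both tries stand for the empty palindrome, because
  \<open>tl [] = []\<close>. It may thus be counted twice, whence \<open>N + 1\<close>.\<close>

fun forces :: "nat \<Rightarrow> (bool \<times> bool list) list \<Rightarrow> trie \<Rightarrow> trie \<Rightarrow> bool" where
  "forces N [] s t \<longleftrightarrow> N + 1 < nodes s + nodes t"
| "forces N ((False, u) # cs) s t \<longleftrightarrow> forces N cs (grow u s) t"
| "forces N ((True, u) # cs) s t \<longleftrightarrow> forces N cs s (grow u t)"

definition too_many :: "nat \<Rightarrow> (bool \<times> bool list) list \<Rightarrow> bool" where
  "too_many N cs \<longleftrightarrow> forces N cs Leaf Leaf"

text \<open>Central factors of palindromes in \<open>L\<close> are palindromes in \<open>L\<close>,
  so every node of the tries yields one. Apart from the two roots, different nodes yield different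
  palindromes: the parity of the length separates the tries, and within a trie the palindrome
  determines its half.\<close>

lemma forces_card:
  assumes "bi_extendable L" "finite (palindromes L)"
  shows "forces N cs s t \<Longrightarrow> \<forall>c \<in> set cs. palindrome c \<in> L \<Longrightarrow>
    palindrome ` Pair False ` paths s \<subseteq> palindromes L \<Longrightarrow>
    palindrome ` Pair True ` paths t \<subseteq> palindromes L \<Longrightarrow> N < card (palindromes L)"
proof (induction N cs s t rule: forces.induct)
  case (1 N s t)
  have even: "u = v" if "palindrome (False, u) = palindrome (False, v)" for u v :: "bool list"
  proof -
    have "length (palindrome (False, u)) = length (palindrome (False, v))" using that by simp
    then have "length u = length v" by (simp add: palindrome_def)
    with that show ?thesis by (simp add: palindrome_def)
  qed
  have odd: "u = v" if "palindrome (True, u) = palindrome (True, v)" "u \<noteq> []" "v \<noteq> []"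
    for u v :: "bool list"
  proof -
    have "length (palindrome (True, u)) = length (palindrome (True, v))" using that by simp
    then have "length (rev u) = length (rev v)" using that(2,3)
      by (cases u; cases v) (simp_all add: palindrome_def)
    then show ?thesis using that(1) unfolding palindrome_def by simp
  qed
  have diff: "palindrome (False, u) \<noteq> palindrome (True, v)" if "v \<noteq> []" for u v :: "bool list"
  proof
    assume "palindrome (False, u) = palindrome (True, v)"
    then have "length (palindrome (False, u)) = length (palindrome (True, v))" by simp
    with that show False unfolding palindrome_def by (cases v) (simp_all, presburger)
  qed
  \<comment> \<open>The root of the odd trie is left out, since it denotes the empty word
    again.\<close>
  let ?E = "Pair False ` paths s" and ?O = "Pair True ` (paths t - {[]})"
  have inj: "inj_on palindrome (?E \<union> ?O)"
  proof (rule inj_onI)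
    fix c d assume c: "c \<in> ?E \<union> ?O" and d: "d \<in> ?E \<union> ?O" and eq: "palindrome c = palindrome d"
    show "c = d"
    proof (cases "c \<in> ?E"; cases "d \<in> ?E")
      assume "c \<in> ?E" "d \<in> ?E"
      then obtain u v where "c = (False, u)" "d = (False, v)" by auto
      then show ?thesis using eq even[of u v] by simp
    next
      assume "c \<in> ?E" "d \<notin> ?E"
      then obtain u v where "c = (False, u)" "d = (True, v)" "v \<noteq> []" using d by auto
      then show ?thesis using eq diff[of v u] by simp
    next
      assume "c \<notin> ?E" "d \<in> ?E"
      then obtain u v where "c = (True, v)" "d = (False, u)" "v \<noteq> []" using c by auto
      then show ?thesis using eq diff[of v u] by simp
    next
      assume "c \<notin> ?E" "d \<notin> ?E"
      then obtain u v where "c = (True, u)" "d = (True, v)" "u \<noteq> []" "v \<noteq> []" using c d by auto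
      then show ?thesis using eq odd[of u v] by simp
    qed
  qed
  have "card (palindrome ` (?E \<union> ?O)) = card (?E \<union> ?O)" using inj by (rule card_image)
  also have "\<dots> = card ?E + card ?O"
    by (rule card_Un_disjoint) (auto intro: finite_paths)
  also have "\<dots> = card (paths s) + card (paths t - {[]})"
    by (simp add: card_image inj_on_def)
  finally have "card (palindrome ` (?E \<union> ?O)) = card (paths s) + card (paths t - {[]})" .
  moreover have "card (paths t) - 1 \<le> card (paths t - {[]})"
    using diff_card_le_card_Diff[of "{[]}" "paths t"] by simp
  moreover have "palindrome ` (Pair False ` paths s \<union> Pair True ` (paths t - {[]})) \<subseteq> palindromes L"
    using 1 by blast
  then have "card (palindrome ` (Pair False ` paths s \<union> Pair True ` (paths t - {[]}))) \<le> card (palindromes L)"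
    using assms(2) by (rule card_mono[rotated])
  ultimately show ?case using 1(1) by (simp add: card_paths)
next
  case (2 N u cs s t)
  have "palindrome (False, v) \<in> palindromes L" if "u = v @ w" for v w
    using palindrome_centre[OF assms(1), of False v w] 2(3) that by simp
  with 2(4,5) have "palindrome ` Pair False ` paths (grow u s) \<subseteq> palindromes L"
    unfolding paths_grow image_Un by (simp add: image_subset_iff) blast
  with 2 show ?case by simp
next
  case (3 N u cs s t)
  have "palindrome (True, v) \<in> palindromes L" if "u = v @ w" for v w
    using palindrome_centre[OF assms(1), of True v w] 3(3) that by simp
  with 3(4,5) have "palindrome ` Pair True ` paths (grow u t) \<subseteq> palindromes L"
    unfolding paths_grow image_Un by (simp add: image_subset_iff) blast
  with 3 show ?case by simp
qed

fun begins :: "'a list \<Rightarrow> 'a list \<Rightarrow> bool" where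
  "begins [] ys \<longleftrightarrow> True"
| "begins (x # xs) [] \<longleftrightarrow> False"
| "begins (x # xs) (y # ys) \<longleftrightarrow> x = y \<and> begins xs ys"

lemma begins_iff: "begins xs ys \<longleftrightarrow> (\<exists>zs. ys = xs @ zs)"
  by (induction xs ys rule: begins.induct) auto

text \<open>Position lists alternate distances and table numbers; counting concerns the numbers
  only.\<close>

fun entries :: "nat list \<Rightarrow> nat list" where
  "entries (d # k # ks) = k # entries ks"
| "entries _ = []"

fun located :: "(nat \<Rightarrow> bool \<times> 'a list) \<Rightarrow> nat list \<Rightarrow> 'a list \<Rightarrow> bool" where
  "located tab (d # k # ks) w \<longleftrightarrow> begins (palindrome (tab k)) (drop d w) \<and> located tab ks (drop d w)"
| "located tab _ w \<longleftrightarrow> True"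

lemma located_infix:
  "located tab ks w \<Longrightarrow> k \<in> set (entries ks) \<Longrightarrow> \<exists>u v. w = u @ palindrome (tab k) @ v"
proof (induction tab ks w rule: located.induct)
  case (1 tab d k' ks w)
  show ?case
  proof (cases "k = k'")
    case True
    then obtain zs where "drop d w = palindrome (tab k) @ zs" using 1 by (auto simp: begins_iff)
    then have "w = take d w @ palindrome (tab k) @ zs" by (metis append_take_drop_id)
    then show ?thesis by blast
  next
    case False
    then obtain u v where "drop d w = u @ palindrome (tab k) @ v" using 1 by auto
    then have "w = (take d w @ u) @ palindrome (tab k) @ v" by (metis append_assoc append_take_drop_id)
    then show ?thesis by blast
  qed
qed simp_all

lemma avoided_palindromes:
  assumes "located tab ks w" "too_many N (map tab (entries ks))"
  shows "avoided num den N w"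
  unfolding avoided_def
proof
  fix L assume L: "L \<in> candidates num den N"
  then have ext: "bi_extendable L" by (simp add: candidates_def)
  show "w \<notin> L"
  proof
    assume "w \<in> L"
    have "palindrome (tab k) \<in> L" if k: "k \<in> set (entries ks)" for k
      using located_infix[OF assms(1) k] bi_extendable_infix[OF ext] \<open>w \<in> L\<close> by blast
    then have "\<forall>c \<in> set (map tab (entries ks)). palindrome c \<in> L" by simp
    then have "N < card (palindromes L)"
      using L assms(2) unfolding too_many_def
      by (intro forces_card[OF ext]) (auto simp: candidates_def)
    with L show False by (simp add: candidates_def)
  qed
qed

text \<open>
  A refutation is a search tree in preorder, run on a stack of words that remain to be refuted:
  \<open>Ext\<close> extends the top word to the left by either letter, \<open>Flip\<close> reverses it, \<open>Rep q e\<close> finds a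
  prefix of length \<open>e + q\<close> with period \<open>q\<close>, \<open>Pal\<close> finds too many palindromes (each given by its
  distance from the start of the preceding one and its number in a table), and \<open>Old\<close> refers to
  words that are already known to be avoided.
\<close>

datatype step = Ext | Flip | Old | Rep nat nat | Pal "nat list"

fun rev_onto :: "'a list \<Rightarrow> 'a list \<Rightarrow> 'a list" where
  "rev_onto [] ys = ys"
| "rev_onto (x # xs) ys = rev_onto xs (x # ys)"

lemma rev_onto_rev: "rev_onto xs ys = rev xs @ ys"
  by (induction xs arbitrary: ys) auto

definition long_power :: "nat \<Rightarrow> nat \<Rightarrow> nat \<Rightarrow> nat \<Rightarrow> bool" where
  "long_power num den q e \<longleftrightarrow> num * q \<le> den * (e + q) \<and> 0 < den \<and> 0 < q \<and> 0 < e"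

fun refuted :: "(nat \<Rightarrow> bool \<times> bool list) \<Rightarrow> nat \<Rightarrow> nat \<Rightarrow> nat \<Rightarrow> step list \<Rightarrow> bool list list \<Rightarrow> bool" where
  "refuted tab num den N [] ws \<longleftrightarrow> ws = []"
| "refuted tab num den N (s # ss) [] \<longleftrightarrow> False"
| "refuted tab num den N (Ext # ss) (w # ws) \<longleftrightarrow>
     refuted tab num den N ss ((False # w) # (True # w) # ws)"
| "refuted tab num den N (Flip # ss) (w # ws) \<longleftrightarrow> refuted tab num den N ss (rev_onto w [] # ws)"
| "refuted tab num den N (Old # ss) (w # ws) \<longleftrightarrow> avoided num den N w \<and> refuted tab num den N ss ws"
| "refuted tab num den N (Rep q e # ss) (w # ws) \<longleftrightarrow>
     long_power num den q e \<and> agree e w (drop q w) \<and> refuted tab num den N ss ws"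
| "refuted tab num den N (Pal ks # ss) (w # ws) \<longleftrightarrow>
     too_many N (map tab (entries ks)) \<and> located tab ks w \<and> refuted tab num den N ss ws"

lemma refuted_list_all: "refuted tab num den N ss ws \<Longrightarrow> list_all (avoided num den N) ws"
proof (induction tab num den N ss ws rule: refuted.induct)
  case (3 tab num den N ss w ws)
  then show ?case using avoided_extend by auto
next
  case (4 tab num den N ss w ws)
  then show ?case by (auto intro: avoided_rev simp: rev_onto_rev)
next
  case (6 tab num den N q e ss w ws)
  then show ?case using avoided_power[of e w q num den N] by (auto simp: long_power_def)
next
  case (7 tab num den N ks ss w ws)
  then show ?case using avoided_palindromes[of tab ks w N num den] by (simp del: list.map)
qed simp_all

lemma refuted_avoided: "refuted tab num den N ss [w] \<Longrightarrow> avoided num den N w"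
  using refuted_list_all by fastforce

text \<open>Rewrite rules for explicit words. Only matching letters are covered, because at a
  mismatch the certificate is wrong anyway.\<close>

lemma agree_numeral:
  "agree 0 xs ys \<longleftrightarrow> True"
  "agree (numeral k) (False # xs) (False # ys) \<longleftrightarrow> agree (pred_numeral k) xs ys"
  "agree (numeral k) (True # xs) (True # ys) \<longleftrightarrow> agree (pred_numeral k) xs ys"
  by (simp_all add: agree_iff numeral_eq_Suc)

text \<open>Instantiated with the table, this turns a number directly into a comparison of explicit
  letters.\<close>

lemma begins_palindrome:
  "c = (b, u) \<Longrightarrow> begins (palindrome c) = begins (rev u @ (if b then tl u else u))"
  by (simp add: palindrome_def)

lemma begins_bool:
  "begins (False # xs) (False # ys) \<longleftrightarrow> begins xs ys"
  "begins (True # xs) (True # ys) \<longleftrightarrow> begins xs ys"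
  by simp_all

lemma refuted_Nil: "refuted tab num den N [] [] \<longleftrightarrow> True"
  by simp

lemma drop_numeral:
  "drop 0 xs = xs" "drop 1 (x # xs) = xs" "drop (numeral k) (x # xs) = drop (pred_numeral k) xs"
  by simp_all

lemma located_Nil: "located tab [] w \<longleftrightarrow> True"
  by simp

lemmas refute_rules = refuted.simps(3-) refuted_Nil rev_onto.simps agree_numeral begins.simps(1)
  begins_bool drop_numeral pred_numeral_simps BitM.simps located_Nil located.simps(1)
  entries.simps(1) entries.simps(2) simp_thms(21,22)

text \<open>The arbitrary continuation \<open>v\<close> makes each result a rule about prefixes:
  once \<open>@\<close> has been evaluated on an explicit \<open>w\<close>, it applies to every word
  that starts with one of the four variants. This is how \<open>Old\<close> is decided.\<close>

lemma avoided_variants: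
  assumes "avoided num den N w"
  shows "avoided num den N (w @ v) \<and> avoided num den N (rev w @ v) \<and>
    avoided num den N (map Not w @ v) \<and> avoided num den N (rev (map Not w) @ v)"
proof -
  have "avoided num den N (map Not w)" using assms avoided_map_Not[of num den N "map Not w"] map_Not_Not by metis
  moreover have "avoided num den N (rev w)" using assms avoided_rev[of num den N "rev w"] by simp
  moreover have "avoided num den N (rev (map Not w))"
    using calculation(1) avoided_rev[of num den N "rev (map Not w)"] by simp
  ultimately show ?thesis using assms avoided_append[of _ _ _ _ "[]"] by auto
qed

lemmas refuted_variants = refuted_avoided[THEN avoided_variants]

section \<open>Search trees that extend words at either end\<close>

lemma bi_extendable_left: "bi_extendable L \<Longrightarrow> w \<in> L \<Longrightarrow> \<exists>a. a # w \<in> L"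
  unfolding bi_extendable_def by blast

lemma bi_extendable_right: "bi_extendable L \<Longrightarrow> w \<in> L \<Longrightarrow> \<exists>a. w @ [a] \<in> L"
  unfolding bi_extendable_def by blast

lemma bi_extendable_extend_right:
  assumes "bi_extendable L" "w \<in> L" shows "\<exists>z. length z = n \<and> w @ z \<in> L"
proof (induction n)
  case (Suc n)
  then obtain z where "length z = n" "w @ z \<in> L" by blast
  moreover from this obtain a where "(w @ z) @ [a] \<in> L" using bi_extendable_right[OF assms(1)] by blast
  ultimately show ?case by (intro exI[of _ "z @ [a]"]) simp
qed (use assms in simp)

lemma bi_extendable_extend_left:
  assumes "bi_extendable L" "w \<in> L" shows "\<exists>z. length z = n \<and> z @ w \<in> L"
proof (induction n)
  case (Suc n)
  then obtain z where "length z = n" "z @ w \<in> L" by blast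
  moreover from this obtain a where "a # z @ w \<in> L" using bi_extendable_left[OF assms(1)] by blast
  ultimately show ?case by (intro exI[of _ "a # z"]) simp
qed (use assms in simp)

datatype branch = Left | Right | Stop | Forb nat | Power nat nat nat

text \<open>A search tree in preorder, run on a stack of words; \<open>leaf\<close> decides which words may be abandoned.\<close>

fun explores :: "'a list \<Rightarrow> (branch \<Rightarrow> 'a list \<Rightarrow> bool) \<Rightarrow> branch list \<Rightarrow> 'a list list \<Rightarrow> bool" where
  "explores as leaf [] ws \<longleftrightarrow> ws = []"
| "explores as leaf (s # ss) [] \<longleftrightarrow> False"
| "explores as leaf (Left # ss) (w # ws) \<longleftrightarrow> explores as leaf ss (map (\<lambda>a. a # w) as @ ws)"
| "explores as leaf (Right # ss) (w # ws) \<longleftrightarrow> explores as leaf ss (map (\<lambda>a. w @ [a]) as @ ws)"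
| "explores as leaf (s # ss) (w # ws) \<longleftrightarrow> leaf s w \<and> explores as leaf ss ws"

text \<open>The premises \<open>Left \<in> set ss\<close> and \<open>Right \<in> set ss\<close>
  dispose of the induction step for a direction that the tree never takes.\<close>

lemma explores_induct:
  assumes "explores as leaf ss ws" "set as = UNIV" "\<And>s w. leaf s w \<Longrightarrow> Q w"
    and "\<And>w. Left \<in> set ss \<Longrightarrow> (\<And>a. Q (a # w)) \<Longrightarrow> Q w"
    and "\<And>w. Right \<in> set ss \<Longrightarrow> (\<And>a. Q (w @ [a])) \<Longrightarrow> Q w"
  shows "\<forall>w \<in> set ws. Q w"
  using assms
proof (induction as leaf ss ws rule: explores.induct)
  case (3 as leaf ss w ws)
  have *: "\<forall>v \<in> set (map (\<lambda>a. a # w) as @ ws). Q v"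
  proof (rule "3.IH")
    show "Q w" if "leaf s w" for s w using that by (rule "3.prems"(3))
    show "Q w" if "Left \<in> set ss" "\<And>a. Q (a # w)" for w using "3.prems"(4)[of w] that by simp
    show "Q w" if "Right \<in> set ss" "\<And>a. Q (w @ [a])" for w using "3.prems"(5)[of w] that by simp
  qed (use "3.prems"(1,2) in simp_all)
  have "Q (a # w)" for a
  proof -
    have "a # w \<in> set (map (\<lambda>a. a # w) as @ ws)" using "3.prems"(2) by simp
    with * show ?thesis by blast
  qed
  then have "Q w" using "3.prems"(4)[of w] by simp
  with * show ?case by simp
next
  case (4 as leaf ss w ws)
  have *: "\<forall>v \<in> set (map (\<lambda>a. w @ [a]) as @ ws). Q v"
  proof (rule "4.IH")
    show "Q w" if "leaf s w" for s w using that by (rule "4.prems"(3))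
    show "Q w" if "Left \<in> set ss" "\<And>a. Q (a # w)" for w using "4.prems"(4)[of w] that by simp
    show "Q w" if "Right \<in> set ss" "\<And>a. Q (w @ [a])" for w using "4.prems"(5)[of w] that by simp
  qed (use "4.prems"(1,2) in simp_all)
  have "Q (w @ [a])" for a
  proof -
    have "w @ [a] \<in> set (map (\<lambda>a. w @ [a]) as @ ws)" using "4.prems"(2) by simp
    with * show ?thesis by blast
  qed
  then have "Q w" using "4.prems"(5)[of w] by simp
  with * show ?case by simp
next
  case (1 as leaf ws)
  show ?case using "1.prems"(1) by simp
next
  case (2 as leaf s ss)
  show ?case using "2.prems"(1) by simp
next
  case ("5_1" as leaf ss w ws)
  have "\<forall>v \<in> set ws. Q v"
  proof (rule "5_1.IH")
    show "Q w" if "leaf s w" for s w using that by (rule "5_1.prems"(3))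
    show "Q w" if "Left \<in> set ss" "\<And>a. Q (a # w)" for w using "5_1.prems"(4)[of w] that by simp
    show "Q w" if "Right \<in> set ss" "\<And>a. Q (w @ [a])" for w using "5_1.prems"(5)[of w] that by simp
  qed (use "5_1.prems"(1,2) in simp_all)
  moreover have "Q w" using "5_1.prems"(1,3) by auto
  ultimately show ?case by simp
next
  case ("5_2" as leaf i ss w ws)
  have "\<forall>v \<in> set ws. Q v"
  proof (rule "5_2.IH")
    show "Q w" if "leaf s w" for s w using that by (rule "5_2.prems"(3))
    show "Q w" if "Left \<in> set ss" "\<And>a. Q (a # w)" for w using "5_2.prems"(4)[of w] that by simp
    show "Q w" if "Right \<in> set ss" "\<And>a. Q (w @ [a])" for w using "5_2.prems"(5)[of w] that by simp
  qed (use "5_2.prems"(1,2) in simp_all)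
  moreover have "Q w" using "5_2.prems"(1,3) by auto
  ultimately show ?case by simp
next
  case ("5_3" as leaf i q e ss w ws)
  have "\<forall>v \<in> set ws. Q v"
  proof (rule "5_3.IH")
    show "Q w" if "leaf s w" for s w using that by (rule "5_3.prems"(3))
    show "Q w" if "Left \<in> set ss" "\<And>a. Q (a # w)" for w using "5_3.prems"(4)[of w] that by simp
    show "Q w" if "Right \<in> set ss" "\<And>a. Q (w @ [a])" for w using "5_3.prems"(5)[of w] that by simp
  qed (use "5_3.prems"(1,2) in simp_all)
  moreover have "Q w" using "5_3.prems"(1,3) by auto
  ultimately show ?case by simp
qed

text \<open>
  A leaf is justified if the goal is reached (\<open>Stop\<close>) or if the image of the word contains a
  forbidden factor or a long power at the given position.
\<close>

fun justified :: "'b list list \<Rightarrow> nat \<Rightarrow> nat \<Rightarrow> ('a list \<Rightarrow> 'b list) \<Rightarrow> ('a list \<Rightarrow> bool) \<Rightarrow>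
    branch \<Rightarrow> 'a list \<Rightarrow> bool" where
  "justified F num den im goal Stop w \<longleftrightarrow> goal w"
| "justified F num den im goal (Forb i) w \<longleftrightarrow> list_ex (\<lambda>f. begins f (drop i (im w))) F"
| "justified F num den im goal (Power i q e) w \<longleftrightarrow>
     long_power num den q e \<and> agree e (drop i (im w)) (drop q (drop i (im w)))"
| "justified F num den im goal _ w \<longleftrightarrow> False"

text \<open>The form of the hypotheses that passes to preimages: the bound on the palindromes has
  been traded for forbidden words, which can be pulled back along a morphism.\<close>

definition restricted :: "'b list list \<Rightarrow> nat \<Rightarrow> nat \<Rightarrow> 'b list set \<Rightarrow> bool" where
  "restricted F num den L \<longleftrightarrow> bi_extendable L \<and> power_free (num / den) L \<and> (\<forall>f \<in> set F. f \<notin> L)"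

lemma restricted_forbidden:
  assumes "restricted F num den L" "list_ex (\<lambda>f. begins f (drop i v)) F"
  shows "v \<notin> L"
proof
  assume v: "v \<in> L"
  from assms(2) obtain f zs where "f \<in> set F" "drop i v = f @ zs"
    by (auto simp: list_ex_iff begins_iff)
  moreover from this have "v = take i v @ f @ zs" by (metis append_take_drop_id)
  ultimately show False using assms(1) v unfolding restricted_def by (metis bi_extendable_infix)
qed

lemma power_free_agree:
  assumes "bi_extendable L" "power_free (num / den) L"
    and "long_power num den q e" "agree e (drop i v) (drop q (drop i v))"
  shows "v \<notin> L"
proof
  assume "v \<in> L"
  let ?w = "take (e + q) (drop i v)"
  have e: "num * q \<le> den * (e + q)" "0 < den" "0 < q" "0 < e" using assms(3) by (auto simp: long_power_def)
  have "v = take i v @ ?w @ drop (e + q) (drop i v)" by (metis append_take_drop_id)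
  with \<open>v \<in> L\<close> have "?w \<in> L" using bi_extendable_infix[OF assms(1)] by metis
  then have *: "length ?w / q < num / den"
    using take_periodic[OF assms(4)] e(3) assms(2) unfolding power_free_iff by blast
  have len: "length ?w = e + q"
    using assms(4) e(4) by (auto simp: agree_iff)
  have "real (num * q) \<le> real (den * (e + q))" using e(1) of_nat_le_iff by blast
  with * e(2,3) show False unfolding len by (simp add: field_simps)
qed

lemma justified_cases:
  assumes "restricted F num den L" "justified F num den im goal s w"
  shows "goal w \<or> im w \<notin> L"
proof (cases s)
  case (Forb i)
  then show ?thesis using assms restricted_forbidden[OF assms(1)] by simp
next
  case (Power i q e)
  then show ?thesis using assms power_free_agree[of L num den q e i "im w"]
    by (simp add: restricted_def)
qed (use assms in simp_all)

text \<open>The tree branches over the letters of the preimage \<open>K\<close>, whereas the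
  contradictions appear among the images, inside \<open>L\<close>.\<close>

lemma explores_excluded:
  assumes "explores as (justified F num den im goal) ss [w]" "set as = UNIV"
    and "restricted F num den L" "bi_extendable K" "\<And>w. w \<in> K \<Longrightarrow> im w \<in> L" "\<And>w. goal w \<Longrightarrow> w \<notin> K"
  shows "w \<notin> K"
proof -
  have "\<forall>w \<in> set [w]. w \<notin> K"
    using assms(1,2)
  proof (rule explores_induct)
    show "w \<notin> K" if "justified F num den im goal s w" for s w
      using justified_cases[OF assms(3) that] assms(5,6) by blast
    show "w \<notin> K" if "\<And>a. a # w \<notin> K" for w
      using that bi_extendable_left[OF assms(4)] by blast
    show "w \<notin> K" if "\<And>a. w @ [a] \<notin> K" for w
      using that bi_extendable_right[OF assms(4)] by blast
  qed
  then show ?thesis by simp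
qed

text \<open>The rest \<open>r\<close> stays attached, because blocks have to be recognized inside a
  given longer word. A letter added on the right of \<open>w\<close> would have to agree with
  \<open>r\<close>, hence \<open>Right \<notin> set ss\<close>.\<close>

lemma explores_left:
  assumes "explores as (justified F num den (\<lambda>w. w) goal) ss [w]" "Right \<notin> set ss" "set as = UNIV"
    and L: "restricted F num den L" and "w @ r \<in> L"
  shows "\<exists>z. z @ w @ r \<in> L \<and> goal (z @ w)"
proof -
  have ext: "bi_extendable L" using L by (simp add: restricted_def)
  have "\<forall>w \<in> set [w]. \<forall>r. w @ r \<in> L \<longrightarrow> (\<exists>z. z @ w @ r \<in> L \<and> goal (z @ w))"
    using assms(1,3)
  proof (rule explores_induct)
    show "\<forall>r. w @ r \<in> L \<longrightarrow> (\<exists>z. z @ w @ r \<in> L \<and> goal (z @ w))"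
      if "justified F num den (\<lambda>w. w) goal s w" for s w
      using justified_cases[OF L that] bi_extendable_prefix[OF ext]
      by (metis append.left_neutral)
    show "\<forall>r. w @ r \<in> L \<longrightarrow> (\<exists>z. z @ w @ r \<in> L \<and> goal (z @ w))"
      if *: "\<And>a. \<forall>r. (a # w) @ r \<in> L \<longrightarrow> (\<exists>z. z @ (a # w) @ r \<in> L \<and> goal (z @ a # w))" for w
    proof (intro allI impI)
      fix r assume "w @ r \<in> L"
      then obtain a where "(a # w) @ r \<in> L" using bi_extendable_left[OF ext] by fastforce
      with * obtain z where "z @ (a # w) @ r \<in> L \<and> goal (z @ a # w)" by blast
      then show "\<exists>z. z @ w @ r \<in> L \<and> goal (z @ w)" by (intro exI[of _ "z @ [a]"]) simp
    qed
  qed (use assms(2) in simp)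
  with assms(5) show ?thesis by simp
qed

text \<open>The tree reads its letters from \<open>y\<close> as long as \<open>y\<close> lasts;
  \<open>e\<close> is what must be added to the word when the goal is reached only beyond
  it.\<close>

lemma explores_right:
  assumes "explores as (justified F num den (\<lambda>w. w) goal) ss [w]" "Left \<notin> set ss" "set as = UNIV"
    and L: "restricted F num den L" and "u @ w @ y \<in> L"
  shows "\<exists>e v r. u @ w @ y @ e \<in> L \<and> w @ y @ e = v @ r \<and> goal v"
proof -
  have ext: "bi_extendable L" using L by (simp add: restricted_def)
  let ?Q = "\<lambda>w. \<forall>y. u @ w @ y \<in> L \<longrightarrow> (\<exists>e v r. u @ w @ y @ e \<in> L \<and> w @ y @ e = v @ r \<and> goal v)"
  have "\<forall>w \<in> set [w]. ?Q w"
    using assms(1,3)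
  proof (rule explores_induct)
    fix s w assume "justified F num den (\<lambda>w. w) goal s w"
    then have "goal w \<or> w \<notin> L" using justified_cases[OF L] by blast
    moreover have "w \<in> L" if "u @ w @ y \<in> L" for y using bi_extendable_infix[OF ext that] .
    ultimately show "?Q w" by (metis append.right_neutral)
  next
    fix w assume *: "\<And>a. ?Q (w @ [a])"
    show "?Q w"
    proof (intro allI impI)
      fix y assume y: "u @ w @ y \<in> L"
      show "\<exists>e v r. u @ w @ y @ e \<in> L \<and> w @ y @ e = v @ r \<and> goal v"
      proof (cases y)
        case Nil
        with y obtain a where "u @ (w @ [a]) @ [] \<in> L" using bi_extendable_right[OF ext, of "u @ w"] by auto
        with * obtain e v r where "u @ (w @ [a]) @ [] @ e \<in> L" "(w @ [a]) @ [] @ e = v @ r" "goal v" by blast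
        then have "u @ w @ y @ a # e \<in> L" "w @ y @ a # e = v @ r" using Nil by simp_all
        with \<open>goal v\<close> show ?thesis by blast
      next
        case (Cons a y')
        with y have "u @ (w @ [a]) @ y' \<in> L" by simp
        with * obtain e v r where "u @ (w @ [a]) @ y' @ e \<in> L" "(w @ [a]) @ y' @ e = v @ r" "goal v" by blast
        then have "u @ w @ y @ e \<in> L" "w @ y @ e = v @ r" using Cons by simp_all
        with \<open>goal v\<close> show ?thesis by blast
      qed
    qed
  qed (use assms(2) in simp)
  with assms(5) show ?thesis by simp
qed

subsection \<open>Desubstitution\<close>

text \<open>The final marker certifies that the image ends at a block boundary, so that preimages
  can be cut and prolonged.\<close>

definition desubst :: "('a \<Rightarrow> 'b list) \<Rightarrow> 'b list \<Rightarrow> 'b list set \<Rightarrow> 'a list set" where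
  "desubst h m L = {w. morph h w @ m \<in> L}"

lemma morph_simps [simp]: "morph h [] = []" "morph h (a # w) = h a @ morph h w"
  by (simp_all add: morph_def)

lemma append_eq_prefix:
  assumes "a @ x = u @ y" "length u \<le> length a" shows "\<exists>v. a = u @ v"
proof -
  have "u = take (length u) (a @ x)" using assms(1) by simp
  also have "\<dots> = take (length u) a" using assms(2) by simp
  finally show ?thesis by (metis append_take_drop_id)
qed

lemma append_eq_suffix:
  assumes "a @ x = u @ y" "length y \<le> length x" shows "\<exists>v. x = v @ y"
proof -
  have "rev x @ rev a = rev y @ rev u" using assms(1) by (metis rev_append)
  then obtain v where "rev x = rev y @ v" using append_eq_prefix assms(2) by (metis length_rev)
  then have "x = rev v @ y" by (metis rev_append rev_rev_ident)
  then show ?thesis by blast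
qed

text \<open>The interface between the finite searches and the descent. In \<open>right\<close>, the
  extension \<open>e\<close> is needed because the given word may end inside the block. By
  \<open>occurs\<close>, some marker stands in front of any factor, and parsing starts from
  there.\<close>

locale marked =
  fixes h :: "'a \<Rightarrow> 'b list" and m :: "'b list" and L :: "'b list set"
  assumes ext: "bi_extendable L"
    and nonerasing: "h x \<noteq> []"
    and start: "begins m (h x @ m)"
    and right: "u @ m @ y \<in> L \<Longrightarrow> \<exists>e x r. u @ m @ y @ e \<in> L \<and> m @ y @ e = h x @ m @ r"
    and left: "m @ r \<in> L \<Longrightarrow> \<exists>x. h x @ m @ r \<in> L"
    and occurs: "w \<in> L \<Longrightarrow> \<exists>y. m @ y @ w \<in> L"
begin

lemma morph_start: "\<exists>z. morph h w @ m = m @ z"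
proof (induction w)
  case (Cons a w)
  then obtain z where z: "morph h w @ m = m @ z" by blast
  obtain z' where "h a @ m = m @ z'" using start[of a] by (auto simp: begins_iff)
  then have "h a @ m @ z = m @ z' @ z" by (metis append_assoc)
  with z show ?case by (intro exI[of _ "z' @ z"]) simp
qed simp

lemma desubst_bi_extendable: "bi_extendable (desubst h m L)"
  unfolding bi_extendable_def
proof (intro conjI allI impI ballI)
  have "[] \<in> L" using ext by (simp add: bi_extendable_def)
  then obtain y where "m @ y \<in> L" using occurs by fastforce
  then show "[] \<in> desubst h m L" using bi_extendable_prefix[OF ext] by (simp add: desubst_def)
next
  fix u v w assume "u @ v @ w \<in> desubst h m L"
  then have "morph h u @ morph h v @ morph h w @ m \<in> L" by (simp add: desubst_def morph_append)
  \<comment> \<open>The marker required behind the image of \<open>v\<close> is the beginning of the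
    image of \<open>w\<close> with its own marker.\<close>
  moreover obtain z where "morph h w @ m = m @ z" using morph_start by blast
  ultimately have "morph h u @ (morph h v @ m) @ z \<in> L" by simp
  then show "v \<in> desubst h m L" unfolding desubst_def using bi_extendable_infix[OF ext] by blast
next
  fix w assume w: "w \<in> desubst h m L"
  then have "morph h w @ m \<in> L" by (simp add: desubst_def)
  moreover obtain z where z: "morph h w @ m = m @ z" using morph_start by blast
  ultimately obtain x where "h x @ m @ z \<in> L" using left by metis
  then have "x # w \<in> desubst h m L" using z by (simp add: desubst_def)
  then show "\<exists>a. a # w \<in> desubst h m L" by blast
next
  fix w assume "w \<in> desubst h m L"
  then have "morph h w @ m \<in> L" by (simp add: desubst_def)
  then have "\<exists>e x r. (morph h w @ m) @ e \<in> L \<and> m @ e = h x @ m @ r"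
    using right[of "morph h w" "[]"] by simp
  then obtain e x r where "(morph h w @ m) @ e \<in> L" "m @ e = h x @ m @ r" by blast
  then have "(morph h (w @ [x]) @ m) @ r \<in> L" by (simp add: morph_append)
  then have "w @ [x] \<in> desubst h m L" unfolding desubst_def using bi_extendable_prefix[OF ext] by blast
  then show "\<exists>a. w @ [a] \<in> desubst h m L" by blast
qed

text \<open>The number of blocks is at choice, since \<open>right\<close> may lengthen the word at
  every block.\<close>

lemma parse:
  "u @ m @ y \<in> L \<Longrightarrow>
    \<exists>e v c. length v = n \<and> u @ m @ y @ e \<in> L \<and> m @ y @ e = morph h v @ m @ c"
proof (induction n arbitrary: u y)
  case 0
  then show ?case by (intro exI[of _ "[]"] exI[of _ y]) simp
next
  case (Suc n)
  obtain e x r where *: "u @ m @ y @ e \<in> L" "m @ y @ e = h x @ m @ r" using right[OF Suc.prems] by blast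
  then have "(u @ h x) @ m @ r \<in> L" by simp
  then obtain e' v c where "length v = n" "(u @ h x) @ m @ r @ e' \<in> L" "m @ r @ e' = morph h v @ m @ c"
    using Suc.IH by blast
  moreover have "m @ y @ e @ e' = h x @ m @ r @ e'" using *(2) by (metis append_assoc)
  ultimately show ?case by - (rule exI[of _ "e @ e'"], rule exI[of _ "x # v"], rule exI[of _ c], simp)
qed

lemma cover:
  assumes "w \<in> L" shows "\<exists>v \<in> desubst h m L. \<exists>a b. morph h v = a @ w @ b"
proof -
  obtain y where y: "m @ y @ w \<in> L" using occurs[OF assms] by blast
  \<comment> \<open>No block is empty, so as many blocks as the word has letters will cover
    it.\<close>
  let ?n = "length (m @ y @ w)"
  obtain e v c where v: "length v = ?n" "m @ (y @ w) @ e \<in> L" "m @ (y @ w) @ e = morph h v @ m @ c"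
    using parse[of "[]" "y @ w" ?n] y by auto
  have n: "?n \<le> length (morph h v)" using length_morph_ge[of h v] nonerasing v(1) by simp
  have "morph h v @ m @ c = (m @ y @ w) @ e" using v(3) by simp
  then obtain b where "morph h v = (m @ y @ w) @ b" using append_eq_prefix n by blast
  moreover have "(morph h v @ m) @ c \<in> L" using v(2,3) by simp
  then have "morph h v @ m \<in> L" by (rule bi_extendable_prefix[OF ext])
  moreover have "morph h v = (m @ y) @ w @ b" using calculation(1) by simp
  ultimately show ?thesis unfolding desubst_def by blast
qed

text \<open>In a shortest cover the first and the last block both meet \<open>w\<close>. The
  \<open>length v - 2\<close> blocks in between have length at least 2 each and lie within
  \<open>w\<close>, leaving at least two of its letters to the outer blocks.\<close>

lemma cover_short:
  assumes "w \<in> L" "\<And>x. 2 \<le> length (h x)"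
  shows "\<exists>v \<in> desubst h m L. (\<exists>a b. morph h v = a @ w @ b) \<and> 2 * length v \<le> length w + 2"
proof -
  let ?P = "\<lambda>v. v \<in> desubst h m L \<and> (\<exists>a b. morph h v = a @ w @ b)"
  obtain v where v: "?P v" and min: "\<And>v'. ?P v' \<Longrightarrow> length v \<le> length v'"
    using cover[OF assms(1)] ex_has_least_nat[of ?P _ length] by blast
  then obtain a b where ab: "morph h v = a @ w @ b" by blast
  have "2 * length v \<le> length w + 2"
  proof (cases "length v \<le> 1")
    case False
    then obtain x y u where u: "v = x # u @ [y]"
      by (metis One_nat_def append_butlast_last_id length_Cons length_append_singleton less_or_eq_imp_le list.size(3) neq_Nil_conv not_less_eq_eq zero_less_Suc list.exhaust le_refl)
    have "length a < length (h x)"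
    proof (rule ccontr)
      assume "\<not> length a < length (h x)"
      moreover have "a @ (w @ b) = h x @ morph h (u @ [y])" using ab u by simp
      ultimately obtain a' where "a = h x @ a'" using append_eq_prefix by (metis not_less)
      then have "morph h (u @ [y]) = a' @ w @ b" using ab u by simp
      moreover have "u @ [y] \<in> desubst h m L"
        using v u bi_extendable_suffix[OF desubst_bi_extendable, of "[x]" "u @ [y]"] by simp
      ultimately show False using min[of "u @ [y]"] u by auto
    qed
    moreover have "length b < length (h y)"
    proof (rule ccontr)
      assume "\<not> length b < length (h y)"
      moreover have "(a @ w) @ b = morph h (x # u) @ h y" using ab u by (simp add: morph_append)
      ultimately obtain b' where "b = b' @ h y" using append_eq_suffix by (metis not_less)
      then have "morph h (x # u) = a @ w @ b'" using ab u by (simp add: morph_append)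
      moreover have "x # u \<in> desubst h m L"
        using v u bi_extendable_prefix[OF desubst_bi_extendable, of "x # u" "[y]"] by simp
      ultimately show False using min[of "x # u"] u by auto
    qed
    moreover have "2 * length u \<le> length (morph h u)"
    proof (induction u)
      case (Cons z u)
      then show ?case using assms(2)[of z] by simp
    qed simp
    moreover have "length (morph h v) = length (h x) + length (morph h u) + length (h y)"
      using u by (simp add: morph_append)
    moreover have "length (morph h v) = length a + length w + length b" using ab by simp
    ultimately show ?thesis using u by simp
  qed (use ab in auto)
  with v show ?thesis by blast
qed

end

text \<open>A morphism maps cubes to cubes, whereas it may change a fractional exponent; so
  cube-freeness is what the preimage inherits from the power bound.\<close>

lemma desubst_cube_free:
  assumes L: "bi_extendable L" "power_free \<alpha> L" "\<alpha> \<le> 3" and h: "\<And>x. h x \<noteq> []"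
  shows "power_free 3 (desubst h m L)"
  unfolding power_free_iff
proof (intro ballI allI impI, rule ccontr)
  fix v q assume v: "v \<in> desubst h m L" "0 < (q :: nat)" "\<forall>i. i + q < length v \<longrightarrow> v ! i = v ! (i + q)"
    and "\<not> length v / q < 3"
  then have len: "3 * q \<le> length v" by (simp add: field_simps)
  let ?u = "take q v"
  have "take q (drop q v) = ?u" "take q (drop (q + q) v) = ?u"
    using v(3) len by (auto intro!: nth_equalityI) (metis add.commute add.assoc add_less_mono less_le_trans)+
  then have "v = ?u @ ?u @ ?u @ drop (3 * q) v"
    by (metis append_take_drop_id drop_drop mult_2 numeral_3_eq_3 mult_Suc add.assoc numeral_2_eq_2)
  then have "morph h v = morph h (?u @ ?u @ ?u @ drop (3 * q) v)" by simp
  then have "morph h ?u @ morph h ?u @ morph h ?u @ morph h (drop (3 * q) v) @ m \<in> L"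
    using v(1) by (simp add: desubst_def morph_append)
  then have *: "morph h ?u @ morph h ?u @ morph h ?u \<in> L"
    using bi_extendable_prefix[OF L(1)] by (metis append_assoc)
  let ?w = "morph h ?u"
  have "?w \<noteq> []" using length_morph_ge[of h ?u] h v(2) len by auto
  moreover have "(?w @ ?w @ ?w) ! i = (?w @ ?w @ ?w) ! (i + length ?w)" if "i + length ?w < length (?w @ ?w @ ?w)" for i
    using that by (auto simp: nth_append)
  ultimately have "length (?w @ ?w @ ?w) / length ?w < \<alpha>"
    using L(2) * unfolding power_free_iff by blast
  moreover have "length (?w @ ?w @ ?w) / length ?w = 3" using \<open>?w \<noteq> []\<close> by (simp add: field_simps)
  ultimately show False using L(3) by simp
qed

fun contains :: "'a list \<Rightarrow> 'a list \<Rightarrow> bool" where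
  "contains g [] \<longleftrightarrow> g = []"
| "contains g (x # xs) \<longleftrightarrow> begins g (x # xs) \<or> contains g xs"

lemma contains_iff: "contains g w \<longleftrightarrow> (\<exists>u v. w = u @ g @ v)"
proof (induction g w rule: contains.induct)
  case (2 g x xs)
  show ?case by (auto simp: 2 begins_iff Cons_eq_append_conv)
qed simp

text \<open>Each word may be excluded with the help of the words before it: \<open>Stop\<close> ends
  a branch that contains one of them.\<close>

fun derives :: "'b list list \<Rightarrow> nat \<Rightarrow> nat \<Rightarrow> (letter list \<Rightarrow> 'b list) \<Rightarrow> letter list list \<Rightarrow>
    (letter list \<times> branch list) list \<Rightarrow> bool" where
  "derives F num den im known [] \<longleftrightarrow> True"
| "derives F num den im known ((f, ss) # cs) \<longleftrightarrow>
     explores [T0, T1, T2] (justified F num den im (\<lambda>w. list_ex (\<lambda>g. contains g w) known)) ss [f] \<and>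
     derives F num den im (f # known) cs"

lemma UNIV_letter: "set [T0, T1, T2] = UNIV"
  using letter.exhaust by auto

lemma derives_excluded:
  assumes "restricted F num den L" "bi_extendable K" "\<And>w. w \<in> K \<Longrightarrow> im w \<in> L"
  shows "derives F num den im known cs \<Longrightarrow> \<forall>g \<in> set known. g \<notin> K \<Longrightarrow> \<forall>f \<in> fst ` set cs. f \<notin> K"
proof (induction cs arbitrary: known)
  case (Cons c cs)
  obtain f ss where c: "c = (f, ss)" by (cases c)
  have "f \<notin> K"
  proof (rule explores_excluded[OF _ UNIV_letter assms(1,2,3)])
    show "explores [T0, T1, T2] (justified F num den im (\<lambda>w. list_ex (\<lambda>g. contains g w) known)) ss [f]"
      using Cons.prems(1) c by simp
    show "w \<notin> K" if "list_ex (\<lambda>g. contains g w) known" for w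
      using that Cons.prems(2) bi_extendable_infix[OF assms(2)]
      by (auto simp: list_ex_iff contains_iff)
  qed
  moreover have "\<forall>f \<in> fst ` set cs. f \<notin> K"
    using Cons.prems c \<open>f \<notin> K\<close> by (intro Cons.IH[of "f # known"]) simp_all
  ultimately show ?case using c by simp
qed simp

section \<open>Ternary languages that resemble the factors of \<open>p\<close>\<close>

text \<open>The list reproduces itself: together with cube-freeness it suffices to exclude the same
  words in the preimage under \<open>phi2\<close>. This stability allows the descent to be repeated
  at every level.\<close>

definition p_forbidden :: "letter list list" where
  "p_forbidden = [[T0, T0], [T1, T1], [T2, T2], [T2, T0], [T2, T1, T2], [T0, T1, T0, T1], [T0, T2, T1, T0, T2], [T1, T2, T1, T0, T1, T2], [T0, T1, T0, T2, T1, T0, T1, T0], [T2, T1, T0, T2, T1, T0, T1, T2, T1, T0, T2]]"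

abbreviation p_like :: "letter list set \<Rightarrow> bool" where
  "p_like \<equiv> restricted p_forbidden 3 1"

text \<open>A common checker for the three morphisms. The tree \<open>rs\<close> parses a block to
  the right of a marker, \<open>ls\<close> a block to its left, \<open>os\<close> finds a marker
  before any word, and \<open>cs\<close> pulls the contradictions back to the ternary list.\<close>

lemma marked_p_like:
  assumes L: "restricted F num den L" "num \<le> 3 * den" "0 < den" and as: "set as = UNIV"
    and h: "list_all (\<lambda>x. h x \<noteq> [] \<and> begins m (h x @ m)) [T0, T1, T2]"
    and rs: "explores as (justified F num den (\<lambda>w. w)
          (\<lambda>w. list_ex (\<lambda>x. begins (h x @ m) w) [T0, T1, T2])) rs [m]" "Left \<notin> set rs"
    and ls: "explores as (justified F num den (\<lambda>w. w)
          (\<lambda>w. list_ex (\<lambda>x. w = h x @ m) [T0, T1, T2])) ls [m]" "Right \<notin> set ls"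
    and os: "explores as (justified F num den (\<lambda>w. w) (begins m)) os [[]]" "Right \<notin> set os"
    and cs: "derives F num den (\<lambda>w. morph h w @ m) [] cs" "map fst cs = p_forbidden"
  shows "marked h m L \<and> p_like (desubst h m L)"
proof -
  have ext: "bi_extendable L" and free: "power_free (num / den) L" using L(1) by (auto simp: restricted_def)
  have all: "P x" if "list_all P [T0, T1, T2]" for P x
    using that UNIV_letter by (metis UNIV_I list_all_iff)
  have marked: "marked h m L"
  proof
    show "h x \<noteq> []" "begins m (h x @ m)" for x using all[OF h, of x] by auto
    show "\<exists>e x r. u @ m @ y @ e \<in> L \<and> m @ y @ e = h x @ m @ r" if *: "u @ m @ y \<in> L" for u y
    proof -
      obtain e v r where v: "u @ m @ y @ e \<in> L" "m @ y @ e = v @ r"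
          "list_ex (\<lambda>x. begins (h x @ m) v) [T0, T1, T2]"
        using explores_right[OF rs as L(1) *] by blast
      obtain x zs where "v = (h x @ m) @ zs" using v(3) unfolding list_ex_iff begins_iff by blast
      with v(2) have "m @ y @ e = h x @ m @ (zs @ r)" by simp
      with v(1) show ?thesis by blast
    qed
    show "\<exists>x. h x @ m @ r \<in> L" if *: "m @ r \<in> L" for r
    proof -
      obtain z where z: "z @ m @ r \<in> L" "list_ex (\<lambda>x. z @ m = h x @ m) [T0, T1, T2]"
        using explores_left[OF ls as L(1) *] by blast
      then obtain x where "z @ m = h x @ m" unfolding list_ex_iff by blast
      with z(1) show ?thesis by (metis append_assoc)
    qed
    show "\<exists>y. m @ y @ w \<in> L" if *: "w \<in> L" for w
    proof -
      obtain z where z: "z @ [] @ w \<in> L" "begins m (z @ [])"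
        using explores_left[OF os as L(1)] * by (metis append_Nil)
      then obtain y where "z = m @ y" by (auto simp: begins_iff)
      with z(1) show ?thesis by auto
    qed
  qed (rule ext)
  then interpret marked h m L .
  have "power_free 3 (desubst h m L)"
    using ext free
  proof (rule desubst_cube_free)
    have "real num \<le> 3 * real den" using L(2) by (metis of_nat_le_iff of_nat_mult of_nat_numeral)
    then show "real num / real den \<le> 3" using L(3) by (simp add: field_simps)
  qed (rule nonerasing)
  moreover have "\<forall>f \<in> fst ` set cs. f \<notin> desubst h m L"
    using derives_excluded[OF L(1) desubst_bi_extendable _ cs(1)] by (simp add: desubst_def)
  moreover have "fst ` set cs = set p_forbidden" using cs(2) by (metis set_map)
  ultimately show ?thesis
    using marked desubst_bi_extendable by (simp add: restricted_def)
qed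

text \<open>This is \<open>phi\<close> applied twice, see \<open>morph_phi2\<close>; the single
  letter \<open>T0\<close> is the marker of its blocks.\<close>

fun phi2 :: "letter \<Rightarrow> letter list" where
  "phi2 T0 = [T0, T1, T2, T1]"
| "phi2 T1 = [T0, T2, T1]"
| "phi2 T2 = [T0, T1]"

lemma phi2_p_like:
  assumes "p_like L"
  shows "marked phi2 [T0] L \<and> p_like (desubst phi2 [T0] L)"
  by (rule marked_p_like[OF assms, where h = phi2 and m = "[T0]" and as = "[T0, T1, T2]"
      and rs = "[Right, Forb 0, Right, Stop, Forb 1, Right, Forb 2, Right, Stop, Forb 3, Forb 2, Forb 2, Right, Forb 1, Right, Stop, Forb 2, Forb 1, Forb 1]"
      and ls = "[Left, Forb 0, Left, Stop, Forb 0, Left, Stop, Left, Stop, Forb 0, Forb 0, Forb 0, Forb 0]"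
      and os = "[Left, Stop, Left, Stop, Forb 0, Left, Stop, Left, Stop, Forb 0, Forb 0, Forb 0, Left, Stop, Left, Stop, Forb 0, Forb 0, Forb 0]"
      and cs = "[([T0, T0], [Forb 1]),
     ([T1, T1], [Forb 0]),
     ([T2, T2], [Forb 0]),
     ([T2, T0], [Forb 0]),
     ([T2, T1, T2], [Forb 0]),
     ([T0, T1, T0, T1], [Forb 2]),
     ([T0, T2, T1, T0, T2], [Left, Stop, Right, Stop, Right, Left, Power 3 9 18, Stop, Power 0 9 18, Stop, Stop, Stop, Stop]),
     ([T1, T2, T1, T0, T1, T2], [Left, Right, Stop, Left, Stop, Right, Left, Stop, Stop, Left, Power 2 12 24, Power 0 12 24, Stop, Stop, Stop, Stop, Stop, Stop, Stop]),
     ([T0, T1, T0, T2, T1, T0, T1, T0], [Left, Stop, Right, Stop, Stop, Left, Stop, Stop, Right, Stop, Right, Right, Stop, Left, Power 0 16 32, Right, Power 1 16 32, Stop, Power 1 16 32, Stop, Stop, Stop, Stop, Stop, Stop]),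
     ([T2, T1, T0, T2, T1, T0, T1, T2, T1, T0, T2], [Left, Stop, Right, Stop, Left, Right, Left, Stop, Right, Stop, Left, Stop, Stop, Left, Left, Stop, Right, Power 0 21 42, Stop, Power 0 21 42, Stop, Stop, Stop, Stop, Stop, Stop, Stop, Stop, Stop, Stop, Stop])]"],
    simp_all add: UNIV_letter[simplified] p_forbidden_def long_power_def)

text \<open>The words 000, 111 and 010010 occur in no candidate. The other three fix the
  orientation: in a candidate without 11011, they cannot coexist with their reversals if the
  language is irreducible.\<close>

definition nu_forbidden :: "bool list list" where
  "nu_forbidden = [[\<zero>, \<zero>, \<zero>], [\<one>, \<one>, \<one>], [\<zero>, \<one>, \<zero>, \<one>], [\<one>, \<zero>, \<one>, \<one>], [\<zero>, \<one>, \<zero>, \<zero>, \<one>, \<zero>], [\<one>, \<one>, \<zero>, \<zero>, \<one>, \<one>, \<zero>, \<zero>]]"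

lemma nu_p_like:
  assumes "restricted nu_forbidden 28 11 L"
  shows "marked nu [\<zero>] L \<and> p_like (desubst nu [\<zero>] L)"
  by (rule marked_p_like[OF assms, where h = nu and m = "[\<zero>]" and as = "[\<zero>, \<one>]"
      and rs = "[Right, Stop, Right, Stop, Right, Stop, Forb 1]"
      and ls = "[Left, Stop, Left, Stop, Left, Stop, Forb 0]"
      and os = "[Left, Stop, Left, Stop, Left, Stop, Forb 0]"
      and cs = "[([T0, T0], [Forb 2]),
     ([T1, T1], [Forb 0]),
     ([T2, T2], [Forb 0]),
     ([T2, T0], [Forb 0]),
     ([T2, T1, T2], [Forb 0]),
     ([T0, T1, T0, T1], [Forb 1]),
     ([T0, T2, T1, T0, T2], [Right, Stop, Right, Power 0 6 10, Stop, Stop, Stop]),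
     ([T1, T2, T1, T0, T1, T2], [Left, Right, Stop, Right, Power 0 7 11, Stop, Stop, Stop, Stop, Stop]),
     ([T0, T1, T0, T2, T1, T0, T1, T0], [Left, Stop, Right, Stop, Stop, Left, Stop, Stop, Right, Stop, Right, Power 0 10 16, Stop, Stop, Stop, Stop]),
     ([T2, T1, T0, T2, T1, T0, T1, T2, T1, T0, T2], [Left, Stop, Right, Stop, Left, Right, Left, Stop, Left, Stop, Stop, Left, Power 0 13 21, Stop, Stop, Stop, Stop, Stop, Stop, Stop, Stop, Stop])]"],
    simp_all add: UNIV_bool p_forbidden_def nu_forbidden_def long_power_def insert_commute)

text \<open>
  \<open>mu'\<close> is the conjugate of \<open>mu \<circ> phi\<close> by the factor 01; all of its blocks start with 0101, which
  occurs nowhere else in an image.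
\<close>

fun mu' :: "letter \<Rightarrow> bool list" where
  "mu' T0 = [\<zero>, \<one>, \<zero>, \<one>, \<one>, \<zero>, \<zero>, \<one>, \<one>, \<zero>]"
| "mu' T1 = [\<zero>, \<one>, \<zero>, \<one>, \<zero>]"
| "mu' T2 = [\<zero>, \<one>, \<zero>, \<one>, \<one>, \<zero>]"

text \<open>The words 000, 111 and 00100 occur in no candidate; 10101 is removed by passing to the
  complement if necessary, 1101 and 010011 by passing to the reversal.\<close>

definition mu_forbidden :: "bool list list" where
  "mu_forbidden = [[\<zero>, \<zero>, \<zero>], [\<one>, \<one>, \<one>], [\<one>, \<one>, \<zero>, \<one>], [\<one>, \<zero>, \<one>, \<zero>, \<one>], [\<zero>, \<zero>, \<one>, \<zero>, \<zero>], [\<zero>, \<one>, \<zero>, \<zero>, \<one>, \<one>]]"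

text \<open>Some of the powers, such as the one with period 10 and excess 16, have exponent exactly
  13/5, so the hypothesis enters in its non-strict form.\<close>

lemma mu_p_like:
  assumes "restricted mu_forbidden 13 5 L"
  shows "marked mu' [\<zero>, \<one>, \<zero>, \<one>] L \<and> p_like (desubst mu' [\<zero>, \<one>, \<zero>, \<one>] L)"
  by (rule marked_p_like[OF assms, where h = mu' and m = "[\<zero>, \<one>, \<zero>, \<one>]" and as = "[\<zero>, \<one>]"
      and rs = "[Right, Right, Right, Forb 4, Right, Right, Forb 4, Stop, Forb 2, Forb 1, Right, Right, Right, Forb 5, Right, Right, Forb 5, Stop, Right, Right, Right, Forb 9, Right, Right, Forb 9, Stop, Power 2 4 7, Forb 7, Forb 7, Forb 3, Forb 3]"
      and ls = "[Left, Left, Forb 0, Left, Left, Forb 0, Left, Stop, Forb 0, Left, Left, Left, Forb 0, Left, Forb 0, Left, Left, Power 0 4 7, Left, Stop, Forb 0, Forb 0, Left, Stop, Forb 0, Forb 0, Forb 0]"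
      and os = "[Left, Left, Left, Forb 0, Left, Left, Forb 0, Left, Stop, Forb 0, Left, Left, Left, Forb 0, Left, Forb 0, Left, Left, Left, Forb 0, Power 0 4 7, Left, Stop, Forb 0, Forb 0, Left, Stop, Forb 0, Forb 0, Left, Left, Left, Forb 0, Left, Left, Forb 0, Left, Stop, Forb 0, Left, Left, Left, Forb 0, Left, Forb 0, Left, Left, Power 0 4 7, Left, Stop, Forb 0, Forb 0, Left, Stop, Forb 0, Forb 0, Left, Stop, Forb 0, Left, Left, Left, Forb 0, Left, Forb 0, Left, Left, Left, Forb 0, Left, Forb 0, Power 0 4 7, Left, Stop, Forb 0, Forb 0, Left, Stop, Forb 0, Forb 0, Left, Left, Left, Forb 0, Left, Left, Forb 0, Left, Stop, Forb 0, Left, Left, Left, Forb 0, Left, Forb 0, Left, Left, Power 0 4 7, Left, Stop, Forb 0, Forb 0, Left, Stop, Forb 0, Forb 0, Left, Stop, Forb 0, Left, Left, Left, Forb 0, Left, Forb 0, Left, Left, Left, Forb 0, Left, Forb 0, Left, Power 0 4 7, Forb 0, Left, Stop, Forb 0, Forb 0, Left, Stop, Forb 0, Forb 0]"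
      and cs = "[([T0, T0], [Left, Power 0 10 16, Power 3 10 16, Power 2 10 16]),
     ([T1, T1], [Power 0 5 8]),
     ([T2, T2], [Power 0 6 10]),
     ([T2, T0], [Left, Power 6 6 10, Power 3 6 10, Stop]),
     ([T2, T1, T2], [Right, Stop, Right, Power 0 11 18, Stop, Power 0 11 18, Stop]),
     ([T0, T1, T0, T1], [Left, Stop, Power 0 15 24, Stop]),
     ([T0, T2, T1, T0, T2], [Right, Stop, Right, Power 0 21 34, Stop, Stop, Stop]),
     ([T1, T2, T1, T0, T1, T2], [Left, Right, Stop, Left, Stop, Right, Power 0 26 42, Stop, Stop, Stop, Stop, Stop, Stop]),
     ([T0, T1, T0, T2, T1, T0, T1, T0], [Left, Stop, Right, Stop, Stop, Left, Stop, Stop, Right, Stop, Right, Power 0 36 58, Stop, Stop, Stop, Stop]),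
     ([T2, T1, T0, T2, T1, T0, T1, T2, T1, T0, T2], [Left, Stop, Right, Stop, Left, Right, Left, Stop, Left, Stop, Stop, Left, Power 0 47 76, Stop, Stop, Stop, Stop, Stop, Stop, Stop, Stop, Stop])]"],
    simp_all add: UNIV_bool p_forbidden_def mu_forbidden_def long_power_def insert_commute)

section \<open>Factors of \<open>p\<close> and of its images\<close>

lemma factors_prefix: "v \<in> factors w \<longleftrightarrow> (\<exists>n a b. prefix n w = a @ v @ b)"
proof
  assume "v \<in> factors w"
  then obtain i j where v: "v = w [i \<rightarrow> j]" by (auto simp: factors_def)
  show "\<exists>n a b. prefix n w = a @ v @ b"
  proof (cases "i \<le> j")
    case True
    then have "prefix j w = prefix i w @ v @ []"
      using v by (metis append_Nil2 le_Suc_ex le_add_diff_inverse subsequence_append)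
    then show ?thesis by blast
  next
    case False
    then have "prefix 0 w = [] @ v @ []" using v by simp
    then show ?thesis by blast
  qed
next
  assume "\<exists>n a b. prefix n w = a @ v @ b"
  then obtain n a b where n: "prefix n w = a @ v @ b" by blast
  have "length (prefix n w) = n" by simp
  then have len: "length a + length v \<le> n" unfolding n by simp
  have "v = w [length a \<rightarrow> length a + length v]"
  proof (rule nth_equalityI)
    fix i assume i: "i < length v"
    have "v ! i = prefix n w ! (length a + i)" unfolding n using i by (simp add: nth_append)
    also have "\<dots> = w (length a + i)" using i len by simp
    finally show "v ! i = w [length a \<rightarrow> length a + length v] ! i" using i by simp
  qed simp
  then show "v \<in> factors w" unfolding factors_def by blast
qed

lemma factors_infix: "a @ v @ b \<in> factors w \<Longrightarrow> v \<in> factors w"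
  unfolding factors_prefix by (metis append_assoc)

lemma factors_right: "v \<in> factors w \<Longrightarrow> \<exists>c. v @ [c] \<in> factors w"
proof -
  assume "v \<in> factors w"
  then obtain i j where v: "v = w [i \<rightarrow> j]" by (auto simp: factors_def)
  show ?thesis
  proof (cases "i \<le> j")
    case True
    then have "v @ [w j] = w [i \<rightarrow> Suc j]" using v by simp
    then show ?thesis unfolding factors_def by blast
  next
    case False
    then have "v @ [w 0] = w [0 \<rightarrow> Suc 0]" using v by simp
    then show ?thesis unfolding factors_def by blast
  qed
qed

lemma prefix_morph_word:
  assumes "\<And>a. h a \<noteq> []"
  shows "prefix (length (morph h (prefix n w))) (morph_word h w) = morph h (prefix n w)"
  by (rule nth_equalityI) (use morph_word_nth[where h = h and m = n and w = w] assms in simp_all)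

lemma factors_morph_word:
  assumes h: "\<And>a. h a \<noteq> []"
  shows "v \<in> factors (morph_word h w) \<longleftrightarrow> (\<exists>u \<in> factors w. \<exists>a b. morph h u = a @ v @ b)"
proof
  assume "v \<in> factors (morph_word h w)"
  then obtain n a b where n: "prefix n (morph_word h w) = a @ v @ b" unfolding factors_prefix by blast
  let ?u = "prefix n w"
  have le: "n \<le> length (morph h ?u)" using length_morph_ge[of h ?u] h by simp
  have "morph h ?u = prefix (length (morph h ?u)) (morph_word h w)"
    using prefix_morph_word[where h = h and n = n and w = w] h by simp
  also have "\<dots> = prefix n (morph_word h w) @ (morph_word h w) [n \<rightarrow> length (morph h ?u)]"
    using le by (metis le_add_diff_inverse subsequence_append)
  finally have "morph h ?u = a @ v @ (b @ (morph_word h w) [n \<rightarrow> length (morph h ?u)])" using n by simp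
  moreover have "?u \<in> factors w" unfolding factors_def by blast
  ultimately show "\<exists>u \<in> factors w. \<exists>a b. morph h u = a @ v @ b" by blast
next
  assume "\<exists>u \<in> factors w. \<exists>a b. morph h u = a @ v @ b"
  then obtain u a b where "u \<in> factors w" and u: "morph h u = a @ v @ b" by blast
  then obtain n c d where "prefix n w = c @ u @ d" unfolding factors_prefix by blast
  with u have "morph h (prefix n w) = (morph h c @ a) @ v @ (b @ morph h d)" by (simp add: morph_append)
  then show "v \<in> factors (morph_word h w)" unfolding factors_prefix
    using prefix_morph_word[where h = h and n = n and w = w] h by metis
qed

lemma factors_p: "v \<in> factors p \<longleftrightarrow> (\<exists>n a b. (morph phi ^^ n) [T0] = a @ v @ b)"
proof
  assume "v \<in> factors p"
  then obtain n a b where n: "prefix n p = a @ v @ b" unfolding factors_prefix by blast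
  let ?L = "length ((morph phi ^^ n) [T0])"
  have "prefix ?L p = prefix n p @ p [n \<rightarrow> ?L]"
    using length_phi_pow[of n] by (metis le_add_diff_inverse less_imp_le subsequence_append)
  then have "(morph phi ^^ n) [T0] = a @ v @ (b @ p [n \<rightarrow> ?L])" using n p_prefix[of n] by simp
  then show "\<exists>n a b. (morph phi ^^ n) [T0] = a @ v @ b" by blast
next
  assume "\<exists>n a b. (morph phi ^^ n) [T0] = a @ v @ b"
  then show "v \<in> factors p" unfolding factors_prefix using p_prefix by metis
qed

lemma morph_phi_p: "morph_word phi p = p"
  using p_unique_fixed_point[of p] by simp

lemma factors_p_morph: "v \<in> factors p \<Longrightarrow> morph phi v \<in> factors p"
  using factors_morph_word[of phi "morph phi v" p] phi_nonerasing unfolding morph_phi_p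
  by (metis append_Nil append_Nil2)

lemma factors_p_cover: "v \<in> factors p \<Longrightarrow> \<exists>u \<in> factors p. \<exists>a b. morph phi u = a @ v @ b"
  using factors_morph_word[of phi v p] phi_nonerasing unfolding morph_phi_p by blast

lemma factors_p_pow: "v \<in> factors p \<Longrightarrow> (morph phi ^^ n) v \<in> factors p"
  by (induction n) (auto intro: factors_p_morph)

lemma factors_p_pair:
  "[T0, T1] \<in> factors p" "[T0, T2] \<in> factors p" "[T1, T0] \<in> factors p"
  "[T1, T2] \<in> factors p" "[T2, T1] \<in> factors p"
proof -
  have "(morph phi ^^ 4) [T0] = [T0, T1, T2, T1, T0, T2, T1, T0, T1, T0, T2, T1]"
    by (simp add: numeral_eq_Suc)
  then have *: "[T0, T1, T2, T1, T0, T2, T1, T0, T1, T0, T2, T1] \<in> factors p"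
    unfolding factors_p by (metis append_Nil append_Nil2)
  show "[T0, T1] \<in> factors p" using * factors_infix[of "[]" "[T0, T1]"] by simp
  show "[T0, T2] \<in> factors p" using * factors_infix[of "[T0, T1, T2, T1]" "[T0, T2]"] by simp
  show "[T1, T0] \<in> factors p" using * factors_infix[of "[T0, T1, T2]" "[T1, T0]"] by simp
  show "[T1, T2] \<in> factors p" using * factors_infix[of "[T0]" "[T1, T2]"] by simp
  show "[T2, T1] \<in> factors p" using * factors_infix[of "[T0, T1]" "[T2, T1]"] by simp
qed

text \<open>A prefix of \<open>p\<close> has no left neighbour at position 0. But
  \<open>[T1, T0]\<close> is a factor, so every iterate of \<open>T0\<close>, and with it every
  factor, also occurs behind an iterate of \<open>T1\<close>.\<close>

lemma factors_p_left:
  assumes "v \<in> factors p" shows "\<exists>c. c # v \<in> factors p"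
proof -
  obtain n a b where n: "(morph phi ^^ n) [T0] = a @ v @ b" using assms unfolding factors_p by blast
  have "(morph phi ^^ n) ([T1] @ [T0]) \<in> factors p" using factors_p_pow factors_p_pair(3) by simp
  then have *: "((morph phi ^^ n) [T1] @ a) @ v @ b \<in> factors p" unfolding morph_pow_append n by simp
  have "(morph phi ^^ n) [T1] @ a \<noteq> []" using length_phi_pow_ge[of "[T1]" n] by auto
  then obtain x c where "(morph phi ^^ n) [T1] @ a = x @ [c]" by (meson rev_exhaust)
  with * have "x @ (c # v) @ b \<in> factors p" by simp
  then show ?thesis using factors_infix by blast
qed

lemma morph_phi2: "morph phi2 v = morph phi (morph phi v)"
proof (induction v)
  case (Cons a v)
  then show ?case by (cases a) simp_all
qed simp

lemma morph_phi2_pow: "(morph phi2 ^^ n) v = (morph phi ^^ (n + n)) v"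
  by (induction n) (simp_all add: morph_phi2)

section \<open>The forbidden list characterizes the factors of \<open>p\<close>\<close>

lemma p_like_pair:
  assumes "p_like L" "[a, b] \<in> L" shows "[a, b] \<in> factors p"
  using assms factors_p_pair by (cases a; cases b) (auto simp: restricted_def p_forbidden_def)

text \<open>The cover satisfies \<open>2 * length v \<le> length w + 2\<close>, so it is shorter
  than \<open>w\<close> unless \<open>length w \<le> 2\<close>; pairs are settled by the forbidden
  list. The language varies in the induction because the cover lives in the preimage.\<close>

lemma p_like_subset:
  assumes "p_like L" "w \<in> L" shows "w \<in> factors p"
  using assms
proof (induction "length w" arbitrary: w L rule: less_induct)
  case less
  have ext: "bi_extendable L" using less.prems(1) by (simp add: restricted_def)
  show ?case
  proof (cases "length w \<le> 2")
    case True
    obtain z where z: "length z = 2 - length w" "w @ z \<in> L"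
      using bi_extendable_extend_right[OF ext less.prems(2)] by blast
    have "length (w @ z) = 2" using True z(1) by simp
    then obtain a b where "w @ z = [a, b]" by (metis length_0_conv length_Suc_conv numeral_2_eq_2)
    then have "w @ z \<in> factors p" using p_like_pair[OF less.prems(1)] z(2) by metis
    then show ?thesis using factors_infix[of "[]" w z] by simp
  next
    case False
    interpret marked phi2 "[T0]" L using phi2_p_like[OF less.prems(1)] by blast
    have "2 \<le> length (phi2 x)" for x by (cases x) simp_all
    then obtain v a b where v: "v \<in> desubst phi2 [T0] L" "morph phi2 v = a @ w @ b" "2 * length v \<le> length w + 2"
      using cover_short[OF less.prems(2)] by blast
    have "v \<in> factors p"
      using less.hyps[of v "desubst phi2 [T0] L"] v(1,3) False phi2_p_like[OF less.prems(1)] by simp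
    then have "morph phi2 v \<in> factors p" using factors_p_morph morph_phi2 by metis
    then show ?thesis using v(2) factors_infix by metis
  qed
qed

text \<open>The converse movement: \<open>T0\<close> occurs in every preimage, however deep, and
  each level on the way back applies \<open>phi2\<close> once.\<close>

lemma p_like_pow:
  assumes "p_like L" shows "(morph phi2 ^^ n) [T0] \<in> L"
  using assms
proof (induction n arbitrary: L)
  case 0
  interpret marked phi2 "[T0]" L using phi2_p_like[OF 0] by blast
  have "[] \<in> L" using ext by (simp add: bi_extendable_def)
  then show ?case using occurs bi_extendable_prefix[OF ext] by fastforce
next
  case (Suc n)
  interpret marked phi2 "[T0]" L using phi2_p_like[OF Suc.prems] by blast
  have "(morph phi2 ^^ n) [T0] \<in> desubst phi2 [T0] L" using Suc phi2_p_like by blast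
  then have "morph phi2 ((morph phi2 ^^ n) [T0]) @ [T0] \<in> L" by (simp add: desubst_def)
  then show ?case using bi_extendable_prefix[OF ext] by simp
qed

theorem p_like_factors:
  assumes "p_like L" shows "L = factors p"
proof (intro equalityI subsetI)
  fix v assume "v \<in> factors p"
  then obtain n a b where "(morph phi ^^ n) [T0] = a @ v @ b" unfolding factors_p by blast
  \<comment> \<open>Passing to an even number of steps turns the iterate of \<open>phi\<close> into
    one of \<open>phi2\<close> and only lengthens it.\<close>
  moreover obtain t where "(morph phi ^^ (n + n)) [T0] = (morph phi ^^ n) [T0] @ t" using phi_pow_prefix by blast
  ultimately have "(morph phi2 ^^ n) [T0] = a @ v @ (b @ t)" unfolding morph_phi2_pow by simp
  moreover have "(morph phi2 ^^ n) [T0] \<in> L" using p_like_pow[OF assms] .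
  moreover have "bi_extendable L" using assms by (simp add: restricted_def)
  ultimately show "v \<in> L" using bi_extendable_infix by metis
qed (use p_like_subset[OF assms] in blast)

lemma marked_factors:
  assumes "marked h m L" "p_like (desubst h m L)"
  shows "L = factors (morph_word h p)"
proof -
  interpret marked h m L by fact
  have *: "desubst h m L = factors p" using p_like_factors[OF assms(2)] .
  show ?thesis
  proof (intro equalityI subsetI)
    fix w assume "w \<in> L"
    then show "w \<in> factors (morph_word h p)"
      using cover unfolding factors_morph_word[OF nonerasing] * by blast
  next
    fix w assume "w \<in> factors (morph_word h p)"
    then obtain u a b where u: "u \<in> factors p" "morph h u = a @ w @ b"
      unfolding factors_morph_word[OF nonerasing] by blast
    then have "u \<in> desubst h m L" using * by blast
    then have "morph h u @ m \<in> L" unfolding desubst_def by (rule CollectD)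
    then have "a @ w @ (b @ m) \<in> L" using u(2) by simp
    then show "w \<in> L" using bi_extendable_infix[OF ext] by blast
  qed
qed

theorem nu_characterization:
  assumes "restricted nu_forbidden 28 11 L" shows "L = factors (morph_word nu p)"
  using marked_factors nu_p_like[OF assms] by blast

lemma mu'_conjugate: "[\<zero>, \<one>] @ morph mu (morph phi u) = morph mu' u @ [\<zero>, \<one>]"
proof (induction u)
  case (Cons a u)
  have "morph mu' (a # u) @ [\<zero>, \<one>] = mu' a @ [\<zero>, \<one>] @ morph mu (morph phi u)" using Cons by simp
  then show ?case by (cases a) simp_all
qed simp

lemma mu'_nonerasing: "mu' a \<noteq> []"
  by (cases a) auto

text \<open>The two letters that conjugation moves from one end of the image to the other are
  supplied by a neighbouring block: by the left neighbour in the first inclusion, by the right one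
  in the second.\<close>

lemma factors_mu': "factors (morph_word mu' p) = factors (morph_word mu p)"
proof (intro equalityI subsetI)
  fix v assume "v \<in> factors (morph_word mu' p)"
  then obtain u a b where u: "u \<in> factors p" "morph mu' u = a @ v @ b"
    unfolding factors_morph_word[OF mu'_nonerasing] by blast
  obtain c where c: "c # u \<in> factors p" using factors_p_left u(1) by blast
  \<comment> \<open>All blocks of \<open>mu \<circ> phi\<close> end with 01.\<close>
  have "morph mu (phi c) = butlast (butlast (morph mu (phi c))) @ [\<zero>, \<one>]"
    by (cases c) simp_all
  then obtain s where "morph mu (phi c) = s @ [\<zero>, \<one>]" by blast
  then have "morph mu (morph phi (c # u)) = s @ morph mu' u @ [\<zero>, \<one>]"
    by (simp add: morph_append flip: mu'_conjugate)
  then have "morph mu (morph phi (c # u)) = (s @ a) @ v @ (b @ [\<zero>, \<one>])" using u(2) by simp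
  then show "v \<in> factors (morph_word mu p)"
    unfolding factors_morph_word[OF mu_nonerasing] using factors_p_morph[OF c] by blast
next
  fix v assume "v \<in> factors (morph_word mu p)"
  then obtain u a b where u: "u \<in> factors p" "morph mu u = a @ v @ b"
    unfolding factors_morph_word[OF mu_nonerasing] by blast
  obtain u' c d where u': "u' \<in> factors p" "morph phi u' = c @ u @ d" using factors_p_cover[OF u(1)] by blast
  obtain x where x: "u' @ [x] \<in> factors p" using factors_right[OF u'(1)] by blast
  obtain s where "mu' x = [\<zero>, \<one>] @ s" by (cases x) auto
  then have "morph mu' (u' @ [x]) = [\<zero>, \<one>] @ morph mu (morph phi u') @ s"
    using mu'_conjugate[of u'] by (simp add: morph_append)
  also have "\<dots> = ([\<zero>, \<one>] @ morph mu c @ a) @ v @ (b @ morph mu d @ s)"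
    using u(2) u'(2) by (simp add: morph_append)
  finally show "v \<in> factors (morph_word mu' p)"
    unfolding factors_morph_word[OF mu'_nonerasing] using x by blast
qed

theorem mu_characterization:
  assumes "restricted mu_forbidden 13 5 L" shows "L = factors (morph_word mu p)"
  using marked_factors mu_p_like[OF assms] factors_mu' by blast

section \<open>Traps: which of two words can come first\<close>

datatype move = Down | Lost | Inside

fun shorter :: "nat \<Rightarrow> 'a list \<Rightarrow> bool" where
  "shorter n [] \<longleftrightarrow> 0 < n"
| "shorter n (x # xs) \<longleftrightarrow> 0 < n \<and> shorter (n - 1) xs"

lemma shorter_iff: "shorter n xs \<longleftrightarrow> length xs < n"
  by (induction n xs rule: shorter.induct) auto

text \<open>
  A set of words of length \<open>n\<close> is a trap if no window of length \<open>n\<close> can leave it when the window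
  is moved to the left.
\<close>

fun descends :: "nat \<Rightarrow> (bool list \<Rightarrow> bool) \<Rightarrow> bool list list \<Rightarrow> move list \<Rightarrow> bool list list \<Rightarrow> bool" where
  "descends n bad S [] ws \<longleftrightarrow> ws = []"
| "descends n bad S (s # ss) [] \<longleftrightarrow> False"
| "descends n bad S (Down # ss) (w # ws) \<longleftrightarrow>
     shorter n w \<and> descends n bad S ss ((False # w) # (True # w) # ws)"
| "descends n bad S (Lost # ss) (w # ws) \<longleftrightarrow> bad w \<and> descends n bad S ss ws"
| "descends n bad S (Inside # ss) (w # ws) \<longleftrightarrow> w \<in> set S \<and> descends n bad S ss ws"

text \<open>On the way to the left from a word of \<open>Bs\<close> the window falls into
  \<open>S\<close> and cannot leave it again. As no window in \<open>S\<close> contains a word of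
  \<open>As\<close>, no such word occurs before a word of \<open>Bs\<close>.\<close>

definition trap :: "nat \<Rightarrow> (bool list \<Rightarrow> bool) \<Rightarrow> bool list list \<Rightarrow> bool list list \<Rightarrow> bool list list \<Rightarrow> bool" where
  "trap n bad S Bs As \<longleftrightarrow>
     (\<exists>ss. descends n bad S ss Bs) \<and> (\<forall>u \<in> set S. length u = n) \<and>
     (\<forall>u \<in> set S. \<forall>c. bad (c # u) \<or> butlast (c # u) \<in> set S) \<and>
     (\<forall>u \<in> set S. \<forall>v \<in> set As. \<not> contains v u) \<and> (\<forall>v \<in> set As \<union> set Bs. length v \<le> n)"

text \<open>The list appears in two forms: as the constant \<open>S\<close>, whose membership is
  looked up among the facts produced by \<open>members\<close>, and as the explicit list
  \<open>us\<close>, over which the checks run.\<close>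

lemma trapI:
  assumes S: "S = us" and "descends n bad S ss Bs"
    and "list_all (\<lambda>u. (bad (False # u) \<or> butlast (False # u) \<in> set S) \<and>
      (bad (True # u) \<or> butlast (True # u) \<in> set S)) us"
    and "list_all (\<lambda>u. \<not> shorter n u \<and> shorter (Suc n) u) us"
    and "list_all (\<lambda>u. list_all (\<lambda>v. \<not> contains v u) As) us"
    and "list_all (shorter (Suc n)) (As @ Bs)"
  shows "trap n bad S Bs As"
proof -
  have "\<forall>u \<in> set S. bad (c # u) \<or> butlast (c # u) \<in> set S" for c
    using assms(3) unfolding S list_all_iff by (cases c) auto
  moreover have "\<forall>u \<in> set S. length u = n" "\<forall>v \<in> set As \<union> set Bs. length v \<le> n"
    using assms(4,6) S unfolding list_all_iff shorter_iff by (auto simp: less_Suc_eq_le)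
  moreover have "\<forall>u \<in> set S. \<forall>v \<in> set As. \<not> contains v u"
    using assms(5) S unfolding list_all_iff by blast
  ultimately show ?thesis using assms(2) unfolding trap_def by blast
qed

lemma shorter_numeral:
  "shorter 0 xs \<longleftrightarrow> False" "shorter (numeral k) [] \<longleftrightarrow> True"
  "shorter (numeral k) (x # xs) \<longleftrightarrow> shorter (pred_numeral k) xs"
  by (simp_all add: shorter_iff numeral_eq_Suc)

lemma begins_mismatch:
  "begins (False # xs) (True # ys) \<longleftrightarrow> False" "begins (True # xs) (False # ys) \<longleftrightarrow> False"
  by simp_all

lemma contains_Nil: "contains (x # xs) [] \<longleftrightarrow> False"
  by simp

lemma butlast_Cons: "butlast [x] = []" "butlast (x # y # ys) = x # butlast (y # ys)"
  by simp_all

lemma descends_Nil: "descends n bad S [] [] \<longleftrightarrow> True"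
  by simp

lemmas trap_rules = descends.simps(3-) descends_Nil shorter_numeral begins.simps(1,2) begins_bool
  begins_mismatch contains_Nil contains.simps(2) butlast_Cons list.pred_inject pred_numeral_simps
  BitM.simps arith_simps add_num_simps Suc_numeral append.simps simp_thms

lemma members: "S = ws \<Longrightarrow> list_all (\<lambda>w. w \<in> set S) ws"
  by (simp add: list_all_iff)

lemma butlast_window: "n \<le> length y \<Longrightarrow> butlast (c # take n y) = take n (c # y)"
  by (cases n) (simp_all add: butlast_conv_take)

text \<open>Inside, \<open>main\<close> follows the search tree until a window is complete, and
  \<open>closed\<close> then moves that window to the left end of \<open>y\<close>.\<close>

lemma trap_window:
  assumes "trap n bad S Bs As" "bi_extendable L" "\<And>w. w \<in> L \<Longrightarrow> \<not> bad w"
    and "b \<in> set Bs" "y @ b @ r \<in> L" "n \<le> length (y @ b)"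
  shows "take n (y @ b) \<in> set S"
proof -
  have closed: "take n (x @ u) \<in> set S" if "u \<in> set S" "x @ u @ r \<in> L" for x u r
    using that(2)
  proof (induction x)
    case Nil
    then show ?case using that(1) assms(1) by (simp add: trap_def)
  next
    case (Cons c x)
    have "x @ u @ r \<in> L" using Cons.prems bi_extendable_suffix[OF assms(2), of "[c]"] by simp
    with Cons.IH have *: "take n (x @ u) \<in> set S" by blast
    have len: "n \<le> length (x @ u)" using that(1) assms(1) by (auto simp: trap_def)
    have "(c # take n (x @ u)) @ (drop n (x @ u) @ r) \<in> L" using Cons.prems by (metis append.assoc append_Cons append_take_drop_id)
    then have "c # take n (x @ u) \<in> L" by (rule bi_extendable_prefix[OF assms(2)])
    then have "butlast (c # take n (x @ u)) \<in> set S" using * assms(1,3) unfolding trap_def by blast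
    moreover have "butlast (c # take n (x @ u)) = take n (c # x @ u)"
      using butlast_window[OF len, of c] by simp
    ultimately show ?case by simp
  qed
  have main: "descends n bad S ss ws \<Longrightarrow>
      \<forall>w \<in> set ws. \<forall>y r. y @ w @ r \<in> L \<longrightarrow> n \<le> length (y @ w) \<longrightarrow> take n (y @ w) \<in> set S" for ss ws
  proof (induction ss arbitrary: ws)
    case (Cons s ss)
    then obtain v vs where ws: "ws = v # vs" by (cases ws) auto
    show ?case
    proof (cases s)
      case Down
      then have len: "length v < n" and "descends n bad S ss ((False # v) # (True # v) # vs)"
        using Cons.prems ws by (simp_all add: shorter_iff)
      then have IH: "\<forall>w \<in> set ((False # v) # (True # v) # vs). \<forall>y r. y @ w @ r \<in> L \<longrightarrow>
          n \<le> length (y @ w) \<longrightarrow> take n (y @ w) \<in> set S"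
        using Cons.IH by blast
      have "take n (y @ v) \<in> set S" if yv: "y @ v @ r \<in> L" "n \<le> length (y @ v)" for y r
      proof -
        obtain y' c where y: "y = y' @ [c]" using yv(2) len by (cases y rule: rev_cases) auto
        have "c # v \<in> set ((False # v) # (True # v) # vs)" by (cases c) simp_all
        moreover have "y' @ (c # v) @ r \<in> L" "n \<le> length (y' @ (c # v))" using yv y by simp_all
        ultimately have "take n (y' @ (c # v)) \<in> set S" using IH by blast
        then show ?thesis using y by simp
      qed
      then have "\<forall>y r. y @ v @ r \<in> L \<longrightarrow> n \<le> length (y @ v) \<longrightarrow> take n (y @ v) \<in> set S" by blast
      moreover have "\<forall>w \<in> set vs. \<forall>y r. y @ w @ r \<in> L \<longrightarrow> n \<le> length (y @ w) \<longrightarrow> take n (y @ w) \<in> set S"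
        using IH by (meson list.set_intros(2))
      ultimately show ?thesis unfolding ws list.set(2) by blast
    next
      case Lost
      then have "bad v" "descends n bad S ss vs" using Cons.prems ws by simp_all
      moreover have "y @ v @ r \<notin> L" for y r using calculation(1) assms(3) bi_extendable_infix[OF assms(2)] by blast
      ultimately show ?thesis using Cons.IH[of vs] ws by simp
    next
      case Inside
      then have "v \<in> set S" "descends n bad S ss vs" using Cons.prems ws by simp_all
      then show ?thesis using Cons.IH[of vs] closed[of v] unfolding ws list.set(2) by blast
    qed
  qed simp
  obtain ss where "descends n bad S ss Bs" using assms(1) unfolding trap_def by blast
  from main[OF this] show ?thesis using assms(4-6) by blast
qed

text \<open>The equation says that \<open>a\<close> ends no later than \<open>b\<close>, so
  overlapping occurrences are included.\<close>

lemma trap_separates: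
  assumes "trap n bad S Bs As" "bi_extendable L" "\<And>w. w \<in> L \<Longrightarrow> \<not> bad w"
    and "a \<in> set As" "b \<in> set Bs" "x @ a @ x' = z @ b"
  shows "z @ b @ r \<notin> L"
proof
  assume zbr: "z @ b @ r \<in> L"
  have len: "length a \<le> n" "length b \<le> n" using assms(1,4,5) by (auto simp: trap_def)
  have no: "u \<in> set S \<Longrightarrow> \<not> contains a u" for u using assms(1,4) by (auto simp: trap_def)
  \<comment> \<open>This makes room on the left for a complete window.\<close>
  obtain y where y: "length y = n" "y @ z @ b @ r \<in> L"
    using bi_extendable_extend_left[OF assms(2) zbr] by blast
  show False
  \<comment> \<open>If \<open>a\<close> starts at least \<open>n\<close> letters before the end of
    \<open>b\<close>, the window that starts with \<open>a\<close> is in the trap; otherwise the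
    window that ends together with \<open>b\<close> contains \<open>a\<close>.\<close>
  proof (cases "n \<le> length (a @ x')")
    case True
    then obtain t where t: "a @ x' = t @ b"
      using append_eq_suffix[of x "a @ x'" z b] assms(6) len(2) by auto
    have "z = x @ t" using assms(6) t by (metis append_assoc append_same_eq)
    then have "(y @ x) @ t @ b @ r \<in> L" using y(2) by simp
    then have "t @ b @ r \<in> L" by (rule bi_extendable_suffix[OF assms(2)])
    then have "take n (t @ b) \<in> set S" using trap_window[OF assms(1-3,5)] True t by metis
    moreover have "take n (t @ b) = a @ take (n - length a) x'" using len(1) by (simp flip: t)
    ultimately show False using no[of "take n (t @ b)"] unfolding contains_iff by (metis append_Nil)
  next
    case False
    have "n \<le> length (y @ x @ a @ x')" using y(1) by simp
    then obtain s t where st: "y @ x = s @ t" "length (t @ a @ x') = n"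
    proof -
      let ?k = "length (y @ x @ a @ x') - n"
      have k: "?k \<le> length (y @ x)" using False by simp
      show ?thesis
        by (rule that[of "take ?k (y @ x)" "drop ?k (y @ x)"], simp only: append_take_drop_id)
          (use k y(1) False in simp)
    qed
    have eq: "y @ z @ b = s @ t @ a @ x'" using st(1) assms(6) by (metis append_assoc)
    then obtain v where v: "t @ a @ x' = v @ b"
      using append_eq_suffix[of s "t @ a @ x'" "y @ z" b] st(2) len(2) by auto
    have "y @ z = s @ v" using eq v by (metis append_assoc append_same_eq)
    then have "s @ v @ b @ r \<in> L" using y(2) by (metis append_assoc)
    then have "v @ b @ r \<in> L" by (rule bi_extendable_suffix[OF assms(2)])
    then have "take n (v @ b) \<in> set S" using trap_window[OF assms(1-3,5)] st(2) v by (metis order_refl)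
    then have "t @ a @ x' \<in> set S" using st(2) v by simp
    then show False using no unfolding contains_iff by blast
  qed
qed

section \<open>Words avoided for exponent 13/5 and 18 palindromes\<close>

named_theorems mu_rules
named_theorems nu_rules

context
begin

private abbreviation (input) "F \<equiv> False"
private abbreviation (input) "T \<equiv> True"
private abbreviation (input) "e \<equiv> Ext"
private abbreviation (input) "f \<equiv> Flip"
private abbreviation (input) "x \<equiv> Old"
private abbreviation (input) "r \<equiv> Rep"
private abbreviation (input) "q \<equiv> Pal"

definition mu_pal :: "nat \<Rightarrow> bool \<times> bool list" where
  "mu_pal k =
   [(T,[F,T,F]), (F,[F,T,F,T]), (T,[T,F,F,T,T,F]), (F,[T,F,F,T,F]), (F,[F,T,F,T,T]), (T,[F,T]),
    (T,[T,F,T,T,F]), (F,[F,T]), (T,[F,T,T,F,F]), (T,[T,F,F,T,T,F,T,F,F]), (T,[T,F,T]),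
    (T,[T,F,F,T,T,F,T,F]), (T,[F,T,T,F]), (T,[T,F,F,T,T,F,T]), (T,[F,T,F,F,T]),
    (F,[T,F,F,T,F,F]), (F,[F,T,T,F]), (T,[T,F,F,T,T,F,F]), (T,[F,T,T]), (F,[T,F,F,T,F,T]),
    (F,[F,T,T,F,T]), (F,[T,F,T]), (F,[F,T,F]), (F,[T,F,F,T,F,F,T,T]), (F,[T,F,T,F,F]),
    (F,[T,F,T,F]), (F,[T,F,F,T]), (T,[T,F,T,T]), (F,[F,T,T]), (T,[T,F,F,T,T,F,T,F,F,T]),
    (F,[T,F]), (T,[T,F,F,T,T,F,T,F,F,T,T,F]), (T,[T,F,T,T,F,F]), (T,[F,T,T,F,F,T,F]),
    (T,[F,T,T,F,F,T]), (T,[F,T,F,F]), (F,[F,T,F,T,T,F]), (T,[F]), (T,[T,F,F,T,T,F,F,T,F]),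
    (T,[T,F,F,T,T,F,F,T]), (T,[T,F,F,T,T,F,F,T,T]), (F,[T,F,F]), (T,[T,F]), (T,[F,T,F,F,T,F]),
    (F,[T,F,T,F,F,T]), (F,[T,F,T,F,F,T,T]), (F,[T,F,T,F,F,T,F]), (F,[T,F,T,F,F,T,F,T]),
    (F,[F,T,F,T,T,F,F,T]), (F,[F,T,F,T,T,F,T,F]), (F,[T,F,T,F,F,T,T,F]),
    (F,[T,F,T,F,F,T,T,F,T,F]), (F,[F,T,F,T,F]), (F,[T,F,F,T,F,T,F]), (T,[F,T,F,F,T,T]),
    (T,[F,T,F,F,T,T,F]), (T,[F,T,F,F,T,T,F,F]), (T,[F,T,F,F,T,T,F,T]),
    (F,[T,F,F,T,F,T,T,F,F,T,F]), (F,[T,F,F,T,F,T,T,F,F,T]), (F,[T,F,F,T,F,T,T,F]),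
    (T,[T,F,T,T,F,F,T]), (T,[T,F,T,T,F,F,T,T]), (T,[T,F,T,T,F,F,T,F,T]),
    (T,[T,F,T,T,F,F,T,F,T,T,F,F]), (T,[T,F,T,T,F,F,T,F,T,T,F])] ! (k - 2)"

private abbreviation (input) "m ks \<equiv> too_many 18 (map mu_pal ks)"
private abbreviation (input) "t k \<equiv> mu_pal k"
private abbreviation (input) "R ss w \<equiv> refuted mu_pal 13 5 18 ss [w]"

lemma mu_pal_nth:
  "t 2 = (T,[F,T,F])" "t 3 = (F,[F,T,F,T])" "t 4 = (T,[T,F,F,T,T,F])" "t 5 = (F,[T,F,F,T,F])"
  "t 6 = (F,[F,T,F,T,T])" "t 7 = (T,[F,T])" "t 8 = (T,[T,F,T,T,F])" "t 9 = (F,[F,T])"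
  "t 10 = (T,[F,T,T,F,F])" "t 11 = (T,[T,F,F,T,T,F,T,F,F])" "t 12 = (T,[T,F,T])"
  "t 13 = (T,[T,F,F,T,T,F,T,F])" "t 14 = (T,[F,T,T,F])" "t 15 = (T,[T,F,F,T,T,F,T])"
  "t 16 = (T,[F,T,F,F,T])" "t 17 = (F,[T,F,F,T,F,F])" "t 18 = (F,[F,T,T,F])"
  "t 19 = (T,[T,F,F,T,T,F,F])" "t 20 = (T,[F,T,T])" "t 21 = (F,[T,F,F,T,F,T])"
  "t 22 = (F,[F,T,T,F,T])" "t 23 = (F,[T,F,T])" "t 24 = (F,[F,T,F])"
  "t 25 = (F,[T,F,F,T,F,F,T,T])" "t 26 = (F,[T,F,T,F,F])" "t 27 = (F,[T,F,T,F])"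
  "t 28 = (F,[T,F,F,T])" "t 29 = (T,[T,F,T,T])" "t 30 = (F,[F,T,T])"
  "t 31 = (T,[T,F,F,T,T,F,T,F,F,T])" "t 32 = (F,[T,F])" "t 33 = (T,[T,F,F,T,T,F,T,F,F,T,T,F])"
  "t 34 = (T,[T,F,T,T,F,F])" "t 35 = (T,[F,T,T,F,F,T,F])" "t 36 = (T,[F,T,T,F,F,T])"
  "t 37 = (T,[F,T,F,F])" "t 38 = (F,[F,T,F,T,T,F])" "t 39 = (T,[F])"
  "t 40 = (T,[T,F,F,T,T,F,F,T,F])" "t 41 = (T,[T,F,F,T,T,F,F,T])" "t 42 = (T,[T,F,F,T,T,F,F,T,T])"
  "t 43 = (F,[T,F,F])" "t 44 = (T,[T,F])" "t 45 = (T,[F,T,F,F,T,F])" "t 46 = (F,[T,F,T,F,F,T])"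
  "t 47 = (F,[T,F,T,F,F,T,T])" "t 48 = (F,[T,F,T,F,F,T,F])" "t 49 = (F,[T,F,T,F,F,T,F,T])"
  "t 50 = (F,[F,T,F,T,T,F,F,T])" "t 51 = (F,[F,T,F,T,T,F,T,F])" "t 52 = (F,[T,F,T,F,F,T,T,F])"
  "t 53 = (F,[T,F,T,F,F,T,T,F,T,F])" "t 54 = (F,[F,T,F,T,F])" "t 55 = (F,[T,F,F,T,F,T,F])"
  "t 56 = (T,[F,T,F,F,T,T])" "t 57 = (T,[F,T,F,F,T,T,F])" "t 58 = (T,[F,T,F,F,T,T,F,F])"
  "t 59 = (T,[F,T,F,F,T,T,F,T])" "t 60 = (F,[T,F,F,T,F,T,T,F,F,T,F])"
  "t 61 = (F,[T,F,F,T,F,T,T,F,F,T])" "t 62 = (F,[T,F,F,T,F,T,T,F])" "t 63 = (T,[T,F,T,T,F,F,T])"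
  "t 64 = (T,[T,F,T,T,F,F,T,T])" "t 65 = (T,[T,F,T,T,F,F,T,F,T])"
  "t 66 = (T,[T,F,T,T,F,F,T,F,T,T,F,F])" "t 67 = (T,[T,F,T,T,F,F,T,F,T,T,F])"
  by (simp_all add: mu_pal_def)

lemmas [mu_rules] =
  mu_pal_nth[THEN begins_palindrome, simplified]

text \<open>Sets of palindromes that force more than 18. The same set closes several branches, so it
  is counted once here and only looked up afterwards.\<close>

lemma [mu_rules]:
  "m [2,3,4,5]" "m [2,5,4,18]" "m [2,28,18,63]" "m [2,63,18,28]" "m [6,7,4,5]" "m [6,44,16,46]"
  "m [6,44,46,16]" "m [7,3,18,28,4]" "m [7,3,31,32]" "m [7,5,40,9]" "m [7,5,41,30]"
  "m [7,12,4,5,18]" "m [7,12,13,9,5]" "m [7,12,18,4,5]" "m [7,12,27,5,9,4]" "m [7,21,4,18]"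
  "m [7,21,18,4]" "m [7,21,44,9,52]" "m [7,22,5,4]" "m [7,23,5,4,18]" "m [7,23,8,13,9]"
  "m [7,23,28,18,63]" "m [7,23,63,18,28]" "m [7,23,67,9]" "m [7,49,44,38]" "m [8,7,4,28,30]"
  "m [8,7,9,4,5]" "m [8,18,28,16]" "m [8,27,3,16]" "m [9,16,5,4]" "m [9,16,65,32]"
  "m [9,28,4,8,7,23]" "m [9,28,4,34,7]" "m [9,28,4,36]" "m [9,28,52,7,29]" "m [10,9,4,5]"
  "m [11,7,9,5]" "m [12,27,28,18,3,2]" "m [12,46,3,16]" "m [12,57,9,21]" "m [13,7,9,8,23]"
  "m [13,7,32,9,34]" "m [13,7,32,38]" "m [13,32,3,37]" "m [14,15,9,5]" "m [14,18,28,4]"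
  "m [16,28,18,8]" "m [17,4,7,18]" "m [18,7,4,17]" "m [18,28,4,14]" "m [18,28,52,44,7]"
  "m [18,61,7,44]" "m [19,5,7,18]" "m [20,4,5,18]" "m [20,15,9,8,23]" "m [20,15,32,3,37]"
  "m [20,15,32,9,34]" "m [20,15,32,38]" "m [20,18,4,5]" "m [23,8,18,28,37]" "m [23,21,44,9,57]"
  "m [23,21,44,16,3]" "m [24,7,4,5,18]" "m [24,7,18,4,5]" "m [25,9,4,7]" "m [26,7,5,9,4]"
  "m [27,8,16,3]" "m [28,4,3,37]" "m [28,4,38,7]" "m [28,16,3,27,12]" "m [28,16,44,3,26]"
  "m [28,46,44,7,38]" "m [28,52,44,7,3]" "m [29,7,18,28,4]" "m [29,7,27,62,9]" "m [29,7,46,38]"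
  "m [29,16,3,26]" "m [30,3,44,16,21]" "m [30,21,44,57]" "m [30,36,4,43]" "m [30,36,32,15]"
  "m [30,57,44,21]" "m [30,61,44,2]" "m [32,33,9,7]" "m [34,32,7,13,9]" "m [35,9,4,43]"
  "m [35,9,32,15]" "m [39,17,40,9]" "m [39,17,41,30]" "m [39,18,41,5]" "m [39,18,42,28]"
  "m [43,16,44,3,46]" "m [43,44,16,3,46]" "m [43,46,44,3,16]" "m [44,24,21,57]" "m [44,24,57,21]"
  "m [44,45,3,46]" "m [44,48,3,16]" "m [44,51,7,46]" "m [44,53,7,3]" "m [44,54,16,21]"
  "m [44,55,9,57]" "m [44,55,16,3]" "m [44,60,9,2]" "m [47,44,3,16]" "m [50,7,44,46]"
  "m [53,7,9,29]" "m [56,44,3,21]" "m [58,9,44,21]" "m [59,9,44,21]" "m [64,7,18,28]"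
  "m [66,32,7,9]"
  by (simp_all add: too_many_def mu_pal_nth)

text \<open>For the periods 5, 10 and 15 the exponent is exactly 13/5.\<close>

lemma [mu_rules]:
  "long_power 13 5 1 2" "long_power 13 5 2 4" "long_power 13 5 3 5" "long_power 13 5 4 7"
  "long_power 13 5 5 8" "long_power 13 5 6 10" "long_power 13 5 10 16" "long_power 13 5 11 18"
  "long_power 13 5 13 21" "long_power 13 5 14 23" "long_power 13 5 15 24" "long_power 13 5 23 37"
  by (simp_all add: long_power_def)

lemmas [mu_rules] = refute_rules

text \<open>From here on every refuted word joins the rules with its variants, and later trees can
  stop at it by \<open>Old\<close>.\<close>

lemma [THEN refuted_variants, simplified, mu_rules]:
  "R [r 1 2]
    [F,F,F]"
  by (simp only: mu_rules)

lemma [THEN refuted_variants, simplified, mu_rules]: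
  "R [r 2 4]
    [F,T,F,T,F,T]"
  by (simp only: mu_rules)

lemma [THEN refuted_variants, simplified, mu_rules]:
  "R [e,e,x,e,r 3 5,f,e,x,e,e,e,x,r 3 5,e,q [0,2,1,3,6,4,4,5],q [0,6,1,7,6,4,4,5],e,f,e,e,e,x,f,e,e,x,r 13 21,e,e,r 6 10,e,x,e,q [0,8,2,7,5,9,4,4,4,5],x,e,e,q [0,10,6,9,4,4,4,5],r 3 5,x,e,e,q [0,11,2,7,3,9,8,5],q [0,7,0,12,1,13,4,9,8,5],e,q [0,14,2,15,3,9,8,5],x,x,x,e,e,e,x,q [0,9,0,16,10,5,3,4],x,e,r 6 10,x]
    [F,T,F,F,T,T,F,T,F,F,T,T,F,F,T,F,F,T,T,F,T,F,F]"
  by (simp only: mu_rules)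

text \<open>This word and the three after it form a chain of prefixes, the longest first: one deep
  search is cut into shallower ones.\<close>

lemma [THEN refuted_variants, simplified, mu_rules]:
  "R [e,q [0,17,4,4,9,7,4,18],e,q [0,2,2,5,3,4,13,18],e,e,e,x,e,x,e,e,e,x,f,e,x,f,e,f,e,e,e,x,e,r 3 5,e,e,q [0,19,5,5,8,7,14,18],e,r 13 21,q [0,20,2,4,4,5,22,18],x,q [0,7,0,21,10,4,13,18],e,e,r 4 7,e,e,r 23 37,q [0,7,0,12,3,18,10,4,4,5],q [0,20,2,18,10,4,4,5],x,r 4 7,q [0,7,0,22,8,5,3,4],x,q [0,7,0,23,4,5,3,4,13,18],x]
    [F,T,F,F,T,T,F,F,T,F,F,T,T,F,T,F,F,T,T,F,F,T,T,F,T,F,F,T,T,F,F,T,F,F,T,T,F,T,F,F,T,T,F,F]"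
  by (simp only: mu_rules)

lemma [THEN refuted_variants, simplified, mu_rules]:
  "R [e,q [0,17,4,4,9,7,4,18],f,e,x,f,e,q [0,2,2,5,3,4,13,18],f,e,f,e,f,e,f,e,f,e,x,f,e,x,f,e,r 3 5,f,e,x,f,e,f,e,f,e,q [0,19,5,5,8,7,1,18],f,e,f,e,e,e,x,e,q [0,24,4,7,1,4,4,5,9,18],e,e,x,e,e,r 6 10,q [0,7,0,12,9,4,4,5,9,18],q [0,20,8,4,4,5,9,18],x,q [0,7,0,12,3,4,4,5,9,18],q [0,20,2,4,4,5,9,18],q [0,7,0,22,8,5,3,4],x,x,q [0,7,0,23,4,5,3,4,13,18],q [0,7,0,21,10,18,10,4],x,e,r 10 16,x]
    [F,T,F,F,T,T,F,F,T,F,F,T,T,F,T,F,F,T,T,F,F,T,T,F,T,F,F,T,T,F,F]"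
  by (simp only: mu_rules)

lemma [THEN refuted_variants, simplified, mu_rules]:
  "R [e,f,e,q [0,18,9,7,1,4,3,17],x,f,e,f,e,q [0,2,2,5,3,4,13,18],f,e,r 4 7,f,e,f,e,f,e,f,e,f,e,x,f,e,x,f,e,x,f,e,q [0,24,4,7,1,18,10,4,4,5],f,e,f,e,f,e,f,e,x,e,e,e,x,r 6 10,q [0,7,0,12,9,18,10,4,4,5],q [0,20,8,18,10,4,4,5],q [0,7,0,22,8,5,3,4],x,x,q [0,7,0,12,3,18,10,4,4,5],q [0,7,0,23,4,5,3,4,13,18],q [0,20,2,18,10,4,4,5],x,x]
    [F,T,F,F,T,T,F,F,T,F,F,T,T,F,T,F,F,T,T,F,F,T,T]"
  by (simp only: mu_rules)

lemma [THEN refuted_variants, simplified, mu_rules]: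
  "R [e,e,x,e,r 3 5,q [0,25,1,9,5,4,9,7],e,e,e,x,q [0,9,0,16,4,5,3,4],x,e,e,e,x,e,x,e,f,e,x,f,e,f,e,q [0,24,4,7,1,4,4,5,9,18],f,e,x,f,e,e,e,x,e,e,e,x,e,r 3 5,e,e,q [0,19,5,5,8,7,14,18],e,r 13 21,q [0,20,2,4,4,5,22,18],x,q [0,7,0,21,10,4,13,18],x,e,e,r 6 10,q [0,7,0,12,9,4,4,5,9,18],q [0,20,8,4,4,5,9,18],x,q [0,7,0,22,8,5,3,4],x,e,e,q [0,26,2,7,4,5,1,9,2,4],q [0,7,0,12,1,27,5,5,1,9,2,4],e,r 3 5,x,x]
    [F,T,F,F,T,T,F,F,T,F,F,T,T,F,T,F,F]"
  by (simp only: mu_rules)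

lemma [THEN refuted_variants, simplified, mu_rules]:
  "R [e,x,e,e,r 4 7,e,e,e,x,e,e,e,x,r 3 5,q [0,7,0,3,6,18,2,28,2,4],f,e,f,e,f,e,e,x,e,e,e,x,e,r 3 5,e,e,q [0,19,5,5,8,7,1,18],e,e,x,q [0,7,0,12,3,4,4,5,9,18],q [0,20,2,4,4,5,9,18],x,q [0,7,0,21,10,18,10,4],e,r 10 16,x,e,e,e,x,r 6 10,e,x,q [0,29,1,7,9,18,2,28,8,4],e,q [0,14,9,18,2,28,8,4],x,x,x,e,x,q [0,29,1,7,3,18,2,28,2,4],e,q [0,14,3,18,2,28,2,4],x,x]
    [T,F,F,T,T,F,F,T,F,F,T,T,F,T,F,F,T,T,F,F,T,T,F,T,F,F,T,T]"
  by (simp only: mu_rules)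

lemma [THEN refuted_variants, simplified, mu_rules]:
  "R [e,x,e,x,e,f,e,f,e,r 4 7,f,e,f,e,f,e,x,f,e,f,e,r 3 5,f,e,x,f,e,e,q [0,19,5,5,8,7,8,18],e,e,x,q [0,7,0,12,3,4,4,5,16,18],q [0,20,2,4,4,5,16,18],x,q [0,7,0,12,3,18,4,4,10,5],q [0,20,2,18,4,4,10,5],q [0,7,0,21,10,4,7,18],f,e,r 4 7,e,e,f,e,f,e,x,f,e,r 4 7,e,e,e,x,e,e,e,x,r 3 5,q [0,7,0,3,6,18,2,28,8,4],x,e,x,q [0,29,1,7,3,18,2,28,8,4],e,q [0,14,3,18,2,28,8,4],x,x,e,x,q [0,29,1,7,3,18,2,28,2,4],e,q [0,14,3,18,2,28,2,4],x,x]
    [F,F,T,T,F,F,T,F,F,T,T,F,T,F,F,T,T,F,F,T]"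
  by (simp only: mu_rules)

lemma [THEN refuted_variants, simplified, mu_rules]:
  "R [e,x,e,r 3 5,e,f,e,f,e,e,x,e,x,f,e,e,x,x,e,e,r 6 10,e,x,e,q [0,8,2,7,9,4,5,28,3,30],x,e,f,e,q [0,18,2,28,2,4,13,14],x,x,e,e,e,x,e,e,e,x,r 3 5,q [0,7,0,3,2,31,4,32],e,q [0,32,0,33,2,9,3,7],x,e,x,e,e,q [0,34,1,32,2,7,1,13,4,9],q [0,7,0,23,1,8,3,13,4,9],x,e,e,e,x,e,q [0,35,1,9,2,32,2,15],q [0,30,1,36,2,32,2,15],r 3 5,x,x,x]
    [F,F,T,F,F,T,T,F,T,F,F,T,T]"
  by (simp only: mu_rules)

lemma [THEN refuted_variants, simplified, mu_rules]:
  "R [e,x,f,e,f,e,r 3 5,f,e,x,e,e,e,x,r 3 5,f,e,f,e,f,e,f,e,f,e,x,q [0,28,2,4,9,3,3,37],x,f,e,f,e,q [0,13,2,32,9,3,3,37],q [0,20,1,15,1,32,9,3,3,37],x,f,e,f,e,f,e,x,q [0,28,2,4,7,38,2,7],x,f,e,f,e,q [0,13,1,7,1,32,7,38],q [0,20,1,15,1,32,7,38],x,x,x,f,e,r 3 5,f,e,x,f,e,f,e,f,e,f,e,f,e,x,q [0,9,0,28,2,4,6,34,3,7],f,e,x,q [0,9,0,28,2,4,7,8,2,7,2,23],f,e,f,e,q [0,13,1,7,1,32,2,9,4,34],q [0,20,1,15,1,32,2,9,4,34],f,e,q [0,13,1,7,3,9,5,8,4,23],q [0,20,1,15,3,9,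5,8,4,23],x,x]
    [F,F,T,F,F,T,T,F,T,F]"
  by (simp only: mu_rules)

text \<open>With 00100, the last of the words that \<open>mu_avoided\<close> requires is
  available.\<close>

lemma [THEN refuted_variants, simplified, mu_rules]:
  "R [e,x,f,e,x,f,e,r 3 5,f,e,r 3 5,f,e,f,e,f,e,f,e,f,e,x,f,e,x,f,e,f,e,f,e,q [0,39,0,17,1,40,1,9],q [0,7,1,5,0,40,1,9],f,e,q [0,39,0,17,2,41,10,30],q [0,7,1,5,1,41,10,30],f,e,f,e,q [0,39,0,18,2,41,6,5],x,f,e,q [0,39,0,18,1,42,1,28],x,e,x,e,e,e,x,f,e,x,q [0,9,0,28,2,4,5,36],r 3 5,x,e,x,e,e,e,x,f,e,f,e,q [0,35,1,9,5,4,6,43],q [0,30,1,36,5,4,6,43],f,e,q [0,35,1,9,2,32,2,15],q [0,30,1,36,2,32,2,15],r 3 5,x,x,x]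
    [F,F,T,F,F]"
  by (simp only: mu_rules)

lemma [THEN refuted_variants, simplified, mu_rules]:
  "R [e,f,e,x,f,e,e,x,r 6 10,e,e,e,x,e,e,x,e,e,e,x,e,q [0,44,0,45,4,3,2,46],e,e,q [0,43,3,16,2,44,1,3,2,46],e,f,e,e,x,e,e,e,x,e,q [0,44,0,45,4,3,19,46],r 11 18,x,q [0,6,2,44,7,16,11,46],e,e,q [0,43,5,44,4,16,3,3,8,46],e,r 6 10,x,x,x,x,x,q [0,6,2,44,1,46,14,16],q [0,47,3,44,10,3,2,16],e,x,e,q [0,8,3,27,10,3,2,16],x,x,x]
    [T,T,F,T,F,F,T,T,F,T,F,F,T,F,T,F,F,T,T,F,T,F,F]"
  by (simp only: mu_rules)

lemma [THEN refuted_variants, simplified, mu_rules]: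
  "R [e,f,e,e,x,e,e,x,r 5 8,f,e,e,x,r 6 10,f,e,f,e,f,e,f,e,f,e,x,q [0,28,4,16,2,44,1,3,9,26],f,e,x,q [0,28,4,16,3,3,10,27,4,12],f,e,f,e,e,x,e,x,q [0,29,6,16,3,3,9,26],x,e,x,e,q [0,8,3,27,10,3,2,16],x,x,x,x,x]
    [T,T,F,T,F,F,T,T,F,T,F,F,T,F,T,F]"
  by (simp only: mu_rules)

lemma [THEN refuted_variants, simplified, mu_rules]:
  "R [e,e,x,e,e,x,r 5 8,f,e,e,e,x,f,e,f,e,q [0,44,0,48,7,3,2,16],f,e,q [0,43,3,16,2,44,1,3,2,46],f,e,f,e,f,e,q [0,43,3,46,2,44,4,3,2,16],e,e,e,x,e,e,x,e,x,q [0,6,2,44,7,46,8,16],e,r 6 10,x,q [0,12,5,46,6,3,2,16],x,x,x,x,e,x,e,q [0,8,3,27,4,3,2,16],x,x,x]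
    [F,T,F,T,F,F,T,F,T,T,F,T]"
  by (simp only: mu_rules)

lemma [THEN refuted_variants, simplified, mu_rules]:
  "R [e,f,e,e,x,q [0,7,0,49,1,44,5,38],e,e,e,x,q [0,28,4,46,2,44,1,7,1,38],e,e,e,x,e,e,x,e,x,e,e,e,x,q [0,50,4,7,1,44,7,46],e,e,e,x,e,e,x,q [0,7,0,49,1,44,5,38],e,e,e,x,q [0,28,4,46,2,44,1,7,1,38],e,e,f,e,f,e,x,r 14 23,e,q [0,44,0,51,1,7,5,46],x,e,x,q [0,29,1,7,5,46,4,38],x,x,x,x,x,e,r 6 10,x,e,x,q [0,29,1,7,5,46,4,38],x,x,x]
    [T,T,F,T,F,F,T,F,T,T,F,T,F,F,T]"
  by (simp only: mu_rules)

lemma [THEN refuted_variants, simplified, mu_rules]: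
  "R [e,x,f,e,x,f,e,e,x,e,x,x,f,e,e,x,e,x,x,f,e,f,e,f,e,e,x,e,e,x,q [0,7,0,21,1,44,1,9,2,52],e,q [0,18,2,28,2,52,4,44,1,7],x,e,e,e,x,e,f,e,f,e,x,f,e,x,q [0,28,2,52,4,44,1,7,9,3],f,e,x,f,e,q [0,44,0,53,1,7,15,3],x,e,r 6 10,x,f,e,f,e,x,f,e,x,q [0,9,0,28,2,52,5,7,8,29],f,e,x,f,e,q [0,53,1,7,3,9,11,29],x,x,x,x]
    [F,F,T,F,T,T,F,T,F,F]"
  by (simp only: mu_rules)

lemma [THEN refuted_variants, simplified, mu_rules]:
  "R [e,x,r 4 7]
    [F,F,T,T,F,F,T,T,F,F]"
  by (simp only: mu_rules)

lemma [THEN refuted_variants, simplified, mu_rules]: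
  "R [e,x,e,x,x]
    [F,T,F,F,T,F,T,T,F,T]"
  by (simp only: mu_rules)

lemma [THEN refuted_variants, simplified, mu_rules]:
  "R [e,x,f,e,x,f,e,q [0,44,0,54,3,16,3,21],f,e,q [0,44,0,55,7,16,3,3],f,e,f,e,f,e,f,e,f,e,x,f,e,x,f,e,e,x,e,e,e,x,e,e,x,e,q [0,44,0,54,3,16,14,21],e,e,e,x,e,r 11 18,q [0,30,5,3,1,44,1,16,14,21],x,x,q [0,56,3,44,7,3,5,21],x,x,q [0,30,5,3,1,44,1,16,3,21],q [0,23,3,21,1,44,5,16,3,3],x,x,x]
    [F,T,F,F,T,F,T,F,F,T,T,F,F,T,F]"
  by (simp only: mu_rules)

lemma [THEN refuted_variants, simplified, mu_rules]:
  "R [e,e,x,e,x,f,e,x,f,e,f,e,q [0,44,0,55,3,9,2,57],f,e,q [0,58,3,9,2,44,1,21],f,e,f,e,f,e,f,e,f,e,x,f,e,x,f,e,e,x,e,e,e,x,e,q [0,44,0,24,10,21,4,57],e,e,e,x,e,e,x,e,q [0,44,0,55,3,9,2,57],e,f,e,q [0,44,0,24,5,57,5,21],r 15 24,x,q [0,30,3,57,4,44,7,21],q [0,59,3,9,2,44,7,21],x,x,e,r 6 10,x,q [0,30,5,21,1,44,3,57],q [0,12,3,57,2,9,3,21],q [0,23,3,21,1,44,1,9,2,57],x,x,x,x]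
    [F,T,F,T,F,F,T,T,F,F,T,F]"
  by (simp only: mu_rules)

lemma [THEN refuted_variants, simplified, mu_rules]:
  "R [e,x,f,e,x,f,e,x,f,e,x,f,e,f,e,f,e,e,x,f,e,e,x,f,e,e,x,e,f,e,q [0,44,0,60,1,9,18,2],q [0,30,1,61,5,44,13,2],e,r 6 10,x,e,q [0,18,2,61,4,7,1,44],x,e,e,x,e,x,q [0,29,1,7,1,27,2,62,4,9],x,e,e,x,e,x,q [0,29,1,7,1,27,2,62,4,9],x,x,x]
    [F,T,F,F,T,T,F,F,T,F]"
  by (simp only: mu_rules)

lemma [THEN refuted_variants, simplified, mu_rules]:
  "R [e,f,e,f,e,x,r 5 8,x,x]
    [F,T,F,T,F,F,T,F,T,F]"
  by (simp only: mu_rules)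

lemma [THEN refuted_variants, simplified, mu_rules]:
  "R [f,e,e,f,e,x,f,e,x,f,e,f,e,f,e,x,f,e,x,f,e,q [0,2,3,63,7,18,2,28],f,e,q [0,2,3,28,2,18,2,63],f,e,f,e,f,e,e,x,e,e,x,r 6 10,e,e,e,x,e,e,x,e,q [0,2,3,28,2,18,8,63],e,e,f,e,f,e,x,f,e,x,f,e,e,x,e,q [0,2,9,28,2,18,8,63],e,r 6 10,x,e,e,e,x,r 10 16,x,x,q [0,7,0,23,5,28,2,18,2,63],q [0,7,0,23,5,28,2,18,8,63],x,x,x,x,q [0,7,0,23,5,63,7,18,2,28],x,x,x,q [0,64,5,7,3,18,2,28],x,x]
    [F,F,T,T,F,T,F,T,T,F,F,T,T]"
  by (simp only: mu_rules)

lemma [THEN refuted_variants, simplified, mu_rules]: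
  "R [e,x,f,e,x,f,e,f,e,f,e,x,f,e,x,f,e,e,e,x,q [0,9,0,16,3,65,4,32],x,f,e,e,e,x,q [0,9,0,16,3,65,4,32],x,f,e,f,e,f,e,f,e,q [0,66,1,32,2,7,2,9],q [0,7,0,23,1,67,4,9],q [0,7,0,23,1,67,4,9],x,x,x,x]
    [F,F,T,T,F,T,F,T,T,F,F]"
  by (simp only: mu_rules)

lemma [THEN refuted_variants, simplified, mu_rules]:
  "R [e,x,f,e,x,r 5 8]
    [F,T,F,F,T,F,T,F,F,T,F]"
  by (simp only: mu_rules)

lemma [THEN refuted_variants, simplified, mu_rules]:
  "R [e,x,f,e,f,e,e,x,e,x,x,e,r 6 10,x,x]
    [F,F,T,F,T,T,F,F,T,F,T,T]"
  by (simp only: mu_rules)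

lemma [THEN refuted_variants, simplified, mu_rules]:
  "R [e,f,e,x,f,e,x,f,e,f,e,f,e,x,f,e,x,f,e,q [0,27,2,8,7,16,3,3],x,x,x,x]
    [F,T,F,T,F,F,T,T,F,T,F,T]"
  by (simp only: mu_rules)

lemma [THEN refuted_variants, simplified, mu_rules]:
  "R [e,x,f,e,f,e,x,f,e,f,e,f,e,x,f,e,x,f,e,f,e,f,e,x,f,e,e,x,r 10 16,f,e,f,e,x,f,e,f,e,f,e,x,q [0,16,5,28,2,18,14,8],x,x,e,r 10 16,x,x,x,x,x,x]
    [F,F,T,T,F,F,T,F,T,T,F,F,T,T]"
  by (simp only: mu_rules)

lemma [THEN refuted_variants, simplified, mu_rules]:
  "R [e,x,f,e,r 6 10,x]
    [F,T,F,F,T,T,F,T,F,F,T,T,F,T]"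
  by (simp only: mu_rules)

lemma [THEN refuted_variants, simplified, mu_rules]:
  "R [e,f,e,x,f,e,x,f,e,q [0,8,5,18,2,28,4,16],x,x]
    [F,T,F,T,F,F,T,T,F,F,T,T,F,T,F,T]"
  by (simp only: mu_rules)

lemma [THEN refuted_variants, simplified, mu_rules]:
  "R [e,x,f,e,x,f,e,f,e,f,e,x,e,e,f,e,x,q [0,23,1,8,5,18,2,28,11,37],x,x,x,x]
    [F,F,T,T,F,T,F,F,T,T,F,F,T,T,F,T,F,T]"
  by (simp only: mu_rules)

lemma [THEN refuted_variants, simplified, mu_rules]:
  "R [e,x,f,e,f,e,e,e,x,e,e,x,e,x,e,f,e,r 11 18,x,x,x,x,x,x]
    [F,T,F,F,T,T,F,T,F,F,T,F,T,F,F,T,T,F,T]"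
  by (simp only: mu_rules)

lemma [THEN refuted_variants, simplified, mu_rules]:
  "R [e,x,f,e,f,e,f,e,x,f,e,x,f,e,f,e,f,e,x,f,e,f,e,x,f,e,x,f,e,q [0,8,11,18,2,28,10,16],x,x,x,x,x,x]
    [F,F,T,T,F,T,F,F,T,T,F,F,T,T,F,T,F,F,T,T]"
  by (simp only: mu_rules)

lemma [THEN refuted_variants, simplified, mu_rules]:
  "R [e,x,f,e,f,e,f,e,x,q [0,12,1,27,6,28,2,18,6,3,4,2],x,x]
    [F,T,F,F,T,F,T,T,F,F,T,T,F,F,T,F,T,T,F,T]"
  by (simp only: mu_rules)

lemma [THEN refuted_variants, simplified, mu_rules]:
  "R [e,x,f,e,f,e,x,f,e,x,f,e,f,e,f,e,x,f,e,x,f,e,f,e,x,f,e,f,e,f,e,x,f,e,r 15 24,x,x,x,x,x,x,x]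
    [F,F,T,T,F,F,T,F,T,F,F,T,F,T,T,F,F,T,T,F,F,T,F,T,F]"
  by (simp only: mu_rules)

section \<open>Words avoided for exponent 28/11 and 20 palindromes\<close>

definition nu_pal :: "nat \<Rightarrow> bool \<times> bool list" where
  "nu_pal k =
   [(T,[T,F,F]), (F,[T,F,F,T,F]), (T,[F,T,F,F,T]), (F,[F,T,F,T]), (F,[T,F,T,F,F]),
    (F,[T,F,F,T,F,T]), (T,[T,F]), (F,[F,T,T,F]), (F,[T,F,F,T]), (F,[T,F,T,F]), (T,[T,F,T,T]),
    (F,[F,T,T]), (T,[F,T,T,F,F,T]), (T,[T,F,T]), (T,[F,T,F,F,T,T,F]), (F,[T,F,F,T,F,T,F]),
    (F,[F,T,F,T,F]), (F,[T,F,T]), (T,[F,T,F,F,T,T,F,T]), (T,[F,T,T]), (T,[T,F,F,T,T]),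
    (F,[F,T,F]), (T,[F,T,F,F,T,F]), (F,[F,T,F,T,T]), (F,[F,T,T,F,T,F,F]), (F,[F,T,T,F,T,F]),
    (T,[F,T,T,F]), (F,[F,T,T,F,T]), (F,[F,T,F,T,T,F,F]), (F,[F,T,F,T,T,F]), (T,[T,F,T,T,F]),
    (T,[F,T,T,F,F]), (T,[T,F,F,T]), (T,[F,T,F,F,T,T]), (T,[T,F,F,T,T,F]),
    (T,[F,T,F,F,T,T,F,T,F,F,T,F]), (F,[T,F]), (F,[T,F,F]), (T,[F,T,F,F,T,T,F,T,F,F,T]),
    (T,[F,T,F,F,T,T,F,T,F]), (F,[T,F,T,F,F,T]), (F,[T,F,T,F,F,T,F]), (F,[T,F,T,F,F,T,T]),
    (F,[F,T,F,T,T,F,F,T,F]), (F,[F,T,F,T,T,F,F,T,F,T,F]), (F,[F,T,F,T,T,F,F,T,F,T]),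
    (F,[F,T,F,T,T,F,F,T]), (T,[F,T,T,F,F,T,F]), (T,[F,T,T,F,F,T,F,T]), (F,[T,F,T,F,F,T,T,F]),
    (F,[T,F,T,F,F,T,T,F,T]), (T,[T,F,T,T,F,F,T]), (T,[T,F,T,T,F,T]), (F,[F,T]),
    (T,[T,F,T,T,F,F,T,F]), (T,[T,F,F,T,T,F,T,F,F]), (T,[T,F,F,T,T,F,T,F]), (T,[T,F,F,T,T,F,T]),
    (F,[T,F,F,T,F,T,T]), (F,[T,F,F,T,F,T,F,F,T]), (T,[F,T,F,F,T,T,F,F]), (T,[F,T,F,F]),
    (T,[F,T,F,F,T,T,F,F,T,F]), (T,[F,T,F,F,T,T,F,F,T]), (F,[T,F,F,T,F,T,T,F,F]),
    (F,[T,F,F,T,F,T,T,F]), (T,[F,T,F,F,T,T,F,T,F,F]), (T,[F,T,F,F,T,T,F,F,T,T]), (T,[F,T]),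
    (F,[T,F,T,F,F,T,F,T,T,F]), (F,[F,T,F,T,T,F,F,T,T,F,F]), (F,[F,T,F,T,T,F,F,T,T,F]),
    (F,[F,T,F,T,T,F,F,T,T,F,T]), (T,[F,T,T,F,F,T,F,F,T]), (T,[T,F,F,T,T,F,T,T,F]),
    (T,[F,T,T,F,F,T,F,T,T]), (T,[F,T,T,F,F,T,F,T,T,F,F,T,T]), (T,[F,T,T,F,F,T,F,F]),
    (T,[T,F,F,T,T,F,T,T]), (F,[F,T,T,F,T,F,F,T,T,F,F,T]), (F,[F,T,T,F,T,F,F,T,T,F]),
    (F,[F,T,T,F,T,F,F,T,T,F,T]), (T,[F,T,T,F,F,T,T,F,F,T]),
    (T,[T,F,F,T,T,F,F,T,F,T,T])] ! (k - 2)"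

private abbreviation (input) "n ks \<equiv> too_many 20 (map nu_pal ks)"
private abbreviation (input) "u k \<equiv> nu_pal k"
private abbreviation (input) "S ss w \<equiv> refuted nu_pal 28 11 20 ss [w]"

lemma nu_pal_nth:
  "u 2 = (T,[T,F,F])" "u 3 = (F,[T,F,F,T,F])" "u 4 = (T,[F,T,F,F,T])" "u 5 = (F,[F,T,F,T])"
  "u 6 = (F,[T,F,T,F,F])" "u 7 = (F,[T,F,F,T,F,T])" "u 8 = (T,[T,F])" "u 9 = (F,[F,T,T,F])"
  "u 10 = (F,[T,F,F,T])" "u 11 = (F,[T,F,T,F])" "u 12 = (T,[T,F,T,T])" "u 13 = (F,[F,T,T])"
  "u 14 = (T,[F,T,T,F,F,T])" "u 15 = (T,[T,F,T])" "u 16 = (T,[F,T,F,F,T,T,F])"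
  "u 17 = (F,[T,F,F,T,F,T,F])" "u 18 = (F,[F,T,F,T,F])" "u 19 = (F,[T,F,T])"
  "u 20 = (T,[F,T,F,F,T,T,F,T])" "u 21 = (T,[F,T,T])" "u 22 = (T,[T,F,F,T,T])"
  "u 23 = (F,[F,T,F])" "u 24 = (T,[F,T,F,F,T,F])" "u 25 = (F,[F,T,F,T,T])"
  "u 26 = (F,[F,T,T,F,T,F,F])" "u 27 = (F,[F,T,T,F,T,F])" "u 28 = (T,[F,T,T,F])"
  "u 29 = (F,[F,T,T,F,T])" "u 30 = (F,[F,T,F,T,T,F,F])" "u 31 = (F,[F,T,F,T,T,F])"
  "u 32 = (T,[T,F,T,T,F])" "u 33 = (T,[F,T,T,F,F])" "u 34 = (T,[T,F,F,T])"
  "u 35 = (T,[F,T,F,F,T,T])" "u 36 = (T,[T,F,F,T,T,F])" "u 37 = (T,[F,T,F,F,T,T,F,T,F,F,T,F])"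
  "u 38 = (F,[T,F])" "u 39 = (F,[T,F,F])" "u 40 = (T,[F,T,F,F,T,T,F,T,F,F,T])"
  "u 41 = (T,[F,T,F,F,T,T,F,T,F])" "u 42 = (F,[T,F,T,F,F,T])" "u 43 = (F,[T,F,T,F,F,T,F])"
  "u 44 = (F,[T,F,T,F,F,T,T])" "u 45 = (F,[F,T,F,T,T,F,F,T,F])"
  "u 46 = (F,[F,T,F,T,T,F,F,T,F,T,F])" "u 47 = (F,[F,T,F,T,T,F,F,T,F,T])"
  "u 48 = (F,[F,T,F,T,T,F,F,T])" "u 49 = (T,[F,T,T,F,F,T,F])" "u 50 = (T,[F,T,T,F,F,T,F,T])"
  "u 51 = (F,[T,F,T,F,F,T,T,F])" "u 52 = (F,[T,F,T,F,F,T,T,F,T])" "u 53 = (T,[T,F,T,T,F,F,T])"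
  "u 54 = (T,[T,F,T,T,F,T])" "u 55 = (F,[F,T])" "u 56 = (T,[T,F,T,T,F,F,T,F])"
  "u 57 = (T,[T,F,F,T,T,F,T,F,F])" "u 58 = (T,[T,F,F,T,T,F,T,F])" "u 59 = (T,[T,F,F,T,T,F,T])"
  "u 60 = (F,[T,F,F,T,F,T,T])" "u 61 = (F,[T,F,F,T,F,T,F,F,T])" "u 62 = (T,[F,T,F,F,T,T,F,F])"
  "u 63 = (T,[F,T,F,F])" "u 64 = (T,[F,T,F,F,T,T,F,F,T,F])" "u 65 = (T,[F,T,F,F,T,T,F,F,T])"
  "u 66 = (F,[T,F,F,T,F,T,T,F,F])" "u 67 = (F,[T,F,F,T,F,T,T,F])"
  "u 68 = (T,[F,T,F,F,T,T,F,T,F,F])" "u 69 = (T,[F,T,F,F,T,T,F,F,T,T])" "u 70 = (T,[F,T])"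
  "u 71 = (F,[T,F,T,F,F,T,F,T,T,F])" "u 72 = (F,[F,T,F,T,T,F,F,T,T,F,F])"
  "u 73 = (F,[F,T,F,T,T,F,F,T,T,F])" "u 74 = (F,[F,T,F,T,T,F,F,T,T,F,T])"
  "u 75 = (T,[F,T,T,F,F,T,F,F,T])" "u 76 = (T,[T,F,F,T,T,F,T,T,F])"
  "u 77 = (T,[F,T,T,F,F,T,F,T,T])" "u 78 = (T,[F,T,T,F,F,T,F,T,T,F,F,T,T])"
  "u 79 = (T,[F,T,T,F,F,T,F,F])" "u 80 = (T,[T,F,F,T,T,F,T,T])"
  "u 81 = (F,[F,T,T,F,T,F,F,T,T,F,F,T])" "u 82 = (F,[F,T,T,F,T,F,F,T,T,F])"
  "u 83 = (F,[F,T,T,F,T,F,F,T,T,F,T])" "u 84 = (T,[F,T,T,F,F,T,T,F,F,T])"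
  "u 85 = (T,[T,F,F,T,T,F,F,T,F,T,T])"
  by (simp_all add: nu_pal_def)

lemmas [nu_rules] =
  nu_pal_nth[THEN begins_palindrome, simplified]

lemma [nu_rules]:
  "n [2,3,4,5,6]" "n [2,3,16,9,15]" "n [2,3,42,70,31]" "n [2,3,55,16,33]" "n [2,3,64,55]"
  "n [2,4,7,5,9]" "n [2,4,7,9,5]" "n [2,4,9,5,7]" "n [2,4,31,42]" "n [2,4,42,31]" "n [2,4,47,38]"
  "n [2,5,4,9,7]" "n [2,5,7,16]" "n [2,5,9,10,16]" "n [2,5,16,10,9]" "n [2,7,16,5]"
  "n [2,9,5,4,7]" "n [2,9,7,4,5]" "n [2,9,10,5,16]" "n [2,9,16,7]" "n [2,16,5,7]" "n [2,16,7,5]"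
  "n [2,16,7,9]" "n [2,16,9,7]" "n [2,24,5,11,32]" "n [2,38,5,4,50]" "n [2,42,31,4]"
  "n [2,49,55,38,20]" "n [3,4,5,11,12]" "n [3,36,5,4]" "n [3,55,36,49]" "n [4,8,5,51,39]"
  "n [4,8,5,52]" "n [4,61,8,5]" "n [6,8,5,4,7]" "n [6,8,5,4,10,9]" "n [6,8,5,4,14]"
  "n [6,8,7,4,5]" "n [6,8,10,9,5,4]" "n [6,8,31,16]" "n [7,8,4,5,6]" "n [7,8,55,16,33]"
  "n [7,8,64,55]" "n [7,16,9,15]" "n [8,3,4,5,42]" "n [8,3,5,9,16]" "n [8,3,9,5,16]"
  "n [8,3,16,9,5]" "n [8,10,84,9]" "n [8,11,9,5,4,3]" "n [8,11,31,9,10,63]" "n [8,17,16,5]"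
  "n [8,17,16,9]" "n [8,18,4,7,9]" "n [8,18,4,9,7]" "n [8,18,4,31,42]" "n [8,18,4,47,38]"
  "n [8,18,7,16]" "n [8,23,9,16,7]" "n [8,24,5,9,10,16]" "n [8,24,5,16,7]" "n [8,24,42,31]"
  "n [8,27,70,31,42]" "n [8,37,38,5]" "n [8,41,5,3]" "n [8,43,4,31]" "n [8,43,31,4]"
  "n [8,45,38,16]" "n [8,46,38,4]" "n [8,49,55,16,10]" "n [8,64,55,7]" "n [9,5,4,32,11]"
  "n [9,10,4,8,5,6]" "n [9,10,16,8,33]" "n [9,10,42,8,70,31]" "n [9,14,36,10]" "n [9,16,8,5,3]"
  "n [9,32,11,5,4]" "n [9,48,70,8,42]" "n [9,65,8,3]" "n [9,69,10,8]" "n [10,4,5,11,32]"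
  "n [10,9,31,70,8,42]" "n [10,11,32,4,5]" "n [10,81,8,70]" "n [10,82,8,28]" "n [11,70,31,36,10]"
  "n [11,70,31,58]" "n [12,9,10,5,35]" "n [12,11,5,4,33]" "n [13,5,8,7,16]" "n [13,7,8,16,5]"
  "n [13,8,4,31,42]" "n [13,8,5,16,7]" "n [13,10,4,5,11,12]" "n [13,10,36,5,4]" "n [13,10,36,49]"
  "n [13,14,8,16,10]" "n [13,14,16,8,10]" "n [13,16,8,5,7]" "n [13,16,8,7,5]" "n [13,48,38,8,16]"
  "n [13,53,16,39]" "n [13,53,38,20]" "n [13,65,8,7]" "n [13,78,38,8]" "n [14,4,8,5,6]"
  "n [14,8,4,5,6]" "n [14,9,10,36]" "n [14,38,20,8,5]" "n [15,4,31,42]" "n [15,4,42,31]"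
  "n [15,5,9,10,16]" "n [15,5,16,7]" "n [15,5,16,10,9]" "n [15,9,10,5,16]" "n [15,9,16,7]"
  "n [15,11,5,4,7]" "n [15,11,5,4,10,9]" "n [15,11,5,4,14]" "n [15,11,7,4,5]" "n [15,11,10,9,5,4]"
  "n [15,11,31,16]" "n [15,27,5,4,10]" "n [15,27,10,5,4]" "n [15,31,4,42]" "n [15,31,42,4]"
  "n [15,42,4,31]" "n [15,42,31,4]" "n [15,58,38,5,4]" "n [16,8,7,5,13]" "n [16,8,9,5,3]"
  "n [16,8,9,7,23]" "n [16,8,10,9,5,21]" "n [16,10,9,5,15]" "n [16,32,11,5]" "n [19,5,8,7,16]"
  "n [19,7,8,16,5]" "n [19,7,8,16,9]" "n [19,8,4,47]" "n [19,8,5,4,9,7]" "n [19,8,5,4,50]"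
  "n [19,8,5,7,16]" "n [19,8,9,5,4,7]" "n [19,8,9,7,4,5]" "n [19,31,8,9,10,4]" "n [19,47,8,4]"
  "n [19,67,8,55,16]" "n [20,8,5,7]" "n [20,8,5,10,9]" "n [20,8,7,5]" "n [20,8,10,9,5]"
  "n [21,4,8,42,31]" "n [21,8,4,31,42]" "n [21,8,4,42,31]" "n [21,8,5,9,10,16]" "n [21,8,5,16,7]"
  "n [21,8,5,16,10,9]" "n [21,8,9,10,5,16]" "n [21,8,9,16,7]" "n [21,8,16,7,9]" "n [21,9,8,16,7]"
  "n [21,9,10,8,5,16]" "n [21,9,10,16,8,5]" "n [21,16,8,7,9]" "n [21,16,8,10,9,5]"
  "n [21,19,8,9,5,4,3]" "n [21,19,31,8,9,10,63]" "n [21,19,31,36,10]" "n [21,19,31,58]"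
  "n [21,20,8,5,3]" "n [21,20,55,32,11]" "n [21,29,31,8,42]" "n [21,31,8,4,42]" "n [21,31,8,42,4]"
  "n [21,38,40,8,5]" "n [21,42,8,4,31]" "n [21,42,8,31,4]" "n [21,54,11,5,4]" "n [22,3,4,5,13]"
  "n [22,3,16,23]" "n [22,5,4,7]" "n [22,5,4,10,9]" "n [22,7,4,5]" "n [22,10,9,5,4]"
  "n [22,55,16,7]" "n [25,8,9,10,16]" "n [25,8,16,7]" "n [26,8,5,4,10]" "n [26,8,10,5,4]"
  "n [28,4,5,11,32]" "n [28,8,9,10,5,35]" "n [28,9,8,16,3]" "n [28,11,32,4,5]" "n [28,20,8,10,9]"
  "n [28,29,5,8,4,10]" "n [28,29,8,10,5,4]" "n [28,59,31,19]" "n [29,5,8,4,7]" "n [29,7,8,4,5]"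
  "n [29,7,8,16]" "n [29,8,5,4,7]" "n [29,38,5,8,4,14]" "n [29,38,14,8,4,5]" "n [29,38,48,8,4]"
  "n [30,8,4,42]" "n [30,8,9,10,4]" "n [30,8,42,4]" "n [31,11,32,4]" "n [31,71,70,8]"
  "n [32,4,5,9,10]" "n [32,4,5,42]" "n [32,9,10,4,5]" "n [32,9,10,16]" "n [32,11,31,4]"
  "n [33,4,8,5,9,10]" "n [33,4,8,5,42]" "n [33,8,4,5,9,10]" "n [33,8,9,10,4,5]" "n [33,8,9,10,16]"
  "n [33,9,10,4,8,5]" "n [33,9,10,8,4,5]" "n [33,9,10,8,16]" "n [33,9,10,16,8]" "n [33,16,55,8,7]"
  "n [33,29,3,22]" "n [33,38,83,8]" "n [33,82,8,39]" "n [34,3,4,5,9]" "n [34,3,9,4,5]"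
  "n [34,3,9,16]" "n [34,3,16,9]" "n [34,5,4,32,11]" "n [34,32,11,5,4]" "n [34,45,38,4]"
  "n [34,49,38,4,5]" "n [35,8,5,9,7]" "n [35,8,7,5,9]" "n [35,8,7,9,5]" "n [35,8,9,5,7]"
  "n [35,8,9,7,5]" "n [35,8,31,42]" "n [36,3,4,5]" "n [36,55,3,16]" "n [38,9,14,8,20]"
  "n [38,9,14,20,8]" "n [38,9,14,80]" "n [38,9,59,49]" "n [38,28,59,5,4]" "n [38,32,41,5]"
  "n [38,76,55,49]" "n [39,4,8,42,31]" "n [39,8,4,42,31]" "n [39,9,5,8,4,14]" "n [39,9,14,8,4,5]"
  "n [39,9,48,8,4]" "n [39,36,49,9]" "n [39,40,8,5]" "n [39,42,8,4,31]" "n [39,42,8,31,4]"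
  "n [39,72,9,70,8]" "n [39,73,70,8,29]" "n [41,55,32,11]" "n [42,5,4,32]" "n [42,8,5,4,3]"
  "n [42,8,5,4,10,13]" "n [44,8,4,31]" "n [48,8,9,10,63]" "n [48,38,59,21]" "n [48,38,70,58]"
  "n [48,70,36,10]" "n [50,8,55,38,20]" "n [53,4,5,11]" "n [55,10,16,32,11]" "n [55,10,49,59]"
  "n [55,61,8,16]" "n [55,75,38,59]" "n [56,55,16,39]" "n [56,55,38,20]" "n [57,38,5,4]"
  "n [57,38,55,49]" "n [59,38,49,9]" "n [60,8,4,5,9]" "n [60,8,9,4,5]" "n [60,8,9,16]"
  "n [60,8,16,9]" "n [62,8,7,9]" "n [62,8,10,9,5]" "n [66,8,55,16]" "n [68,8,10,9]"
  "n [70,7,8,42,31]" "n [70,29,73,8,39]" "n [70,29,74,38,8]" "n [70,47,8,42]" "n [77,55,38,59]"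
  "n [79,55,36,10]" "n [79,55,38,80]" "n [85,70,3,55]"
  by (simp_all add: too_many_def nu_pal_nth)

text \<open>For the periods 11 and 22 the exponent is exactly 28/11.\<close>

lemma [nu_rules]:
  "long_power 28 11 1 2" "long_power 28 11 2 4" "long_power 28 11 3 5" "long_power 28 11 4 7"
  "long_power 28 11 5 8" "long_power 28 11 6 10" "long_power 28 11 7 11" "long_power 28 11 10 16"
  "long_power 28 11 11 17" "long_power 28 11 13 21" "long_power 28 11 14 22"
  "long_power 28 11 15 24" "long_power 28 11 16 25" "long_power 28 11 17 27"
  "long_power 28 11 21 33" "long_power 28 11 22 34" "long_power 28 11 25 39"
  "long_power 28 11 26 41" "long_power 28 11 36 56" "long_power 28 11 38 59"
  by (simp_all add: long_power_def)

lemmas [nu_rules] = refute_rules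

lemma [THEN refuted_variants, simplified, nu_rules]:
  "S [r 1 2]
    [F,F,F]"
  by (simp only: nu_rules)

lemma [THEN refuted_variants, simplified, nu_rules]:
  "S [f,e,e,x,f,e,e,x,r 3 5,e,e,r 5 8,r 2 4,e,f,e,e,e,x,r 3 5,r 5 8,e,f,e,e,x,r 11 17,e,f,e,e,x,f,e,f,e,e,q [0,2,1,3,5,4,3,5,14,6],q [0,7,1,8,5,4,3,5,14,6],e,q [0,9,2,10,4,4,2,8,1,5,14,6],x,e,r 2 4,f,e,q [0,3,5,4,3,5,15,11,3,12],q [0,13,1,10,4,4,3,5,15,11,3,12],e,r 11 17,e,e,e,x,f,e,q [0,6,1,8,4,5,2,4,16,14],q [0,15,1,11,4,5,2,4,16,14],r 3 5,x,e,r 3 5,x,x,x,r 2 4]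
    [F,T,F,F,T,F,T,F,F,T,T,F,T,F,F,T,F,T,F]"
  by (simp only: nu_rules)

lemma [THEN refuted_variants, simplified, nu_rules]:
  "S [e,e,e,x,e,e,q [0,2,4,16,11,5,11,7],e,q [0,8,0,17,5,16,11,5],e,e,e,x,e,e,q [0,2,6,7,4,16,11,5],e,e,e,x,e,e,q [0,2,11,7,4,16,11,5],e,q [0,8,0,18,12,7,4,16],e,r 26 41,x,f,e,f,e,f,e,x,f,e,f,e,f,e,x,e,e,q [0,2,4,16,11,7,15,5],e,q [0,8,0,17,5,16,26,5],e,e,r 15 24,q [0,19,3,7,1,8,3,16,26,5],x,q [0,13,3,16,4,8,7,7,15,5],q [0,13,7,8,1,5,6,16,5,7],q [0,20,5,8,7,7,15,5],x,e,e,e,x,r 26 41,q [0,15,8,5,6,16,5,7],q [0,21,6,8,1,5,6,16,5,7],r 2 4,e,r 6 10,x,q [0,13,5,7,1,8,3,16,11,5],q [0,19,3,7,1,8,3,16,11,5],x,q [0,13,3,16,4,8,7,5,11,7],q [0,20,5,8,7,5,11,7],x]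
    [T,T,F,F,T,F,T,F,F,T,T,F,T,F,F,T,F,T,F,F,T,T,F,T,F,F,T,T,F,F,T,F,T,F,F,T,T,F,T,F,F,T,F,T,F,F,T,T,F]"
  by (simp only: nu_rules)

lemma [THEN refuted_variants, simplified, nu_rules]:
  "S [e,e,e,x,e,e,q [0,2,6,7,4,16,11,5],e,e,e,x,e,e,q [0,2,11,7,4,16,11,5],e,q [0,8,0,18,12,7,4,16],e,e,e,x,e,e,q [0,2,6,5,11,7,4,16],e,e,e,x,e,x,x,r 2 4,e,e,e,x,r 6 10,q [0,19,4,8,5,5,11,7,4,16],x,q [0,13,5,5,1,8,10,7,4,16],q [0,19,3,5,1,8,10,7,4,16],x,e,e,e,x,e,e,q [0,2,4,16,11,7,15,5],e,q [0,8,0,17,5,16,26,5],e,e,r 15 24,q [0,19,3,7,1,8,3,16,26,5],x,q [0,13,3,16,4,8,7,7,15,5],q [0,20,5,8,7,7,15,5],x,r 2 4,e,r 6 10,x,q [0,13,5,7,1,8,3,16,11,5],q [0,19,3,7,1,8,3,16,11,5],x]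
    [T,T,F,T,F,F,T,T,F,F,T,F,T,F,F,T,T,F,T,F,F,T,F,T,F,F,T,T,F]"
  by (simp only: nu_rules)

lemma [THEN refuted_variants, simplified, nu_rules]:
  "S [e,e,x,e,r 3 5,q [0,22,3,3,3,16,12,23],f,e,e,x,r 3 5,f,e,q [0,8,0,17,5,16,11,5],f,e,e,e,x,e,q [0,8,0,24,4,5,6,16,5,7],e,x,x,r 2 4,q [0,25,2,8,5,16,5,7]]
    [F,T,F,F,T,T,F,F,T,F,T,F,F,T,T,F,T,F,F,T,F]"
  by (simp only: nu_rules)

lemma [THEN refuted_variants, simplified, nu_rules]:
  "S [e,f,e,x,f,e,e,x,e,r 3 5,q [0,22,8,5,2,4,5,10,2,9],e,e,e,x,e,x,e,e,f,e,e,q [0,2,11,5,6,9,2,10,70,16],e,x,q [0,25,2,8,16,9,2,10,70,16],e,e,e,x,e,q [0,8,0,3,14,5,6,9,72,16],e,r 21 33,x,e,r 6 10,q [0,21,6,8,7,5,6,9,2,10,70,16],x,q [0,20,5,8,7,5,7,10,2,9],x,r 2 4,e,e,e,x,r 6 10,e,e,q [0,6,1,8,10,5,2,4,5,10,2,9],q [0,15,1,11,10,5,2,4,5,10,2,9],e,r 3 5,x,x,e,e,r 36 56,e,e,q [0,26,1,8,8,5,2,4,5,10],q [0,15,1,27,8,5,2,4,5,10],e,q [0,28,2,29,7,5,1,8,1,4,5,10],x,x]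
    [T,F,F,T,T,F,T,F,F,T,F,T,F,F,T,T,F,F,T,T,F,T,F,F,T,F,T,F,F,T,T,F,T,F,F,T,T,F,F,T,T,F,T,F,F,T,F,T,F,F,T,T,F,F,T,T,F,T,F,F,T,F,T,F,F,T,T,F,T,F,F,T,T,F,F,T,T,F,T,F,F,T,F,T,F,F,T,T,F,T,F,F]"
  by (simp only: nu_rules)

text \<open>Many of the following words extend 010011010010100110011, which is itself refuted after
  them: dead ends deep in its search are settled beforehand.\<close>

lemma [THEN refuted_variants, simplified, nu_rules]:
  "S [f,e,e,x,r 3 5,e,e,e,x,f,e,e,x,e,r 3 5,q [0,22,8,5,2,4,5,10,2,9],e,e,e,x,e,x,e,f,e,q [0,8,0,24,4,5,6,9,2,10,70,16],e,e,e,x,e,q [0,8,0,3,8,5,6,9,72,16],r 36 56,e,e,x,q [0,15,8,5,6,9,2,10,70,16],q [0,21,6,8,1,5,6,9,2,10,70,16],x,x,r 2 4,e,e,e,x,r 6 10,e,e,q [0,6,1,8,10,5,2,4,5,10,2,9],q [0,15,1,11,10,5,2,4,5,10,2,9],e,r 3 5,x,x,r 2 4,e,e,q [0,30,4,8,5,9,2,10,10,4],q [0,19,1,31,3,8,5,9,2,10,10,4],x]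
    [F,T,F,F,T,T,F,T,F,F,T,F,T,F,F,T,T,F,F,T,T,F,T,F,F,T,F,T,F,F,T,T,F,T,F,F,T,T,F,F,T,T,F,T,F,F,T,F,T,F,F,T,T,F,F,T,T,F,T,F,F,T,F,T,F,F,T,T,F,T,F,F,T,T,F,F,T,T,F,T,F,F,T,F]"
  by (simp only: nu_rules)

lemma [THEN refuted_variants, simplified, nu_rules]:
  "S [e,e,x,e,r 3 5,q [0,22,8,5,2,4,5,10,2,9],e,e,e,x,e,x,e,e,e,x,e,x,e,e,r 4 7,f,e,x,f,e,f,e,x,e,e,e,x,e,q [0,8,0,3,9,9,15,5,57,16],e,r 10 16,x,e,e,e,x,r 6 10,q [0,15,9,9,2,10,13,5,57,16],q [0,21,6,8,2,9,2,10,13,5,57,16],x,q [0,21,2,9,2,10,2,16,4,8,7,5],x,q [0,20,5,8,7,5,7,10,2,9],x,r 2 4,e,e,e,x,r 6 10,e,e,q [0,6,1,8,10,5,2,4,5,10,2,9],q [0,15,1,11,10,5,2,4,5,10,2,9],e,r 3 5,x,x]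
    [F,T,F,F,T,T,F,T,F,F,T,F,T,F,F,T,T,F,F,T,T,F,T,F,F,T,F,T,F,F,T,T,F,T,F,F,T,T,F,F,T,T,F,T,F,F,T,F,T,F,F,T,T,F,F,T,T,F,T,F,F,T,F,T,F,F,T,T,F,T,F,F,T,T,F,F,T,T,F,T,F,F]"
  by (simp only: nu_rules)

lemma [THEN refuted_variants, simplified, nu_rules]:
  "S [e,e,r 5 8,r 2 4,e,f,e,f,e,e,x,e,x,e,e,e,x,e,e,e,x,e,r 3 5,q [0,22,4,10,2,9,6,5,2,4],e,r 15 24,e,e,e,x,f,e,x,r 36 56,e,e,q [0,6,1,8,6,10,2,9,6,5,2,4],q [0,15,1,11,6,10,2,9,6,5,2,4],e,r 3 5,x,x,r 4 7,e,e,q [0,26,1,8,8,5,2,4,5,10],q [0,15,1,27,8,5,2,4,5,10],e,q [0,28,2,29,7,5,1,8,1,4,5,10],x,x,e,e,q [0,6,1,8,4,5,2,4,5,10,2,9],q [0,15,1,11,4,5,2,4,5,10,2,9],e,r 3 5,x,e,r 2 4,e,q [0,32,5,9,2,10,10,4,3,5],x,x]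
    [T,F,T,F,F,T,F,T,F,F,T,T,F,F,T,T,F,T,F,F,T,F,T,F,F,T,T,F,T,F,F,T,T,F,F,T,T,F,T,F,F,T,F,T,F,F,T,T,F,F,T,T,F,T,F,F,T,F,T,F,F,T,T,F,T,F,F,T,T,F,F,T,T,F,T,F]"
  by (simp only: nu_rules)

lemma [THEN refuted_variants, simplified, nu_rules]:
  "S [f,e,e,r 4 7,f,e,e,x,r 3 5,f,e,x,e,e,q [0,33,4,9,2,10,6,8,4,4,3,5],r 3 5,x,x]
    [F,T,F,F,T,F,T,F,F,T,T,F,F,T,T,F,T,F,F,T,F,T,F,F,T,T,F,T,F,F,T,T,F,F,T,T,F,T,F,F,T,F,T,F,F,T,T,F,F,T,T,F,T,F,F,T,F,T,F,F,T,T,F,T,F,F,T,T,F,F,T,T]"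
  by (simp only: nu_rules)

lemma [THEN refuted_variants, simplified, nu_rules]:
  "S [e,e,x,e,r 3 5,q [0,22,8,5,2,4,5,10,2,9],e,e,e,x,e,x,e,e,e,x,e,x,e,e,r 4 7,f,e,f,e,f,e,e,x,e,e,q [0,2,11,5,6,9,2,10,49,16],e,x,q [0,25,2,8,16,9,2,10,49,16],e,e,e,x,e,q [0,8,0,3,14,5,6,9,51,16],x,e,r 6 10,q [0,21,6,8,7,5,6,9,2,10,49,16],x,q [0,15,8,5,6,9,2,10,49,16],q [0,21,2,9,2,10,2,16,4,8,7,5],q [0,21,6,8,1,5,6,9,2,10,49,16],x,q [0,20,5,8,7,5,7,10,2,9],x,r 2 4,e,e,e,x,r 6 10,e,e,q [0,6,1,8,10,5,2,4,5,10,2,9],q [0,15,1,11,10,5,2,4,5,10,2,9],e,r 3 5,x,x]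
    [F,T,F,F,T,T,F,T,F,F,T,F,T,F,F,T,T,F,F,T,T,F,T,F,F,T,F,T,F,F,T,T,F,T,F,F,T,T,F,F,T,T,F,T,F,F,T,F,T,F,F,T,T,F,F,T,T,F,T,F,F,T,F,T,F,F,T,T,F,T]"
  by (simp only: nu_rules)

lemma [THEN refuted_variants, simplified, nu_rules]:
  "S [f,e,e,x,r 3 5,e,e,e,x,e,e,e,x,r 3 5,r 5 8,e,e,r 15 24,x,x,r 2 4,e,e,q [0,30,4,8,5,9,2,10,4,4],q [0,19,1,31,3,8,5,9,2,10,4,4],x]
    [F,T,F,F,T,T,F,T,F,F,T,F,T,F,F,T,T,F,F,T,T,F,T,F,F,T,F,T,F,F,T,T,F,T,F,F,T,T,F,F,T,T,F,T,F,F,T,F,T,F,F,T,T,F,F,T,T,F,T,F,F,T,F]"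
  by (simp only: nu_rules)

lemma [THEN refuted_variants, simplified, nu_rules]:
  "S [e,e,x,e,r 3 5,q [0,22,8,5,2,4,5,10,2,9],e,e,e,x,e,x,f,e,f,e,f,e,f,e,f,e,x,f,e,x,f,e,q [0,8,0,3,9,9,9,5,42,16],e,e,r 4 7,e,e,e,x,r 10 16,q [0,15,3,9,2,10,17,5,42,16],q [0,21,2,9,2,10,6,8,11,5,42,16],x,q [0,20,5,8,7,5,7,10,2,9],e,e,e,x,r 6 10,q [0,15,9,9,2,10,7,5,42,16],q [0,21,6,8,2,9,2,10,7,5,42,16],x,x,r 2 4,e,e,e,x,r 6 10,e,e,q [0,6,1,8,10,5,2,4,5,10,2,9],q [0,15,1,11,10,5,2,4,5,10,2,9],e,r 3 5,x,x]
    [F,T,F,F,T,T,F,T,F,F,T,F,T,F,F,T,T,F,F,T,T,F,T,F,F,T,F,T,F,F,T,T,F,T,F,F,T,T,F,F,T,T,F,T,F,F,T,F,T,F,F,T,T,F,F,T,T,F,T,F,F,T,T]"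
  by (simp only: nu_rules)

lemma [THEN refuted_variants, simplified, nu_rules]:
  "S [e,e,x,e,r 3 5,q [0,22,8,5,2,4,5,10,2,9],e,e,e,x,e,x,e,e,f,e,x,f,e,x,f,e,q [0,8,0,3,8,5,6,9,36,16],f,e,x,f,e,e,r 4 7,e,e,e,x,e,x,x,q [0,15,3,9,2,10,7,5,42,16],q [0,21,2,9,2,10,6,8,1,5,42,16],x,q [0,20,5,8,7,5,7,10,2,9],x,r 2 4,e,e,e,x,r 6 10,e,e,q [0,6,1,8,10,5,2,4,5,10,2,9],q [0,15,1,11,10,5,2,4,5,10,2,9],e,r 3 5,x,x]
    [F,T,F,F,T,T,F,T,F,F,T,F,T,F,F,T,T,F,F,T,T,F,T,F,F,T,F,T,F,F,T,T,F,T,F,F,T,T,F,F,T,T,F,T,F,F,T,F,T,F,F,T,T,F,F]"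
  by (simp only: nu_rules)

lemma [THEN refuted_variants, simplified, nu_rules]:
  "S [e,e,x,e,r 3 5,q [0,22,8,5,2,4,5,10,2,9],e,e,e,x,e,x,e,e,e,x,e,x,e,e,r 4 7,f,e,e,x,e,e,q [0,2,11,5,6,9,2,10,34,16],e,x,q [0,25,2,8,16,9,2,10,34,16],e,e,e,x,e,q [0,8,0,3,14,5,6,9,36,16],e,r 21 33,x,e,r 6 10,q [0,21,6,8,7,5,6,9,2,10,34,16],x,q [0,15,8,5,6,9,2,10,34,16],x,q [0,20,5,8,7,5,7,10,2,9],x,r 2 4,e,e,e,x,r 6 10,e,e,q [0,6,1,8,10,5,2,4,5,10,2,9],q [0,15,1,11,10,5,2,4,5,10,2,9],e,r 3 5,x,x]
    [F,T,F,F,T,T,F,T,F,F,T,F,T,F,F,T,T,F,F,T,T,F,T,F,F,T,F,T,F,F,T,T,F,T,F,F,T,T,F,F,T,T,F,T,F,F,T,F,T,F,F,T,T,F,T,F]"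
  by (simp only: nu_rules)

lemma [THEN refuted_variants, simplified, nu_rules]:
  "S [f,e,e,x,r 3 5,e,e,e,x,e,e,e,x,r 3 5,r 5 8,e,e,x,e,x,e,e,q [0,33,6,4,2,8,1,5,6,9,2,10],r 3 5,x,x,r 2 4,e,e,q [0,30,4,8,5,9,2,10,10,4],q [0,19,1,31,3,8,5,9,2,10,10,4],x]
    [F,T,F,F,T,T,F,T,F,F,T,F,T,F,F,T,T,F,F,T,T,F,T,F,F,T,F,T,F,F,T,T,F,T,F,F,T,T,F,F,T,T,F,T,F,F,T,F]"
  by (simp only: nu_rules)

lemma [THEN refuted_variants, simplified, nu_rules]:
  "S [e,e,x,e,r 3 5,q [0,22,8,5,2,4,5,10,2,9],e,e,e,x,e,x,e,e,e,x,e,x,e,e,r 4 7,f,e,x,f,e,f,e,x,e,e,e,x,e,q [0,8,0,3,9,9,15,5,21,16],e,r 10 16,x,e,e,e,x,r 6 10,q [0,15,9,9,2,10,13,5,21,16],q [0,21,6,8,2,9,2,10,13,5,21,16],x,q [0,21,2,9,2,10,2,16,4,8,7,5],x,q [0,20,5,8,7,5,7,10,2,9],x,r 2 4,e,e,e,x,r 6 10,e,e,q [0,6,1,8,10,5,2,4,5,10,2,9],q [0,15,1,11,10,5,2,4,5,10,2,9],e,r 3 5,x,x]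
    [F,T,F,F,T,T,F,T,F,F,T,F,T,F,F,T,T,F,F,T,T,F,T,F,F,T,F,T,F,F,T,T,F,T,F,F,T,T,F,F,T,T,F,T,F,F]"
  by (simp only: nu_rules)

lemma [THEN refuted_variants, simplified, nu_rules]:
  "S [e,e,x,e,r 3 5,q [0,22,8,5,2,4,5,10,2,9],e,e,e,x,e,x,e,e,f,e,x,f,e,x,f,e,e,q [0,2,11,5,6,9,2,10,13,16],e,x,q [0,25,2,8,16,9,2,10,13,16],f,e,x,f,e,f,e,f,e,e,x,e,q [0,8,0,3,14,5,6,9,15,16],e,e,r 4 7,e,e,x,q [0,15,3,9,2,10,13,5,21,16],q [0,21,2,9,2,10,6,8,7,5,21,16],x,e,r 6 10,q [0,21,6,8,7,5,6,9,2,10,13,16],x,x,q [0,20,5,8,7,5,7,10,2,9],x,r 2 4,e,e,e,x,r 6 10,e,e,q [0,6,1,8,10,5,2,4,5,10,2,9],q [0,15,1,11,10,5,2,4,5,10,2,9],e,r 3 5,x,x]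
    [F,T,F,F,T,T,F,T,F,F,T,F,T,F,F,T,T,F,F,T,T,F,T,F,F,T,F,T,F,F,T,T,F,T,F,F]"
  by (simp only: nu_rules)

lemma [THEN refuted_variants, simplified, nu_rules]:
  "S [f,e,e,x,f,e,e,x,e,r 3 5,q [0,22,8,5,2,4,5,10,2,9],e,e,e,x,e,x,e,e,f,e,q [0,8,0,24,4,5,6,9,2,10,13,16],f,e,x,f,e,f,e,x,f,e,f,e,f,e,x,e,q [0,8,0,3,8,5,6,9,15,16],e,e,r 4 7,e,e,r 15 24,q [0,15,3,9,2,10,7,5,21,16],q [0,21,2,9,2,10,6,8,1,5,21,16],x,x,e,e,x,q [0,15,8,5,6,9,2,10,13,16],q [0,21,6,8,1,5,6,9,2,10,13,16],x,q [0,20,5,8,7,5,7,10,2,9],x,r 2 4,e,e,e,x,r 6 10,e,e,q [0,6,1,8,10,5,2,4,5,10,2,9],q [0,15,1,11,10,5,2,4,5,10,2,9],e,r 3 5,x,x,r 2 4]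
    [F,T,F,F,T,T,F,T,F,F,T,F,T,F,F,T,T,F,F,T,T,F,T,F,F,T,F,T,F]"
  by (simp only: nu_rules)

lemma [THEN refuted_variants, simplified, nu_rules]:
  "S [f,e,e,x,r 3 5,e,x,e,e,q [0,30,4,8,5,9,2,10,4,4],q [0,19,1,31,3,8,5,9,2,10,4,4],x]
    [F,T,F,F,T,T,F,T,F,F,T,F,T,F,F,T,T,F,F,T,T,F,T,F,F,T,F]"
  by (simp only: nu_rules)

lemma [THEN refuted_variants, simplified, nu_rules]:
  "S [e,e,x,e,r 3 5,q [0,22,8,5,2,4,5,10,2,9],e,e,e,x,e,x,f,e,f,e,f,e,f,e,f,e,x,f,e,x,f,e,q [0,8,0,3,9,9,9,5,6,16],e,e,r 4 7,e,e,e,x,r 10 16,q [0,15,3,9,2,10,17,5,6,16],q [0,21,2,9,2,10,6,8,11,5,6,16],x,q [0,20,5,8,7,5,7,10,2,9],e,e,e,x,r 6 10,q [0,15,9,9,2,10,7,5,6,16],q [0,21,6,8,2,9,2,10,7,5,6,16],x,x,r 2 4,e,e,e,x,r 6 10,e,e,q [0,6,1,8,10,5,2,4,5,10,2,9],q [0,15,1,11,10,5,2,4,5,10,2,9],e,r 3 5,x,x]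
    [F,T,F,F,T,T,F,T,F,F,T,F,T,F,F,T,T,F,F,T,T,F,T,F,F,T,T]"
  by (simp only: nu_rules)

lemma [THEN refuted_variants, simplified, nu_rules]:
  "S [f,e,e,r 4 7,e,e,e,x,e,x,x,e,r 2 4,e,q [0,32,5,9,2,10,4,4,3,5],x,e,e,q [0,33,4,9,2,10,4,4,2,8,1,5],r 3 5,x,x]
    [F,T,F,F,T,T,F,T,F,F,T,F,T,F,F,T,T,F,F,T,T]"
  by (simp only: nu_rules)

lemma [THEN refuted_variants, simplified, nu_rules]:
  "S [e,e,x,e,r 3 5,q [0,22,8,5,2,4,11,10,2,9],e,e,e,x,e,x,f,e,f,e,f,e,f,e,f,e,x,f,e,x,f,e,q [0,8,0,3,9,9,9,5,63,16],e,e,r 4 7,e,e,e,x,r 10 16,q [0,15,3,9,2,10,17,5,63,16],q [0,21,2,9,2,10,6,8,11,5,63,16],x,q [0,20,5,8,7,5,13,10,2,9],e,e,e,x,r 6 10,q [0,15,9,9,2,10,7,5,63,16],q [0,21,6,8,2,9,2,10,7,5,63,16],x,x,r 2 4,e,e,e,x,r 6 10,e,e,q [0,6,1,8,10,5,2,4,11,10,2,9],q [0,15,1,11,10,5,2,4,11,10,2,9],e,r 3 5,x,x]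
    [F,T,F,F,T,T,F,T,F,F,T,F,T,F,F,T,T,F,T,F,F,T,T,F,F,T,T,F,T,F,F,T,F,T,F,F,T,T,F,F,T,T,F,T,F,F,T,F,T,F,F,T,T,F,T,F,F,T,T,F,F,T,T,F,T,F,F,T,F,T,F,F,T,T,F,F,T,T,F,T,F,F,T,T]"
  by (simp only: nu_rules)

lemma [THEN refuted_variants, simplified, nu_rules]:
  "S [f,e,e,r 4 7,e,e,e,x,e,e,e,x,r 3 5,e,e,e,x,e,e,e,x,r 3 5,r 5 8,e,e,r 15 24,e,e,r 36 56,e,r 2 4,e,q [0,32,7,4,3,5,6,9,2,10],x,e,e,q [0,33,6,4,2,8,1,5,6,9,2,10],r 3 5,x,x,r 2 4,e,e,q [0,30,4,8,5,9,2,10,4,4],q [0,19,1,31,3,8,5,9,2,10,4,4],x,x,e,r 2 4,e,q [0,32,5,9,2,10,4,4,3,5],x,e,e,q [0,33,4,9,2,10,4,4,2,8,1,5],r 3 5,x,x]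
    [F,T,F,F,T,T,F,T,F,F,T,F,T,F,F,T,T,F,T,F,F,T,T,F,F,T,T,F,T,F,F,T,F,T,F,F,T,T,F,F,T,T,F,T,F,F,T,F,T,F,F,T,T,F,T,F,F,T,T,F,F,T,T,F,T,F,F,T,F,T,F,F,T,T,F,F,T,T]"
  by (simp only: nu_rules)

lemma [THEN refuted_variants, simplified, nu_rules]:
  "S [e,e,x,e,r 3 5,q [0,22,8,5,2,4,11,10,2,9],e,e,e,x,e,x,e,e,e,x,e,x,e,e,r 4 7,f,e,e,x,e,e,q [0,2,11,5,6,9,2,10,55,16],e,x,q [0,25,2,8,16,9,2,10,55,16],e,e,e,x,e,q [0,8,0,3,14,5,6,9,57,16],e,r 21 33,x,e,r 6 10,q [0,21,6,8,7,5,6,9,2,10,55,16],x,q [0,15,8,5,6,9,2,10,55,16],x,q [0,20,5,8,7,5,13,10,2,9],x,r 2 4,e,e,e,x,r 6 10,e,e,q [0,6,1,8,10,5,2,4,11,10,2,9],q [0,15,1,11,10,5,2,4,11,10,2,9],e,r 3 5,x,x]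
    [F,T,F,F,T,T,F,T,F,F,T,F,T,F,F,T,T,F,T,F,F,T,T,F,F,T,T,F,T,F,F,T,F,T,F,F,T,T,F,F,T,T,F,T,F,F,T,F,T,F,F,T,T,F,T,F,F,T,T,F,F,T,T,F,T,F,F,T,F,T,F,F,T,T,F,T,F]"
  by (simp only: nu_rules)

lemma [THEN refuted_variants, simplified, nu_rules]:
  "S [f,e,e,x,r 3 5,e,e,e,x,e,e,e,x,r 3 5,r 5 8,e,e,e,x,e,e,e,x,q [0,34,2,3,5,4,3,5,6,9],f,e,q [0,2,6,5,2,4,13,9,47,7],e,e,e,x,e,x,q [0,35,3,8,7,5,15,9,47,7],r 2 4,e,e,e,x,r 6 10,q [0,19,4,8,5,5,2,4,13,9,47,7],x,x,e,x,e,e,q [0,33,6,4,2,8,1,5,6,9,2,10],r 3 5,x,x,r 2 4,e,e,q [0,30,4,8,5,9,2,10,10,4],q [0,19,1,31,3,8,5,9,2,10,10,4],x]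
    [F,T,F,F,T,T,F,T,F,F,T,F,T,F,F,T,T,F,T,F,F,T,T,F,F,T,T,F,T,F,F,T,F,T,F,F,T,T,F,F,T,T,F,T,F,F,T,F,T,F,F,T,T,F,T,F,F,T,T,F,F,T,T,F,T,F,F,T,F]"
  by (simp only: nu_rules)

lemma [THEN refuted_variants, simplified, nu_rules]:
  "S [e,e,x,e,r 3 5,q [0,22,8,5,2,4,11,10,2,9],e,e,e,x,e,x,e,e,e,x,e,x,e,e,r 4 7,f,e,x,f,e,f,e,x,e,e,e,x,e,q [0,8,0,3,9,9,15,5,42,16],e,r 10 16,x,e,e,e,x,r 6 10,q [0,15,9,9,2,10,13,5,42,16],q [0,21,6,8,2,9,2,10,13,5,42,16],x,q [0,21,2,9,2,10,2,16,4,8,7,5],x,q [0,20,5,8,7,5,13,10,2,9],x,r 2 4,e,e,e,x,r 6 10,e,e,q [0,6,1,8,10,5,2,4,11,10,2,9],q [0,15,1,11,10,5,2,4,11,10,2,9],e,r 3 5,x,x]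
    [F,T,F,F,T,T,F,T,F,F,T,F,T,F,F,T,T,F,T,F,F,T,T,F,F,T,T,F,T,F,F,T,F,T,F,F,T,T,F,F,T,T,F,T,F,F,T,F,T,F,F,T,T,F,T,F,F,T,T,F,F,T,T,F,T,F,F]"
  by (simp only: nu_rules)

lemma [THEN refuted_variants, simplified, nu_rules]:
  "S [e,e,x,e,r 3 5,q [0,22,8,5,2,4,11,10,2,9],e,e,e,x,e,x,e,e,f,e,x,f,e,x,f,e,e,q [0,2,11,5,6,9,2,10,34,16],e,x,q [0,25,2,8,16,9,2,10,34,16],f,e,x,f,e,f,e,f,e,e,x,e,q [0,8,0,3,14,5,6,9,36,16],e,e,r 4 7,e,e,x,q [0,15,3,9,2,10,13,5,42,16],q [0,21,2,9,2,10,6,8,7,5,42,16],x,e,r 6 10,q [0,21,6,8,7,5,6,9,2,10,34,16],x,x,q [0,20,5,8,7,5,13,10,2,9],x,r 2 4,e,e,e,x,r 6 10,e,e,q [0,6,1,8,10,5,2,4,11,10,2,9],q [0,15,1,11,10,5,2,4,11,10,2,9],e,r 3 5,x,x]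
    [F,T,F,F,T,T,F,T,F,F,T,F,T,F,F,T,T,F,T,F,F,T,T,F,F,T,T,F,T,F,F,T,F,T,F,F,T,T,F,F,T,T,F,T,F,F,T,F,T,F,F,T,T,F,T,F,F]"
  by (simp only: nu_rules)

lemma [THEN refuted_variants, simplified, nu_rules]:
  "S [f,e,e,x,r 3 5,e,e,e,x,e,e,e,x,r 3 5,r 5 8,e,e,r 15 24,e,e,x,e,r 2 4,e,q [0,32,7,4,3,5,6,9,2,10],x,e,e,q [0,33,6,4,2,8,1,5,6,9,2,10],r 3 5,x,x,r 2 4,e,e,q [0,30,4,8,5,9,2,10,4,4],q [0,19,1,31,3,8,5,9,2,10,4,4],x]
    [F,T,F,F,T,T,F,T,F,F,T,F,T,F,F,T,T,F,T,F,F,T,T,F,F,T,T,F,T,F,F,T,F,T,F,F,T,T,F,F,T,T,F,T,F,F,T,F]"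
  by (simp only: nu_rules)

lemma [THEN refuted_variants, simplified, nu_rules]:
  "S [e,e,x,e,r 3 5,q [0,22,8,5,2,4,11,10,2,9],e,e,e,x,e,x,f,e,f,e,f,e,f,e,f,e,x,f,e,x,f,e,q [0,8,0,3,9,9,9,5,27,16],e,e,r 4 7,e,e,e,x,r 10 16,q [0,15,3,9,2,10,17,5,27,16],q [0,21,2,9,2,10,6,8,11,5,27,16],x,q [0,20,5,8,7,5,13,10,2,9],e,e,e,x,r 6 10,q [0,15,9,9,2,10,7,5,27,16],q [0,21,6,8,2,9,2,10,7,5,27,16],x,x,r 2 4,e,e,e,x,r 6 10,e,e,q [0,6,1,8,10,5,2,4,11,10,2,9],q [0,15,1,11,10,5,2,4,11,10,2,9],e,r 3 5,x,x]
    [F,T,F,F,T,T,F,T,F,F,T,F,T,F,F,T,T,F,T,F,F,T,T,F,F,T,T,F,T,F,F,T,F,T,F,F,T,T,F,F,T,T,F,T,F,F,T,T]"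
  by (simp only: nu_rules)

lemma [THEN refuted_variants, simplified, nu_rules]:
  "S [e,e,x,e,r 3 5,q [0,22,8,5,2,4,11,10,2,9],e,e,e,x,e,x,e,e,f,e,x,f,e,x,f,e,q [0,8,0,3,8,5,6,9,21,16],f,e,x,f,e,e,r 4 7,e,e,e,x,e,x,x,q [0,15,3,9,2,10,7,5,27,16],q [0,21,2,9,2,10,6,8,1,5,27,16],x,q [0,20,5,8,7,5,13,10,2,9],x,r 2 4,e,e,e,x,r 6 10,e,e,q [0,6,1,8,10,5,2,4,11,10,2,9],q [0,15,1,11,10,5,2,4,11,10,2,9],e,r 3 5,x,x]
    [F,T,F,F,T,T,F,T,F,F,T,F,T,F,F,T,T,F,T,F,F,T,T,F,F,T,T,F,T,F,F,T,F,T,F,F,T,T,F,F]"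
  by (simp only: nu_rules)

lemma [THEN refuted_variants, simplified, nu_rules]:
  "S [e,e,e,x,e,r 3 5,q [0,22,8,5,2,4,11,10,2,9],e,e,e,x,e,x,e,e,e,x,e,x,e,f,e,e,q [0,2,6,9,2,10,13,5,27,16],r 21 33,e,e,e,x,e,q [0,8,0,3,9,9,15,5,27,16],e,r 10 16,x,e,e,e,x,r 6 10,q [0,15,9,9,2,10,13,5,27,16],q [0,21,6,8,2,9,2,10,13,5,27,16],x,x,q [0,20,5,8,7,5,13,10,2,9],x,r 2 4,e,e,e,x,r 6 10,e,e,q [0,6,1,8,10,5,2,4,11,10,2,9],q [0,15,1,11,10,5,2,4,11,10,2,9],e,r 3 5,x,x,e,r 21 33,x]
    [T,F,F,T,T,F,T,F,F,T,F,T,F,F,T,T,F,T,F,F,T,T,F,F,T,T,F,T,F,F,T,F,T,F,F,T,T,F,T,F,F,T,T,F,F,T,T,F,T,F,F,T]"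
  by (simp only: nu_rules)

lemma [THEN refuted_variants, simplified, nu_rules]:
  "S [f,e,e,r 4 7,f,e,e,x,r 3 5,e,e,r 5 8,r 2 4,e,f,e,e,e,x,f,e,e,x,x,e,e,q [0,6,1,8,4,5,2,4,11,10,2,9],q [0,15,1,11,4,5,2,4,11,10,2,9],e,r 3 5,x,e,r 2 4,e,q [0,32,5,9,2,10,10,4,3,5],x,e,e,q [0,33,4,9,2,10,6,8,4,4,3,5],r 3 5,x,x,x]
    [F,T,F,F,T,F,T,F,F,T,T,F,T,F,F,T,T,F,F,T,T,F,T,F,F,T,F,T,F,F,T,T,F,T,F,F,T,T,F,F,T,T]"
  by (simp only: nu_rules)

lemma [THEN refuted_variants, simplified, nu_rules]:
  "S [e,e,x,e,r 3 5,q [0,22,8,5,2,4,11,10,2,9],e,e,e,x,e,x,e,e,e,x,e,x,e,e,r 4 7,f,e,f,e,f,e,e,x,e,e,q [0,2,11,5,6,9,2,10,19,16],e,x,q [0,25,2,8,16,9,2,10,19,16],e,e,e,x,e,q [0,8,0,3,14,5,6,9,21,16],x,e,r 6 10,q [0,21,6,8,7,5,6,9,2,10,19,16],x,q [0,15,8,5,6,9,2,10,19,16],q [0,21,2,9,2,10,2,16,4,8,7,5],q [0,21,6,8,1,5,6,9,2,10,19,16],x,q [0,20,5,8,7,5,13,10,2,9],x,r 2 4,e,e,e,x,r 6 10,e,e,q [0,6,1,8,10,5,2,4,11,10,2,9],q [0,15,1,11,10,5,2,4,11,10,2,9],e,r 3 5,x,x]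
    [F,T,F,F,T,T,F,T,F,F,T,F,T,F,F,T,T,F,T,F,F,T,T,F,F,T,T,F,T,F,F,T,F,T,F,F,T,T,F,T]"
  by (simp only: nu_rules)

lemma [THEN refuted_variants, simplified, nu_rules]:
  "S [f,e,e,x,r 3 5,e,e,e,x,e,e,e,x,r 3 5,r 5 8,e,e,x,x,x,r 2 4,e,e,q [0,30,4,8,5,9,2,10,10,4],q [0,19,1,31,3,8,5,9,2,10,10,4],x]
    [F,T,F,F,T,T,F,T,F,F,T,F,T,F,F,T,T,F,T,F,F,T,T,F,F,T,T,F,T,F,F,T,F]"
  by (simp only: nu_rules)

lemma [THEN refuted_variants, simplified, nu_rules]:
  "S [e,e,x,e,r 3 5,q [0,22,8,5,2,4,11,10,2,9],e,e,e,x,e,x,e,e,e,x,e,x,e,e,r 4 7,f,e,x,f,e,f,e,x,e,e,e,x,e,q [0,8,0,3,9,9,15,5,6,16],e,r 10 16,x,e,e,e,x,r 6 10,q [0,15,9,9,2,10,13,5,6,16],q [0,21,6,8,2,9,2,10,13,5,6,16],x,q [0,21,2,9,2,10,2,16,4,8,7,5],x,q [0,20,5,8,7,5,13,10,2,9],x,r 2 4,e,e,e,x,r 6 10,e,e,q [0,6,1,8,10,5,2,4,11,10,2,9],q [0,15,1,11,10,5,2,4,11,10,2,9],e,r 3 5,x,x]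
    [F,T,F,F,T,T,F,T,F,F,T,F,T,F,F,T,T,F,T,F,F,T,T,F,F,T,T,F,T,F,F]"
  by (simp only: nu_rules)

lemma [THEN refuted_variants, simplified, nu_rules]:
  "S [f,e,e,e,x,e,r 3 5,e,q [0,36,4,3,11,4,3,5],x,f,e,e,x,e,r 3 5,q [0,22,8,5,2,4,9,7],e,e,e,x,e,x,e,e,e,x,e,x,q [0,13,3,16,4,8,7,5,11,7],q [0,20,5,8,7,5,11,7],x,r 2 4,e,e,e,x,r 6 10,e,e,q [0,6,1,8,10,5,2,4,9,7],q [0,15,1,11,10,5,2,4,9,7],e,r 3 5,x,x,e,e,r 4 7,e,e,x,e,r 2 4,e,q [0,32,5,9,2,10,10,4,3,5],x,e,e,q [0,33,4,9,2,10,6,8,4,4,3,5],r 3 5,x,x]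
    [F,T,F,F,T,T,F,T,F,F,T,F,T,F,F,T,T,F,T,F,F,T,T,F,F,T]"
  by (simp only: nu_rules)

lemma [THEN refuted_variants, simplified, nu_rules]:
  "S [e,e,x,e,x,e,e,e,x,e,x,e,f,e,e,e,x,e,e,q [0,2,11,5,6,16,7,10,2,9],r 11 17,e,e,e,x,x,e,r 6 10,q [0,21,6,8,7,5,6,16,7,10,2,9],x,q [0,15,8,5,6,16,7,10,2,9],q [0,21,6,8,1,5,6,16,7,10,2,9],x,e,e,e,x,e,q [0,8,0,37,5,38,11,5],e,e,q [0,39,3,40,2,8,13,5],e,r 6 10,q [0,21,2,38,2,40,2,8,13,5],x,e,r 2 4,e,q [0,38,0,32,3,41,13,5],x,e,e,e,x,q [0,14,2,38,2,20,5,8,7,5],r 3 5,x,x,r 2 4]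
    [F,T,F,T,F,F,T,T,F,T,F,F,T,F,T,F,F,T,T,F,T]"
  by (simp only: nu_rules)

lemma [THEN refuted_variants, simplified, nu_rules]:
  "S [f,e,e,x,e,e,e,x,r 3 5,r 5 8,e,f,e,f,e,f,e,x,f,e,x,f,e,x,e,e,f,e,f,e,x,e,x,e,q [0,9,4,16,4,8,7,5,6,3],x,x,f,e,f,e,q [0,8,0,41,13,5,6,3],q [0,21,1,20,5,8,7,5,6,3],x,x,x,r 2 4,x,r 2 4]
    [F,T,F,T,F,F,T,T,F,T,F,F,T,F,T,F]"
  by (simp only: nu_rules)

lemma [THEN refuted_variants, simplified, nu_rules]:
  "S [e,x,f,e,e,x,e,q [0,8,0,24,12,42,4,31],e,e,q [0,39,3,4,2,8,9,42,4,31],f,e,e,q [0,2,8,4,7,31,4,42],e,x,e,e,e,x,r 6 10,e,e,f,e,f,e,x,f,e,e,x,e,e,q [0,2,8,4,11,42,4,31],e,x,e,e,q [0,30,4,8,7,4,11,42],e,e,e,x,e,q [0,8,0,43,5,31,10,4],f,e,r 25 39,q [0,44,3,8,12,4,7,31],q [0,15,3,31,10,4,11,42],q [0,21,2,31,3,8,7,4,11,42],x,e,e,q [0,39,5,8,4,4,11,42,4,31],e,r 6 10,q [0,21,6,8,4,4,11,42,4,31],x,q [0,15,5,4,11,42,4,31],q [0,21,4,4,2,8,9,42,4,31],q [0,15,13,4,7,31,4,42],q [0,21,5,8,7,4,7,31,4,42],x,q [0,13,6,8,1,4,7,31,4,42],x,r 2 4]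
    [F,F,T,T,F,T,F,F,T,F,T,F,F,T,T,F,T,F,F,T,F,T,T,F,T,F,F,T,T,F,T,F,F,T,F,T,F]"
  by (simp only: nu_rules)

lemma [THEN refuted_variants, simplified, nu_rules]:
  "S [e,x,f,e,e,x,e,q [0,8,0,43,5,31,10,4],e,e,q [0,39,3,42,2,8,2,31,10,4],e,e,e,x,e,e,q [0,2,8,42,4,31,10,4],e,x,e,e,q [0,30,4,8,7,42,14,4],e,e,e,x,e,q [0,8,0,43,5,31,24,4],e,r 14 22,x,q [0,15,3,31,10,42,14,4],q [0,21,2,31,3,8,7,42,14,4],x,e,r 6 10,x,q [0,15,5,42,4,31,10,4],q [0,21,4,42,2,8,2,31,10,4],x,e,r 2 4,e,q [0,32,3,11,2,31,10,4],x]
    [F,F,T,T,F,T,F,F,T,F,T,F,F,T,T,F,T,F,F,T,F,T,T,F,T,F]"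
  by (simp only: nu_rules)

lemma [THEN refuted_variants, simplified, nu_rules]:
  "S [f,e,e,x,r 3 5,e,x,e,e,e,x,e,e,e,x,q [0,34,2,45,3,38,10,4],e,q [0,8,0,46,5,38,10,4],e,e,e,x,r 6 10,q [0,19,3,47,1,8,13,4],x,e,e,q [0,39,1,9,2,48,5,8,7,4],q [0,29,1,38,2,48,5,8,7,4],x,e,x,e,r 3 5,x,x]
    [F,F,T,T,F,T,F,F,T,F,T,F,F,T,T,F,T,F,F,T,F]"
  by (simp only: nu_rules)

lemma [THEN refuted_variants, simplified, nu_rules]:
  "S [e,x,e,e,q [0,2,2,4,7,31,4,42],e,q [0,8,0,18,3,4,7,31,4,42],e,e,x,e,e,e,x,e,q [0,8,0,43,9,4,7,31],e,f,e,q [0,2,8,42,4,31,10,4],f,e,q [0,39,3,42,2,8,6,4,7,31],e,e,f,e,e,e,x,e,q [0,8,0,24,12,42,4,31],e,e,q [0,39,3,4,2,8,9,42,4,31],e,e,e,x,e,x,e,e,q [0,39,5,8,4,4,11,42,4,31],e,r 6 10,q [0,21,6,8,4,4,11,42,4,31],x,q [0,15,5,4,11,42,4,31],q [0,21,4,4,2,8,9,42,4,31],x,r 2 4,e,e,q [0,30,4,8,7,42,14,4],e,e,e,x,e,q [0,8,0,43,5,31,24,4],e,r 14 22,x,q [0,15,3,31,10,42,14,4],q [0,21,2,31,3,8,7,42,14,4],x,q [0,15,5,42,8,4,7,31],q [0,21,4,42,2,8,6,4,7,31],x,q [0,15,7,4,7,31,4,42],q [0,21,5,8,1,4,7,31,4,42],x,q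 [0,35,3,8,5,31,4,42]]
    [F,F,T,F,T,F,F,T,T,F,T,F,F,T,F,T,T,F,T,F,F,T,T,F,T,F,F,T,F]"
  by (simp only: nu_rules)

lemma [THEN refuted_variants, simplified, nu_rules]:
  "S [e,e,x,e,f,e,e,e,x,f,e,q [0,2,2,4,7,31,4,42],f,e,q [0,8,0,43,5,31,10,4],f,e,q [0,8,0,18,3,4,7,31,4,42],f,e,f,e,f,e,q [0,39,3,42,2,8,2,31,10,4],e,e,e,x,e,x,e,r 6 10,x,q [0,15,5,42,4,31,10,4],q [0,21,4,42,2,8,2,31,10,4],x,x,e,r 2 4,e,q [0,32,3,11,2,31,10,4],x,e,r 3 5,x,f,e,f,e,f,e,q [0,6,1,8,2,31,8,16],q [0,15,1,11,2,31,8,16],x,e,r 3 5,x,r 2 4]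
    [F,T,F,T,F,F,T,T,F,T,F,F,T,F,T,T,F,T]"
  by (simp only: nu_rules)

lemma [THEN refuted_variants, simplified, nu_rules]:
  "S [f,e,e,x,r 3 5,e,x,e,f,e,e,x,f,e,f,e,f,e,x,e,e,e,x,q [0,34,2,45,3,38,10,4],f,e,q [0,2,2,4,3,47,4,38],e,q [0,8,0,18,3,4,3,47,4,38],e,e,x,q [0,19,4,8,1,4,3,47],x,e,e,q [0,39,1,9,2,48,5,8,7,4],q [0,29,1,38,2,48,5,8,7,4],x,f,e,x,f,e,f,e,q [0,8,0,45,3,38,8,16],q [0,13,1,48,2,38,3,8,5,16],x,x,r 2 4,x]
    [F,T,F,T,F,F,T,T,F,T,F,F,T,F]"
  by (simp only: nu_rules)

lemma [THEN refuted_variants, simplified, nu_rules]: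
  "S [f,e,x,e,x,e,e,e,x,x,e,r 6 10,e,e,e,x,e,e,e,x,q [0,34,2,49,3,38,11,4,3,5],f,e,q [0,2,4,38,2,5,2,4,9,50],e,x,e,e,e,x,r 6 10,q [0,19,4,8,5,5,2,4,9,50],x,e,e,q [0,39,1,9,2,14,9,8,4,4,3,5],q [0,29,1,38,2,14,9,8,4,4,3,5],x,r 3 5,x,x]
    [F,T,F,F,T,T,F,T,F,F,T,F,T,F,F,T,T,F,T,F,F]"
  by (simp only: nu_rules)

lemma [THEN refuted_variants, simplified, nu_rules]:
  "S [f,e,f,e,x,e,f,e,x,e,e,e,x,r 3 5,r 5 8,e,e,e,x,e,q [0,8,0,3,5,4,3,5,8,42],x,e,e,x,e,r 2 4,e,q [0,32,7,4,3,5,8,42],x,e,e,q [0,33,6,4,2,8,1,5,8,42],r 3 5,x,x,e,e,f,e,x,q [0,4,2,8,1,5,6,51,11,39],f,e,x,q [0,4,2,8,1,5,5,52],x,r 2 4]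
    [F,F,T,F,T,T,F,T,F,F,T,T,F,T,F,F,T,F,T,F]"
  by (simp only: nu_rules)

lemma [THEN refuted_variants, simplified, nu_rules]:
  "S [e,x,f,e,x,e,e,q [0,2,1,24,4,5,10,11,2,32],r 5 8,e,e,e,x,q [0,10,4,4,3,5,10,11,2,32],e,f,e,f,e,x,f,e,e,x,q [0,34,7,5,2,4,7,32,3,11],e,x,e,e,e,x,r 6 10,e,e,x,e,r 2 4,f,e,r 2 4,e,e,e,x,q [0,53,9,4,3,5,10,11],f,e,e,e,x,r 22 34,e,r 5 8,q [0,21,1,54,4,11,10,5,2,4],x,x,e,r 3 5,x,x,e,q [0,9,6,5,2,4,7,32,3,11],x,e,q [0,28,5,4,3,5,10,11,2,32],x,x]
    [F,F,T,T,F,T,F,F,T,F,T,F,F,T,T,F,T,F,T,T,F,T,F,F,T,T,F,T,F,F,T,F,T,F,F]"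
  by (simp only: nu_rules)

lemma [THEN refuted_variants, simplified, nu_rules]:
  "S [e,e,x,r 3 5,f,e,f,e,e,r 5 8,r 2 4,e,e,x,f,e,e,x,e,f,e,e,e,x,q [0,42,6,5,2,4,7,32],e,r 2 4,f,e,e,x,r 3 5,e,e,f,e,f,e,x,f,e,f,e,e,q [0,2,1,24,4,5,4,11,2,32],r 5 8,f,e,x,r 38 59,e,r 5 8,q [0,21,1,54,4,11,4,5,2,4],x,r 2 4,e,q [0,31,6,11,2,32,7,4],x,e,r 3 5,x,x,e,r 2 4,r 5 8,x,e,r 3 5,x]
    [F,T,F,F,T,F,T,F,F,T,T,F,T,F,T,T,F,T,F,F,T,T,F,T,F,F,T,F,T,F,F,T,T,F,T,F,T,T,F,T,F,F,T,F,T,F,F,T,T,F,T,F,T,T,F,T,F,F,T,T,F,T,F,F,T,F,T,F,F,T,T,F,T,F,T,T,F,T]"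
  by (simp only: nu_rules)

lemma [THEN refuted_variants, simplified, nu_rules]:
  "S [e,x,f,e,f,e,f,e,e,x,q [0,10,4,4,3,5,10,11,2,32],f,e,e,x,r 6 10,f,e,f,e,e,x,e,r 2 4,f,e,x,f,e,e,e,x,e,e,e,x,q [0,34,5,32,3,11,10,5,2,4],f,e,r 2 4,e,e,e,x,q [0,53,9,4,3,5,10,11],f,e,e,e,x,e,x,e,q [0,16,9,32,3,11,10,5],x,r 2 4,x,x,e,q [0,9,4,32,3,11,10,5,2,4],x,e,r 5 8,q [0,21,1,54,4,11,10,5,2,4],x,e,r 3 5,x,e,q [0,28,5,4,3,5,10,11,2,32],x,x,x]
    [T,F,T,F,F,T,T,F,T,F,F,T,F,T,F,F,T,T,F,T,F,T,T,F,T,F,F,T,F,T,F,F,T,T,F,T,F,T,T,F,T,F,F,T,T,F,T,F,F,T,F,T,F,F,T,T]"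
  by (simp only: nu_rules)

lemma [THEN refuted_variants, simplified, nu_rules]:
  "S [f,e,e,e,x,q [0,10,6,11,2,32,7,4,3,5],f,e,e,x,e,e,e,x,r 3 5,e,e,r 5 8,r 2 4,f,e,e,e,x,e,e,e,x,r 3 5,e,e,f,e,e,e,x,f,e,x,e,e,q [0,2,1,24,4,5,10,11,2,32],r 5 8,f,e,e,e,x,q [0,34,7,5,2,4,7,32,3,11],x,e,q [0,9,6,5,2,4,7,32,3,11],x,r 16 25,x,r 2 4,x,e,r 6 10,x,x,e,q [0,28,7,11,2,32,7,4,3,5],x,e,q [0,16,9,32,3,11,4,5],x,r 2 4,x]
    [F,T,F,T,F,F,T,T,F,T,F,T,T,F,T,F,F,T,F,T,F,F,T,T,F,T,F,T,T,F,T,F,F,T,T]"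
  by (simp only: nu_rules)

lemma [THEN refuted_variants, simplified, nu_rules]:
  "S [f,e,e,e,x,q [0,53,9,4,3,5,4,11],f,e,e,x,q [0,34,5,32,3,11,4,5,2,4],f,e,f,e,f,e,e,x,e,f,e,e,x,e,f,e,e,x,r 3 5,e,e,r 16 25,r 2 4,e,q [0,31,6,11,2,32,7,4],x,e,q [0,16,9,32,3,11,4,5],x,r 2 4,x,e,r 2 4,r 5 8,e,e,e,x,e,e,e,x,q [0,34,11,32,3,11,4,5,2,4],r 6 10,e,q [0,9,10,32,3,11,4,5,2,4],x,x,x,e,r 3 5,x,x]
    [F,T,F,F,T,T,F,T,F,T,T,F,T,F,F,T,F,T,F,F,T,T,F,T,F,T,T]"
  by (simp only: nu_rules)

lemma [THEN refuted_variants, simplified, nu_rules]: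
  "S [e,r 2 4,f,e,f,e,f,e,x,f,e,f,e,e,q [0,2,1,24,4,5,4,11,2,32],r 5 8,f,e,x,f,e,f,e,f,e,e,x,q [0,10,4,4,3,5,4,11,2,32],f,e,e,x,q [0,34,5,32,3,11,4,5,2,4],f,e,f,e,e,x,r 2 4,e,e,e,x,e,e,e,x,q [0,34,11,32,3,11,4,5,2,4],r 6 10,e,q [0,9,10,32,3,11,4,5,2,4],x,x,x,e,q [0,28,5,4,3,5,4,11,2,32],x,e,q [0,9,4,32,3,11,4,5,2,4],x,x,e,r 5 8,q [0,21,1,54,4,11,4,5,2,4],x,r 2 4]
    [T,F,T,F,T,T,F,T,F,F,T,F,T,F]"
  by (simp only: nu_rules)

lemma [THEN refuted_variants, simplified, nu_rules]:
  "S [e,e,f,e,e,e,x,e,x,e,e,e,x,e,f,e,x,q [0,42,2,8,4,5,2,4,10,3],f,e,x,q [0,42,2,8,4,5,2,4,11,10,3,13],e,r 6 10,e,e,e,x,q [0,14,9,8,4,4,3,5,3,6],r 3 5,x,x,e,r 2 4,e,f,e,x,q [0,42,6,5,2,4,7,32],x,e,e,e,x,q [0,14,7,4,2,8,1,5,3,6],r 3 5,x,x,e,r 3 5,x]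
    [T,F,T,T,F,T,F,F,T,F,T,F,F,T,T,F,T]"
  by (simp only: nu_rules)

lemma [THEN refuted_variants, simplified, nu_rules]:
  "S [f,e,e,x,e,e,e,x,r 3 5,r 5 8,e,f,e,f,e,f,e,f,e,x,e,e,q [0,2,1,3,5,4,3,5,3,6],q [0,7,1,8,5,4,3,5,3,6],e,q [0,9,2,10,4,4,2,8,1,5,3,6],x,x,x,e,r 3 5,x,x,r 2 4]
    [T,F,T,T,F,T,F,F,T,F,T,F]"
  by (simp only: nu_rules)

lemma [THEN refuted_variants, simplified, nu_rules]:
  "S [e,e,e,x,r 3 5,e,e,r 5 8,r 2 4,f,e,f,e,e,e,x,f,e,x,e,x,e,f,e,f,e,e,x,q [0,10,6,11,2,32,7,4,3,5],f,e,e,x,q [0,34,7,5,2,4,7,32,3,11],e,x,e,e,e,x,r 6 10,e,e,x,e,r 2 4,x,e,r 3 5,x,x,e,q [0,9,6,5,2,4,7,32,3,11],x,x,x,x,e,r 2 4,r 5 8,e,e,e,x,q [0,55,0,10,2,16,9,32,3,11],e,q [0,41,4,55,7,32,3,11],q [0,21,1,20,3,55,7,32,3,11],x]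
    [T,F,F,T,F,T,F,F,T,T,F,T,F,T,T,F,T,F]"
  by (simp only: nu_rules)

lemma [THEN refuted_variants, simplified, nu_rules]:
  "S [e,f,e,r 2 4,f,e,x,f,e,f,e,e,e,x,r 3 5,x,f,e,f,e,f,e,x,f,e,f,e,q [0,56,1,55,7,16,8,39],q [0,13,1,53,7,16,8,39],f,e,q [0,56,1,55,2,38,4,20],q [0,13,1,53,2,38,4,20],x,e,x,e,r 3 5,x,x,r 2 4]
    [F,T,F,T,F,F,T,T,F,T,F,T]"
  by (simp only: nu_rules)

text \<open>The families of extensions of 0100110100101001 that were treated above merge
  here.\<close>

lemma [THEN refuted_variants, simplified, nu_rules]:
  "S [f,e,e,e,x,r 3 5,r 5 8,e,f,e,e,x,e,r 3 5,e,e,e,x,e,q [0,3,3,36,9,5,2,4],q [0,13,1,10,2,36,9,5,2,4],e,e,q [0,57,3,38,9,5,2,4],q [0,15,1,58,2,38,9,5,2,4],e,q [0,38,0,28,2,59,10,5,2,4],x,x,e,x,e,e,e,x,r 6 10,e,e,x,f,e,e,x,f,e,r 2 4,f,e,q [0,3,5,4,3,5,10,11,3,12],x,e,e,x,x,e,e,f,e,r 2 4,q [0,12,2,11,10,5,2,4,6,33],r 3 5,x,e,r 3 5,x,x,x]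
    [F,T,F,F,T,T,F,T,F,F,T,F,T,F,F,T]"
  by (simp only: nu_rules)

lemma [THEN refuted_variants, simplified, nu_rules]:
  "S [f,e,e,x,x,r 2 4]
    [F,T,F,F,T,T,F,T,F,F,T,F,T,F]"
  by (simp only: nu_rules)

lemma [THEN refuted_variants, simplified, nu_rules]:
  "S [f,e,e,x,q [0,34,2,3,5,4,3,5,6,9],f,e,e,x,e,e,q [0,2,2,4,7,9,6,5,5,7],e,q [0,8,0,18,3,4,7,9,11,7],e,e,e,x,e,x,e,e,e,x,e,r 15 24,r 4 7,q [0,29,7,5,1,8,1,4,18,7],x,x,x,q [0,35,3,8,5,9,6,5,5,7],r 2 4]
    [F,T,F,T,F,F,T,T,F,F,T,T,F,T,F,F,T,F,T,F,F,T,T,F,F,T,F]"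
  by (simp only: nu_rules)

lemma [THEN refuted_variants, simplified, nu_rules]:
  "S [e,e,x,e,e,q [0,2,10,9,6,5,2,4,60,7],e,e,e,x,e,x,q [0,35,3,8,11,9,6,5,62,7],r 2 4,e,r 6 10,x,e,e,e,x,e,e,q [0,2,4,9,16,5,2,4,60,7],r 10 16,r 4 7,q [0,29,8,8,9,5,2,4,60,7],x,q [0,19,4,8,3,9,6,5,2,4,60,7]]
    [F,T,T,F,T,F,F,T,T,F,F,T,T,F,T,F,F,T,F,T,F,F,T,T,F,T,F,F,T,T,F,F,T,T,F,T,F,F,T,F,T,F,F,T,T,F,F,T,T,F,T,F,F,T,F,T,F,F,T,T,F,T,F,F,T,T,F,F,T,T,F,T,F,F,T,F,T,F,F,T,T,F,F,T,F,T,T,F,F,T,F,T,F,F,T,F,T,T,F,F,T,T,F,F,T,F,T,F,F,T,F,T,T,F,F,T,T,F,F,T,F,T,T,F,F,T,F,T,F,F,T,F,T,T,F,F,T,T,F,F,T,F,T]"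
  by (simp only: nu_rules)

lemma [THEN refuted_variants, simplified, nu_rules]:
  "S [e,q [0,2,10,9,6,5,2,4,39,7],f,e,f,e,f,e,f,e,f,e,x,f,e,x,f,e,x,f,e,f,e,f,e,q [0,2,2,4,13,9,6,5,41,7],e,q [0,8,0,18,3,4,13,9,47,7],e,e,e,x,e,x,e,f,e,f,e,f,e,x,f,e,x,f,e,f,e,e,q [0,2,4,9,6,5,2,4,60,7],e,e,e,x,e,x,q [0,35,3,8,5,9,6,5,62,7],r 2 4,f,e,q [0,2,4,9,6,5,2,4,45,7],f,e,x,x,r 4 7,r 4 7,q [0,29,7,5,1,8,1,4,60,7],q [0,29,7,5,1,8,1,4,45,7],x,x,x,x,q [0,35,3,8,11,9,6,5,41,7],r 2 4,x,e,r 6 10,x,x]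
    [F,T,F,F,T,T,F,T,F,F,T,T,F,F,T,T,F,T,F,F,T,F,T,F,F,T,T,F,F,T,T,F,T,F,F,T,F,T,F,F,T,T,F,T,F,F,T,T,F,F,T,T,F,T,F,F,T,F,T,F,F,T,T,F,F,T,F,T,T,F,F,T,F,T,F,F,T,F,T,T,F,F,T,T,F,F,T,F,T,F,F,T,F,T,T,F,F,T,T,F,F,T,F,T,T,F,F,T,F,T,F,F,T,F,T,T]"
  by (simp only: nu_rules)

lemma [THEN refuted_variants, simplified, nu_rules]:
  "S [e,q [0,2,10,9,6,5,2,4,39,7],e,e,e,x,e,e,q [0,2,2,4,13,9,6,5,41,7],e,q [0,8,0,18,3,4,13,9,47,7],e,e,e,x,e,x,e,e,f,e,x,f,e,x,f,e,e,q [0,2,10,9,6,5,2,4,24,7],e,e,e,x,e,e,q [0,2,2,4,13,9,6,5,26,7],e,q [0,8,0,18,3,4,13,9,32,7],x,q [0,35,3,8,11,9,6,5,26,7],r 2 4,e,r 6 10,x,e,e,e,x,e,e,q [0,2,4,9,16,5,2,4,24,7],r 10 16,r 4 7,q [0,29,8,8,9,5,2,4,24,7],x,q [0,29,7,5,1,8,1,4,60,7],x,x,x,q [0,35,3,8,11,9,6,5,41,7],r 2 4,e,r 6 10,x]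
    [F,T,F,F,T,T,F,T,F,F,T,T,F,F,T,T,F,T,F,F,T,F,T,F,F,T,T,F,F,T,T,F,T,F,F,T,F,T,F,F,T,T,F,T,F,F,T,T,F,F,T,T,F,T,F,F,T,F,T,F,F,T,T,F,F,T,F,T,T,F,F,T,F,T,F,F,T,F,T,T,F,F,T,T,F,F,T,F,T,F,F,T,F,T,T,F,F,T,T,F,F,T,F,T,T,F,F]"
  by (simp only: nu_rules)

lemma [THEN refuted_variants, simplified, nu_rules]:
  "S [e,f,e,x,f,e,x,f,e,f,e,f,e,q [0,2,2,4,7,9,6,5,11,7],f,e,q [0,2,2,4,7,9,6,5,26,7],f,e,q [0,8,0,18,3,4,7,9,17,7],f,e,q [0,8,0,18,3,4,7,9,32,7],f,e,f,e,f,e,f,e,f,e,x,f,e,x,f,e,x,f,e,x,f,e,f,e,f,e,f,e,f,e,x,f,e,x,f,e,f,e,f,e,q [0,2,4,9,6,5,2,4,24,7],f,e,q [0,2,4,9,6,5,2,4,39,7],f,e,r 15 24,f,e,r 15 24,f,e,f,e,f,e,f,e,e,x,e,x,e,e,e,x,e,e,q [0,2,4,9,16,5,2,4,39,7],r 10 16,r 4 7,q [0,29,8,8,9,5,2,4,39,7],x,q [0,19,4,8,3,9,6,5,2,4,39,7],q [0,19,4,8,3,9,6,5,2,4,24,7],x,x,r 4 7,r 4 7,q [0,29,7,5,1,8,1,4,39,7],q [0,29,7,5,1,8,1,4,24,7],x,x,x,x,x,x,q [0,35,3,8,5,9,6,5,26,7],q [0,35,3,8,5,9,6,5,11,7],r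 2 4]
    [F,T,F,T,F,F,T,T,F,F,T,T,F,T,F,F,T,F,T,F,F,T,T,F,T,F,F,T,T,F,F,T,T,F,T,F,F,T,F,T,F,F,T,T,F,F,T,F,T,T,F,F,T,F,T,F,F,T,F,T,T,F,F,T,T,F,F,T,F,T,F,F]"
  by (simp only: nu_rules)

lemma [THEN refuted_variants, simplified, nu_rules]:
  "S [e,x,e,e,e,x,e,e,q [0,2,10,9,6,5,2,4,24,7],e,e,e,x,e,x,q [0,35,3,8,11,9,6,5,26,7],r 2 4,e,r 6 10,x,e,e,e,x,e,e,q [0,2,4,9,16,5,2,4,24,7],r 10 16,r 4 7,q [0,29,8,8,9,5,2,4,24,7],x,q [0,19,4,8,3,9,6,5,2,4,24,7],x]
    [T,F,T,F,F,T,T,F,F,T,T,F,T,F,F,T,F,T,F,F,T,T,F,T,F,F,T,T,F,F,T,T,F,T,F,F,T,F,T,F,F,T,T,F,F,T,F,T,T,F,F,T,F,T,F,F,T,F,T,T,F,F,T,T,F,F,T,F,T,F,F,T,F,T,T,F,F,T,T,F,F,T,F,T,T,F]"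
  by (simp only: nu_rules)

lemma [THEN refuted_variants, simplified, nu_rules]:
  "S [f,e,e,q [0,2,4,9,6,5,2,4,24,7],e,r 15 24,e,f,e,e,x,e,e,q [0,2,10,9,6,5,2,4,3,7],e,e,e,x,e,e,q [0,2,2,4,13,9,6,5,5,7],e,q [0,8,0,18,3,4,13,9,11,7],e,e,e,x,e,x,e,e,e,x,e,e,q [0,2,4,9,6,5,2,4,24,7],x,r 4 7,q [0,29,7,5,1,8,1,4,24,7],x,x,x,q [0,35,3,8,11,9,6,5,5,7],r 2 4,e,r 6 10,x,e,e,e,x,e,e,q [0,2,4,9,16,5,2,4,3,7],r 10 16,r 4 7,q [0,29,8,8,9,5,2,4,3,7],x,q [0,19,4,8,3,9,6,5,2,4,3,7],x,r 4 7]
    [F,T,T,F,T,F,F,T,T,F,F,T,T,F,T,F,F,T,F,T,F,F,T,T,F,F,T,F,T,T,F,F,T,F,T,F,F,T,F,T,T,F,F,T,T,F,F,T,F,T,F,F,T,F,T,T,F,F,T,T,F,F,T]"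
  by (simp only: nu_rules)

lemma [THEN refuted_variants, simplified, nu_rules]:
  "S [e,e,x,q [0,34,2,3,11,4,3,5,6,9],f,e,f,e,f,e,x,f,e,f,e,f,e,x,f,e,q [0,2,2,4,7,9,6,5,11,7],f,e,f,e,q [0,8,0,18,3,4,7,9,17,7],f,e,q [0,2,2,4,3,7,15,5,6,9],f,e,f,e,q [0,8,0,18,3,4,3,7,21,9],f,e,f,e,f,e,x,f,e,f,e,x,f,e,x,f,e,f,e,x,f,e,f,e,f,e,x,f,e,e,x,e,e,q [0,2,4,9,6,5,2,4,3,7],e,x,e,x,x,r 4 7,q [0,29,7,5,1,8,1,4,3,7],x,q [0,29,7,5,1,8,1,4,24,7],x,x,x,x,x,q [0,35,3,8,1,7,15,5,6,9],q [0,35,3,8,5,9,6,5,11,7],r 2 4,q [0,60,2,8,11,4,3,5,6,9],r 2 4]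
    [F,T,F,F,T,T,F,F,T,F,T,T,F,F,T,F,T,F,F,T,F,T,T,F,F,T,T,F,F,T,F,T,F]"
  by (simp only: nu_rules)

lemma [THEN refuted_variants, simplified, nu_rules]:
  "S [e,x,e,e,e,x,q [0,34,2,3,11,4,3,5,6,9],e,e,e,x,e,e,q [0,2,2,4,3,7,15,5,6,9],e,q [0,8,0,18,3,4,3,7,21,9],e,e,e,x,e,x,e,e,e,x,e,e,q [0,2,4,9,6,5,2,4,3,7],e,x,f,e,x,f,e,f,e,e,q [0,2,10,9,6,5,2,4,66,7],e,e,e,x,e,x,q [0,35,3,8,11,9,6,5,68,7],r 2 4,e,r 6 10,x,e,e,e,x,e,e,q [0,2,4,9,16,5,2,4,66,7],r 10 16,r 4 7,q [0,29,8,8,9,5,2,4,66,7],x,x,r 4 7,q [0,29,7,5,1,8,1,4,3,7],x,x,x,q [0,35,3,8,1,7,15,5,6,9],r 2 4,q [0,60,2,8,11,4,3,5,6,9],x]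
    [F,F,T,T,F,F,T,F,T,T,F,F,T,F,T,F,F,T,F,T,T,F,F,T,T,F,F,T,F,T,T,F,F,T,F,T,F,F,T,F,T,T,F,F,T,T,F,F,T,F,T,F,F,T,F,T,T,F,F,T,T,F,F,T,F,T,T,F,F,T,F,T,F,F,T,F,T,T,F,F,T,T,F,F,T,F,T,T,F,F]"
  by (simp only: nu_rules)

lemma [THEN refuted_variants, simplified, nu_rules]:
  "S [e,f,e,x,f,e,e,x,e,x,e,e,e,x,e,e,e,x,q [0,34,2,3,11,4,3,5,6,9],e,f,e,e,q [0,2,4,9,6,5,2,4,66,7],e,e,e,x,e,x,q [0,35,3,8,5,9,6,5,68,7],r 2 4,e,e,x,q [0,19,4,8,3,9,6,5,2,4,66,7],x,r 4 7,q [0,60,2,8,11,4,3,5,6,9],x,e,r 6 10,e,e,q [0,33,8,8,4,4,3,5,6,9,2,10],r 3 5,x,x,x,e,e,q [0,33,6,4,2,8,1,5,6,9,2,10],r 3 5,x]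
    [T,F,T,T,F,F,T,F,T,F,F,T,F,T,T,F,F,T,T,F,F,T,F,T,T,F,F,T,F,T,F,F,T,F,T,T,F,F,T,T,F,F,T,F,T,F,F,T,F,T,T,F,F,T,T,F,F,T,F,T,T,F,F,T,F,T,F,F,T,F,T,T,F,F,T,T,F,F]"
  by (simp only: nu_rules)

lemma [THEN refuted_variants, simplified, nu_rules]:
  "S [e,f,e,e,x,r 3 5,e,e,r 5 8,r 2 4,e,e,e,x,e,x,e,e,x,e,e,q [0,26,1,8,8,5,2,4,11,10],q [0,15,1,27,8,5,2,4,11,10],e,q [0,28,2,29,7,5,1,8,1,4,11,10],x,x,x,x,e,e,q [0,33,6,4,2,8,1,5,6,9,2,10],r 3 5,x]
    [T,F,T,T,F,F,T,F,T,F,F,T,F,T,T,F,F,T,T,F,F,T,F,T,T,F,F,T,F,T,F,F,T,F,T,T,F,F,T,T,F,F,T,F,T,F,F,T,F,T,T,F,F,T,T,F,F,T,F,T,T,F,F,T,F,T,F,F,T,F]"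
  by (simp only: nu_rules)

lemma [THEN refuted_variants, simplified, nu_rules]:
  "S [e,f,e,e,x,e,r 3 5,q [0,22,10,10,2,9,6,5,2,4],e,e,e,x,e,x,e,e,e,x,e,q [0,8,0,3,3,16,15,9,6,5],e,e,r 4 7,f,e,e,x,e,x,e,e,e,x,e,q [0,8,0,3,14,5,6,9,46,16],x,e,r 6 10,q [0,21,6,8,7,5,6,9,2,10,44,16],x,x,x,q [0,20,5,8,9,10,2,9,6,5],x,r 2 4,e,r 6 10,x,e,e,q [0,33,6,4,2,8,1,5,6,9,2,10],r 3 5,x]
    [T,F,T,T,F,F,T,F,T,F,F,T,F,T,T,F,F,T,T,F,F,T,F,T,T,F,F,T,F,T,F,F,T,F,T,T,F,F,T,T,F,F,T,F,T,F,F,T,F,T,T,F,F,T,T,F,F,T,F,T,T,F,F,T,F]"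
  by (simp only: nu_rules)

lemma [THEN refuted_variants, simplified, nu_rules]:
  "S [e,e,e,x,e,x,e,e,e,x,e,e,e,x,q [0,34,2,3,11,4,3,5,6,9],f,e,q [0,2,4,9,6,5,2,4,45,7],f,e,f,e,r 15 24,f,e,f,e,f,e,x,f,e,f,e,f,e,x,f,e,q [0,2,2,4,3,7,15,5,6,9],f,e,x,e,e,e,x,e,e,q [0,2,4,9,16,5,2,4,45,7],r 10 16,r 4 7,q [0,29,8,8,9,5,2,4,45,7],x,q [0,35,3,8,1,7,15,5,6,9],q [0,19,4,8,3,9,6,5,2,4,45,7],x,r 2 4,q [0,60,2,8,11,4,3,5,6,9],x,e,r 6 10,e,e,q [0,33,8,8,4,4,3,5,6,9,2,10],r 3 5,x,x,x,e,e,q [0,33,6,4,2,8,1,5,6,9,2,10],r 3 5,x]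
    [T,F,T,T,F,F,T,F,T,F,F,T,F,T,T,F,F,T,T,F,F,T,F,T,T,F,F,T,F,T,F,F,T,F,T,T,F,F,T,T,F,F,T,F,T,F,F,T,F,T,T,F,F,T,T,F,F,T,F]"
  by (simp only: nu_rules)

lemma [THEN refuted_variants, simplified, nu_rules]:
  "S [e,f,e,e,x,r 3 5,e,e,r 5 8,r 2 4,e,f,e,f,e,f,e,x,e,x,e,e,e,x,e,e,e,x,q [0,34,2,3,11,4,3,5,6,9],f,e,x,e,x,e,e,e,x,e,x,r 4 7,q [0,29,7,5,1,8,1,4,45,7],x,x,e,r 6 10,e,e,q [0,33,8,8,4,4,3,5,6,9,2,10],r 3 5,x,x,x,x,x,e,e,q [0,33,6,4,2,8,1,5,6,9,2,10],r 3 5,x]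
    [T,F,T,T,F,F,T,F,T,F,F,T,F,T,T,F,F,T,T,F,F,T,F,T,T,F,F,T,F,T,F,F,T,F,T,T,F,F,T,T,F,F,T,F,T,F,F,T,F]"
  by (simp only: nu_rules)

lemma [THEN refuted_variants, simplified, nu_rules]:
  "S [e,f,e,x,f,e,e,x,e,x,e,e,e,x,e,f,e,f,e,e,x,q [0,34,2,3,11,4,3,5,6,9],f,e,q [0,2,4,9,6,5,2,4,30,7],e,e,e,x,e,x,q [0,35,3,8,5,9,6,5,32,7],r 2 4,e,r 21 33,x,r 4 7,x,e,r 6 10,e,e,q [0,33,8,8,4,4,3,5,6,9,2,10],r 3 5,x,x,x,e,e,q [0,33,6,4,2,8,1,5,6,9,2,10],r 3 5,x]
    [T,F,T,T,F,F,T,F,T,F,F,T,F,T,T,F,F,T,T,F,F,T,F,T,T,F,F,T,F,T,F,F,T,F,T,T,F,F,T,T,F,F]"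
  by (simp only: nu_rules)

lemma [THEN refuted_variants, simplified, nu_rules]:
  "S [e,f,e,e,x,r 3 5,e,e,r 5 8,r 2 4,e,e,e,x,e,x,e,e,x,e,e,q [0,26,1,8,8,5,2,4,11,10],q [0,15,1,27,8,5,2,4,11,10],e,q [0,28,2,29,7,5,1,8,1,4,11,10],x,x,x,x,e,e,q [0,33,6,4,2,8,1,5,6,9,2,10],r 3 5,x]
    [T,F,T,T,F,F,T,F,T,F,F,T,F,T,T,F,F,T,T,F,F,T,F,T,T,F,F,T,F,T,F,F,T,F]"
  by (simp only: nu_rules)

lemma [THEN refuted_variants, simplified, nu_rules]:
  "S [e,e,x,q [0,34,2,3,11,4,3,5,6,9],e,e,e,x,e,e,q [0,2,2,4,3,7,15,5,6,9],e,q [0,8,0,18,3,4,3,7,21,9],e,e,e,x,e,x,e,e,e,x,e,e,q [0,2,4,9,6,5,2,4,3,7],e,x,f,e,x,f,e,f,e,e,q [0,2,10,9,6,5,2,4,9,7],e,e,e,x,e,x,q [0,35,3,8,11,9,6,5,11,7],r 2 4,e,r 6 10,x,e,e,e,x,e,e,q [0,2,4,9,16,5,2,4,9,7],r 10 16,r 4 7,q [0,29,8,8,9,5,2,4,9,7],x,x,r 4 7,q [0,29,7,5,1,8,1,4,3,7],x,x,x,q [0,35,3,8,1,7,15,5,6,9],r 2 4,q [0,60,2,8,11,4,3,5,6,9]]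
    [F,T,F,F,T,T,F,F,T,F,T,T,F,F,T,F,T,F,F,T,F,T,T,F,F,T,T,F,F,T,F,T,T,F,F]"
  by (simp only: nu_rules)

lemma [THEN refuted_variants, simplified, nu_rules]:
  "S [f,e,e,x,r 3 5,e,e,r 5 8,r 2 4,e,e,e,x,e,x,f,e,e,x,e,r 3 5,q [0,22,3,3,11,4,3,5,7,13],f,e,f,e,f,e,f,e,f,e,x,e,e,q [0,2,4,9,6,5,2,4,9,7],e,x,e,e,x,q [0,19,4,8,3,9,6,5,2,4,9,7],x,r 4 7,r 2 4,q [0,29,7,5,1,8,1,4,9,7],q [0,60,2,8,11,4,3,5,6,9],x,x,x]
    [F,T,F,F,T,T,F,F,T,F,T,T,F,F,T,F,T,F,F,T,F]"
  by (simp only: nu_rules)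

lemma [THEN refuted_variants, simplified, nu_rules]:
  "S [e,e,x,r 3 5,f,e,e,x,e,r 3 5,q [0,22,8,7,6,4,3,5],f,e,e,r 5 8,r 2 4,f,e,f,e,f,e,f,e,f,e,x,f,e,x,f,e,x,f,e,x,f,e,q [0,16,4,8,7,7,9,5,7,13],x,x,r 2 4,x,e,r 6 10,x]
    [F,T,F,F,T,F,T,F,F,T,T,F,F,T,F,T,T,F,F,T,F]"
  by (simp only: nu_rules)

lemma [THEN refuted_variants, simplified, nu_rules]:
  "S [e,e,x,e,e,q [0,2,10,9,6,5,2,4,60,7],e,e,e,x,e,x,q [0,35,3,8,11,9,6,5,62,7],r 2 4,e,r 6 10,x,e,e,e,x,e,e,q [0,2,4,9,16,5,2,4,60,7],r 10 16,r 4 7,q [0,29,8,8,9,5,2,4,60,7],x,q [0,19,4,8,3,9,6,5,2,4,60,7]]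
    [F,T,T,F,T,F,F,T,T,F,F,T,T,F,T,F,F,T,F,T,F,F,T,T,F,T,F,F,T,T,F,F,T,T,F,T,F,F,T,F,T,F,F,T,T,F,F,T,T,F,T,F,F,T,F,T,F,F,T,T,F,T,F,F,T,T,F,F,T,T,F,T,F,F,T,F,T,F,F,T,T,F,F,T,F,T,T,F,F,T,T,F,F,T,F,T,F,F,T,F,T,T,F,F,T,T,F,F,T,F,T,T,F,F,T,F,T,F,F,T,F,T,T,F,F,T,T,F,F,T,F,T,F,F,T,F,T,T,F,F,T,T,F,F,T,F,T,T,F]"
  by (simp only: nu_rules)

lemma [THEN refuted_variants, simplified, nu_rules]:
  "S [e,q [0,2,10,9,6,5,2,4,39,7],f,e,x,f,e,f,e,f,e,f,e,f,e,x,f,e,x,f,e,f,e,f,e,q [0,2,2,4,13,9,6,5,41,7],f,e,q [0,2,4,9,6,5,2,4,49,7],f,e,q [0,8,0,18,3,4,13,9,47,7],e,e,e,x,e,x,e,e,f,e,r 15 24,f,e,x,f,e,f,e,e,q [0,2,4,9,6,5,2,4,60,7],e,e,e,x,e,x,q [0,35,3,8,5,9,6,5,62,7],r 2 4,e,x,x,r 4 7,x,q [0,29,7,5,1,8,1,4,60,7],x,x,x,r 4 7,q [0,35,3,8,11,9,6,5,41,7],q [0,29,7,5,1,8,1,4,49,7],r 2 4,x,e,r 6 10,x]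
    [F,T,F,F,T,T,F,T,F,F,T,T,F,F,T,T,F,T,F,F,T,F,T,F,F,T,T,F,F,T,T,F,T,F,F,T,F,T,F,F,T,T,F,T,F,F,T,T,F,F,T,T,F,T,F,F,T,F,T,F,F,T,T,F,F,T,F,T,T,F,F,T,T,F,F,T,F,T,F,F,T,F,T,T,F,F,T,T,F,F,T,F,T,T,F,F,T,F,T,F,F,T,F,T,T,F,F,T,T,F,F,T,F,T,F,F,T,F,T,T,F,F,T]"
  by (simp only: nu_rules)

lemma [THEN refuted_variants, simplified, nu_rules]:
  "S [e,x,f,e,x,e,e,e,x,e,r 3 5,q [0,22,10,10,2,9,6,5,2,4],e,e,e,x,e,x,e,e,f,e,q [0,8,0,3,9,9,9,5,37,16],e,e,r 4 7,e,e,e,x,r 10 16,q [0,15,3,9,2,10,17,5,37,16],q [0,21,2,9,2,10,6,8,11,5,37,16],x,q [0,20,5,8,9,10,2,9,6,5],x,r 2 4,e,r 6 10,x,e,e,e,x,e,e,e,x,e,r 3 5,q [0,22,4,10,2,9,16,5,2,4],r 10 16,r 4 7,e,e,q [0,26,1,8,10,10,8,5,2,4],q [0,15,1,27,10,10,8,5,2,4],e,q [0,28,2,29,8,8,1,10,8,5,2,4],x,x]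
    [F,F,T,T,F,F,T,F,T,T,F,F,T,T,F,F,T,F,T,F,F,T,F,T,T,F,F,T,T,F,F,T,F,T,T,F,F,T,F,T,F,F,T,F,T,T,F,F,T,T,F,F,T,F,T,T,F,F]"
  by (simp only: nu_rules)

lemma [THEN refuted_variants, simplified, nu_rules]:
  "S [e,f,e,f,e,f,e,q [0,2,4,9,6,5,2,4,34,7],f,e,x,f,e,f,e,f,e,f,e,q [0,2,4,9,6,5,2,4,39,7],f,e,x,e,e,q [0,2,2,4,7,9,6,5,36,7],e,q [0,8,0,18,3,4,7,9,42,7],e,e,e,x,f,e,r 15 24,f,e,x,f,e,f,e,f,e,f,e,f,e,x,f,e,x,f,e,x,e,e,e,x,e,e,q [0,2,4,9,16,5,2,4,39,7],r 10 16,r 4 7,q [0,29,8,8,9,5,2,4,39,7],x,q [0,29,7,5,1,8,1,4,49,7],q [0,19,4,8,3,9,6,5,2,4,39,7],x,x,x,x,q [0,35,3,8,5,9,6,5,36,7],r 2 4,r 4 7,e,e,x,q [0,19,4,8,3,9,6,5,2,4,34,7],x,q [0,29,7,5,1,8,1,4,39,7],r 4 7,x]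
    [T,T,F,F,T,T,F,T,F,F,T,F,T,F,F,T,T,F,F,T,T,F,T,F,F,T,F,T,F,F,T,T,F,T,F,F,T,T,F,F,T,T,F,T,F,F,T,F,T,F,F,T,T,F,F,T,F,T,T,F,F,T,T,F,F,T,F,T,F,F,T,F,T,T,F,F,T,T,F,F,T,F,T,T,F,F,T,F,T,F,F,T,F,T,T,F,F,T,T,F,F,T]"
  by (simp only: nu_rules)

lemma [THEN refuted_variants, simplified, nu_rules]:
  "S [e,f,e,q [0,2,10,9,6,5,2,4,13,7],f,e,x,f,e,f,e,f,e,f,e,q [0,2,2,4,7,9,6,5,26,7],f,e,x,f,e,q [0,8,0,18,3,4,7,9,32,7],f,e,f,e,f,e,q [0,2,2,4,13,9,6,5,15,7],f,e,f,e,q [0,8,0,18,3,4,13,9,21,7],f,e,x,f,e,f,e,x,f,e,e,x,e,x,e,e,e,x,x,q [0,29,7,5,1,8,1,4,34,7],x,x,x,x,x,q [0,35,3,8,11,9,6,5,15,7],r 2 4,q [0,35,3,8,5,9,6,5,26,7],e,r 6 10,x,r 2 4]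
    [F,T,F,T,F,F,T,T,F,F,T,T,F,T,F,F,T,F,T,F,F,T,T,F,T,F,F,T,T,F,F,T,T,F,T,F,F,T,F,T,F,F,T,T,F,F,T,F,T,T,F,F,T,T,F,F,T,F,T,F,F,T,F,T,T,F,F,T,T,F,F,T,F,T,T,F,F,T,F]"
  by (simp only: nu_rules)

lemma [THEN refuted_variants, simplified, nu_rules]:
  "S [e,f,e,f,e,f,e,x,f,e,x,f,e,x,e,e,e,x,e,e,q [0,2,4,9,16,5,2,4,13,7],r 10 16,r 4 7,q [0,29,8,8,9,5,2,4,13,7],x,r 2 4,q [0,19,4,8,3,9,6,5,2,4,13,7],e,e,e,x,e,e,q [0,2,10,9,6,5,2,4,24,7],e,e,e,x,e,x,q [0,35,3,8,11,9,6,5,26,7],r 2 4,e,r 6 10,x,e,e,e,x,e,e,q [0,2,4,9,16,5,2,4,24,7],r 10 16,r 4 7,q [0,29,8,8,9,5,2,4,24,7],x,q [0,19,4,8,3,9,6,5,2,4,24,7],x]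
    [T,F,T,F,F,T,T,F,F,T,T,F,T,F,F,T,F,T,F,F,T,T,F,T,F,F,T,T,F,F,T,T,F,T,F,F,T,F,T,F,F,T,T,F,F,T,F,T,T,F,F,T,T,F,F,T,F,T,F,F,T,F,T,T,F,F,T,T,F,F,T,F,T,T,F]"
  by (simp only: nu_rules)

lemma [THEN refuted_variants, simplified, nu_rules]:
  "S [f,e,x,e,f,e,x,f,e,f,e,e,q [0,2,10,9,6,5,2,4,3,7],e,e,e,x,e,e,q [0,2,2,4,13,9,6,5,5,7],e,q [0,8,0,18,3,4,13,9,11,7],e,e,e,x,e,x,e,e,e,x,e,e,q [0,2,4,9,6,5,2,4,24,7],x,r 4 7,q [0,29,7,5,1,8,1,4,24,7],x,x,x,q [0,35,3,8,11,9,6,5,5,7],r 2 4,e,r 6 10,x,e,e,e,x,e,e,q [0,2,4,9,16,5,2,4,3,7],r 10 16,r 4 7,q [0,29,8,8,9,5,2,4,3,7],x,q [0,29,7,5,1,8,1,4,34,7],x]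
    [F,F,T,T,F,T,F,F,T,T,F,F,T,T,F,T,F,F,T,F,T,F,F,T,T,F,F,T,F,T,T,F,F,T,T,F,F,T,F,T,F,F,T,F,T,T,F,F,T,T,F,F,T,F,T,T,F,F,T,F,T,F,F,T,F,T,T,F,F,T]"
  by (simp only: nu_rules)

lemma [THEN refuted_variants, simplified, nu_rules]:
  "S [e,e,e,x,e,e,q [0,2,2,4,3,7,10,9,9,5],e,q [0,8,0,18,3,4,3,7,10,9],e,e,e,x,e,x,e,e,e,x,e,e,q [0,2,4,9,6,5,2,4,3,7],e,x,e,f,e,e,x,e,e,q [0,2,10,9,6,5,2,4,13,7],e,e,e,x,e,e,q [0,2,2,4,13,9,6,5,15,7],e,q [0,8,0,18,3,4,13,9,21,7],e,e,e,x,f,e,x,q [0,19,4,8,3,9,6,5,2,4,3,7],x,x,q [0,35,3,8,11,9,6,5,15,7],r 2 4,e,r 6 10,x,e,e,e,x,e,e,q [0,2,4,9,16,5,2,4,13,7],r 10 16,r 4 7,q [0,29,8,8,9,5,2,4,13,7],x,q [0,19,4,8,3,9,6,5,2,4,13,7],x,r 4 7,q [0,29,7,5,1,8,1,4,3,7],x,x,x,q [0,35,3,8,1,7,10,9,9,5],r 2 4,q [0,60,2,8,9,9,6,4,3,5]]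
    [T,F,T,F,F,T,T,F,F,T,F,T,T,F,F,T,T,F,F,T,F,T,F,F,T,F,T,T,F,F,T,T,F,F,T,F,T,T,F]"
  by (simp only: nu_rules)

lemma [THEN refuted_variants, simplified, nu_rules]:
  "S [f,e,x,e,f,e,x,e,e,e,x,q [0,34,2,3,9,9,6,4,3,5],f,e,q [0,2,4,9,6,5,2,4,13,7],f,e,f,e,f,e,f,e,f,e,x,f,e,x,e,e,q [0,2,2,4,7,9,6,5,15,7],e,q [0,8,0,18,3,4,7,9,21,7],e,e,r 15 24,x,x,q [0,35,3,8,5,9,6,5,15,7],r 2 4,r 2 4,e,x,x,q [0,60,2,8,9,9,6,4,3,5],e,e,r 4 7,e,e,e,x,r 10 16,e,r 2 4,e,q [0,32,5,9,2,10,14,4,3,5],x,e,e,q [0,33,4,9,2,10,6,8,8,4,3,5],r 3 5,x,x,r 4 7]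
    [F,F,T,T,F,F,T,F,T,T,F,F,T,T,F,F,T,F,T,F,F,T,F,T,T,F,F,T,T,F,F]"
  by (simp only: nu_rules)

lemma [THEN refuted_variants, simplified, nu_rules]:
  "S [f,e,e,x,r 3 5,e,e,r 5 8,r 2 4,e,e,e,x,e,x,e,e,f,e,e,x,e,e,e,x,r 6 10,e,r 2 4,e,q [0,32,11,9,2,10,4,4,3,5],x,e,e,q [0,33,8,8,2,9,2,10,4,4,3,5],r 3 5,x,x,e,e,q [0,26,1,8,8,5,2,4,5,10],q [0,15,1,27,8,5,2,4,5,10],e,q [0,28,2,29,7,5,1,8,1,4,5,10],x,x,x,x]
    [T,T,F,F,T,F,T,T,F,F,T,T,F,F,T,F,T,F,F,T,F]"
  by (simp only: nu_rules)

lemma [THEN refuted_variants, simplified, nu_rules]: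
  "S [f,e,e,x,e,x,e,q [0,16,4,8,5,9,6,7,10,23],x,r 2 4]
    [F,T,F,F,T,F,T,F,F,T,T,F,F,T,F,T,T,F,F,T,T,F,F,T,F,T,F]"
  by (simp only: nu_rules)

lemma [THEN refuted_variants, simplified, nu_rules]:
  "S [f,e,x,e,e,q [0,2,4,9,6,5,2,4,55,7],e,e,e,x,e,x,q [0,35,3,8,5,9,6,5,57,7],r 2 4,e,e,e,x,e,e,q [0,2,10,9,6,5,2,4,55,7],e,e,e,x,e,x,q [0,35,3,8,11,9,6,5,57,7],r 2 4,e,r 6 10,x,e,e,e,x,e,e,q [0,2,4,9,16,5,2,4,55,7],r 10 16,r 4 7,q [0,29,8,8,9,5,2,4,55,7],x,q [0,19,4,8,3,9,6,5,2,4,55,7],x,r 4 7]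
    [T,F,T,F,F,T,T,F,F,T,T,F,T,F,F,T,F,T,F,F,T,T,F,T,F,F,T,T,F,F,T,T,F,T,F,F,T,F,T,F,F,T,T,F,F,T,F,T,T,F,F,T,T,F,F,T,F,T,T,F,F,T,F,T,F,F,T,F,T,T,F,F,T,T,F,F,T,F,T,F,F,T,F,T,T,F,F,T,T,F,F,T,F,T,T,F,F,T,F,T,F,F,T,F,T,T,F,F,T,T,F,F]"
  by (simp only: nu_rules)

lemma [THEN refuted_variants, simplified, nu_rules]:
  "S [f,e,e,x,e,e,q [0,2,2,4,13,9,6,5,36,7],e,q [0,8,0,18,3,4,13,9,42,7],e,e,e,x,e,x,e,f,e,x,f,e,f,e,e,q [0,2,10,9,6,5,2,4,3,7],e,e,e,x,e,e,q [0,2,2,4,13,9,6,5,5,7],e,q [0,8,0,18,3,4,13,9,11,7],e,e,e,x,e,x,e,e,e,x,e,e,q [0,2,4,9,6,5,2,4,24,7],x,r 4 7,q [0,29,7,5,1,8,1,4,24,7],x,x,x,q [0,35,3,8,11,9,6,5,5,7],r 2 4,e,r 6 10,x,e,e,e,x,e,e,q [0,2,4,9,16,5,2,4,3,7],r 10 16,r 4 7,q [0,29,8,8,9,5,2,4,3,7],x,q [0,29,7,5,1,8,1,4,55,7],x,x,x,q [0,35,3,8,11,9,6,5,36,7],r 2 4]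
    [F,F,T,T,F,T,F,F,T,T,F,F,T,T,F,T,F,F,T,F,T,F,F,T,T,F,F,T,F,T,T,F,F,T,T,F,F,T,F,T,T,F,F,T,F,T,F,F,T,F,T,T,F,F,T,T,F,F,T,F,T,F,F,T,F,T,T,F,F,T,T,F,F,T,F,T,T,F,F,T,F,T,F]"
  by (simp only: nu_rules)

lemma [THEN refuted_variants, simplified, nu_rules]:
  "S [e,e,x,q [0,34,2,3,9,9,12,4,3,5],f,e,x,f,e,f,e,f,e,f,e,f,e,x,f,e,x,f,e,f,e,f,e,q [0,2,2,4,3,7,10,9,15,5],f,e,q [0,2,4,9,6,5,2,4,34,7],f,e,q [0,8,0,18,3,4,3,7,10,9],e,e,e,x,e,x,e,e,e,x,e,e,q [0,2,4,9,6,5,2,4,3,7],e,x,f,e,r 15 24,f,e,f,e,f,e,f,e,e,x,e,e,q [0,2,10,9,6,5,2,4,34,7],e,x,e,r 6 10,x,e,e,e,x,e,e,q [0,2,4,9,16,5,2,4,34,7],r 10 16,r 4 7,q [0,29,8,8,9,5,2,4,34,7],x,q [0,19,4,8,3,9,6,5,2,4,34,7],q [0,19,4,8,3,9,6,5,2,4,3,7],x,x,r 4 7,q [0,29,7,5,1,8,1,4,3,7],x,x,x,r 4 7,q [0,35,3,8,1,7,10,9,15,5],q [0,29,7,5,1,8,1,4,34,7],r 2 4,x,q [0,60,2,8,9,9,12,4,3,5]]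
    [F,T,F,F,T,T,F,F,T,F,T,T,F,F,T,T,F,F,T,F,T,T,F,F,T,F,T,F,F,T,F,T,T,F,F,T,T,F,F,T,F,T,F,F,T,F,T,T,F,F,T]"
  by (simp only: nu_rules)

lemma [THEN refuted_variants, simplified, nu_rules]:
  "S [f,e,e,e,x,r 3 5,e,e,r 5 8,r 2 4,e,e,e,x,f,e,e,e,x,e,x,e,r 10 16,x,e,e,e,x,r 6 10,e,r 2 4,e,q [0,32,11,9,2,10,10,4,3,5],x,e,e,q [0,33,8,8,2,9,2,10,10,4,3,5],r 3 5,x,x,x,x,f,e,e,e,x,e,f,e,q [0,16,4,8,5,9,6,5,22,3],x,e,r 10 16,x,e,e,e,x,r 6 10,f,e,q [0,16,7,10,2,9,6,5,27,15],x,e,q [0,28,7,8,2,9,2,10,13,5,11,35],x,x]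
    [T,T,F,F,T,F,T,T,F,F,T,T,F,F,T,F,T,T,F,F,T,F,T,F,F,T,F,T,T,F,F,T,T,F,F,T,F,T,F,F,T]"
  by (simp only: nu_rules)

lemma [THEN refuted_variants, simplified, nu_rules]:
  "S [f,e,e,x,x,r 2 4]
    [T,T,F,F,T,F,T,T,F,F,T,T,F,F,T,F,T,T,F,F,T,F,T,F,F,T,F,T,T,F,F,T,T,F,F,T,F,T,F]"
  by (simp only: nu_rules)

lemma [THEN refuted_variants, simplified, nu_rules]:
  "S [e,e,x,q [0,34,2,3,9,9,12,4,3,5],e,e,e,x,e,e,q [0,2,2,4,3,7,10,9,15,5],e,q [0,8,0,18,3,4,3,7,10,9],e,e,e,x,e,x,e,e,e,x,e,e,q [0,2,4,9,6,5,2,4,3,7],e,x,f,e,x,f,e,f,e,e,q [0,2,10,9,6,5,2,4,19,7],e,e,e,x,e,x,q [0,35,3,8,11,9,6,5,21,7],r 2 4,e,r 6 10,x,e,e,e,x,e,e,q [0,2,4,9,16,5,2,4,19,7],r 10 16,r 4 7,q [0,29,8,8,9,5,2,4,19,7],x,x,r 4 7,q [0,29,7,5,1,8,1,4,3,7],x,x,x,q [0,35,3,8,1,7,10,9,15,5],r 2 4,q [0,60,2,8,9,9,12,4,3,5]]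
    [F,T,F,F,T,T,F,F,T,F,T,T,F,F,T,T,F,F,T,F,T,T,F,F,T,F,T,F,F,T,F,T,T,F,F,T,T,F,F,T,F,T,T,F,F]"
  by (simp only: nu_rules)

lemma [THEN refuted_variants, simplified, nu_rules]:
  "S [f,e,e,r 5 8,r 2 4,e,e,e,x,e,x,e,e,e,x,e,e,e,x,e,r 3 5,q [0,22,4,10,2,9,6,5,2,4],e,x,e,f,e,e,e,x,e,f,e,x,e,q [0,8,0,11,8,9,6,5,2,4,20,3],q [0,21,1,19,4,8,3,9,6,5,2,4,20,3],e,r 10 16,x,e,e,e,x,r 6 10,e,r 2 4,e,q [0,32,11,9,2,10,10,4,3,5],x,e,e,q [0,33,8,8,2,9,2,10,10,4,3,5],r 3 5,x,x,x,r 4 7,e,e,q [0,26,1,8,8,5,2,4,11,10],q [0,15,1,27,8,5,2,4,11,10],e,q [0,28,2,29,7,5,1,8,1,4,11,10],x,x,x,x]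
    [T,T,F,F,T,F,T,T,F,F,T,T,F,F,T,F,T,T,F,F,T,F,T,F,F,T,F,T]"
  by (simp only: nu_rules)

lemma [THEN refuted_variants, simplified, nu_rules]:
  "S [f,e,e,x,r 3 5,x]
    [T,T,F,F,T,F,T,T,F,F,T,T,F,F,T,F,T,T,F,F,T,F,T,F,F,T,F]"
  by (simp only: nu_rules)

lemma [THEN refuted_variants, simplified, nu_rules]:
  "S [e,e,x,r 3 5,f,e,x,f,e,e,r 5 8,r 2 4,f,e,x,f,e,f,e,f,e,f,e,f,e,x,f,e,x,f,e,x,f,e,f,e,f,e,q [0,2,4,9,6,7,6,4,3,5],f,e,e,x,e,e,q [0,2,4,9,6,5,2,4,3,7],e,x,f,e,x,e,e,e,x,e,e,q [0,2,10,9,6,7,6,4,3,5],e,e,e,x,e,x,q [0,35,3,8,11,9,6,7,9,5],r 2 4,e,r 6 10,x,e,r 10 16,x,q [0,19,4,8,3,9,6,7,6,4,3,5],x,r 4 7,q [0,29,7,5,1,8,1,4,3,7],x,r 4 7,q [0,29,7,7,1,8,5,4,3,5],x,x,x]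
    [F,T,F,F,T,F,T,F,F,T,T,F,F,T,F,T,T,F,F]"
  by (simp only: nu_rules)

lemma [THEN refuted_variants, simplified, nu_rules]:
  "S [e,e,x,r 3 5,e,e,r 5 8,r 2 4,e,f,e,e,x,e,r 3 5,e,q [0,36,4,3,5,4,3,5],x,e,e,e,x,q [0,4,0,61,2,8,10,5],r 2 4,e,e,x,e,e,q [0,6,1,8,4,7,6,4,3,5],q [0,15,1,11,4,7,6,4,3,5],e,r 3 5,x,x,x]
    [F,T,F,F,T,F,T,F,F,T,T,F,F,T,F]"
  by (simp only: nu_rules)

lemma [THEN refuted_variants, simplified, nu_rules]:
  "S [e,e,x,r 3 5,f,e,f,e,e,r 5 8,r 2 4,e,e,f,e,e,x,r 3 5,e,e,e,x,e,e,e,x,r 3 5,r 5 8,e,e,r 15 24,e,e,e,x,e,x,e,e,e,x,e,x,x,e,r 6 10,e,e,q [0,33,8,8,4,4,3,5,6,9,2,10],r 3 5,x,x,x,e,e,q [0,33,6,4,2,8,1,5,6,9,2,10],r 3 5,x,x,r 2 4,e,e,q [0,30,4,8,5,9,2,10,4,4],q [0,19,1,31,3,8,5,9,2,10,4,4],x,x,x,x]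
    [F,T,F,F,T,F,T,F,F,T,T,F,F,T,T,F,T,F,F,T,F,T,F,F,T,T,F,T,F,F,T,T,F,F,T,T,F,T,F,F,T,F,T,F,F,T,T,F,F,T,T,F,T,F,F,T]"
  by (simp only: nu_rules)

lemma [THEN refuted_variants, simplified, nu_rules]:
  "S [e,e,x,r 3 5,f,e,f,e,e,r 5 8,r 2 4,f,e,f,e,f,e,x,f,e,f,e,x,e,e,r 4 7,e,e,e,x,x,e,r 2 4,e,q [0,32,5,9,2,10,4,4,3,5],x,e,e,q [0,33,4,9,2,10,4,4,2,8,1,5],r 3 5,x,x,x,x,x,x]
    [F,T,F,F,T,F,T,F,F,T,T,F,F,T,T,F,T,F,F,T,F,T,F,F,T,T,F,T,F,F,T,T,F,F,T,T,F,T,F,F,T,F,T,F,F,T,T]"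
  by (simp only: nu_rules)

lemma [THEN refuted_variants, simplified, nu_rules]:
  "S [e,e,x,r 3 5,e,e,r 5 8,r 2 4,e,f,e,e,r 4 7,e,f,e,f,e,e,x,e,e,e,x,r 3 5,e,e,e,x,e,e,e,x,r 3 5,r 5 8,x,r 2 4,e,e,q [0,30,4,8,5,9,2,10,10,4],q [0,19,1,31,3,8,5,9,2,10,10,4],x,x,e,r 2 4,e,q [0,32,5,9,2,10,10,4,3,5],x,x,e,e,q [0,33,4,9,2,10,6,8,4,4,3,5],r 3 5,x,x,x]
    [F,T,F,F,T,F,T,F,F,T,T,F,F,T,T,F,T,F,F,T,F,T,F,F,T,T,F,T,F,F,T,T,F,F,T,T]"
  by (simp only: nu_rules)

lemma [THEN refuted_variants, simplified, nu_rules]: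
  "S [e,x,f,e,x,f,e,f,e,f,e,q [0,62,5,8,3,10,2,9,6,5],f,e,q [0,2,6,9,2,10,13,5,10,16],f,e,f,e,e,e,x,e,q [0,8,0,24,4,5,6,9,2,10,23,16],e,e,e,x,e,x,e,e,r 4 7,e,e,e,x,e,e,q [0,2,6,9,2,10,7,5,31,16],e,e,e,x,e,q [0,8,0,24,4,5,6,9,2,10,38,16],e,e,r 15 24,e,e,e,x,e,x,e,e,e,x,e,x,x,e,r 6 10,q [0,21,6,8,7,5,6,9,2,10,38,16],x,x,q [0,21,6,8,1,5,6,9,2,10,38,16],x,r 2 4,q [0,25,2,8,5,9,2,10,38,16],x,q [0,15,3,9,2,10,7,5,31,16],q [0,21,2,9,2,10,6,8,1,5,31,16],x,x,x,r 2 4,q [0,25,2,8,5,9,2,10,23,16],q [0,21,2,16,4,8,3,10,2,9,6,5],x,x]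
    [T,F,F,T,F,T,F,F,T,T,F,F,T,T,F,T,F,F,T,F,T,F,F,T,T,F,T,F,F,T,T,F,F,T,T,F,T,F,F]"
  by (simp only: nu_rules)

lemma [THEN refuted_variants, simplified, nu_rules]:
  "S [f,e,e,e,x,e,x,e,e,e,x,e,x,f,e,e,x,e,x,f,e,e,r 4 7,e,e,x,e,r 2 4,q [0,12,4,9,2,10,13,5,11,35],f,e,q [0,16,4,8,3,10,2,9,6,5,20,21],x,x,r 2 4,e,r 6 10,e,e,q [0,33,8,8,4,4,3,5,6,9,2,10],r 3 5,x,x,x,e,e,q [0,33,6,4,2,8,1,5,6,9,2,10],r 3 5,x]
    [F,T,F,T,F,F,T,T,F,F,T,T,F,T,F,F,T,F,T,F,F,T,T,F,T]"
  by (simp only: nu_rules)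

lemma [THEN refuted_variants, simplified, nu_rules]:
  "S [f,e,x,e,e,e,x,r 3 5,r 5 8,e,e,e,x,e,x,e,e,r 4 7,e,e,e,x,e,e,e,x,r 3 5,e,e,e,x,f,e,e,x,r 15 24,r 2 4,r 2 4,e,e,q [0,30,4,8,5,9,2,10,4,4],q [0,19,1,31,3,8,5,9,2,10,4,4],x,x,e,r 2 4,e,q [0,32,5,9,2,10,4,4,3,5],x,e,e,q [0,33,4,9,2,10,4,4,2,8,1,5],r 3 5,x,x,x,x]
    [F,T,F,T,F,F,T,T,F,F,T,T,F,T,F,F,T,F,T,F,F]"
  by (simp only: nu_rules)

lemma [THEN refuted_variants, simplified, nu_rules]:
  "S [f,e,e,x,r 3 5,e,e,x,r 2 4,e,e,f,e,f,e,x,q [0,48,5,8,5,9,2,10,5,63],r 2 4,f,e,f,e,q [0,8,0,11,2,31,8,9,2,10,5,63],q [0,21,1,19,1,31,3,8,5,9,2,10,5,63],r 2 4,x]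
    [F,T,F,T,F,F,T,T,F,F,T,T,F,T,F,F,T,F]"
  by (simp only: nu_rules)

lemma [THEN refuted_variants, simplified, nu_rules]:
  "S [e,e,x,r 3 5,e,e,r 5 8,r 2 4,e,f,e,x,f,e,f,e,x,e,e,r 4 7,e,e,e,x,e,x,x,e,r 2 4,e,q [0,32,5,9,2,10,4,4,3,5],x,e,e,q [0,33,4,9,2,10,4,4,2,8,1,5],r 3 5,x,x,x,x]
    [F,T,F,F,T,F,T,F,F,T,T,F,F]"
  by (simp only: nu_rules)

lemma [THEN refuted_variants, simplified, nu_rules]:
  "S [e,e,x,r 3 5,e,e,r 5 8,r 2 4,e,f,e,e,r 4 7,e,f,e,f,e,e,x,e,e,e,x,r 3 5,e,e,e,x,e,e,e,x,r 3 5,r 5 8,e,e,x,x,x,r 2 4,e,e,q [0,30,4,8,5,9,2,10,10,4],q [0,19,1,31,3,8,5,9,2,10,10,4],x,x,e,r 2 4,e,q [0,32,5,9,2,10,10,4,3,5],x,x,e,e,q [0,33,4,9,2,10,6,8,4,4,3,5],r 3 5,x,x,x]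
    [F,T,F,F,T,F,T,F,F,T,T,F,T,F,F,T,T,F,F,T,T]"
  by (simp only: nu_rules)

lemma [THEN refuted_variants, simplified, nu_rules]:
  "S [e,e,x,r 3 5,e,e,r 5 8,r 2 4,e,f,e,f,e,f,e,x,f,e,x,f,e,e,e,x,e,x,e,e,e,x,e,x,x,e,r 6 10,e,e,f,e,x,f,e,x,f,e,e,q [0,39,1,9,6,5,1,8,1,4,11,14],q [0,29,1,38,6,5,1,8,1,4,11,14],x,r 3 5,x,x,x,e,e,f,e,x,f,e,x,f,e,e,q [0,39,1,9,6,5,1,8,1,4,5,14],q [0,29,1,38,6,5,1,8,1,4,5,14],x,r 3 5,x,x,x,x]
    [F,T,F,F,T,F,T,F,F,T,T]"
  by (simp only: nu_rules)

lemma [THEN refuted_variants, simplified, nu_rules]: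
  "S [e,e,x,r 3 5,f,e,e,x,e,e,e,x,r 3 5,r 5 8,x,r 2 4]
    [F,T,F,F,T,F,T,F]"
  by (simp only: nu_rules)

lemma [THEN refuted_variants, simplified, nu_rules]:
  "S [e,q [0,2,4,16,15,9,6,7],f,e,x,f,e,q [0,8,0,17,5,16,15,9],f,e,e,q [0,2,10,16,5,7,10,9],e,e,e,x,e,x,e,e,q [0,62,5,8,1,7,25,9],e,e,r 15 24,x,q [0,21,2,16,4,8,1,7,25,9],x,r 2 4,q [0,60,2,8,9,16,15,9],e,e,r 4 7,e,e,f,e,f,e,x,f,e,e,x,e,f,e,q [0,8,0,23,5,9,10,16,5,7],e,e,e,x,r 25 39,e,e,e,x,r 6 10,q [0,15,9,9,10,16,5,7],q [0,21,6,8,2,9,10,16,5,7],x,e,e,f,e,q [0,8,0,23,5,9,10,16,5,7],r 25 39,q [0,29,7,7,1,8,3,16],x,q [0,19,3,7,1,8,3,16,15,9],x,q [0,15,3,9,10,16,5,7],q [0,21,2,9,8,8,2,16,5,7],x]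
    [F,T,F,F,T,T,F,F,T,F,T,F,F,T,T,F,T,F,F,T,T,F,F,T,T,F,T,F,F,T,T,F,F,T,F,T,F,F,T,T,F,T,F,F,T,T,F,F]"
  by (simp only: nu_rules)

lemma [THEN refuted_variants, simplified, nu_rules]:
  "S [e,e,x,q [0,34,2,3,3,16,15,9],e,q [0,8,0,17,5,16,15,9],e,f,e,q [0,8,0,23,5,9,10,16,5,7],e,e,e,x,e,e,q [0,2,10,9,10,16,5,7],e,e,e,x,e,x,e,e,q [0,62,5,8,1,7,10,9],e,e,e,x,e,x,e,e,x,e,r 6 10,q [0,21,6,8,2,16,5,7,10,9],x,x,q [0,21,2,16,4,8,1,7,10,9],x,r 2 4,q [0,60,2,8,9,9,10,16],e,r 10 16,x,e,e,e,x,r 6 10,q [0,15,9,9,10,16,5,7],q [0,21,6,8,2,9,10,16,5,7],x,x]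
    [F,T,F,F,T,T,F,F,T,F,T,F,F,T,T,F,T,F,F,T,T,F,F,T,T,F,T,F,F,T]"
  by (simp only: nu_rules)

lemma [THEN refuted_variants, simplified, nu_rules]:
  "S [f,e,e,r 4 7,e,e,e,x,x,f,e,q [0,2,1,3,3,16,15,9,6,15],q [0,7,4,16,15,9,6,15],e,q [0,28,3,9,8,8,2,16,6,3],x,x]
    [F,T,F,F,T,T,F,F,T,F,T,F,F,T,T,F,T,F,F,T,T,F,F,T,T]"
  by (simp only: nu_rules)

lemma [THEN refuted_variants, simplified, nu_rules]:
  "S [e,e,x,e,r 3 5,e,q [0,36,2,55,2,3,3,16],x,f,e,x,e,e,e,x,e,r 3 5,q [0,22,1,55,11,16,5,7],e,e,f,e,e,e,x,q [0,55,0,61,2,8,5,16],r 2 4,f,e,x,e,x,e,e,e,x,e,q [0,8,0,64,1,55,7,7],q [0,13,1,65,6,8,1,7],e,e,e,x,e,x,e,r 15 24,x,x,e,e,q [0,33,4,16,2,55,2,8,1,7],r 3 5,x,x,r 2 4,e,e,q [0,66,4,8,1,55,8,16],q [0,19,1,67,3,8,1,55,8,16],x,x]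
    [F,T,F,F,T,T,F,F,T,F,T,F,F,T,T,F,T,F,F,T,T,F,F]"
  by (simp only: nu_rules)

lemma [THEN refuted_variants, simplified, nu_rules]:
  "S [f,e,e,x,e,x,e,e,e,x,e,e,q [0,2,1,3,0,64,1,55],q [0,7,1,8,0,64,1,55],e,q [0,9,2,65,6,8,2,3],x,e,e,e,x,e,x,e,e,x,e,r 6 10,e,e,f,e,q [0,2,1,3,1,55,2,16,14,33],q [0,7,1,8,1,55,2,16,14,33],r 3 5,x,x,x,e,e,f,e,q [0,2,1,3,1,55,2,16,8,33],q [0,7,1,8,1,55,2,16,8,33],r 3 5,x,x,r 2 4]
    [F,T,F,F,T,T,F,F,T,F,T,F]"
  by (simp only: nu_rules)

lemma [THEN refuted_variants, simplified, nu_rules]: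
  "S [e,e,e,x,f,e,e,e,x,r 3 5,e,x,q [0,25,2,8,5,9,2,10,8,16],e,e,e,x,e,e,e,x,q [0,34,2,3,9,9,10,16],e,x,q [0,60,2,8,9,9,10,16],e,r 10 16,x,e,e,e,x,r 6 10,e,r 2 4,e,q [0,32,11,9,2,10,8,16],x,e,e,q [0,33,8,8,2,9,2,10,8,16],r 3 5,x,x,e,r 2 4,e,q [0,32,5,9,2,10,2,16],x,e,e,q [0,33,4,9,2,10,2,16,4,8],r 3 5,x]
    [T,F,T,T,F,F,T,T,F,F,T,F,T,F,F,T,T,F,T,F,F,T,T,F,F,T,T,F,T,F,F,T]"
  by (simp only: nu_rules)

lemma [THEN refuted_variants, simplified, nu_rules]:
  "S [e,e,e,x,f,e,f,e,x,e,e,f,e,r 4 7,f,e,x,f,e,e,e,x,f,e,x,e,e,r 4 7,x,x,e,r 2 4,e,q [0,32,5,9,2,10,8,16],x,e,e,q [0,33,4,9,2,10,6,8,2,16],r 3 5,x,e,e,q [0,68,1,8,15,10,2,9],x,e,q [0,28,2,20,5,8,9,10,2,9],x,x,x,r 2 4,e,r 6 10,x]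
    [T,F,T,F,F,T,T,F,T,F,F,T,T,F,F,T,T]"
  by (simp only: nu_rules)

lemma [THEN refuted_variants, simplified, nu_rules]:
  "S [e,f,e,x,f,e,f,e,f,e,x,e,x,e,f,e,e,x,e,r 3 5,e,q [0,36,2,55,2,3,9,16],x,e,x,e,e,q [0,66,4,8,1,55,8,16],q [0,19,1,67,3,8,1,55,8,16],x,x,x,r 2 4,e,r 6 10,x]
    [T,F,T,F,F,T,T,F,T,F,F,T,T,F,F]"
  by (simp only: nu_rules)

lemma [THEN refuted_variants, simplified, nu_rules]:
  "S [f,e,e,x,f,e,f,e,r 6 10,f,e,f,e,f,e,x,e,x,e,f,e,f,e,f,e,x,f,e,x,f,e,q [0,8,0,49,1,55,11,16,7,10],q [0,13,1,14,9,8,2,16,7,10],f,e,x,e,e,q [0,2,1,49,1,55,2,38,8,20],q [0,50,1,8,1,55,2,38,8,20],e,q [0,38,0,9,2,14,9,8,1,20],x,r 3 5,x,x,r 2 4,r 6 10,x]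
    [T,F,T,F,F,T,T,F,T,F,F,T,T]"
  by (simp only: nu_rules)

lemma [THEN refuted_variants, simplified, nu_rules]:
  "S [e,e,x,e,x,f,e,e,e,x,e,x,e,q [0,9,1,69,1,10,6,8],x,e,e,e,x,e,x,x,x,e,e,f,e,q [0,9,2,10,2,16,4,8,4,33],x,r 3 5,x,x,e,e,e,x,e,x,x,x,e,f,e,f,e,f,e,f,e,x,f,e,x,f,e,q [0,8,0,49,1,55,5,16,7,10],q [0,13,1,14,5,16,4,8,3,10],f,e,x,e,e,q [0,2,1,49,1,55,2,38,2,20],q [0,50,1,8,1,55,2,38,2,20],e,q [0,38,0,9,2,14,4,20,5,8],x,r 3 5,x,x]
    [F,T,T,F,F,T,F,T,F,F,T,T]"
  by (simp only: nu_rules)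

lemma [THEN refuted_variants, simplified, nu_rules]:
  "S [e,f,e,f,e,x,f,e,x,f,e,x,f,e,x,f,e,x,x,r 2 4,r 2 4]
    [F,T,F,T,F]"
  by (simp only: nu_rules)

lemma [THEN refuted_variants, simplified, nu_rules]:
  "S [e,x,f,e,e,x,r 3 5,e,x,e,f,e,r 3 5,e,e,f,e,f,e,x,f,e,x,q [0,48,4,70,6,36,5,10],f,e,x,f,e,q [0,11,1,70,1,31,8,36,5,10],q [0,21,1,19,1,31,8,36,5,10],f,e,f,e,f,e,x,q [0,48,2,38,2,70,4,58],f,e,x,q [0,48,2,38,7,59,9,21],f,e,f,e,q [0,11,1,70,1,31,6,58],q [0,21,1,19,1,31,6,58],e,q [0,28,2,59,8,31,7,19],x,x,x]
    [F,F,T,F,F,T,T,F,T,F,F,T,F]"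
  by (simp only: nu_rules)

lemma [THEN refuted_variants, simplified, nu_rules]:
  "S [e,x,e,x,e,e,x,e,f,e,e,x,e,e,e,x,r 3 5,e,x,e,q [0,31,0,71,2,70,1,8],x,e,e,e,x,e,e,q [0,2,1,3,5,42,3,70,1,31],q [0,70,0,7,1,8,5,42,4,31],e,q [0,9,2,10,4,42,2,8,1,70,1,31],x,e,e,e,x,e,f,e,e,x,f,e,e,x,r 3 5,e,x,e,r 14 22,x,x,x,x,x,x,x,e,r 3 5,x,x]
    [F,T,F,F,T,T,F,T,F,F,T,F,T,T,F,T,F]"
  by (simp only: nu_rules)

lemma [THEN refuted_variants, simplified, nu_rules]:
  "S [e,x,e,x,e,f,e,e,x,r 3 5,f,e,x,f,e,x,f,e,f,e,f,e,f,e,f,e,x,f,e,x,e,e,x,q [0,70,0,47,1,8,13,42],e,q [0,9,2,48,4,70,1,8,7,42],x,e,x,e,r 3 5,x,x,x,e,r 3 5,x,x]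
    [F,T,F,F,T,T,F,T,F,F,T,F]"
  by (simp only: nu_rules)

lemma [THEN refuted_variants, simplified, nu_rules]:
  "S [e,x,f,e,e,x,r 3 5,e,x,e,f,e,x,f,e,e,x,e,x,f,e,f,e,f,e,f,e,q [0,39,0,72,1,9,6,70,1,8],q [0,70,0,29,1,73,7,8,8,39],f,e,q [0,39,1,73,6,70,1,8,4,29],q [0,70,0,29,0,74,1,38,7,8],x,x,e,e,f,e,f,e,x,f,e,e,x,q [0,10,2,9,4,31,2,70,1,8,1,42],e,q [0,8,0,27,1,70,5,31,4,42],q [0,21,1,29,5,31,3,8,1,42],x,x,e,r 3 5,x,x]
    [F,F,T,T,F,T,F,F,T,F]"
  by (simp only: nu_rules)

text \<open>With 010010, the last of the words that \<open>nu_avoided\<close> requires is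
  available.\<close>

lemma [THEN refuted_variants, simplified, nu_rules]:
  "S [e,e,x,r 3 5,e,x,e,e,x,e,e,e,x,e,e,e,x,r 3 5,f,e,e,x,r 3 5,f,e,x,f,e,x,f,e,f,e,q [0,31,0,71,2,70,1,8],x,x,x,x,e,r 3 5,x,x]
    [F,T,F,F,T,F]"
  by (simp only: nu_rules)

lemma [THEN refuted_variants, simplified, nu_rules]:
  "S [f,e,e,x,e,x,e,e,e,x,e,q [0,3,1,55,2,36,10,49],q [0,13,1,10,2,36,10,49],e,e,q [0,57,3,38,2,55,8,49],x,f,e,f,e,e,e,x,e,e,e,x,q [0,55,0,75,5,38,2,59],f,e,x,e,x,e,e,e,x,q [0,55,0,10,6,49,11,59],e,f,e,x,f,e,f,e,f,e,x,f,e,r 16 25,x,x,x,e,q [0,38,0,76,5,55,2,49],x,x,e,q [0,38,0,9,6,59,11,49],x,x,x,e,x,q [0,77,3,55,2,38,8,59],x,x]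
    [F,T,F,F,T,T,F,T,T,F,F,T,F,T,T,F,F,T,F]"
  by (simp only: nu_rules)

lemma [THEN refuted_variants, simplified, nu_rules]:
  "S [f,e,x,e,e,e,x,f,e,f,e,x,f,e,x,e,x,e,f,e,f,e,q [0,39,1,36,4,49,12,9],q [0,59,1,38,4,49,12,9],x,x,e,x,e,e,e,x,f,e,x,f,e,x,q [0,13,0,78,3,38,3,8],x,x,x,x]
    [F,T,F,F,T,T,F,T,T,F,F,T,F,T]"
  by (simp only: nu_rules)

lemma [THEN refuted_variants, simplified, nu_rules]:
  "S [e,x,f,e,f,e,x,f,e,f,e,f,e,x,f,e,f,e,f,e,x,f,e,q [0,79,2,55,5,36,5,10],x,f,e,x,f,e,q [0,9,2,14,5,36,5,10],x,f,e,f,e,x,f,e,q [0,79,2,55,2,38,1,80],x,f,e,x,f,e,q [0,38,0,9,2,14,3,80],x,x,x,x]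
    [F,F,T,F,F,T,T,F,T,T]"
  by (simp only: nu_rules)

lemma [THEN refuted_variants, simplified, nu_rules]:
  "S [e,x,r 4 7]
    [F,F,T,T,F,F,T,T,F,F]"
  by (simp only: nu_rules)

lemma [THEN refuted_variants, simplified, nu_rules]:
  "S [e,e,x,e,x,x,x]
    [F,T,F,T,T,F,F,T,F,T]"
  by (simp only: nu_rules)

lemma [THEN refuted_variants, simplified, nu_rules]:
  "S [e,x,f,e,x,f,e,x,f,e,x,f,e,f,e,r 7 11,x,x]
    [F,F,T,F,F,T,T,F,F,T,F,F]"
  by (simp only: nu_rules)

lemma [THEN refuted_variants, simplified, nu_rules]:
  "S [e,f,e,f,e,x,f,e,x,f,e,x,f,e,x,f,e,f,e,f,e,f,e,f,e,x,f,e,x,q [0,10,0,81,6,8,1,70],e,x,e,f,e,x,q [0,10,2,82,4,8,12,28],x,e,x,e,f,e,f,e,q [0,33,4,82,4,8,11,39],x,f,e,q [0,33,1,38,2,83,5,8],x,x,x,x,x,x]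
    [F,T,F,T,T,F,F,T,T,F,T,F]"
  by (simp only: nu_rules)

lemma [THEN refuted_variants, simplified, nu_rules]:
  "S [e,x,x]
    [F,T,F,F,T,T,F,T,T,F,F,T,F]"
  by (simp only: nu_rules)

lemma [THEN refuted_variants, simplified, nu_rules]:
  "S [e,x,f,e,f,e,x,f,e,f,e,f,e,x,q [0,14,5,9,2,10,2,36],x,x,x]
    [F,F,T,F,F,T,T,F,F,T,T,F,T,T]"
  by (simp only: nu_rules)

lemma [THEN refuted_variants, simplified, nu_rules]:
  "S [e,f,e,x,f,e,x,f,e,f,e,x,f,e,f,e,f,e,x,f,e,f,e,x,f,e,x,f,e,q [0,9,2,14,11,36,5,10],x,x,x,x,x,x]
    [F,T,F,F,T,T,F,T,F,F,T,T,F,T]"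
  by (simp only: nu_rules)

lemma [THEN refuted_variants, simplified, nu_rules]:
  "S [e,x,f,e,x,f,e,q [0,8,1,10,0,84,2,9],x]
    [F,F,T,T,F,F,T,T,F,T,T,F,F,T,T,F,F]"
  by (simp only: nu_rules)

lemma [THEN refuted_variants, simplified, nu_rules]:
  "S [e,x,f,e,x,f,e,x,f,e,x,q [0,85,1,70,1,3,1,55]]
    [F,T,F,F,T,T,F,F,T,F,F,T,T,F,F,T,F]"
  by (simp only: nu_rules)

lemma [THEN refuted_variants, simplified, nu_rules]:
  "S [e,x,f,e,f,e,f,e,x,f,e,f,e,e,e,x,e,x,r 10 16,x,f,e,x,f,e,f,e,x,f,e,f,e,f,e,x,q [0,14,5,9,2,10,12,36],x,x,x,e,x,e,e,r 10 16,x,x,x,x]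
    [F,F,T,T,F,F,T,T,F,T,F,F,T,T,F,F,T,T]"
  by (simp only: nu_rules)

lemma [THEN refuted_variants, simplified, nu_rules]:
  "S [e,f,e,x,f,e,x,f,e,f,e,x,f,e,q [0,33,3,29,8,3,4,22],x,x,x]
    [F,T,F,F,T,T,F,F,T,F,T,T,F,F,T,T,F,T]"
  by (simp only: nu_rules)

lemma [THEN refuted_variants, simplified, nu_rules]:
  "S [f,e,x,e,f,e,x,e,x,e,f,e,e,x,q [0,14,11,9,2,10,2,36],x,x,x]
    [F,F,T,F,F,T,T,F,F,T,T,F,T,F,F,T,T,F,T]"
  by (simp only: nu_rules)

lemma [THEN refuted_variants, simplified, nu_rules]:
  "S [e,f,e,f,e,x,f,e,e,x,e,x,f,e,x,f,e,f,e,f,e,f,e,f,e,x,f,e,x,r 13 21,x,x,x,x,x,x,x]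
    [F,T,F,F,T,T,F,T,F,F,T,T,F,F,T,F,F,T,T,F,T]"
  by (simp only: nu_rules)

lemma [THEN refuted_variants, simplified, nu_rules]:
  "S [e,x,f,e,r 10 16,x]
    [F,F,T,T,F,F,T,F,T,T,F,F,T,T,F,F,T,F,T,T,F,F,T,T]"
  by (simp only: nu_rules)

lemma [THEN refuted_variants, simplified, nu_rules]:
  "S [e,f,e,x,f,e,x,f,e,f,e,x,f,e,f,e,f,e,x,q [0,14,11,9,2,10,8,36],x,x,x,x]
    [F,T,F,F,T,T,F,T,F,F,T,T,F,F,T,T,F,T,F,F,T,T,F,T]"
  by (simp only: nu_rules)

lemma [THEN refuted_variants, simplified, nu_rules]:
  "S [f,e,x,e,x,e,e,x,e,e,e,x,e,x,e,e,e,x,e,f,e,x,f,e,f,e,x,f,e,x,e,x,e,r 17 27,x,x,x,x,x,x,x,x]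
    [F,F,T,F,F,T,T,F,F,T,T,F,T,F,F,T,T,F,F,T,F,F,T,T,F,F]"
  by (simp only: nu_rules)

section \<open>Sets of windows that form traps\<close>

private abbreviation (input) "d \<equiv> Down"
private abbreviation (input) "l \<equiv> Lost"
private abbreviation (input) "i \<equiv> Inside"

definition mu_trap1 :: "bool list list" where
  "mu_trap1 =
   [[F,F,T,F,T,F,F,T,F,T,T,F,F,T,F,T,F,F,T],
    [F,F,T,F,T,F,F,T,F,T,T,F,F,T,T,F,F,T,F],
    [F,F,T,F,T,F,F,T,T,F,F,T,T,F,T,F,F,T,F],
    [F,F,T,F,T,F,F,T,T,F,T,F,F,T,F,T,F,F,T],
    [F,F,T,F,T,F,F,T,T,F,T,F,F,T,T,F,F,T,T],
    [F,F,T,F,T,T,F,F,T,F,T,F,F,T,F,T,T,F,F],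
    [F,F,T,F,T,T,F,F,T,T,F,F,T,F,T,F,F,T,F],
    [F,F,T,F,T,T,F,F,T,T,F,F,T,F,T,T,F,F,T],
    [F,F,T,T,F,F,T,F,T,F,F,T,F,T,T,F,F,T,F],
    [F,F,T,T,F,F,T,F,T,F,F,T,F,T,T,F,F,T,T],
    [F,F,T,T,F,F,T,F,T,T,F,F,T,F,T,F,F,T,F],
    [F,F,T,T,F,F,T,T,F,T,F,F,T,F,T,F,F,T,T],
    [F,F,T,T,F,T,F,F,T,F,T,F,F,T,T,F,F,T,T],
    [F,F,T,T,F,T,F,F,T,F,T,F,F,T,T,F,T,F,F],
    [F,F,T,T,F,T,F,F,T,T,F,F,T,T,F,T,F,F,T],
    [F,T,F,F,T,F,T,F,F,T,T,F,F,T,T,F,T,F,F],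
    [F,T,F,F,T,F,T,F,F,T,T,F,T,F,F,T,F,T,F],
    [F,T,F,F,T,F,T,F,F,T,T,F,T,F,F,T,T,F,F],
    [F,T,F,F,T,F,T,T,F,F,T,F,T,F,F,T,F,T,T],
    [F,T,F,F,T,F,T,T,F,F,T,T,F,F,T,F,T,F,F],
    [F,T,F,F,T,F,T,T,F,F,T,T,F,F,T,F,T,T,F],
    [F,T,F,F,T,T,F,F,T,T,F,T,F,F,T,F,T,F,F],
    [F,T,F,F,T,T,F,T,F,F,T,F,T,F,F,T,T,F,F],
    [F,T,F,F,T,T,F,T,F,F,T,T,F,F,T,T,F,T,F],
    [F,T,F,T,F,F,T,F,T,T,F,F,T,F,T,F,F,T,F],
    [F,T,F,T,F,F,T,F,T,T,F,F,T,T,F,F,T,F,T],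
    [F,T,F,T,F,F,T,T,F,F,T,T,F,T,F,F,T,F,T],
    [F,T,F,T,F,F,T,T,F,T,F,F,T,F,T,F,F,T,T],
    [F,T,F,T,F,F,T,T,F,T,F,F,T,T,F,F,T,T,F],
    [F,T,F,T,T,F,F,T,F,T,F,F,T,F,T,T,F,F,T],
    [F,T,F,T,T,F,F,T,T,F,F,T,F,T,F,F,T,F,T],
    [F,T,F,T,T,F,F,T,T,F,F,T,F,T,T,F,F,T,F],
    [F,T,T,F,F,T,F,T,F,F,T,F,T,T,F,F,T,F,T],
    [F,T,T,F,F,T,F,T,F,F,T,F,T,T,F,F,T,T,F],
    [F,T,T,F,F,T,F,T,T,F,F,T,F,T,F,F,T,F,T],
    [F,T,T,F,F,T,T,F,F,T,F,T,F,F,T,F,T,T,F],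
    [F,T,T,F,F,T,T,F,F,T,F,T,T,F,F,T,F,T,F],
    [F,T,T,F,F,T,T,F,T,F,F,T,F,T,F,F,T,T,F],
    [F,T,T,F,T,F,F,T,F,T,F,F,T,T,F,F,T,T,F],
    [F,T,T,F,T,F,F,T,F,T,F,F,T,T,F,T,F,F,T],
    [F,T,T,F,T,F,F,T,T,F,F,T,T,F,T,F,F,T,F],
    [T,F,F,T,F,T,F,F,T,F,T,T,F,F,T,F,T,F,F],
    [T,F,F,T,F,T,F,F,T,F,T,T,F,F,T,T,F,F,T],
    [T,F,F,T,F,T,F,F,T,T,F,F,T,T,F,T,F,F,T],
    [T,F,F,T,F,T,F,F,T,T,F,T,F,F,T,F,T,F,F],
    [T,F,F,T,F,T,F,F,T,T,F,T,F,F,T,T,F,F,T],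
    [T,F,F,T,F,T,T,F,F,T,F,T,F,F,T,F,T,T,F],
    [T,F,F,T,F,T,T,F,F,T,T,F,F,T,F,T,F,F,T],
    [T,F,F,T,F,T,T,F,F,T,T,F,F,T,F,T,T,F,F],
    [T,F,F,T,T,F,F,T,F,T,F,F,T,F,T,T,F,F,T],
    [T,F,F,T,T,F,F,T,F,T,T,F,F,T,F,T,F,F,T],
    [T,F,F,T,T,F,F,T,T,F,T,F,F,T,F,T,F,F,T],
    [T,F,F,T,T,F,T,F,F,T,F,T,F,F,T,T,F,F,T],
    [T,F,F,T,T,F,T,F,F,T,F,T,F,F,T,T,F,T,F],
    [T,F,F,T,T,F,T,F,F,T,T,F,F,T,T,F,T,F,F],
    [T,F,T,F,F,T,F,T,F,F,T,T,F,F,T,T,F,T,F],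
    [T,F,T,F,F,T,F,T,F,F,T,T,F,T,F,F,T,F,T],
    [T,F,T,F,F,T,F,T,F,F,T,T,F,T,F,F,T,T,F],
    [T,F,T,F,F,T,F,T,T,F,F,T,F,T,F,F,T,F,T],
    [T,F,T,F,F,T,F,T,T,F,F,T,T,F,F,T,F,T,F],
    [T,F,T,F,F,T,F,T,T,F,F,T,T,F,F,T,F,T,T],
    [T,F,T,F,F,T,T,F,F,T,T,F,T,F,F,T,F,T,F],
    [T,F,T,F,F,T,T,F,T,F,F,T,F,T,F,F,T,T,F],
    [T,F,T,F,F,T,T,F,T,F,F,T,T,F,F,T,T,F,T],
    [T,F,T,T,F,F,T,F,T,F,F,T,F,T,T,F,F,T,T],
    [T,F,T,T,F,F,T,T,F,F,T,F,T,F,F,T,F,T,T],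
    [T,F,T,T,F,F,T,T,F,F,T,F,T,T,F,F,T,F,T],
    [T,T,F,F,T,F,T,F,F,T,F,T,T,F,F,T,F,T,F],
    [T,T,F,F,T,F,T,F,F,T,F,T,T,F,F,T,T,F,F],
    [T,T,F,F,T,F,T,T,F,F,T,F,T,F,F,T,F,T,T],
    [T,T,F,F,T,T,F,F,T,F,T,F,F,T,F,T,T,F,F],
    [T,T,F,F,T,T,F,F,T,F,T,T,F,F,T,F,T,F,F],
    [T,T,F,F,T,T,F,T,F,F,T,F,T,F,F,T,T,F,F],
    [T,T,F,F,T,T,F,T,F,F,T,F,T,F,F,T,T,F,T],
    [T,T,F,T,F,F,T,F,T,F,F,T,T,F,F,T,T,F,T],
    [T,T,F,T,F,F,T,F,T,F,F,T,T,F,T,F,F,T,F],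
    [T,T,F,T,F,F,T,F,T,F,F,T,T,F,T,F,F,T,T],
    [T,T,F,T,F,F,T,T,F,F,T,T,F,T,F,F,T,F,T]]"

lemmas mu_trap1_rules = members[OF mu_trap1_def, unfolded list.pred_inject simp_thms]

text \<open>So 10101 cannot precede 01010. Complementation exchanges the two words, and the opposite
  order is therefore covered by the same trap.\<close>

lemma mu_trap1_trap: "trap 19 (\<lambda>w. avoided 13 5 18 w) mu_trap1 [[F,T,F,T,F]] [[T,F,T,F,T]]"
  by (rule trapI[OF mu_trap1_def, where ss = "[d,d,l,d,d,l,d,l,d,d,d,l,d,d,l,d,d,d,l,d,i,l,l,l,d,d,d,l,d,d,l,i,l,l,l,l,l,d,d,d,l,d,l,d,d,l,d,d,d,l,d,d,l,i,l,l,l,l,d,d,d,l,d,d,l,d,d,d,l,d,l,i,l,l,d,d,d,l,d,l,d,i,l,l,l,l,l,l,l]"])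
    (simp_all only: trap_rules mu_rules mu_trap1_rules)

definition mu_trap2 :: "bool list list" where
  "mu_trap2 =
   [[F,F,T,F,T,F,F,T,T,F,F,T,T,F,T,F,F,T,F,T,F,F,T,T],
    [F,F,T,F,T,F,F,T,T,F,T,F,F,T,F,T,F,F,T,T,F,F,T,T],
    [F,F,T,F,T,F,F,T,T,F,T,F,F,T,T,F,F,T,T,F,T,F,F,T],
    [F,F,T,T,F,F,T,T,F,T,F,F,T,F,T,F,F,T,T,F,F,T,T,F],
    [F,F,T,T,F,F,T,T,F,T,F,F,T,F,T,F,F,T,T,F,T,F,F,T],
    [F,F,T,T,F,T,F,F,T,F,T,F,F,T,T,F,F,T,T,F,T,F,F,T],
    [F,F,T,T,F,T,F,F,T,F,T,F,F,T,T,F,T,F,F,T,F,T,F,F],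
    [F,F,T,T,F,T,F,F,T,F,T,F,F,T,T,F,T,F,F,T,T,F,F,T],
    [F,F,T,T,F,T,F,F,T,T,F,F,T,T,F,T,F,F,T,F,T,F,F,T],
    [F,T,F,F,T,F,T,F,F,T,T,F,F,T,T,F,T,F,F,T,F,T,F,F],
    [F,T,F,F,T,F,T,F,F,T,T,F,T,F,F,T,F,T,F,F,T,T,F,F],
    [F,T,F,F,T,F,T,F,F,T,T,F,T,F,F,T,T,F,F,T,T,F,T,F],
    [F,T,F,F,T,T,F,F,T,T,F,T,F,F,T,F,T,F,F,T,T,F,F,T],
    [F,T,F,F,T,T,F,F,T,T,F,T,F,F,T,F,T,F,F,T,T,F,T,F],
    [F,T,F,F,T,T,F,T,F,F,T,F,T,F,F,T,T,F,F,T,T,F,T,F],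
    [F,T,F,F,T,T,F,T,F,F,T,T,F,F,T,T,F,T,F,F,T,F,T,F],
    [F,T,F,T,F,F,T,T,F,F,T,T,F,T,F,F,T,F,T,F,F,T,T,F],
    [F,T,F,T,F,F,T,T,F,T,F,F,T,F,T,F,F,T,T,F,F,T,T,F],
    [F,T,F,T,F,F,T,T,F,T,F,F,T,T,F,F,T,T,F,T,F,F,T,F],
    [F,T,T,F,F,T,T,F,T,F,F,T,F,T,F,F,T,T,F,F,T,T,F,T],
    [F,T,T,F,F,T,T,F,T,F,F,T,F,T,F,F,T,T,F,T,F,F,T,F],
    [F,T,T,F,F,T,T,F,T,F,F,T,F,T,F,F,T,T,F,T,F,F,T,T],
    [F,T,T,F,T,F,F,T,F,T,F,F,T,T,F,F,T,T,F,T,F,F,T,F],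
    [F,T,T,F,T,F,F,T,F,T,F,F,T,T,F,T,F,F,T,F,T,F,F,T],
    [F,T,T,F,T,F,F,T,F,T,F,F,T,T,F,T,F,F,T,T,F,F,T,T],
    [F,T,T,F,T,F,F,T,T,F,F,T,T,F,T,F,F,T,F,T,F,F,T,T],
    [T,F,F,T,F,T,F,F,T,T,F,F,T,T,F,T,F,F,T,F,T,F,F,T],
    [T,F,F,T,F,T,F,F,T,T,F,T,F,F,T,F,T,F,F,T,T,F,F,T],
    [T,F,F,T,F,T,F,F,T,T,F,T,F,F,T,T,F,F,T,T,F,T,F,F],
    [T,F,F,T,T,F,F,T,T,F,T,F,F,T,F,T,F,F,T,T,F,F,T,T],
    [T,F,F,T,T,F,F,T,T,F,T,F,F,T,F,T,F,F,T,T,F,T,F,F],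
    [T,F,F,T,T,F,T,F,F,T,F,T,F,F,T,T,F,F,T,T,F,T,F,F],
    [T,F,F,T,T,F,T,F,F,T,F,T,F,F,T,T,F,T,F,F,T,F,T,F],
    [T,F,F,T,T,F,T,F,F,T,F,T,F,F,T,T,F,T,F,F,T,T,F,F],
    [T,F,F,T,T,F,T,F,F,T,T,F,F,T,T,F,T,F,F,T,F,T,F,F],
    [T,F,T,F,F,T,F,T,F,F,T,T,F,F,T,T,F,T,F,F,T,F,T,F],
    [T,F,T,F,F,T,F,T,F,F,T,T,F,T,F,F,T,F,T,F,F,T,T,F],
    [T,F,T,F,F,T,F,T,F,F,T,T,F,T,F,F,T,T,F,F,T,T,F,T],
    [T,F,T,F,F,T,T,F,F,T,T,F,T,F,F,T,F,T,F,F,T,T,F,F],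
    [T,F,T,F,F,T,T,F,F,T,T,F,T,F,F,T,F,T,F,F,T,T,F,T],
    [T,F,T,F,F,T,T,F,T,F,F,T,F,T,F,F,T,T,F,F,T,T,F,T],
    [T,F,T,F,F,T,T,F,T,F,F,T,T,F,F,T,T,F,T,F,F,T,F,T],
    [T,T,F,F,T,T,F,T,F,F,T,F,T,F,F,T,T,F,F,T,T,F,T,F],
    [T,T,F,F,T,T,F,T,F,F,T,F,T,F,F,T,T,F,T,F,F,T,F,T],
    [T,T,F,F,T,T,F,T,F,F,T,F,T,F,F,T,T,F,T,F,F,T,T,F],
    [T,T,F,T,F,F,T,F,T,F,F,T,T,F,F,T,T,F,T,F,F,T,F,T],
    [T,T,F,T,F,F,T,F,T,F,F,T,T,F,T,F,F,T,F,T,F,F,T,T],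
    [T,T,F,T,F,F,T,F,T,F,F,T,T,F,T,F,F,T,T,F,F,T,T,F],
    [T,T,F,T,F,F,T,T,F,F,T,T,F,T,F,F,T,F,T,F,F,T,T,F]]"

lemmas mu_trap2_rules = members[OF mu_trap2_def, unfolded list.pred_inject simp_thms]

text \<open>Windows that begin with 10101 count as lost because this trap is only applied where that
  factor is absent. Reversal interchanges both the two lists and the order, so it yields nothing
  new; the opposite order has a trap of its own, the next one.\<close>

lemma mu_trap2_trap: "trap 24 (\<lambda>w. avoided 13 5 18 w \<or> begins [T,F,T,F,T] w) mu_trap2 [[T,T,F,T], [F,T,F,F,T,T]] [[T,F,T,T], [T,T,F,F,T,F]]"
  by (rule trapI[OF mu_trap2_def, where ss = "[d,d,d,l,d,d,l,d,d,d,l,d,d,l,d,l,d,d,d,l,d,l,d,d,d,l,d,d,l,i,l,l,l,l,l,l,l,d,d,d,l,d,l,d,d,d,l,d,d,l,d,l,d,d,l,d,d,l,l,l,l,l,l,l,d,d,l,l,l,l,d,d,d,l,d,d,l,d,d,d,l,d,d,l,d,l,d,d,d,l,d,d,l,i,d,i,l,l,l,l,l,d,d,d,l,d,d,l,d,d,d,l,d,d,l,i,l,l,l,l,d,d,l,l,l,l,l,l,l,d,d,d,l,d,l,d,d,d,l,d,l,d,d,l,d,d,d,l,d,l,d,d,l,d,d,l,l,l,l,l,l,l,d,d,l,l,l,l,l,l,l,d,l,d,d,d,l,d,d,l,d,l,d,d,d,l,d,d,l,d,d,d,l,d,d,l,d,l,i,l,l,l,d,d,d,l,d,d,l,d,d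,i,l,d,i,l,l,l,l,l,l,l,l,d,d,d,l,d,d,l,d,d,d,l,d,d,l,d,l,d,d,d,l,d,l,d,i,l,l,l,l,l,l,d,d,d,l,d,d,l,d,l,d,d,l,d,d,l,l,l,l,l,l,l,d,d,l,l,l,l]"])
    (simp_all only: trap_rules mu_rules mu_trap2_rules)

definition mu_trap3 :: "bool list list" where
  "mu_trap3 =
   [[F,F,T,F,T,F,F,T,F,T],
    [F,F,T,F,T,T,F,F,T,F],
    [F,F,T,F,T,T,F,F,T,T],
    [F,F,T,T,F,F,T,F,T,F],
    [F,F,T,T,F,F,T,F,T,T],
    [F,T,F,F,T,F,T,T,F,F],
    [F,T,F,T,F,F,T,F,T,T],
    [F,T,F,T,T,F,F,T,F,T],
    [F,T,F,T,T,F,F,T,T,F],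
    [F,T,T,F,F,T,F,T,F,F],
    [F,T,T,F,F,T,F,T,T,F],
    [F,T,T,F,F,T,T,F,F,T],
    [T,F,F,T,F,T,F,F,T,F],
    [T,F,F,T,F,T,T,F,F,T],
    [T,F,F,T,T,F,F,T,F,T],
    [T,F,T,F,F,T,F,T,T,F],
    [T,F,T,T,F,F,T,F,T,F],
    [T,F,T,T,F,F,T,F,T,T],
    [T,F,T,T,F,F,T,T,F,F],
    [T,T,F,F,T,F,T,F,F,T],
    [T,T,F,F,T,F,T,T,F,F],
    [T,T,F,F,T,T,F,F,T,F]]"

lemmas mu_trap3_rules = members[OF mu_trap3_def, unfolded list.pred_inject simp_thms]

lemma mu_trap3_trap: "trap 10 (\<lambda>w. avoided 13 5 18 w \<or> begins [T,F,T,F,T] w) mu_trap3 [[T,F,T,T], [T,T,F,F,T,F]] [[T,T,F,T], [F,T,F,F,T,T]]"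
  by (rule trapI[OF mu_trap3_def, where ss = "[d,d,d,l,d,d,l,d,i,l,d,d,i,i,l,l,l,d,d,d,l,d,l,i,d,d,i,l,l,l]"])
    (simp_all only: trap_rules mu_rules mu_trap3_rules)

definition nu_trap1 :: "bool list list" where
  "nu_trap1 =
   [[F,F,T,F,F,T,T,F,F,T,F,T,T,F,F,T,F,F,T,T,F,F,T,F],
    [F,F,T,F,F,T,T,F,F,T,F,T,T,F,F,T,F,F,T,T,F,F,T,T],
    [F,F,T,F,F,T,T,F,F,T,F,T,T,F,F,T,T,F,F,T,F,F,T,T],
    [F,F,T,F,F,T,T,F,F,T,F,T,T,F,F,T,T,F,F,T,F,T,T,F],
    [F,F,T,F,F,T,T,F,F,T,T,F,T,F,F,T,T,F,F,T,F,F,T,T],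
    [F,F,T,F,F,T,T,F,T,F,F,T,T,F,F,T,F,F,T,T,F,F,T,T],
    [F,F,T,F,F,T,T,F,T,F,F,T,T,F,F,T,T,F,T,F,F,T,T,F],
    [F,F,T,F,T,T,F,F,T,F,F,T,T,F,F,T,F,T,T,F,F,T,T,F],
    [F,F,T,F,T,T,F,F,T,F,F,T,T,F,F,T,T,F,T,F,F,T,T,F],
    [F,F,T,F,T,T,F,F,T,T,F,F,T,F,F,T,T,F,F,T,F,T,T,F],
    [F,F,T,F,T,T,F,F,T,T,F,F,T,F,F,T,T,F,T,F,F,T,T,F],
    [F,F,T,F,T,T,F,F,T,T,F,F,T,F,T,T,F,F,T,F,F,T,T,F],
    [F,F,T,T,F,F,T,F,F,T,T,F,F,T,F,T,T,F,F,T,F,F,T,T],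
    [F,F,T,T,F,F,T,F,F,T,T,F,F,T,F,T,T,F,F,T,T,F,F,T],
    [F,F,T,T,F,F,T,F,F,T,T,F,F,T,T,F,T,F,F,T,T,F,F,T],
    [F,F,T,T,F,F,T,F,F,T,T,F,T,F,F,T,T,F,F,T,F,F,T,T],
    [F,F,T,T,F,F,T,F,F,T,T,F,T,F,F,T,T,F,F,T,T,F,T,F],
    [F,F,T,T,F,F,T,F,T,T,F,F,T,F,F,T,T,F,F,T,F,T,T,F],
    [F,F,T,T,F,F,T,F,T,T,F,F,T,F,F,T,T,F,F,T,T,F,T,F],
    [F,F,T,T,F,F,T,F,T,T,F,F,T,T,F,F,T,F,F,T,T,F,F,T],
    [F,F,T,T,F,F,T,F,T,T,F,F,T,T,F,F,T,F,F,T,T,F,T,F],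
    [F,F,T,T,F,F,T,F,T,T,F,F,T,T,F,F,T,F,T,T,F,F,T,F],
    [F,F,T,T,F,F,T,T,F,T,F,F,T,T,F,F,T,F,F,T,T,F,F,T],
    [F,F,T,T,F,F,T,T,F,T,F,F,T,T,F,F,T,F,F,T,T,F,T,F],
    [F,F,T,T,F,T,F,F,T,T,F,F,T,F,F,T,T,F,F,T,T,F,T,F],
    [F,F,T,T,F,T,F,F,T,T,F,F,T,F,F,T,T,F,T,F,F,T,T,F],
    [F,F,T,T,F,T,F,F,T,T,F,F,T,T,F,T,F,F,T,T,F,F,T,F],
    [F,T,F,F,T,T,F,F,T,F,F,T,T,F,F,T,T,F,T,F,F,T,T,F],
    [F,T,F,F,T,T,F,F,T,F,F,T,T,F,T,F,F,T,T,F,F,T,F,F],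
    [F,T,F,F,T,T,F,F,T,F,F,T,T,F,T,F,F,T,T,F,F,T,T,F],
    [F,T,F,F,T,T,F,F,T,F,T,T,F,F,T,F,F,T,T,F,F,T,F,T],
    [F,T,F,F,T,T,F,F,T,F,T,T,F,F,T,F,F,T,T,F,F,T,T,F],
    [F,T,F,F,T,T,F,F,T,F,T,T,F,F,T,T,F,F,T,F,F,T,T,F],
    [F,T,F,F,T,T,F,F,T,F,T,T,F,F,T,T,F,F,T,F,T,T,F,F],
    [F,T,F,F,T,T,F,F,T,T,F,T,F,F,T,T,F,F,T,F,F,T,T,F],
    [F,T,F,F,T,T,F,T,F,F,T,T,F,F,T,F,F,T,T,F,F,T,T,F],
    [F,T,F,F,T,T,F,T,F,F,T,T,F,F,T,T,F,T,F,F,T,T,F,F],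
    [F,T,F,T,T,F,F,T,F,F,T,T,F,F,T,F,T,T,F,F,T,T,F,F],
    [F,T,F,T,T,F,F,T,F,F,T,T,F,F,T,T,F,T,F,F,T,T,F,F],
    [F,T,F,T,T,F,F,T,T,F,F,T,F,F,T,T,F,F,T,F,T,T,F,F],
    [F,T,F,T,T,F,F,T,T,F,F,T,F,F,T,T,F,T,F,F,T,T,F,F],
    [F,T,F,T,T,F,F,T,T,F,F,T,F,T,T,F,F,T,F,F,T,T,F,F],
    [F,T,T,F,F,T,F,F,T,T,F,F,T,F,T,T,F,F,T,F,F,T,T,F],
    [F,T,T,F,F,T,F,F,T,T,F,F,T,F,T,T,F,F,T,T,F,F,T,F],
    [F,T,T,F,F,T,F,F,T,T,F,F,T,T,F,T,F,F,T,T,F,F,T,F],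
    [F,T,T,F,F,T,F,F,T,T,F,T,F,F,T,T,F,F,T,F,F,T,T,F],
    [F,T,T,F,F,T,F,F,T,T,F,T,F,F,T,T,F,F,T,T,F,T,F,F],
    [F,T,T,F,F,T,F,T,T,F,F,T,F,F,T,T,F,F,T,F,T,T,F,F],
    [F,T,T,F,F,T,F,T,T,F,F,T,F,F,T,T,F,F,T,T,F,T,F,F],
    [F,T,T,F,F,T,F,T,T,F,F,T,T,F,F,T,F,F,T,T,F,F,T,F],
    [F,T,T,F,F,T,F,T,T,F,F,T,T,F,F,T,F,F,T,T,F,T,F,F],
    [F,T,T,F,F,T,F,T,T,F,F,T,T,F,F,T,F,T,T,F,F,T,F,F],
    [F,T,T,F,F,T,T,F,F,T,F,F,T,T,F,F,T,F,T,T,F,F,T,F],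
    [F,T,T,F,F,T,T,F,F,T,F,F,T,T,F,F,T,F,T,T,F,F,T,T],
    [F,T,T,F,F,T,T,F,F,T,F,F,T,T,F,T,F,F,T,T,F,F,T,F],
    [F,T,T,F,F,T,T,F,F,T,F,F,T,T,F,T,F,F,T,T,F,F,T,T],
    [F,T,T,F,F,T,T,F,F,T,F,T,T,F,F,T,F,F,T,T,F,F,T,F],
    [F,T,T,F,F,T,T,F,F,T,F,T,T,F,F,T,F,F,T,T,F,F,T,T],
    [F,T,T,F,F,T,T,F,T,F,F,T,T,F,F,T,F,F,T,T,F,F,T,T],
    [F,T,T,F,F,T,T,F,T,F,F,T,T,F,F,T,F,F,T,T,F,T,F,F],
    [F,T,T,F,T,F,F,T,T,F,F,T,F,F,T,T,F,F,T,T,F,T,F,F],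
    [F,T,T,F,T,F,F,T,T,F,F,T,F,F,T,T,F,T,F,F,T,T,F,F],
    [F,T,T,F,T,F,F,T,T,F,F,T,T,F,T,F,F,T,T,F,F,T,F,F],
    [T,F,F,T,F,F,T,T,F,F,T,F,T,T,F,F,T,F,F,T,T,F,F,T],
    [T,F,F,T,F,F,T,T,F,F,T,F,T,T,F,F,T,T,F,F,T,F,F,T],
    [T,F,F,T,F,F,T,T,F,F,T,F,T,T,F,F,T,T,F,F,T,F,T,T],
    [T,F,F,T,F,F,T,T,F,F,T,T,F,T,F,F,T,T,F,F,T,F,F,T],
    [T,F,F,T,F,F,T,T,F,T,F,F,T,T,F,F,T,F,F,T,T,F,F,T],
    [T,F,F,T,F,F,T,T,F,T,F,F,T,T,F,F,T,T,F,T,F,F,T,T],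
    [T,F,F,T,F,T,T,F,F,T,F,F,T,T,F,F,T,F,T,T,F,F,T,T],
    [T,F,F,T,F,T,T,F,F,T,F,F,T,T,F,F,T,T,F,T,F,F,T,T],
    [T,F,F,T,F,T,T,F,F,T,T,F,F,T,F,F,T,T,F,F,T,F,T,T],
    [T,F,F,T,F,T,T,F,F,T,T,F,F,T,F,F,T,T,F,T,F,F,T,T],
    [T,F,F,T,F,T,T,F,F,T,T,F,F,T,F,T,T,F,F,T,F,F,T,T],
    [T,F,F,T,T,F,F,T,F,F,T,T,F,F,T,F,T,T,F,F,T,F,F,T],
    [T,F,F,T,T,F,F,T,F,F,T,T,F,F,T,F,T,T,F,F,T,T,F,F],
    [T,F,F,T,T,F,F,T,F,F,T,T,F,F,T,T,F,T,F,F,T,T,F,F],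
    [T,F,F,T,T,F,F,T,F,F,T,T,F,T,F,F,T,T,F,F,T,F,F,T],
    [T,F,F,T,T,F,F,T,F,F,T,T,F,T,F,F,T,T,F,F,T,T,F,T],
    [T,F,F,T,T,F,F,T,F,T,T,F,F,T,F,F,T,T,F,F,T,F,T,T],
    [T,F,F,T,T,F,F,T,F,T,T,F,F,T,F,F,T,T,F,F,T,T,F,T],
    [T,F,F,T,T,F,F,T,F,T,T,F,F,T,T,F,F,T,F,F,T,T,F,F],
    [T,F,F,T,T,F,F,T,F,T,T,F,F,T,T,F,F,T,F,F,T,T,F,T],
    [T,F,F,T,T,F,F,T,F,T,T,F,F,T,T,F,F,T,F,T,T,F,F,T],
    [T,F,F,T,T,F,F,T,T,F,T,F,F,T,T,F,F,T,F,F,T,T,F,F],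
    [T,F,F,T,T,F,F,T,T,F,T,F,F,T,T,F,F,T,F,F,T,T,F,T],
    [T,F,F,T,T,F,T,F,F,T,T,F,F,T,F,F,T,T,F,F,T,T,F,T],
    [T,F,F,T,T,F,T,F,F,T,T,F,F,T,F,F,T,T,F,T,F,F,T,T],
    [T,F,F,T,T,F,T,F,F,T,T,F,F,T,T,F,T,F,F,T,T,F,F,T],
    [T,F,T,F,F,T,T,F,F,T,F,F,T,T,F,F,T,T,F,T,F,F,T,T],
    [T,F,T,F,F,T,T,F,F,T,F,F,T,T,F,T,F,F,T,T,F,F,T,F],
    [T,F,T,F,F,T,T,F,F,T,F,F,T,T,F,T,F,F,T,T,F,F,T,T],
    [T,F,T,F,F,T,T,F,F,T,T,F,T,F,F,T,T,F,F,T,F,F,T,T],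
    [T,F,T,T,F,F,T,F,F,T,T,F,F,T,F,T,T,F,F,T,T,F,F,T],
    [T,F,T,T,F,F,T,F,F,T,T,F,F,T,T,F,T,F,F,T,T,F,F,T],
    [T,F,T,T,F,F,T,T,F,F,T,F,F,T,T,F,F,T,F,T,T,F,F,T],
    [T,F,T,T,F,F,T,T,F,F,T,F,F,T,T,F,T,F,F,T,T,F,F,T],
    [T,F,T,T,F,F,T,T,F,F,T,F,T,T,F,F,T,F,F,T,T,F,F,T],
    [T,T,F,F,T,F,F,T,T,F,F,T,F,T,T,F,F,T,F,F,T,T,F,F],
    [T,T,F,F,T,F,F,T,T,F,F,T,F,T,T,F,F,T,T,F,F,T,F,F],
    [T,T,F,F,T,F,F,T,T,F,F,T,F,T,T,F,F,T,T,F,F,T,F,T],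
    [T,T,F,F,T,F,F,T,T,F,F,T,T,F,T,F,F,T,T,F,F,T,F,F],
    [T,T,F,F,T,F,F,T,T,F,T,F,F,T,T,F,F,T,F,F,T,T,F,F],
    [T,T,F,F,T,F,F,T,T,F,T,F,F,T,T,F,F,T,T,F,T,F,F,T],
    [T,T,F,F,T,F,T,T,F,F,T,F,F,T,T,F,F,T,F,T,T,F,F,T],
    [T,T,F,F,T,F,T,T,F,F,T,F,F,T,T,F,F,T,T,F,T,F,F,T],
    [T,T,F,F,T,F,T,T,F,F,T,T,F,F,T,F,F,T,T,F,F,T,F,T],
    [T,T,F,F,T,F,T,T,F,F,T,T,F,F,T,F,F,T,T,F,T,F,F,T],
    [T,T,F,F,T,F,T,T,F,F,T,T,F,F,T,F,T,T,F,F,T,F,F,T],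
    [T,T,F,F,T,T,F,F,T,F,F,T,T,F,F,T,F,T,T,F,F,T,F,F],
    [T,T,F,F,T,T,F,F,T,F,F,T,T,F,F,T,F,T,T,F,F,T,T,F],
    [T,T,F,F,T,T,F,F,T,F,F,T,T,F,T,F,F,T,T,F,F,T,F,F],
    [T,T,F,F,T,T,F,F,T,F,F,T,T,F,T,F,F,T,T,F,F,T,T,F],
    [T,T,F,F,T,T,F,F,T,F,T,T,F,F,T,F,F,T,T,F,F,T,F,T],
    [T,T,F,F,T,T,F,F,T,F,T,T,F,F,T,F,F,T,T,F,F,T,T,F],
    [T,T,F,F,T,T,F,T,F,F,T,T,F,F,T,F,F,T,T,F,F,T,T,F],
    [T,T,F,F,T,T,F,T,F,F,T,T,F,F,T,F,F,T,T,F,T,F,F,T],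
    [T,T,F,T,F,F,T,T,F,F,T,F,F,T,T,F,F,T,T,F,T,F,F,T],
    [T,T,F,T,F,F,T,T,F,F,T,F,F,T,T,F,T,F,F,T,T,F,F,T],
    [T,T,F,T,F,F,T,T,F,F,T,T,F,T,F,F,T,T,F,F,T,F,F,T]]"

lemmas nu_trap1_rules = members[OF nu_trap1_def, unfolded list.pred_inject simp_thms]

text \<open>The words 11011 and 00100 are complementary; since they cannot both occur in an
  irreducible candidate, passing to the complement removes 11011 if necessary.\<close>

lemma nu_trap1_trap: "trap 24 (\<lambda>w. avoided 28 11 20 w) nu_trap1 [[F,F,T,F,F]] [[T,T,F,T,T]]"
  by (rule trapI[OF nu_trap1_def, where ss = "[d,l,d,l,d,d,d,l,d,d,l,d,l,d,d,d,l,d,d,d,l,d,l,d,d,d,l,d,i,i,l,l,l,d,d,d,l,d,d,d,l,d,l,i,d,l,d,i,l,l,l,l,l,l,d,d,l,d,d,d,l,d,l,d,d,d,l,d,d,d,l,d,l,i,l,l,l,l,l,l,l,d,d,d,l,d,l,d,d,d,l,d,d,d,l,d,l,d,d,d,l,d,l,i,l,l,l,d,d,l,d,d,d,l,d,l,d,i,l,l,l,l,l,l,l,l,l]"])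
    (simp_all only: trap_rules nu_rules nu_trap1_rules)

definition nu_trap2 :: "bool list list" where
  "nu_trap2 =
   [[F,F,T,F,F,T,T,F,F,T,F,T,T,F,F,T],
    [F,F,T,F,T,T,F,F,T,F,F,T,T,F,F,T],
    [F,F,T,F,T,T,F,F,T,T,F,F,T,F,F,T],
    [F,F,T,F,T,T,F,F,T,T,F,F,T,F,T,T],
    [F,F,T,T,F,F,T,F,F,T,T,F,F,T,F,T],
    [F,F,T,T,F,F,T,F,T,T,F,F,T,F,F,T],
    [F,F,T,T,F,F,T,F,T,T,F,F,T,T,F,F],
    [F,T,F,F,T,T,F,F,T,F,T,T,F,F,T,F],
    [F,T,F,F,T,T,F,F,T,F,T,T,F,F,T,T],
    [F,T,F,T,T,F,F,T,F,F,T,T,F,F,T,F],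
    [F,T,F,T,T,F,F,T,T,F,F,T,F,F,T,T],
    [F,T,F,T,T,F,F,T,T,F,F,T,F,T,T,F],
    [F,T,T,F,F,T,F,F,T,T,F,F,T,F,T,T],
    [F,T,T,F,F,T,F,T,T,F,F,T,F,F,T,T],
    [F,T,T,F,F,T,F,T,T,F,F,T,T,F,F,T],
    [F,T,T,F,F,T,T,F,F,T,F,F,T,T,F,F],
    [F,T,T,F,F,T,T,F,F,T,F,T,T,F,F,T],
    [T,F,F,T,F,F,T,T,F,F,T,F,T,T,F,F],
    [T,F,F,T,F,T,T,F,F,T,F,F,T,T,F,F],
    [T,F,F,T,F,T,T,F,F,T,T,F,F,T,F,F],
    [T,F,F,T,F,T,T,F,F,T,T,F,F,T,F,T],
    [T,F,F,T,T,F,F,T,F,F,T,T,F,F,T,F],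
    [T,F,F,T,T,F,F,T,F,T,T,F,F,T,F,F],
    [T,F,F,T,T,F,F,T,F,T,T,F,F,T,T,F],
    [T,F,T,T,F,F,T,F,F,T,T,F,F,T,F,T],
    [T,F,T,T,F,F,T,F,T,T,F,F,T,T,F,F],
    [T,F,T,T,F,F,T,T,F,F,T,F,F,T,T,F],
    [T,F,T,T,F,F,T,T,F,F,T,F,T,T,F,F],
    [T,T,F,F,T,F,F,T,T,F,F,T,F,T,T,F],
    [T,T,F,F,T,F,T,T,F,F,T,F,F,T,T,F],
    [T,T,F,F,T,F,T,T,F,F,T,T,F,F,T,F],
    [T,T,F,F,T,T,F,F,T,F,F,T,T,F,F,T],
    [T,T,F,F,T,T,F,F,T,F,T,T,F,F,T,F],
    [T,T,F,F,T,T,F,F,T,F,T,T,F,F,T,T]]"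

lemmas nu_trap2_rules = members[OF nu_trap2_def, unfolded list.pred_inject simp_thms]

text \<open>This excludes one order of the two lists. Irreducibility realizes it, because any factor
  is then followed by any other.\<close>

lemma nu_trap2_trap: "trap 16 (\<lambda>w. avoided 28 11 20 w \<or> begins [T,T,F,T,T] w) nu_trap2 [[F,T,F,T], [T,F,T,T], [T,T,F,F,T,T,F,F]] [[T,F,T,F], [T,T,F,T], [F,F,T,T,F,F,T,T]]"
  by (rule trapI[OF nu_trap2_def, where ss = "[d,d,l,d,l,d,d,d,l,d,d,d,l,d,l,d,d,i,i,l,l,d,d,l,d,d,d,l,i,l,l,l,d,l,l,l,l,d,d,d,l,d,l,d,d,d,l,d,d,d,l,d,l,d,i,l,l,d,d,l,d,d,i,l,l,l,d,l,l,l,l,l,d,d,l,d,d,d,l,d,l,d,d,i,i,l,l,l,l]"])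
    (simp_all only: trap_rules nu_rules nu_trap2_rules)

end

section \<open>Classification of the candidates\<close>

text \<open>What a bi-infinite word guarantees without recurrence: a common factor, with the two
  occurrences in unknown order and possibly overlapping.\<close>

definition joint :: "'a list set \<Rightarrow> bool" where
  "joint L \<longleftrightarrow> (\<forall>u \<in> L. \<forall>v \<in> L. \<exists>w \<in> L. (\<exists>a b. w = a @ u @ b) \<and> (\<exists>a b. w = a @ v @ b))"

text \<open>What recurrence adds: the order can be prescribed, and the occurrences do not
  overlap.\<close>

definition irreducible_language :: "'a list set \<Rightarrow> bool" where
  "irreducible_language L \<longleftrightarrow> (\<forall>u \<in> L. \<forall>v \<in> L. \<exists>z. u @ z @ v \<in> L)"

lemma joint_map: "joint L \<Longrightarrow> joint (map f ` L)"
  unfolding joint_def by (simp add: image_iff) (metis map_append)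

lemma irreducible_map: "irreducible_language L \<Longrightarrow> irreducible_language (map f ` L)"
  unfolding irreducible_language_def by (simp add: image_iff) (metis map_append)

text \<open>A trap compares two occurrences by their right ends, so this is the case distinction
  that it needs.\<close>

lemma end_order:
  assumes "x @ a @ x' = y @ b @ y'"
  shows "(\<exists>t. x @ a @ t = y @ b) \<or> (\<exists>t. y @ b @ t = x @ a)"
proof (cases "length (x @ a) \<le> length (y @ b)")
  case True
  then show ?thesis using append_eq_prefix[of "y @ b" y' "x @ a" x'] assms by auto
next
  case False
  then show ?thesis using append_eq_prefix[of "x @ a" x' "y @ b" y'] assms by auto
qed

lemma mem_rev_image: "v \<in> rev ` L \<longleftrightarrow> rev v \<in> L"
  by (metis image_iff rev_rev_ident)

lemma mem_Not_image: "v \<in> map Not ` L \<longleftrightarrow> map Not v \<in> L"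
  by (metis image_iff map_Not_Not)

lemma rev_rev_image: "rev ` rev ` L = L"
  by (simp add: image_image)

lemma Not_Not_image: "map Not ` map Not ` L = L"
  unfolding image_image by (simp only: map_Not_Not) simp

lemma candidates_avoided: "L \<in> candidates num den N \<Longrightarrow> avoided num den N w \<Longrightarrow> w \<notin> L"
  by (simp add: avoided_def)

lemma candidates_restricted:
  "L \<in> candidates num den N \<Longrightarrow> list_all (\<lambda>f. f \<notin> L) F \<Longrightarrow> restricted F num den L"
  by (simp add: candidates_def restricted_def list_all_iff)

lemma candidates_begins:
  "L \<in> candidates num den N \<Longrightarrow> w \<in> L \<Longrightarrow> v \<notin> L \<Longrightarrow> \<not> (avoided num den N w \<or> begins v w)"
  unfolding candidates_def begins_iff
  by (auto simp: avoided_def candidates_def dest: bi_extendable_prefix)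

lemma mu_avoided:
  assumes "L \<in> candidates 13 5 18"
  shows "[False, False, False] \<notin> L" "[True, True, True] \<notin> L" "[False, False, True, False, False] \<notin> L"
  by (rule candidates_avoided[OF assms], simp only: mu_rules)+

lemma nu_avoided:
  assumes "L \<in> candidates 28 11 20"
  shows "[False, False, False] \<notin> L" "[True, True, True] \<notin> L"
    "[False, True, False, False, True, False] \<notin> L"
  by (rule candidates_avoided[OF assms], simp only: nu_rules)+

lemma mu_split:
  assumes L: "L \<in> candidates 13 5 18" "joint L"
  shows "[True, False, True, False, True] \<notin> L \<or> [False, True, False, True, False] \<notin> L"
proof (rule ccontr)
  let ?a = "[True, False, True, False, True]" and ?b = "[False, True, False, True, False]"
  assume "\<not> ?thesis"
  then obtain w x x' y y' where w: "w \<in> L" "w = x @ ?a @ x'" "w = y @ ?b @ y'"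
    using L(2) unfolding joint_def by blast
  have trap: "z @ ?b @ r \<notin> K" if "K \<in> candidates 13 5 18" "u @ ?a @ t = z @ ?b" for K z r u t
    using trap_separates[OF mu_trap1_trap, of K ?a ?b u t z r] that candidates_avoided[OF that(1)]
    by (auto simp: candidates_def)
  consider t where "x @ ?a @ t = y @ ?b" | t where "y @ ?b @ t = x @ ?a"
    using end_order[of x ?a x' y ?b y'] w(2,3) by metis
  then show False
  proof cases
    case 1
    then show False using trap[OF L(1) 1, of y'] w by simp
  next
    case 2
    have "map Not y @ ?a @ map Not t = map Not x @ ?b" using arg_cong[OF 2, of "map Not"] by simp
    then have "map Not x @ ?b @ map Not x' \<notin> map Not ` L" using trap candidates_map_Not[OF L(1)] by blast
    moreover have "map Not w \<in> map Not ` L" using w(1) by blast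
    ultimately show False using w(2) by simp
  qed
qed

lemma mu_core:
  assumes L: "L \<in> candidates 13 5 18" "joint L" and no: "[True, False, True, False, True] \<notin> L"
  shows "L = factors (morph_word mu p) \<or> L = rev ` factors (morph_word mu p)"
proof -
  have ext: "bi_extendable L" using L(1) by (simp add: candidates_def)
  let ?A = "[[True, True, False, True], [False, True, False, False, True, True]]"
  let ?B = "[[True, False, True, True], [True, True, False, False, True, False]]"
  have bad: "\<not> (avoided 13 5 18 w \<or> begins [True, False, True, False, True] w)" if "w \<in> L" for w
    using candidates_begins[OF L(1) that no] .
  have "\<not> (a \<in> L \<and> b \<in> L)" if "a \<in> set ?A" "b \<in> set ?B" for a b
  proof
    assume "a \<in> L \<and> b \<in> L"
    then obtain w x x' y y' where w: "w \<in> L" "w = x @ a @ x'" "w = y @ b @ y'"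
      using L(2) unfolding joint_def by blast
    consider t where "x @ a @ t = y @ b" | t where "y @ b @ t = x @ a"
      using end_order[of x a x' y b y'] w(2,3) by metis
    then show False
    proof cases
      case 1
      then show False
        using trap_separates[OF mu_trap3_trap ext bad that(1) that(2) 1, of y'] w by simp
    next
      case 2
      then show False
        using trap_separates[OF mu_trap2_trap ext bad that(2) that(1) 2, of x'] w by simp
    qed
  qed
  \<comment> \<open>Every word of one list excludes every word of the other, so one of the lists is
    missing as a whole.\<close>
  then consider "\<forall>a \<in> set ?A. a \<notin> L" | "\<forall>b \<in> set ?B. b \<notin> L" by blast
  then show ?thesis
  proof cases
    case 1
    then have "restricted mu_forbidden 13 5 L"
      using no mu_avoided[OF L(1)]
      by (intro candidates_restricted[OF L(1)]) (simp add: mu_forbidden_def)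
    then show ?thesis using mu_characterization by blast
  next
    case 2
    \<comment> \<open>Reversal turns \<open>?B\<close> into \<open>?A\<close>, and the other entries
      of \<open>mu_forbidden\<close> are palindromes.\<close>
    then have "restricted mu_forbidden 13 5 (rev ` L)"
      using no mu_avoided[OF L(1)]
      by (intro candidates_restricted[OF candidates_rev[OF L(1)]]) (simp add: mu_forbidden_def mem_rev_image)
    then have "rev ` L = factors (morph_word mu p)" by (rule mu_characterization)
    then show ?thesis using rev_rev_image[of L] by simp
  qed
qed

theorem mu_classification:
  assumes L: "L \<in> candidates 13 5 18" "joint L"
  defines "M \<equiv> factors (morph_word mu p)"
  shows "L \<in> {M, map Not ` M, rev ` M, rev ` map Not ` M}"
proof (cases "[True, False, True, False, True] \<in> L")
  case False
  then show ?thesis using mu_core[OF L] unfolding M_def by blast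
next
  case True
  \<comment> \<open>The complement contains 10101 only if \<open>L\<close> contains 01010.\<close>
  then have "[True, False, True, False, True] \<notin> map Not ` L"
    using mu_split[OF L] by (simp add: mem_Not_image)
  then have "map Not ` L = M \<or> map Not ` L = rev ` M"
    using mu_core[OF candidates_map_Not[OF L(1)] joint_map[OF L(2)]] unfolding M_def by blast
  then have "L = map Not ` M \<or> L = map Not ` rev ` M" using Not_Not_image by metis
  moreover have "map Not ` rev ` M = rev ` map Not ` M" by (simp add: image_image rev_map)
  ultimately show ?thesis by auto
qed

lemma nu_split:
  assumes L: "L \<in> candidates 28 11 20" "irreducible_language L"
  shows "[True, True, False, True, True] \<notin> L \<or> [False, False, True, False, False] \<notin> L"
proof (rule ccontr)
  let ?a = "[True, True, False, True, True]" and ?b = "[False, False, True, False, False]"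
  assume "\<not> ?thesis"
  then obtain z where z: "?a @ z @ ?b \<in> L" using L(2) unfolding irreducible_language_def by blast
  show False
    using trap_separates[OF nu_trap1_trap, of L ?a ?b "[]" "z @ ?b" "?a @ z" "[]"] z
      candidates_avoided[OF L(1)] L(1) by (auto simp: candidates_def)
qed

text \<open>Irreducibility puts any word of \<open>?A\<close> before any word of \<open>?B\<close>,
  which the trap forbids; so one of the lists is missing, and the lists are reversals of each
  other.\<close>

lemma nu_core:
  assumes L: "L \<in> candidates 28 11 20" "irreducible_language L"
    and no: "[True, True, False, True, True] \<notin> L"
  shows "L = factors (morph_word nu p) \<or> L = rev ` factors (morph_word nu p)"
proof -
  have ext: "bi_extendable L" using L(1) by (simp add: candidates_def)
  let ?B = "[[False, True, False, True], [True, False, True, True],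
    [True, True, False, False, True, True, False, False]]"
  let ?A = "[[True, False, True, False], [True, True, False, True],
    [False, False, True, True, False, False, True, True]]"
  have bad: "\<not> (avoided 28 11 20 w \<or> begins [True, True, False, True, True] w)" if "w \<in> L" for w
    using candidates_begins[OF L(1) that no] .
  have "\<not> (a \<in> L \<and> b \<in> L)" if "a \<in> set ?A" "b \<in> set ?B" for a b
  proof
    assume "a \<in> L \<and> b \<in> L"
    then obtain z where z: "a @ z @ b \<in> L" using L(2) unfolding irreducible_language_def by blast
    have eq: "[] @ a @ (z @ b) = (a @ z) @ b" by simp
    show False
      using trap_separates[OF nu_trap2_trap ext bad that(1) that(2) eq, of "[]"] z by simp
  qed
  then consider "\<forall>b \<in> set ?B. b \<notin> L" | "\<forall>a \<in> set ?A. a \<notin> L" by blast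
  then show ?thesis
  proof cases
    case 1
    then have "restricted nu_forbidden 28 11 L"
      using nu_avoided[OF L(1)]
      by (intro candidates_restricted[OF L(1)]) (simp add: nu_forbidden_def)
    then show ?thesis using nu_characterization by blast
  next
    case 2
    then have "restricted nu_forbidden 28 11 (rev ` L)"
      using nu_avoided[OF candidates_rev[OF L(1)]]
      by (intro candidates_restricted[OF candidates_rev[OF L(1)]]) (simp add: nu_forbidden_def mem_rev_image)
    then have "rev ` L = factors (morph_word nu p)" by (rule nu_characterization)
    then show ?thesis using rev_rev_image[of L] by simp
  qed
qed

theorem nu_classification:
  assumes L: "L \<in> candidates 28 11 20" "irreducible_language L"
  defines "M \<equiv> factors (morph_word nu p)"
  shows "L \<in> {M, map Not ` M, rev ` M, rev ` map Not ` M}"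
proof (cases "[True, True, False, True, True] \<in> L")
  case False
  then show ?thesis using nu_core[OF L] unfolding M_def by blast
next
  case True
  then have "[True, True, False, True, True] \<notin> map Not ` L"
    using nu_split[OF L] by (simp add: mem_Not_image)
  then have "map Not ` L = M \<or> map Not ` L = rev ` M"
    using nu_core[OF candidates_map_Not[OF L(1)] irreducible_map[OF L(2)]] unfolding M_def by blast
  then have "L = map Not ` M \<or> L = map Not ` rev ` M" using Not_Not_image by metis
  moreover have "map Not ` rev ` M = rev ` map Not ` M" by (simp add: image_image rev_map)
  ultimately show ?thesis by auto
qed

subsection \<open>Languages of words\<close>

lemma factors_complement: "factors (complement w) = map Not ` factors w"
proof -
  have "complement w [i \<rightarrow> j] = map Not (w [i \<rightarrow> j])" for i j by (simp add: complement_def subsequence_def)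
  then show ?thesis unfolding factors_def by auto
qed

lemma bi_subword_append: "bi_subword w i (m + n) = bi_subword w i m @ bi_subword w (i + int m) n"
proof (rule nth_equalityI)
  fix k assume "k < length (bi_subword w i (m + n))"
  then show "bi_subword w i (m + n) ! k = (bi_subword w i m @ bi_subword w (i + int m) n) ! k"
    by (auto simp: bi_subword_def nth_append algebra_simps of_nat_diff)
qed (simp add: bi_subword_def)

lemma bi_subword_in_factors: "bi_subword w i n \<in> bi_factors w"
  unfolding bi_factors_def by blast

lemma subsequence_in_factors: "w [i \<rightarrow> j] \<in> factors w"
  unfolding factors_def by blast

lemma length_bi_subword [simp]: "length (bi_subword w i n) = n"
  by (simp add: bi_subword_def)

lemma bi_subword_1: "bi_subword w i 1 = [w i]"
  by (simp add: bi_subword_def)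

lemma bi_subword_split:
  assumes "bi_subword w i n = u @ v"
  shows "u = bi_subword w i (length u)" "v = bi_subword w (i + int (length u)) (length v)"
proof -
  have "length (bi_subword w i n) = length (u @ v)" using assms by (rule arg_cong)
  then have "n = length u + length v" by simp
  then have "u @ v = bi_subword w i (length u) @ bi_subword w (i + int (length u)) (length v)"
    using assms bi_subword_append[of w i "length u" "length v"] by simp
  then show "u = bi_subword w i (length u)" "v = bi_subword w (i + int (length u)) (length v)"
    by (simp_all add: append_eq_append_conv)
qed

lemma bi_factors_bi_extendable: "bi_extendable (bi_factors w)"
  unfolding bi_extendable_def
proof (intro conjI allI impI ballI)
  have "bi_subword w 0 0 = []" by (simp add: bi_subword_def)
  then show "[] \<in> bi_factors w" using bi_subword_in_factors by metis
next
  fix u v z assume "u @ v @ z \<in> bi_factors w"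
  then obtain i n where "bi_subword w i n = u @ v @ z" unfolding bi_factors_def by auto
  then have "v @ z = bi_subword w (i + int (length u)) (length (v @ z))" by (rule bi_subword_split)
  then have "v = bi_subword w (i + int (length u)) (length v)" using bi_subword_split(1) by metis
  then show "v \<in> bi_factors w" unfolding bi_factors_def by blast
next
  fix v assume "v \<in> bi_factors w"
  then obtain i n where v: "v = bi_subword w i n" unfolding bi_factors_def by auto
  have "w (i - 1) # v = bi_subword w (i - 1) (1 + n)"
    unfolding bi_subword_append bi_subword_1 v by simp
  then show "\<exists>a. a # v \<in> bi_factors w" unfolding bi_factors_def by blast
  have "v @ [w (i + int n)] = bi_subword w i (n + 1)"
    unfolding bi_subword_append bi_subword_1 v by simp
  then show "\<exists>a. v @ [a] \<in> bi_factors w" unfolding bi_factors_def by blast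
qed

lemma bi_subword_infix:
  assumes "j \<le> i" "i + int n \<le> j + int m"
  shows "\<exists>a b. bi_subword w j m = a @ bi_subword w i n @ b"
proof -
  define k l where "k = nat (i - j)" and "l = m - (k + n)"
  have "m = k + (n + l)" "i = j + int k" using assms by (auto simp: k_def l_def)
  then show ?thesis using bi_subword_append[of w j k "n + l"] bi_subword_append[of w i n l] by auto
qed

lemma bi_factors_joint: "joint (bi_factors w)"
  unfolding joint_def
proof (intro ballI)
  fix u v assume "u \<in> bi_factors w" "v \<in> bi_factors w"
  then obtain i n k l where u: "u = bi_subword w i n" and v: "v = bi_subword w k l"
    unfolding bi_factors_def by auto
  define j m where "j = min i k" and "m = nat (max (i + int n) (k + int l) - j)"
  have jm: "j \<le> i" "j \<le> k" "j + int m = max (i + int n) (k + int l)"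
    unfolding j_def m_def by auto
  have "\<exists>a b. bi_subword w j m = a @ u @ b" "\<exists>a b. bi_subword w j m = a @ v @ b"
    unfolding u v by (intro bi_subword_infix; simp add: jm)+
  then show "\<exists>w' \<in> bi_factors w. (\<exists>a b. w' = a @ u @ b) \<and> (\<exists>a b. w' = a @ v @ b)"
    unfolding bi_factors_def by blast
qed

text \<open>The occurrences of a factor in a recurrent bi-infinite word may accumulate on one side
  only, and it is not known which.\<close>

lemma infinite_int_unbounded:
  assumes "infinite (I :: int set)"
  shows "(\<forall>b. \<exists>i \<in> I. b \<le> i) \<or> (\<forall>b. \<exists>i \<in> I. i \<le> b)"
proof (rule ccontr)
  assume "\<not> ?thesis"
  then obtain b c where "\<forall>i \<in> I. i < b" "\<forall>i \<in> I. c < i" by (metis not_less)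
  then have "I \<subseteq> {c..b}" by force
  then show False using assms finite_subset by blast
qed

lemma bi_recurrent_irreducible:
  assumes "bi_recurrent w" shows "irreducible_language (bi_factors w)"
  unfolding irreducible_language_def
proof (intro ballI)
  fix u v assume "u \<in> bi_factors w" "v \<in> bi_factors w"
  then obtain i n k l where u: "u = bi_subword w i n" and v: "v = bi_subword w k l"
    unfolding bi_factors_def by auto
  text \<open>A factor containing both \<open>u\<close> and \<open>v\<close> recurs far to the left or far to the right.\<close>
  define j m where "j = min i k" and "m = nat (max (i + int n) (k + int l) - j)"
  let ?c = "bi_subword w j m"
  have jm: "j \<le> i" "j \<le> k" "j + int m = max (i + int n) (k + int l)"
    unfolding j_def m_def by auto
  have uc: "\<exists>a b. ?c = a @ u @ b" and vc: "\<exists>a b. ?c = a @ v @ b"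
    unfolding u v by (intro bi_subword_infix; simp add: jm)+
  have "?c \<in> bi_factors w" unfolding bi_factors_def by blast
  then have inf: "infinite {t. bi_subword w t (length ?c) = ?c}" using assms unfolding bi_recurrent_def by blast
  have occ: "\<exists>s. t \<le> s \<and> s + int (length x) \<le> t + int m \<and> bi_subword w s (length x) = x"
    if tx: "bi_subword w t m = ?c" "\<exists>a b. ?c = a @ x @ b" for t x
  proof -
    obtain a b where ab: "bi_subword w t m = a @ x @ b" using tx by auto
    have "length (bi_subword w t m) = length a + length x + length b" unfolding ab by simp
    moreover have "x @ b = bi_subword w (t + int (length a)) (length (x @ b))" using bi_subword_split(2)[OF ab] .
    then have "x = bi_subword w (t + int (length a)) (length x)" using bi_subword_split(1) by metis
    ultimately show ?thesis by (intro exI[of _ "t + int (length a)"]) simp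
  qed
  have join: "\<exists>z. u @ z @ v \<in> bi_factors w"
    if "bi_subword w s (length u) = u" "bi_subword w t (length v) = v" "s + int (length u) \<le> t" for s t
  proof -
    define d where "d = nat (t - (s + int (length u)))"
    have t: "t = s + int (length u) + int d" using that(3) by (simp add: d_def)
    have "bi_subword w s (length u + (d + length v)) = u @ bi_subword w (s + int (length u)) d @ v"
      unfolding bi_subword_append using that t by simp
    then show ?thesis using bi_subword_in_factors by metis
  qed
  \<comment> \<open>A copy far to the right supplies a \<open>v\<close> behind the given
    \<open>u\<close>, a copy far to the left a \<open>u\<close> before the given
    \<open>v\<close>.\<close>
  from infinite_int_unbounded[OF inf] show "\<exists>z. u @ z @ v \<in> bi_factors w"
  proof
    assume "\<forall>b. \<exists>t \<in> {t. bi_subword w t (length ?c) = ?c}. b \<le> t"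
    then obtain t where t: "bi_subword w t m = ?c" "i + int n \<le> t" by auto
    obtain s where "t \<le> s" "bi_subword w s (length v) = v" using occ[OF t(1) vc] by blast
    then show ?thesis using join[of i s] t(2) u by simp
  next
    assume "\<forall>b. \<exists>t \<in> {t. bi_subword w t (length ?c) = ?c}. t \<le> b"
    then obtain t where t: "bi_subword w t m = ?c" "t \<le> k - int m" by auto
    obtain s where "s + int (length u) \<le> t + int m" "bi_subword w s (length u) = u" using occ[OF t(1) uc] by blast
    then show ?thesis using join[of s k] t(2) v by simp
  qed
qed

lemma recurrent_occurrence:
  assumes "recurrent w" "v \<in> factors w" shows "\<exists>i \<ge> n. w [i \<rightarrow> i + length v] = v"
  using assms unfolding recurrent_def by (metis (mono_tags, lifting) infinite_nat_iff_unbounded_le mem_Collect_eq)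

lemma recurrent_irreducible:
  assumes "recurrent w" shows "irreducible_language (factors w)"
  unfolding irreducible_language_def
proof (intro ballI)
  fix u v assume uv: "u \<in> factors w" "v \<in> factors w"
  obtain i where i: "w [i \<rightarrow> i + length u] = u" using recurrent_occurrence[OF assms uv(1)] by blast
  obtain k where k: "i + length u \<le> k" "w [k \<rightarrow> k + length v] = v"
    using recurrent_occurrence[OF assms uv(2)] by blast
  then obtain d where d: "k = i + length u + d" using le_Suc_ex by blast
  have "[i..<i + length u + (d + length v)] = [i..<i + length u] @ [i + length u..<k] @ [k..<k + length v]"
    using upt_add_eq_append[of i "i + length u" "d + length v"]
      upt_add_eq_append[of "i + length u" k "length v"] d by (simp add: add.assoc)
  then have "w [i \<rightarrow> i + length u + (d + length v)] = u @ w [i + length u \<rightarrow> k] @ v"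
    using i k(2) by (simp add: subsequence_def)
  then show "\<exists>z. u @ z @ v \<in> factors w" using subsequence_in_factors by metis
qed

lemma recurrent_bi_extendable:
  assumes "recurrent w" shows "bi_extendable (factors w)"
  unfolding bi_extendable_def
proof (intro conjI allI impI ballI)
  have "w [0 \<rightarrow> 0] = []" by simp
  then show "[] \<in> factors w" using subsequence_in_factors by metis
next
  fix v assume "v \<in> factors w"
  \<comment> \<open>An occurrence at position 0 has no left neighbour; recurrence provides a later
    one.\<close>
  then obtain i where i: "1 \<le> i" "w [i \<rightarrow> i + length v] = v" using recurrent_occurrence[OF assms] by blast
  then have "[i - 1..<i + length v] = (i - 1) # [i..<i + length v]"
    using upt_conv_Cons[of "i - 1" "i + length v"] by simp
  then have "w [i - 1 \<rightarrow> i + length v] = w (i - 1) # v"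
    using i(2) unfolding subsequence_def by simp
  then show "\<exists>a. a # v \<in> factors w" using subsequence_in_factors by metis
qed (use factors_infix factors_right in blast)+

subsection \<open>Positions of blocks\<close>

text \<open>The position at which the block of the letter number \<open>n\<close> begins. For
  \<open>phi\<close> this is again a position of \<open>p\<close>, because \<open>p\<close> is a
  fixed point.\<close>

definition pos :: "(letter \<Rightarrow> 'b list) \<Rightarrow> nat \<Rightarrow> nat" where
  "pos h n = length (morph h (prefix n p))"

lemma pos_0 [simp]: "pos h 0 = 0"
  by (simp add: pos_def)

lemma pos_Suc: "pos h (Suc n) = pos h n + length (h (p n))"
  by (simp add: pos_def morph_append)

lemma pos_mono: "m \<le> n \<Longrightarrow> pos h m \<le> pos h n"
  by (rule lift_Suc_mono_le) (simp_all add: pos_Suc)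

lemma pos_strict:
  assumes "\<And>a. h a \<noteq> []" shows "m < n \<Longrightarrow> pos h m < pos h n"
  by (rule lift_Suc_mono_less) (simp_all add: pos_Suc assms)

lemma pos_ge: "(\<And>a. h a \<noteq> []) \<Longrightarrow> n \<le> pos h n"
  using length_morph_ge[of h "prefix n p"] by (simp add: pos_def)

lemma block_nth:
  assumes "\<And>a. h a \<noteq> []" "i < length (h (p n))"
  shows "morph_word h p (pos h n + i) = h (p n) ! i"
proof -
  have "morph_word h p (pos h n + i) = morph h (prefix (Suc n) p) ! (pos h n + i)"
    using morph_word_nth[where h = h and m = "Suc n" and w = p and i = "pos h n + i"] assms
    by (simp add: pos_def morph_append)
  also have "\<dots> = h (p n) ! i" by (simp add: pos_def morph_append nth_append)
  finally show ?thesis .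
qed

lemma block_nth_Suc:
  assumes "\<And>a. h a \<noteq> []" "i < length (h (p n) @ h (p (Suc n)))"
  shows "morph_word h p (pos h n + i) = (h (p n) @ h (p (Suc n))) ! i"
proof (cases "i < length (h (p n))")
  case False
  then have "pos h n + i = pos h (Suc n) + (i - length (h (p n)))" by (simp add: pos_Suc)
  then show ?thesis using block_nth[where h = h and i = "i - length (h (p n))" and n = "Suc n"] assms False
    by (simp add: nth_append)
qed (use block_nth[where h = h] assms(1) in \<open>simp add: nth_append\<close>)

lemma block_nth_rev:
  assumes "\<And>a. h a \<noteq> []" "i < length (h (p n))"
  shows "morph_word h p (pos h (Suc n) - Suc i) = rev (h (p n)) ! i"
proof -
  have "pos h (Suc n) - Suc i = pos h n + (length (h (p n)) - Suc i)" using assms(2) by (simp add: pos_Suc)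
  then show ?thesis using block_nth[where h = h and i = "length (h (p n)) - Suc i" and n = n] assms
    by (simp add: rev_nth)
qed

lemma in_block:
  assumes "\<And>a. h a \<noteq> []" shows "\<exists>n i. j = pos h n + i \<and> i < length (h (p n))"
proof -
  define n where "n = (LEAST n. j < pos h (Suc n))"
  have "j < pos h (Suc j)" using pos_ge[of h "Suc j"] assms by (simp add: Suc_le_eq)
  then have n: "j < pos h (Suc n)" unfolding n_def by (rule LeastI)
  have "pos h n \<le> j"
  proof (cases n)
    case (Suc m)
    then have "\<not> j < pos h (Suc m)" using not_less_Least[of m "\<lambda>n. j < pos h (Suc n)"] n_def by simp
    with Suc show ?thesis by simp
  qed simp
  with n show ?thesis by (intro exI[of _ n] exI[of _ "j - pos h n"]) (simp add: pos_Suc less_diff_conv2)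
qed

text \<open>The relation of adjacency in \<open>p\<close>, consisting of the pairs in
  \<open>factors_p_pair\<close>.\<close>

fun follows :: "letter \<Rightarrow> letter \<Rightarrow> bool" where
  "follows T0 b \<longleftrightarrow> b \<noteq> T0"
| "follows T1 b \<longleftrightarrow> b \<noteq> T1"
| "follows T2 b \<longleftrightarrow> b = T1"

lemma follows_morph: "successively follows v \<Longrightarrow> successively follows (morph phi v)"
proof (induction v rule: induct_list012)
  case (2 a)
  then show ?case by (cases a) simp_all
next
  case (3 a b v)
  then have "follows a b" "successively follows (morph phi (b # v))" by simp_all
  moreover from this(1) have "successively follows (phi a)" "follows (last (phi a)) (hd (phi b))"
    by (cases a; cases b; simp)+
  moreover have "hd (morph phi (b # v)) = hd (phi b)" by (cases b) simp_all
  ultimately show ?case using phi_nonerasing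
    by (subst morph_simps(2)) (simp add: successively_append_iff del: morph_simps)
qed simp

lemma p_follows: "follows (p n) (p (Suc n))"
proof -
  let ?v = "(morph phi ^^ Suc n) [T0]"
  have "successively follows ((morph phi ^^ k) [T0])" for k
    by (induction k) (simp_all add: follows_morph)
  moreover have "Suc n < length ?v" by (rule length_phi_pow)
  ultimately have "follows (?v ! n) (?v ! Suc n)" by (simp add: successively_conv_nth del: funpow.simps)
  then show ?thesis using p_nth[of n "Suc n"] p_nth[of "Suc n" "Suc n"] length_phi_pow[of "Suc n"]
    by (simp del: funpow.simps)
qed

lemma p_0: "p 0 = T0"
  by (simp add: p_def)

lemma p_block: "i < length (phi (p n)) \<Longrightarrow> p (pos phi n + i) = phi (p n) ! i"
  using block_nth[where h = phi and i = i and n = n] phi_nonerasing by (simp add: morph_phi_p)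

lemma p_block_Suc:
  "i < length (phi (p n) @ phi (p (Suc n))) \<Longrightarrow> p (pos phi n + i) = (phi (p n) @ phi (p (Suc n))) ! i"
  using block_nth_Suc[where h = phi and i = i and n = n] phi_nonerasing unfolding morph_phi_p by blast

lemma p_block_rev:
  "i < length (phi (p n)) \<Longrightarrow> p (pos phi (Suc n) - Suc i) = rev (phi (p n)) ! i"
  using block_nth_rev[where h = phi and i = i and n = n] phi_nonerasing unfolding morph_phi_p by blast

text \<open>In the blocks 01, 21 and 0 the second letter is always \<open>T1\<close>, so any other
  letter begins a block.\<close>

lemma p_cut: "p j \<noteq> T1 \<Longrightarrow> \<exists>n. j = pos phi n"
proof -
  assume j: "p j \<noteq> T1"
  obtain n i where n: "j = pos phi n + i" "i < length (phi (p n))" using in_block[where h = phi and j = j] phi_nonerasing by blast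
  then have "phi (p n) ! i \<noteq> T1" using j p_block by simp
  then have "i = 0" using n(2) by (cases "p n"; cases i) auto
  with n show ?thesis by auto
qed

subsection \<open>Repetitions in p\<close>

text \<open>Only the excess is recorded: the repetition itself extends from \<open>i\<close> to
  \<open>e + q\<close>. The window may be empty, and such windows are where the descent
  ends.\<close>

definition matches :: "(nat \<Rightarrow> 'b) \<Rightarrow> nat \<Rightarrow> nat \<Rightarrow> nat \<Rightarrow> bool" where
  "matches w q i e \<longleftrightarrow> (\<forall>j. i \<le> j \<and> j < e \<longrightarrow> w j = w (j + q))"

text \<open>Equal letters have blocks of equal length, so the distance between the two copies of the
  window stays constant in the image.\<close>

lemma pos_shift:
  assumes "matches p q s t" "s \<le> t"
  shows "pos h (t + q) + pos h s = pos h t + pos h (s + q)"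
  using assms(2,1)
proof (induction t rule: dec_induct)
  case (step t)
  then have "p t = p (t + q)" "matches p q s t" by (simp_all add: matches_def)
  then show ?case using step.IH by (simp add: pos_Suc)
qed simp

lemma matches_lift:
  assumes h: "\<And>a. h a \<noteq> []" and m: "matches p r s t" "s \<le> t" "pos h (s + r) = pos h s + q"
  shows "matches (morph_word h p) q (pos h s) (pos h t)"
  unfolding matches_def
proof (intro allI impI)
  fix j assume j: "pos h s \<le> j \<and> j < pos h t"
  obtain n i where n: "j = pos h n + i" "i < length (h (p n))" using in_block[where h = h] h by blast
  have "s \<le> n"
  proof (rule ccontr)
    assume "\<not> s \<le> n"
    then have "pos h (Suc n) \<le> pos h s" by (intro pos_mono) simp
    then show False using n j by (simp add: pos_Suc)
  qed
  moreover have "n < t"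
  proof (rule ccontr)
    assume "\<not> n < t"
    then have "pos h t \<le> pos h n" by (intro pos_mono) simp
    then show False using n j by simp
  qed
  ultimately have eq: "p n = p (n + r)" and "matches p r s n" using m(1) by (auto simp: matches_def)
  then have "pos h (n + r) = pos h n + q" using pos_shift[OF _ \<open>s \<le> n\<close>, of r h] m(3) by simp
  then have "morph_word h p (j + q) = h (p (n + r)) ! i"
    using block_nth[where h = h and i = i and n = "n + r"] h n eq by (simp add: algebra_simps)
  then show "morph_word h p j = morph_word h p (j + q)" using block_nth[where h = h and i = i and n = n] h n eq by simp
qed

text \<open>
  The mismatched letters at the two ends of a maximal repetition determine by how many letters its
  image can be extended. Under \<open>phi\<close> the types of both mismatches alternate.
\<close>

datatype side = Edge | A | B | C

text \<open>Type \<open>C\<close>, the left mismatch of \<open>T1\<close> and \<open>T2\<close>, is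
  not in the range: it never arises from an image.\<close>

fun flip :: "side \<Rightarrow> side" where
  "flip Edge = Edge" | "flip A = B" | "flip B = A" | "flip C = A"

definition left_type :: "letter \<Rightarrow> letter \<Rightarrow> side" where
  "left_type a b = (if {a, b} = {T0, T1} then A else if {a, b} = {T0, T2} then B else C)"

definition right_type :: "letter \<Rightarrow> letter \<Rightarrow> side" where
  "right_type a b = (if {a, b} = {T0, T2} then A else B)"

definition maximal :: "nat \<Rightarrow> nat \<Rightarrow> nat \<Rightarrow> side \<Rightarrow> side \<Rightarrow> bool" where
  "maximal q i e l r \<longleftrightarrow> 0 < q \<and> i \<le> e \<and> matches p q i e \<and>
     p e \<noteq> p (e + q) \<and> r = right_type (p e) (p (e + q)) \<and>
     (if i = 0 then l = Edge
      else p (i - 1) \<noteq> p (i - 1 + q) \<and> l = left_type (p (i - 1)) (p (i - 1 + q)))"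

text \<open>The mismatch at \<open>t\<close> guarantees a right end. On the left, position 0 serves
  as the boundary if there is no mismatch.\<close>

lemma maximal_exists:
  assumes "0 < q" "t \<ge> s" "p t \<noteq> p (t + q)"
  obtains i e l r where "maximal q i e l r" "i \<le> s" "s \<le> e" "e \<le> t"
proof -
  define e where "e = (LEAST e. s \<le> e \<and> p e \<noteq> p (e + q))"
  have e: "s \<le> e \<and> p e \<noteq> p (e + q)" unfolding e_def by (rule LeastI[of _ t]) (use assms in simp)
  have "e \<le> t" unfolding e_def by (rule Least_le) (use assms in simp)
  have se: "matches p q s e"
    unfolding matches_def using not_less_Least[of _ "\<lambda>e. s \<le> e \<and> p e \<noteq> p (e + q)"] e_def by blast
  define i where "i = (LEAST i. matches p q i s)"
  have i: "matches p q i s" unfolding i_def by (rule LeastI[of _ s]) (auto simp: matches_def)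
  have "i \<le> s" unfolding i_def by (rule Least_le) (auto simp: matches_def)
  have "p (i - 1) \<noteq> p (i - 1 + q)" if "i \<noteq> 0"
  proof
    assume eq: "p (i - 1) = p (i - 1 + q)"
    have "p j = p (j + q)" if "i - 1 \<le> j" "j < s" for j
    proof (cases "j = i - 1")
      case False
      with that have "i \<le> j" by simp
      then show ?thesis using i that(2) by (simp add: matches_def)
    qed (use eq in simp)
    then have "matches p q (i - 1) s" by (simp add: matches_def)
    then have "i \<le> i - 1" unfolding i_def by (rule Least_le)
    with that show False by simp
  qed
  moreover have "matches p q i e" using i se unfolding matches_def by (metis not_less)
  ultimately have "maximal q i e (if i = 0 then Edge else left_type (p (i - 1)) (p (i - 1 + q)))
      (right_type (p e) (p (e + q)))"
    using assms(1) e \<open>i \<le> s\<close> unfolding maximal_def by auto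
  then show ?thesis using that \<open>i \<le> s\<close> e \<open>e \<le> t\<close> by blast
qed

text \<open>For \<open>T0\<close> against \<open>T2\<close> the blocks 01 and 0 share their first
  letter; then \<open>T1\<close> meets the first letter of the next block, which is
  \<open>T2\<close> because only \<open>T1\<close> follows \<open>T2\<close>. All other pairs of
  blocks differ at once.\<close>

lemma phi_right:
  assumes "p a \<noteq> p b"
  defines "c \<equiv> (if right_type (p a) (p b) = A then 1 else 0)"
  shows "\<forall>t < c. p (pos phi a + t) = T0 \<and> p (pos phi b + t) = T0"
    and "p (pos phi a + c) \<noteq> p (pos phi b + c)"
    and "right_type (p (pos phi a + c)) (p (pos phi b + c)) = flip (right_type (p a) (p b))"
proof -
  have l: "p (pos phi n) = phi (p n) ! 0" for n using p_block[of 0 n] by (cases "p n") simp_all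
  have l': "p (Suc (pos phi n)) = (phi (p n) @ phi (p (Suc n))) ! 1" for n
    using p_block_Suc[of 1 n] phi_nonerasing[of "p n"] phi_nonerasing[of "p (Suc n)"]
    by (cases "phi (p n)"; cases "phi (p (Suc n))") auto
  note f = p_follows[of a] p_follows[of b]
  show "\<forall>t < c. p (pos phi a + t) = T0 \<and> p (pos phi b + t) = T0"
    "p (pos phi a + c) \<noteq> p (pos phi b + c)"
    "right_type (p (pos phi a + c)) (p (pos phi b + c)) = flip (right_type (p a) (p b))"
    using assms(1) f unfolding c_def
    by (cases "p a"; cases "p b"; simp add: right_type_def l l' doubleton_eq_iff)+
qed

text \<open>Only the blocks 01 and 21 share their last letter, and before it \<open>T0\<close> meets
  \<open>T2\<close>.\<close>

lemma phi_left:
  assumes "p a \<noteq> p b"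
  defines "c \<equiv> (if left_type (p a) (p b) = A then 1 else 0)"
  shows "\<forall>t < c. p (pos phi (Suc a) - Suc t) = T1 \<and> p (pos phi (Suc b) - Suc t) = T1"
    and "p (pos phi (Suc a) - Suc c) \<noteq> p (pos phi (Suc b) - Suc c)"
    and "left_type (p (pos phi (Suc a) - Suc c)) (p (pos phi (Suc b) - Suc c)) = flip (left_type (p a) (p b))"
    and "Suc c \<le> pos phi (Suc a)" "Suc c \<le> pos phi (Suc b)"
proof -
  have l: "p (pos phi (Suc n) - Suc 0) = rev (phi (p n)) ! 0" for n using p_block_rev[of 0 n] by (cases "p n") simp_all
  have l': "p (pos phi (Suc n) - Suc (Suc 0)) = rev (phi (p n)) ! 1" if "p n \<noteq> T2" for n
    using p_block_rev[of 1 n] that by (cases "p n") simp_all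
  show "\<forall>t < c. p (pos phi (Suc a) - Suc t) = T1 \<and> p (pos phi (Suc b) - Suc t) = T1"
    "p (pos phi (Suc a) - Suc c) \<noteq> p (pos phi (Suc b) - Suc c)"
    "left_type (p (pos phi (Suc a) - Suc c)) (p (pos phi (Suc b) - Suc c)) = flip (left_type (p a) (p b))"
    "Suc c \<le> pos phi (Suc a)" "Suc c \<le> pos phi (Suc b)"
    using assms(1) l[of a] l[of b] l'[of a] l'[of b] unfolding c_def
    by (cases "p a"; cases "p b"; simp add: left_type_def doubleton_eq_iff pos_Suc)+
qed

lemma segment_append: "i \<le> j \<Longrightarrow> j \<le> e \<Longrightarrow> w [i \<rightarrow> e] = w [i \<rightarrow> j] @ w [j \<rightarrow> e]"
  using upt_add_eq_append[of i j "e - j"] by (simp add: subsequence_def)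

lemma segment_morph:
  assumes "\<And>a. h a \<noteq> []" "a \<le> b"
  shows "(morph_word h p) [pos h a \<rightarrow> pos h b] = morph h (p [a \<rightarrow> b])"
proof -
  have pre: "(morph_word h p) [0 \<rightarrow> pos h n] = morph h (p [0 \<rightarrow> n])" for n
    using prefix_morph_word[where h = h and n = n and w = p] assms(1) by (simp add: pos_def)
  have "(morph_word h p) [0 \<rightarrow> pos h b] = (morph_word h p) [0 \<rightarrow> pos h a] @ (morph_word h p) [pos h a \<rightarrow> pos h b]"
    using assms(2) by (intro segment_append) (simp_all add: pos_mono)
  moreover have "p [0 \<rightarrow> b] = p [0 \<rightarrow> a] @ p [a \<rightarrow> b]" using assms(2) by (intro segment_append) simp_all
  ultimately show ?thesis using pre[of a] pre[of b] by (simp add: morph_append)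
qed

text \<open>The second claim keeps track of the added letters, because their weights have to be
  counted later.\<close>

lemma maximal_image:
  assumes "maximal r a b l' r'" and q: "pos phi (a + r) = pos phi a + q"
  defines "cl \<equiv> (if l' = A then 1 else 0)" and "cr \<equiv> (if r' = A then 1 else 0)"
  shows "maximal q (pos phi a - cl) (pos phi b + cr) (flip l') (flip r')"
    and "p [pos phi a - cl \<rightarrow> pos phi b + cr] =
      (if l' = A then [T1] else []) @ morph phi (p [a \<rightarrow> b]) @ (if r' = A then [T0] else [])"
proof -
  have m: "0 < r" "a \<le> b" "matches p r a b" "p b \<noteq> p (b + r)" "r' = right_type (p b) (p (b + r))"
    using assms(1) by (auto simp: maximal_def)
  have qb: "pos phi (b + r) = pos phi b + q" using pos_shift[OF m(3,2), of phi] q by simp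
  have "0 < q" using pos_strict[of phi a "a + r"] phi_nonerasing m(1) q by simp
  have mid: "matches p q (pos phi a) (pos phi b)"
    using matches_lift[of phi r a b q] phi_nonerasing m q by (simp add: morph_phi_p)
  have ab: "pos phi a \<le> pos phi b" using m(2) by (rule pos_mono)
  note right = phi_right[OF m(4), folded m(5), folded cr_def]
  have left: "(\<forall>t < cl. p (pos phi a - Suc t) = T1 \<and> p (pos phi a + q - Suc t) = T1) \<and>
      (if a = 0 then l' = Edge else Suc cl \<le> pos phi a \<and>
        p (pos phi a - Suc cl) \<noteq> p (pos phi a + q - Suc cl) \<and>
        left_type (p (pos phi a - Suc cl)) (p (pos phi a + q - Suc cl)) = flip l')"
  proof (cases a)
    case 0
    then show ?thesis using assms(1) by (simp add: maximal_def cl_def)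
  next
    case (Suc c)
    then have c: "p c \<noteq> p (c + r)" "l' = left_type (p c) (p (c + r))" using assms(1) by (auto simp: maximal_def)
    show ?thesis using phi_left[OF c(1)] q unfolding Suc by (simp add: cl_def flip: c(2))
  qed
  have cl: "cl \<le> pos phi a" using left by (cases "a = 0") (auto simp: cl_def)
  have "p j = p (j + q)" if j: "pos phi a - cl \<le> j" "j < pos phi b + cr" for j
  proof -
    consider "j < pos phi a" | "pos phi a \<le> j" "j < pos phi b" | "pos phi b \<le> j" by linarith
    then show ?thesis
    proof cases
      case 1
      define t where "t = pos phi a - Suc j"
      have "t < cl" "j = pos phi a - Suc t" "j + q = pos phi a + q - Suc t" using 1 j cl by (auto simp: t_def)
      then show ?thesis using left by metis
    next
      case 2
      then show ?thesis using mid by (simp add: matches_def)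
    next
      case 3
      define t where "t = j - pos phi b"
      have "t < cr" "j = pos phi b + t" "j + q = pos phi (b + r) + t" using 3 j qb by (auto simp: t_def)
      then show ?thesis using right(1) by metis
    qed
  qed
  moreover have "p (pos phi b + cr) \<noteq> p (pos phi b + cr + q)"
    "flip r' = right_type (p (pos phi b + cr)) (p (pos phi b + cr + q))"
    using right(2,3) qb by (simp_all add: algebra_simps)
  moreover have "if pos phi a - cl = 0 then flip l' = Edge
      else p (pos phi a - cl - 1) \<noteq> p (pos phi a - cl - 1 + q) \<and>
        flip l' = left_type (p (pos phi a - cl - 1)) (p (pos phi a - cl - 1 + q))"
  proof (cases "a = 0")
    case True
    then show ?thesis using left by simp
  next
    case False
    then have "Suc cl \<le> pos phi a" using left by simp
    then have "pos phi a - cl \<noteq> 0" "pos phi a - cl - 1 = pos phi a - Suc cl"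
      "pos phi a - cl - 1 + q = pos phi a + q - Suc cl" by simp_all
    then show ?thesis using left False by simp
  qed
  moreover have "pos phi a - cl \<le> pos phi b + cr" using ab by simp
  ultimately show "maximal q (pos phi a - cl) (pos phi b + cr) (flip l') (flip r')"
    using \<open>0 < q\<close> unfolding maximal_def matches_def by blast
  have "p [pos phi a - cl \<rightarrow> pos phi b + cr] =
      p [pos phi a - cl \<rightarrow> pos phi a] @ p [pos phi a \<rightarrow> pos phi b] @ p [pos phi b \<rightarrow> pos phi b + cr]"
    using segment_append[of "pos phi a - cl" "pos phi a" "pos phi b + cr" p]
      segment_append[of "pos phi a" "pos phi b" "pos phi b + cr" p] ab by simp
  moreover have "p [pos phi a \<rightarrow> pos phi b] = morph phi (p [a \<rightarrow> b])"
    using segment_morph[where h = phi and a = a and b = b] phi_nonerasing m(2) by (simp add: morph_phi_p)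
  moreover have "p [pos phi a - cl \<rightarrow> pos phi a] = (if l' = A then [T1] else [])"
  proof (cases "l' = A")
    case True
    then have "cl = 1" by (simp add: cl_def)
    then have "p [pos phi a - cl \<rightarrow> pos phi a] = [p (pos phi a - Suc 0)]"
      using cl upt_conv_Cons[of "pos phi a - 1" "pos phi a"] by (simp add: subsequence_def)
    then show ?thesis using left True \<open>cl = 1\<close> by simp
  qed (simp add: cl_def)
  moreover have "p [pos phi b \<rightarrow> pos phi b + cr] = (if r' = A then [T0] else [])"
    using right(1) by (auto simp: cr_def)
  ultimately show "p [pos phi a - cl \<rightarrow> pos phi b + cr] =
      (if l' = A then [T1] else []) @ morph phi (p [a \<rightarrow> b]) @ (if r' = A then [T0] else [])" by simp
qed

text \<open>A mismatch stands at each end, so two windows that merely touch at \<open>c\<close> must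
  coincide. The bounds are not strict, in order that empty windows are included.\<close>

lemma maximal_unique:
  assumes "maximal q i e l r" "maximal q i' e' l' r'" "i \<le> c" "c \<le> e" "i' \<le> c" "c \<le> e'"
  shows "i = i'" "e = e'" "l = l'" "r = r'"
proof -
  have "\<not> e < e'" using assms unfolding maximal_def matches_def by (metis order_trans)
  moreover have "\<not> e' < e" using assms unfolding maximal_def matches_def by (metis order_trans)
  ultimately show e: "e = e'" by simp
  have *: "\<not> i < i'" if "maximal q i e l r" "maximal q i' e' l' r'" "c \<le> e" "i' \<le> c" for i i' e e' l l' r r'
  proof
    assume "i < i'"
    then have "p (i' - 1) \<noteq> p (i' - 1 + q)" using that(2) by (auto simp: maximal_def)
    moreover have "i \<le> i' - 1 \<and> i' - 1 < e" using \<open>i < i'\<close> that(3,4) by linarith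
    then have "p (i' - 1) = p (i' - 1 + q)" using that(1) by (simp add: maximal_def matches_def)
    ultimately show False by simp
  qed
  have "\<not> i < i'" using *[OF assms(1,2,4,5)] .
  moreover have "\<not> i' < i" using *[OF assms(2,1,6,3)] .
  ultimately show i: "i = i'" by simp
  show "l = l'" "r = r'" using assms(1,2) i e by (auto simp: maximal_def split: if_splits)
qed

lemma p_no_square_letter: "p n \<noteq> p (Suc n)"
  using p_follows[of n] by (cases "p n"; cases "p (Suc n)") simp_all

text \<open>Only \<open>T2\<close> has a block of one letter, and no two \<open>T2\<close> are
  adjacent; so any stretch of at least two letters grows. A single letter may fail to grow, which is
  the case \<open>q = 1\<close>.\<close>

lemma period_decreases:
  assumes "0 < r" "pos phi (a + r) = pos phi a + q" "q \<noteq> 1" shows "r < q"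
proof -
  have le: "n \<le> pos phi (b + n) - pos phi b" for b n
  proof (induction n)
    case (Suc n)
    have "1 \<le> length (phi (p (b + n)))" by (cases "p (b + n)") simp_all
    moreover have "pos phi b \<le> pos phi (b + n)" by (rule pos_mono) simp
    moreover have "pos phi (b + Suc n) = pos phi (b + n) + length (phi (p (b + n)))" by (simp add: pos_Suc)
    ultimately show ?case using Suc by linarith
  qed simp
  show ?thesis
  proof (cases "r = 1")
    case True
    have "0 < q" using assms pos_strict[of phi a "a + r"] phi_nonerasing by simp
    with True assms(3) show ?thesis by simp
  next
    case False
    then obtain s where s: "r = Suc (Suc s)" using assms(1) by (metis One_nat_def Suc_pred not0_implies_Suc)
    have "p a \<noteq> T2 \<or> p (Suc a) \<noteq> T2" using p_no_square_letter[of a] by auto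
    then have "3 \<le> pos phi (a + 2) - pos phi a"
      by (cases "p a"; cases "p (Suc a)") (simp_all add: pos_Suc numeral_eq_Suc)
    moreover have "s \<le> pos phi (a + 2 + s) - pos phi (a + 2)" using le .
    moreover have "pos phi a \<le> pos phi (a + 2)" "pos phi (a + 2) \<le> pos phi (a + 2 + s)"
      by (rule pos_mono, simp)+
    moreover have "a + r = a + 2 + s" using s by simp
    ultimately show ?thesis using assms(2) s by (simp only:)
  qed
qed

lemma cut_in_window:
  assumes "matches p q i e" "i < e"
  obtains a b where "i \<le> pos phi a" "pos phi a \<le> e" "pos phi b = pos phi a + q"
proof -
  define c where "c = (if p i = T1 then Suc i else i)"
  have "p i = p (i + q)" using assms by (simp add: matches_def)
  then have "p c \<noteq> T1" "p (c + q) \<noteq> T1"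
    using p_no_square_letter[of i] p_no_square_letter[of "i + q"] by (auto simp: c_def)
  then obtain a b where "c = pos phi a" "c + q = pos phi b" using p_cut by blast
  then show ?thesis using that[of a b] assms(2) by (auto simp: c_def split: if_splits)
qed

lemma period_split:
  assumes "pos phi b = pos phi a + q" "0 < q" obtains r where "0 < r" "b = a + r"
proof -
  have "a < b"
  proof (rule ccontr)
    assume "\<not> a < b"
    then have "pos phi b \<le> pos phi a" by (intro pos_mono) simp
    then show False using assms by simp
  qed
  then show ?thesis using that[of "b - a"] by simp
qed

text \<open>Descent on the period: an eventual period \<open>q\<close> desubstitutes to a smaller
  \<open>r\<close>, and the image under \<open>phi\<close> of a repetition bounded by a mismatch for
  \<open>r\<close> ends with a mismatch for \<open>q\<close>. Consequently every repetition has a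
  right end.\<close>

lemma p_aperiodic: "0 < q \<Longrightarrow> \<exists>j \<ge> i. p j \<noteq> p (j + q)"
proof (induction q arbitrary: i rule: less_induct)
  case (less q)
  show ?case
  proof (rule ccontr)
    assume neg: "\<not> ?case"
    have eq: "p j = p (j + q)" if "i \<le> j" for j
    proof (rule ccontr)
      assume "p j \<noteq> p (j + q)"
      then have ?case using that by (intro exI conjI)
      with neg show False by (rule notE)
    qed
    then have "matches p q i (Suc i)" unfolding matches_def by iprover
    from this lessI obtain a b where ab: "i \<le> pos phi a" "pos phi b = pos phi a + q"
      by (rule cut_in_window)
    from ab(2) less.prems obtain r where r: "0 < r" "b = a + r" by (rule period_split)
    have "q \<noteq> 1" using eq[of i] p_no_square_letter[of i] by auto
    then have "r < q" using period_decreases r ab by blast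
    then obtain t where t: "a \<le> t" "p t \<noteq> p (t + r)" using less.IH r(1) by blast
    obtain a0 b0 l0 r0 where m: "maximal r a0 b0 l0 r0" "a0 \<le> a" "a \<le> b0"
      by (rule maximal_exists[OF r(1) t])
    then have "matches p r a0 a" by (auto simp: maximal_def matches_def)
    then have "pos phi (a0 + r) = pos phi a0 + q" using pos_shift[of r a0 a phi] m(2) ab r by simp
    from maximal_image(1)[OF m(1) this] obtain e where "pos phi b0 \<le> e" "p e \<noteq> p (e + q)"
      unfolding maximal_def by (metis le_add1)
    moreover have "pos phi a \<le> pos phi b0" using m(3) by (rule pos_mono)
    ultimately show False using eq[of e] ab(1) by simp
  qed
qed

text \<open>The preimage is found around a single common cut: the maximal repetition there has a
  maximal image that contains the cut, and by uniqueness this image is the given repetition.\<close>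

lemma descent:
  assumes "maximal q i e l r" "i < e"
  obtains q' a b l' r' where "maximal q' a b l' r'" "q' < q" "l = flip l'" "r = flip r'"
    "i \<le> pos phi a" "pos phi a \<le> e" "pos phi (a + q') = pos phi a + q"
    "p [i \<rightarrow> e] = (if l' = A then [T1] else []) @ morph phi (p [a \<rightarrow> b]) @ (if r' = A then [T0] else [])"
proof -
  have m: "0 < q" "matches p q i e" using assms(1) by (auto simp: maximal_def)
  from m(2) assms(2) obtain c d where cd: "i \<le> pos phi c" "pos phi c \<le> e" "pos phi d = pos phi c + q"
    by (rule cut_in_window)
  from cd(3) m(1) obtain q' where q': "0 < q'" "d = c + q'" by (rule period_split)
  have "p i = p (i + q)" using m(2) assms(2) by (simp add: matches_def)
  then have "q \<noteq> 1" using p_no_square_letter[of i] by auto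
  then have less: "q' < q" using period_decreases q' cd(3) by blast
  obtain t where t: "c \<le> t" "p t \<noteq> p (t + q')" using p_aperiodic[OF q'(1)] by blast
  obtain a b l' r' where ab: "maximal q' a b l' r'" "a \<le> c" "c \<le> b"
    by (rule maximal_exists[OF q'(1) t])
  then have "matches p q' a c" by (auto simp: maximal_def matches_def)
  then have shift: "pos phi (a + q') = pos phi a + q" using pos_shift[of q' a c phi] ab(2) cd(3) q'(2) by simp
  let ?i = "pos phi a - (if l' = A then 1 else 0)" and ?e = "pos phi b + (if r' = A then 1 else 0)"
  have "pos phi a \<le> pos phi c" "pos phi c \<le> pos phi b" using ab(2,3) by (auto intro: pos_mono)
  then have "?i \<le> pos phi c" "pos phi c \<le> ?e" by auto
  from maximal_unique[OF assms(1) maximal_image(1)[OF ab(1) shift] cd(1,2) this]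
  have eq: "i = ?i" "e = ?e" "l = flip l'" "r = flip r'" by auto
  have "pos phi a \<le> pos phi b" using ab(2,3) by (intro pos_mono) simp
  then have "i \<le> pos phi a" "pos phi a \<le> e" unfolding eq(1,2) by auto
  moreover have "p [i \<rightarrow> e] = (if l' = A then [T1] else []) @ morph phi (p [a \<rightarrow> b]) @ (if r' = A then [T0] else [])"
    unfolding eq(1,2) using maximal_image(2)[OF ab(1) shift] .
  ultimately show ?thesis using that ab(1) less eq(3,4) shift by blast
qed

subsection \<open>Bounding the exponent of a repetition\<close>

text \<open>Integers are used because the potentials subtract weights.\<close>

definition weight :: "(letter \<Rightarrow> 'b list) \<Rightarrow> nat \<Rightarrow> letter list \<Rightarrow> int" where
  "weight g k v = int (length (morph g ((morph phi ^^ k) v)))"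

lemma weight_append: "weight g k (u @ v) = weight g k u + weight g k v"
  by (simp add: weight_def morph_pow_append morph_append)

lemma weight_Nil [simp]: "weight g k [] = 0"
proof -
  have "(morph phi ^^ k) [] = []" by (induction k) simp_all
  then show ?thesis by (simp add: weight_def)
qed

lemma weight_morph: "weight g k (morph phi v) = weight g (Suc k) v"
  by (simp add: weight_def funpow_swap1)

lemma weight_Suc:
  "weight g (Suc k) [T0] = weight g k [T0] + weight g k [T1]"
  "weight g (Suc k) [T1] = weight g k [T2] + weight g k [T1]"
  "weight g (Suc k) [T2] = weight g k [T0]"
  using weight_append[of g k "[T0]" "[T1]"] weight_append[of g k "[T2]" "[T1]"]
  by (simp_all flip: weight_morph)

text \<open>Moving the period by one letter exchanges two equal letters.\<close>

lemma weight_period: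
  assumes "matches p q i e" "i \<le> j" "j \<le> e"
  shows "weight g k (p [j \<rightarrow> j + q]) = weight g k (p [i \<rightarrow> i + q])"
  using assms(2,3)
proof (induction j rule: dec_induct)
  case (step j)
  have eq: "p j = p (j + q)" using assms(1) step by (simp add: matches_def)
  have "[p j] @ p [Suc j \<rightarrow> Suc j + q] = p [j \<rightarrow> j + q] @ [p (j + q)]"
    using segment_append[of j "Suc j" "Suc (j + q)" p] segment_append[of j "j + q" "Suc (j + q)" p]
    by (simp del: upt_Suc add: subsequence_def) (simp add: upt_conv_Cons)
  then have "weight g k [p j] + weight g k (p [Suc j \<rightarrow> Suc j + q]) =
      weight g k (p [j \<rightarrow> j + q]) + weight g k [p (j + q)]" unfolding weight_append[symmetric] by simp
  then show ?case using eq step by simp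
qed simp

text \<open>
  Five times the potentials of the two ends, which add up the letters by which the images under
  all further powers of \<open>phi\<close> can be extended; this is why they satisfy \<open>left_potential_Suc\<close> and
  \<open>right_potential_Suc\<close>.
\<close>

fun left_potential :: "(letter \<Rightarrow> 'b list) \<Rightarrow> nat \<Rightarrow> side \<Rightarrow> int" where
  "left_potential g k Edge = 0"
| "left_potential g k A = 3 * weight g k [T0] + weight g k [T1] - weight g k [T2]"
| "left_potential g k C = 2 * weight g k [T0] - weight g k [T1] + weight g k [T2]"
| "left_potential g k B = 2 * weight g k [T0] - weight g k [T1] + weight g k [T2]"

fun right_potential :: "(letter \<Rightarrow> 'b list) \<Rightarrow> nat \<Rightarrow> side \<Rightarrow> int" where
  "right_potential g k Edge = 0"
| "right_potential g k A = weight g k [T0] + 2 * weight g k [T1] + 3 * weight g k [T2]"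
| "right_potential g k C = - weight g k [T0] + 3 * weight g k [T1] + 2 * weight g k [T2]"
| "right_potential g k B = - weight g k [T0] + 3 * weight g k [T1] + 2 * weight g k [T2]"

text \<open>Types \<open>A\<close> and \<open>B\<close> alternate, so a letter is gained at every
  second level, and over two levels the potential grows by five times the weight of that letter.
  Solving this amounts to inverting \<open>M^2 - 1\<close> for the incidence matrix \<open>M\<close>
  of \<open>phi\<close>; its determinant is 5 up to sign, and the factor 5 clears the
  denominators.\<close>

lemma left_potential_Suc:
  "left_potential g (Suc k) s = left_potential g k (flip s) + (if s = A then 5 * weight g k [T1] else 0)"
  by (cases s) (simp_all add: weight_Suc)

lemma right_potential_Suc:
  "right_potential g (Suc k) s = right_potential g k (flip s) + (if s = A then 5 * weight g k [T0] else 0)"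
  by (cases s) (simp_all add: weight_Suc)

text \<open>The outcome will be that the excess is at most \<open>d / (5 * c)\<close> periods. The
  functions \<open>left_ext\<close> and \<open>right_ext\<close> bound how far the images of
  mismatched letters agree. In \<open>base\<close>, the two bracketed differences replace the level
  0 potentials of the types reached after \<open>k\<close> flips by these bounds.\<close>

locale bounded_exponent =
  fixes g :: "letter \<Rightarrow> 'b list" and c d :: int and left_ext right_ext :: "side \<Rightarrow> nat"
  assumes nonerasing: "g x \<noteq> []" and pos: "0 < c"
    and left_ext: "p m \<noteq> p n \<Longrightarrow> \<exists>t \<le> left_ext (left_type (p m) (p n)).
      Suc t \<le> pos g (Suc m) \<and> Suc t \<le> pos g (Suc n) \<and>
      morph_word g p (pos g (Suc m) - Suc t) \<noteq> morph_word g p (pos g (Suc n) - Suc t)"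
    and right_ext: "p m \<noteq> p n \<Longrightarrow> \<exists>t \<le> right_ext (right_type (p m) (p n)).
      morph_word g p (pos g m + t) \<noteq> morph_word g p (pos g n + t)"
    and base: "maximal q i i l r \<Longrightarrow>
      c * (left_potential g k l + right_potential g k r +
        (5 * int (left_ext ((flip ^^ k) l)) - left_potential g 0 ((flip ^^ k) l)) +
        (5 * int (right_ext ((flip ^^ k) r)) - right_potential g 0 ((flip ^^ k) r)))
      \<le> d * weight g k (p [i \<rightarrow> i + q])"
begin

definition correction :: "nat \<Rightarrow> side \<Rightarrow> side \<Rightarrow> int" where
  "correction k l r = (5 * int (left_ext ((flip ^^ k) l)) - left_potential g 0 ((flip ^^ k) l)) +
        (5 * int (right_ext ((flip ^^ k) r)) - right_potential g 0 ((flip ^^ k) r))"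

text \<open>Both sides remain unchanged when \<open>descent\<close> replaces the repetition by its
  preimage and \<open>k\<close> by \<open>Suc k\<close>. The process ends at a window without
  excess, where the claim is \<open>base\<close>.\<close>

lemma maximal_bound:
  "maximal q i e l r \<Longrightarrow>
    c * (5 * weight g k (p [i \<rightarrow> e]) + left_potential g k l + right_potential g k r + correction k l r)
    \<le> d * weight g k (p [i \<rightarrow> i + q])"
proof (induction q arbitrary: i e l r k rule: less_induct)
  case (less q)
  show ?case
  proof (cases "i < e")
    case False
    then have "e = i" using less.prems by (simp add: maximal_def)
    then show ?thesis using base[of q i l r k] less.prems by (simp add: correction_def algebra_simps)
  next
    case True
    from less.prems True obtain q' a b l' r' where ab: "maximal q' a b l' r'" "q' < q" "l = flip l'" "r = flip r'"
      "i \<le> pos phi a" "pos phi a \<le> e" "pos phi (a + q') = pos phi a + q"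
      "p [i \<rightarrow> e] = (if l' = A then [T1] else []) @ morph phi (p [a \<rightarrow> b]) @ (if r' = A then [T0] else [])"
      by (rule descent)
    have "5 * weight g k (p [i \<rightarrow> e]) + left_potential g k l + right_potential g k r =
        5 * weight g (Suc k) (p [a \<rightarrow> b]) + left_potential g (Suc k) l' + right_potential g (Suc k) r'"
      unfolding ab(3,4,8) weight_append weight_morph left_potential_Suc right_potential_Suc by simp
    moreover have "correction k l r = correction (Suc k) l' r'"
      unfolding correction_def ab(3,4) by (simp add: funpow_swap1)
    moreover have "matches p q i e" using less.prems by (simp add: maximal_def)
    then have "weight g k (p [i \<rightarrow> i + q]) = weight g k (p [pos phi a \<rightarrow> pos phi a + q])"
      using weight_period[of q i e "pos phi a" g k] ab(5,6) by simp
    moreover have "p [pos phi a \<rightarrow> pos phi (a + q')] = morph phi (p [a \<rightarrow> a + q'])"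
      using segment_morph[where h = phi and a = a and b = "a + q'"] phi_nonerasing by (simp add: morph_phi_p)
    then have "weight g k (p [pos phi a \<rightarrow> pos phi a + q]) = weight g (Suc k) (p [a \<rightarrow> a + q'])"
      unfolding ab(7) weight_morph[symmetric] by simp
    ultimately show ?thesis using less.IH[OF ab(2,1), of "Suc k"] by simp
  qed
qed

lemma window_bound:
  assumes "matches (morph_word g p) q i e" "0 < q"
    and "i \<le> pos g a" "pos g a \<le> e" "pos g b = pos g a + q"
  shows "c * (5 * (int e - int i)) \<le> d * int q"
proof -
  have "a < b"
  proof (rule ccontr)
    assume "\<not> a < b"
    then have "pos g b \<le> pos g a" by (intro pos_mono) simp
    then show False using assms by simp
  qed
  then obtain q' where q': "0 < q'" "b = a + q'" using less_imp_add_positive by blast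
  obtain t where t: "a \<le> t" "p t \<noteq> p (t + q')" using p_aperiodic[OF q'(1)] by blast
  obtain s u l r where m: "maximal q' s u l r" "s \<le> a" "a \<le> u"
    by (rule maximal_exists[OF q'(1) t])
  then have "matches p q' s a" "matches p q' s u" "s \<le> u" by (auto simp: maximal_def matches_def)
  then have shift: "pos g (s + q') = pos g s + q" "pos g (u + q') = pos g u + q"
    using pos_shift[of q' s a g] pos_shift[of q' s u g] m(2) assms(5) q'(2) by simp_all
  have le: "pos g s \<le> pos g a" "pos g a \<le> pos g u" using m(2,3) by (auto intro: pos_mono)
  let ?W = "morph_word g p"
  \<comment> \<open>The window cannot pass the mismatch behind the last matching block; the same
    holds below for the mismatch before the first one.\<close>
  have "e \<le> pos g u + right_ext r"
  proof -
    have "p u \<noteq> p (u + q')" "r = right_type (p u) (p (u + q'))" using m(1) by (auto simp: maximal_def)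
    then obtain t where "t \<le> right_ext r" "?W (pos g u + t) \<noteq> ?W (pos g (u + q') + t)" using right_ext by blast
    moreover from this(2) have "?W (pos g u + t) \<noteq> ?W (pos g u + t + q)" using shift(2) by (simp add: algebra_simps)
    then have "\<not> (i \<le> pos g u + t \<and> pos g u + t < e)" using assms(1) by (auto simp: matches_def)
    ultimately show ?thesis using le assms(3) by linarith
  qed
  moreover have "pos g s \<le> i + left_ext l"
  proof (cases s)
    case (Suc n)
    then have "p n \<noteq> p (n + q')" "l = left_type (p n) (p (n + q'))" using m(1) by (auto simp: maximal_def)
    then obtain t where t: "t \<le> left_ext l" "Suc t \<le> pos g s" "?W (pos g s - Suc t) \<noteq> ?W (pos g (s + q') - Suc t)"
      using left_ext[of n "n + q'"] Suc by auto
    then have "?W (pos g s - Suc t) \<noteq> ?W (pos g s - Suc t + q)" using shift(1) by simp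
    then have "\<not> (i \<le> pos g s - Suc t \<and> pos g s - Suc t < e)" using assms(1) by (auto simp: matches_def)
    then have "pos g s - Suc t < i" using le assms(4) t(2) by linarith
    then show ?thesis using t(1) by linarith
  qed simp
  ultimately have len: "int e - int i \<le> int (pos g u) - int (pos g s) + int (left_ext l) + int (right_ext r)"
    by linarith
  have seg: "weight g 0 (p [x \<rightarrow> y]) = int (pos g y) - int (pos g x)" if "x \<le> y" for x y
  proof -
    have "length ((morph_word g p) [pos g x \<rightarrow> pos g y]) = length (morph g (p [x \<rightarrow> y]))"
      using segment_morph[where h = g and a = x and b = y] nonerasing that by simp
    then have "int (pos g y - pos g x) = int (length (morph g (p [x \<rightarrow> y])))" by (simp only: subsequence_length)
    then show ?thesis using pos_mono[OF that, of g] by (simp add: weight_def of_nat_diff)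
  qed
  have "c * (5 * weight g 0 (p [s \<rightarrow> u]) + 5 * int (left_ext l) + 5 * int (right_ext r)) \<le> d * weight g 0 (p [s \<rightarrow> s + q'])"
    using maximal_bound[OF m(1), of 0] by (simp add: correction_def add.assoc)
  then have "c * (5 * (int (pos g u) - int (pos g s) + int (left_ext l) + int (right_ext r))) \<le> d * int q"
    using seg[OF \<open>s \<le> u\<close>] seg[of s "s + q'"] shift(1) by (simp add: algebra_simps)
  moreover have "c * (5 * (int e - int i)) \<le>
      c * (5 * (int (pos g u) - int (pos g s) + int (left_ext l) + int (right_ext r)))"
    using len pos by (intro mult_left_mono) auto
  ultimately show ?thesis by simp
qed

end

subsection \<open>The exponents of the two words\<close>

text \<open>The incidence matrix of \<open>phi\<close> has the characteristic polynomial
  \<open>x^3 - 2 * x^2 + x - 1\<close>.\<close>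

lemma weight_recurrence:
  "weight g (Suc (Suc (Suc k))) [x] = 2 * weight g (Suc (Suc k)) [x] - weight g (Suc k) [x] + weight g k [x]"
  by (cases x) (simp_all add: weight_Suc)

definition combination :: "(letter \<Rightarrow> 'b list) \<Rightarrow> int \<Rightarrow> int \<Rightarrow> int \<Rightarrow> nat \<Rightarrow> int" where
  "combination g a b c k = a * weight g k [T0] + b * weight g k [T1] + c * weight g k [T2]"

text \<open>Written as \<open>y (k + 3) - y (k + 2) = (y (k + 2) - y (k + 1)) + y k\<close>, the
  recurrence propagates nonnegativity and monotonicity together.\<close>

lemma combination_mono:
  fixes g a b c
  defines "y \<equiv> combination g a b c"
  assumes "0 \<le> y m" "y m \<le> y (Suc m)" "y (Suc m) \<le> y (Suc (Suc m))" "m \<le> n"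
  shows "y m \<le> y n"
proof -
  have rec: "y (Suc (Suc (Suc k))) = 2 * y (Suc (Suc k)) - y (Suc k) + y k" for k
    unfolding y_def combination_def weight_recurrence[of g k] by (simp add: algebra_simps)
  have "y m \<le> y n \<and> y n \<le> y (Suc n) \<and> y (Suc n) \<le> y (Suc (Suc n))"
    using assms(5)
  proof (induction n rule: dec_induct)
    case (step n)
    then show ?case using rec[of n] assms(2) by linarith
  qed (use assms in simp)
  then show ?thesis by simp
qed

lemma flip_pow:
  "(flip ^^ k) s = (if k = 0 then s else if even k then (if s = C then B else s) else flip s)"
proof (induction k)
  case (Suc k)
  then show ?case by (cases s) auto
qed simp

lemma weight_nonneg: "0 \<le> weight g k v"
  by (simp add: weight_def)

text \<open>In a window without excess, a period of length 1 is a single letter, whose neighbours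
  determine both types. A longer period weighs at least as much as its first two letters.
  \<open>Q\<close> stands for the inequality \<open>base\<close> of either word.\<close>

lemma base_cases:
  fixes Q :: "side \<Rightarrow> side \<Rightarrow> int \<Rightarrow> bool"
  assumes max: "maximal q i i l r"
    and two: "\<And>x y l r. follows x y \<Longrightarrow> r = A \<or> r = B \<Longrightarrow> Q l r (weight g k [x] + weight g k [y])"
    and one: "\<And>l r. l = Edge \<or> l = A \<Longrightarrow> r = A \<or> r = B \<Longrightarrow> Q l r (weight g k [T0])"
      "\<And>l. l = A \<or> l = C \<Longrightarrow> Q l B (weight g k [T1])" "\<And>l. l = B \<or> l = C \<Longrightarrow> Q l B (weight g k [T2])"
    and mono: "\<And>l r u v. Q l r u \<Longrightarrow> u \<le> v \<Longrightarrow> Q l r v"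
  shows "Q l r (weight g k (p [i \<rightarrow> i + q]))"
proof -
  have m: "0 < q" "r = right_type (p i) (p (i + q))" using max by (auto simp: maximal_def)
  have r: "r = A \<or> r = B" unfolding m(2) by (simp add: right_type_def)
  show ?thesis
  proof (cases "q = 1")
    case True
    have f: "follows (p i) (p (Suc i))" by (rule p_follows)
    have U: "p [i \<rightarrow> i + q] = [p i]" using True by simp
    have rt: "r = right_type (p i) (p (Suc i))" using m(2) True by simp
    show ?thesis
    proof (cases i)
      case 0
      then have "l = Edge" "p i = T0" using max p_0 by (simp_all add: maximal_def)
      then show ?thesis unfolding U using one(1)[of l r] r by simp
    next
      case (Suc j)
      then have l: "l = left_type (p j) (p i)" using max True by (auto simp: maximal_def)
      have "follows (p j) (p i)" unfolding Suc by (rule p_follows)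
      then show ?thesis unfolding U using one f l rt r
        by (cases "p j"; cases "p i"; cases "p (Suc i)")
          (simp_all add: left_type_def right_type_def doubleton_eq_iff)
    qed
  next
    case False
    then have le: "i + 2 \<le> i + q" using m(1) by simp
    have "p [i \<rightarrow> i + 2] = [p i] @ [p (Suc i)]" by (simp add: subsequence_def numeral_eq_Suc)
    then have "p [i \<rightarrow> i + q] = [p i] @ [p (Suc i)] @ p [i + 2 \<rightarrow> i + q]"
      using segment_append[OF _ le, of i p] by simp
    then have "weight g k [p i] + weight g k [p (Suc i)] \<le> weight g k (p [i \<rightarrow> i + q])"
      using weight_nonneg[of g k "p [i + 2 \<rightarrow> i + q]"] by (simp only: weight_append)
    then show ?thesis using two[OF p_follows r] mono by blast
  qed
qed

text \<open>In this definition and the next three, the values are the lengths to which two blocks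
  agree from their right ends, or from their left ends when continued by the following blocks,
  according to the type of the mismatched letters. Type \<open>C\<close> does not occur on the
  right.\<close>

fun nu_left :: "side \<Rightarrow> nat" where
  "nu_left Edge = 0" | "nu_left A = 0" | "nu_left B = 1" | "nu_left C = 0"

fun nu_right :: "side \<Rightarrow> nat" where
  "nu_right Edge = 0" | "nu_right A = 2" | "nu_right B = 1" | "nu_right C = 0"

fun mu'_left :: "side \<Rightarrow> nat" where
  "mu'_left Edge = 0" | "mu'_left A = 2" | "mu'_left B = 4" | "mu'_left C = 2"

fun mu'_right :: "side \<Rightarrow> nat" where
  "mu'_right Edge = 0" | "mu'_right A = 8" | "mu'_right B = 4" | "mu'_right C = 0"

lemma weight_0 [simp]: "weight g 0 [x] = int (length (g x))"
  by (simp add: weight_def)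

text \<open>
  Each of these combinations satisfies the recurrence of the weights and is increasing from the
  stated index on; its earlier values are computed.
\<close>

lemma combination_bound:
  assumes "0 \<le> combination g a b c m" "combination g a b c m \<le> combination g a b c (Suc m)"
    "combination g a b c (Suc m) \<le> combination g a b c (Suc (Suc m))"
    and "d \<le> combination g a b c m" "list_all (\<lambda>n. d \<le> combination g a b c n) [0..<m]"
  shows "d \<le> a * weight g k [T0] + b * weight g k [T1] + c * weight g k [T2]"
proof (cases "m \<le> k")
  case True
  then show ?thesis using combination_mono[OF assms(1-3) True] assms(4) by (simp add: combination_def)
qed (use assms(5) in \<open>auto simp: combination_def list_all_iff\<close>)

lemma nu_weights:
  "2 \<le> weight nu k [T2]" "weight nu k [T0] + 1 \<le> 2 * weight nu k [T2]"
  "weight nu k [T2] \<le> weight nu k [T1] + 1" "weight nu k [T1] \<le> weight nu k [T0]"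
  "weight nu k [T2] \<le> weight nu k [T0]"
  "3 \<le> weight nu k [T0]"
  using combination_bound[of nu 1 0 0 0 3 k] combination_bound[of nu 1 0 "-1" 0 0 k] combination_bound[of nu 0 0 1 0 2 k] combination_bound[of nu "-1" 0 2 3 1 k]
    combination_bound[of nu 0 1 "-1" 1 "-1" k] combination_bound[of nu 1 "-1" 0 1 0 k]
  by (auto simp: combination_def weight_Suc numeral_eq_Suc less_Suc_eq)

text \<open>These combinations arise from \<open>base\<close> for a period of one letter by
  collecting the weights: for \<open>T2\<close> with left type \<open>B\<close> or \<open>C\<close>,
  for \<open>T1\<close> with \<open>A\<close>, and for \<open>T1\<close> with \<open>C\<close>. The
  first takes the value -2 at level 2, exactly what even levels require, so \<open>base\<close>
  leaves no room there.\<close>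

lemma nu_combinations:
  "(if even k then - 2 else - 3) \<le> combination nu (- 2) (- 4) 9 k"
  "(if even k then - 9 else - 6) \<le> combination nu (- 4) 7 (- 2) k"
  "k \<noteq> 0 \<Longrightarrow> 7 \<le> combination nu (- 2) 11 (- 6) k"
proof -
  show "7 \<le> combination nu (- 2) 11 (- 6) k" if "k \<noteq> 0"
    using combination_mono[of nu "- 2" 11 "- 6" 1 k] that
    by (simp add: combination_def weight_Suc numeral_eq_Suc)
  have "k < 4 \<or> 3 \<le> combination nu (- 2) (- 4) 9 k"
    using combination_mono[of nu "- 2" "- 4" 9 4 k]
    by (cases "k < 4") (simp_all add: combination_def weight_Suc numeral_eq_Suc)
  then have "k = 0 \<or> k = 1 \<or> k = 2 \<or> k = 3 \<or> 3 \<le> combination nu (- 2) (- 4) 9 k" by (elim disjE) linarith+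
  moreover have
    "combination nu (- 2) (- 4) 9 0 = 8"
    "combination nu (- 2) (- 4) 9 1 = 7"
    "combination nu (- 2) (- 4) 9 2 = -2"
    "combination nu (- 2) (- 4) 9 3 = -3"
    by (simp_all add: combination_def weight_Suc numeral_eq_Suc)
  ultimately show "(if even k then - 2 else - 3) \<le> combination nu (- 2) (- 4) 9 k"
    by (elim disjE) simp_all
  have "k < 5 \<or> 1 \<le> combination nu (- 4) 7 (- 2) k"
    using combination_mono[of nu "- 4" 7 "- 2" 5 k]
    by (cases "k < 5") (simp_all add: combination_def weight_Suc numeral_eq_Suc)
  then have "k = 0 \<or> k = 1 \<or> k = 2 \<or> k = 3 \<or> k = 4 \<or> 1 \<le> combination nu (- 4) 7 (- 2) k" by (elim disjE) linarith+
  moreover have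
    "combination nu (- 4) 7 (- 2) 0 = -9"
    "combination nu (- 4) 7 (- 2) 1 = -1"
    "combination nu (- 4) 7 (- 2) 2 = 6"
    "combination nu (- 4) 7 (- 2) 3 = 4"
    "combination nu (- 4) 7 (- 2) 4 = 1"
    by (simp_all add: combination_def weight_Suc numeral_eq_Suc)
  ultimately show "(if even k then - 9 else - 6) \<le> combination nu (- 4) 7 (- 2) k"
    by (elim disjE) simp_all
qed

lemma mu'_weights:
  "2 \<le> weight mu' k [T2]" "weight mu' k [T0] + 1 \<le> 2 * weight mu' k [T2]"
  "weight mu' k [T2] \<le> weight mu' k [T1] + 1" "weight mu' k [T1] \<le> weight mu' k [T0]"
  "weight mu' k [T2] \<le> weight mu' k [T0]"
  "3 \<le> weight mu' k [T0]"
  using combination_bound[of mu' 1 0 0 0 3 k] combination_bound[of mu' 1 0 "-1" 0 0 k] combination_bound[of mu' 0 0 1 0 2 k] combination_bound[of mu' "-1" 0 2 2 1 k]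
    combination_bound[of mu' 0 1 "-1" 1 "-1" k] combination_bound[of mu' 1 "-1" 0 1 0 k]
  by (auto simp: combination_def weight_Suc numeral_eq_Suc less_Suc_eq)

text \<open>Obtained from \<open>base\<close> as for \<open>nu\<close>. Here it is the second
  combination that leaves no room: at level 1 it takes the value 11, which is what odd levels
  require.\<close>

lemma mu'_combinations:
  "22 \<le> combination mu' (- 11) (- 22) 52 k"
  "(if even k then - 81 else 11) \<le> combination mu' (- 22) 41 (- 11) k"
  "k \<noteq> 0 \<Longrightarrow> 198 \<le> combination mu' (- 11) 63 (- 33) k"
proof -
  show "198 \<le> combination mu' (- 11) 63 (- 33) k" if "k \<noteq> 0"
    using combination_mono[of mu' "- 11" 63 "- 33" 1 k] that
    by (simp add: combination_def weight_Suc numeral_eq_Suc)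
  have "k < 2 \<or> 32 \<le> combination mu' (- 11) (- 22) 52 k"
    using combination_mono[of mu' "- 11" "- 22" 52 2 k]
    by (cases "k < 2") (simp_all add: combination_def weight_Suc numeral_eq_Suc)
  then have "k = 0 \<or> k = 1 \<or> 32 \<le> combination mu' (- 11) (- 22) 52 k" by (elim disjE) linarith+
  moreover have
    "combination mu' (- 11) (- 22) 52 0 = 92"
    "combination mu' (- 11) (- 22) 52 1 = 113"
    by (simp_all add: combination_def weight_Suc)
  ultimately show "22 \<le> combination mu' (- 11) (- 22) 52 k" by auto
  have "k < 1 \<or> 11 \<le> combination mu' (- 22) 41 (- 11) k"
    using combination_mono[of mu' "- 22" 41 "- 11" 1 k]
    by (cases "k < 1") (simp_all add: combination_def weight_Suc numeral_eq_Suc)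
  moreover have "combination mu' (- 22) 41 (- 11) 0 = - 81" by (simp add: combination_def)
  ultimately show "(if even k then - 81 else 11) \<le> combination mu' (- 22) 41 (- 11) k"
    by (elim disjE) simp_all
qed

text \<open>The first flip sends both \<open>B\<close> and \<open>C\<close> to \<open>A\<close>, so
  their corrections differ at level 0 only.\<close>

lemma nu_corrections:
  defines "L \<equiv> \<lambda>k s. 5 * int (nu_left ((flip ^^ k) s)) - left_potential nu 0 ((flip ^^ k) s)"
    and "R \<equiv> \<lambda>k s. 5 * int (nu_right ((flip ^^ k) s)) - right_potential nu 0 ((flip ^^ k) s)"
  shows "L k Edge = 0" "L k A = (if even k then - 8 else - 2)" "L k B = (if even k then - 2 else - 8)"
    "L k C = (if k = 0 then - 7 else if even k then - 2 else - 8)"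
    "R k A = (if even k then - 1 else 1)" "R k B = (if even k then 1 else - 1)"
  by (simp_all add: L_def R_def flip_pow)

lemma mu'_corrections:
  defines "L \<equiv> \<lambda>k s. 5 * int (mu'_left ((flip ^^ k) s)) - left_potential mu' 0 ((flip ^^ k) s)"
    and "R \<equiv> \<lambda>k s. 5 * int (mu'_right ((flip ^^ k) s)) - right_potential mu' 0 ((flip ^^ k) s)"
  shows "L k Edge = 0" "L k A = (if even k then - 19 else - 1)" "L k B = (if even k then - 1 else - 19)"
    "L k C = (if k = 0 then - 11 else if even k then - 1 else - 19)"
    "R k A = (if even k then 2 else 3)" "R k B = (if even k then 3 else 2)"
  by (simp_all add: L_def R_def flip_pow)

text \<open>The constants express the exponent 5/2, since 15 / (2 * 5) = 5/2 - 1.\<close>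

interpretation nu: bounded_exponent nu 2 15 nu_left nu_right
proof
  show "nu x \<noteq> []" for x by (rule nu_nonerasing)
  have right: "morph_word nu p (pos nu n + t) = (nu (p n) @ nu (p (Suc n))) ! t" if "t \<le> 2" for n t
    using that p_follows[of n] block_nth_Suc[where h = nu and i = t and n = n] nu_nonerasing
    by (cases "p n"; cases "p (Suc n)") simp_all
  show "\<exists>t \<le> nu_right (right_type (p m) (p n)). morph_word nu p (pos nu m + t) \<noteq> morph_word nu p (pos nu n + t)"
    if "p m \<noteq> p n" for m n
    using that p_follows[of m] p_follows[of n] right[of 1 m] right[of 1 n] right[of 2 m] right[of 2 n]
    by (intro exI[of _ "nu_right (right_type (p m) (p n))"],
      cases "p m"; cases "p n"; cases "p (Suc m)"; cases "p (Suc n)")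
      (simp_all add: right_type_def doubleton_eq_iff)
  have left: "morph_word nu p (pos nu (Suc n) - Suc t) = rev (nu (p n)) ! t" if "t < length (nu (p n))" for n t
    using that block_nth_rev[where h = nu and i = t and n = n] nu_nonerasing by simp
  show "\<exists>t \<le> nu_left (left_type (p m) (p n)). Suc t \<le> pos nu (Suc m) \<and> Suc t \<le> pos nu (Suc n) \<and>
      morph_word nu p (pos nu (Suc m) - Suc t) \<noteq> morph_word nu p (pos nu (Suc n) - Suc t)"
    if "p m \<noteq> p n" for m n
    using that left[of 0 m] left[of 0 n] left[of 1 m] left[of 1 n]
    by (intro exI[of _ "if {p m, p n} = {T0, T2} then 1 else 0"], cases "p m"; cases "p n")
      (simp_all add: left_type_def doubleton_eq_iff pos_Suc)
  show "2 * (left_potential nu k l + right_potential nu k r +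
        (5 * int (nu_left ((flip ^^ k) l)) - left_potential nu 0 ((flip ^^ k) l)) +
        (5 * int (nu_right ((flip ^^ k) r)) - right_potential nu 0 ((flip ^^ k) r)))
      \<le> 15 * weight nu k (p [i \<rightarrow> i + q])"
    if "maximal q i i l r" for q i l r k
  proof (rule base_cases[OF that])
    note w = nu_weights[of k]
    fix l r :: side assume r: "r = A \<or> r = B"
    have l: "l = Edge \<or> l = A \<or> l = B \<or> l = C" by (cases l) simp_all
    show "2 * (left_potential nu k l + right_potential nu k r +
        (5 * int (nu_left ((flip ^^ k) l)) - left_potential nu 0 ((flip ^^ k) l)) +
        (5 * int (nu_right ((flip ^^ k) r)) - right_potential nu 0 ((flip ^^ k) r)))
      \<le> 15 * (weight nu k [x] + weight nu k [y])" if "follows x y" for x y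
    proof -
      \<comment> \<open>Among the adjacent pairs, \<open>T1\<close> with \<open>T2\<close> is the
        lightest.\<close>
      have "weight nu k [T1] + weight nu k [T2] \<le> weight nu k [x] + weight nu k [y]"
        using \<open>follows x y\<close> w by (cases x; cases y) simp_all
      with w r l show ?thesis
        by - (elim disjE; simp only: simp_thms left_potential.simps right_potential.simps nu_corrections;
            cases "even k"; cases "k = 0"; simp only: simp_thms if_True if_False ring_distribs add_0_left; linarith)
    qed
    assume l: "l = Edge \<or> l = A"
    show "2 * (left_potential nu k l + right_potential nu k r +
        (5 * int (nu_left ((flip ^^ k) l)) - left_potential nu 0 ((flip ^^ k) l)) +
        (5 * int (nu_right ((flip ^^ k) r)) - right_potential nu 0 ((flip ^^ k) r)))
      \<le> 15 * weight nu k [T0]"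
      using l
    proof (elim disjE)
      assume l: "l = Edge"
      show ?thesis using r unfolding l
        by (elim disjE; simp only: simp_thms left_potential.simps right_potential.simps nu_corrections; insert w; cases "even k"; simp only: even_Suc if_True if_False not_True_eq_False not_False_eq_True ring_distribs add_0_left; linarith)
    next
      assume l: "l = A"
      \<comment> \<open>\<open>T0\<close> at level \<open>k\<close> weighs the same as
        \<open>T2\<close> at level \<open>Suc k\<close>, so the combination for \<open>T2\<close> is
        used one level up.\<close>
      show ?thesis using r unfolding l
        by (elim disjE; simp only: simp_thms left_potential.simps right_potential.simps nu_corrections; insert w nu_combinations(1)[of "Suc k", unfolded combination_def weight_Suc]; cases "even k"; simp only: even_Suc if_True if_False not_True_eq_False not_False_eq_True ring_distribs add_0_left; linarith)
    qed
  next
    note w = nu_weights[of k]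
    show "2 * (left_potential nu k l + right_potential nu k B +
        (5 * int (nu_left ((flip ^^ k) l)) - left_potential nu 0 ((flip ^^ k) l)) +
        (5 * int (nu_right ((flip ^^ k) B)) - right_potential nu 0 ((flip ^^ k) B)))
      \<le> 15 * weight nu k [T1]" if "l = A \<or> l = C" for l
      using that
    proof (elim disjE)
      assume l: "l = A"
      show ?thesis unfolding l left_potential.simps right_potential.simps nu_corrections
        using w nu_combinations(2)[of k, unfolded combination_def]
        by (cases "even k"; simp only: even_Suc if_True if_False not_True_eq_False not_False_eq_True ring_distribs add_0_left; linarith)
    next
      assume l: "l = C"
      show ?thesis
      \<comment> \<open>At level 0 type \<open>C\<close> has not been flipped and has a correction
        of its own.\<close>
      proof (cases "k = 0")
        case False
        then show ?thesis unfolding l left_potential.simps right_potential.simps nu_corrections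
          using w nu_combinations(3)[of k, unfolded combination_def, OF False]
          by (cases "even k"; simp only: even_Suc if_True if_False not_True_eq_False not_False_eq_True ring_distribs add_0_left; linarith)
      qed (simp add: l)
    qed
    show "2 * (left_potential nu k l + right_potential nu k B +
        (5 * int (nu_left ((flip ^^ k) l)) - left_potential nu 0 ((flip ^^ k) l)) +
        (5 * int (nu_right ((flip ^^ k) B)) - right_potential nu 0 ((flip ^^ k) B)))
      \<le> 15 * weight nu k [T2]" if "l = B \<or> l = C" for l
      using that
    proof (elim disjE)
      assume l: "l = B"
      show ?thesis unfolding l left_potential.simps right_potential.simps nu_corrections
        using w nu_combinations(1)[of k, unfolded combination_def]
        by (cases "even k"; simp only: even_Suc if_True if_False not_True_eq_False not_False_eq_True ring_distribs add_0_left; linarith)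
    next
      assume l: "l = C"
      show ?thesis
      proof (cases "k = 0")
        case False
        then show ?thesis unfolding l left_potential.simps right_potential.simps nu_corrections
          using w nu_combinations(1)[of k, unfolded combination_def]
          by (cases "even k"; simp only: even_Suc if_True if_False not_True_eq_False not_False_eq_True ring_distribs add_0_left; linarith)
      qed (simp add: l)
    qed
  qed simp
qed simp

text \<open>The constants express the exponent 28/11, since 85 / (11 * 5) = 28/11 - 1.\<close>

interpretation mu': bounded_exponent mu' 11 85 mu'_left mu'_right
proof
  show "mu' x \<noteq> []" for x by (rule mu'_nonerasing)
  have right: "morph_word mu' p (pos mu' n + t) = (mu' (p n) @ mu' (p (Suc n))) ! t" if "t \<le> 8" for n t
    using that p_follows[of n] block_nth_Suc[where h = mu' and i = t and n = n] mu'_nonerasing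
    by (cases "p n"; cases "p (Suc n)") simp_all
  show "\<exists>t \<le> mu'_right (right_type (p m) (p n)). morph_word mu' p (pos mu' m + t) \<noteq> morph_word mu' p (pos mu' n + t)"
    if "p m \<noteq> p n" for m n
    using that p_follows[of m] p_follows[of n] right[of 4 m] right[of 4 n] right[of 8 m] right[of 8 n]
    by (intro exI[of _ "mu'_right (right_type (p m) (p n))"],
      cases "p m"; cases "p n"; cases "p (Suc m)"; cases "p (Suc n)")
      (simp_all add: right_type_def doubleton_eq_iff)
  have left: "morph_word mu' p (pos mu' (Suc n) - Suc t) = rev (mu' (p n)) ! t" if "t < length (mu' (p n))" for n t
    using that block_nth_rev[where h = mu' and i = t and n = n] mu'_nonerasing by simp
  have le: "5 \<le> length (mu' x)" for x by (cases x) simp_all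
  show "\<exists>t \<le> mu'_left (left_type (p m) (p n)). Suc t \<le> pos mu' (Suc m) \<and> Suc t \<le> pos mu' (Suc n) \<and>
      morph_word mu' p (pos mu' (Suc m) - Suc t) \<noteq> morph_word mu' p (pos mu' (Suc n) - Suc t)"
    if "p m \<noteq> p n" for m n
    using that left[of 2 m] left[of 2 n] left[of 4 m] left[of 4 n] le[of "p m"] le[of "p n"]
    by (intro exI[of _ "if {p m, p n} = {T0, T2} then 4 else 2"], cases "p m"; cases "p n")
      (simp_all add: left_type_def doubleton_eq_iff pos_Suc)
  show "11 * (left_potential mu' k l + right_potential mu' k r +
        (5 * int (mu'_left ((flip ^^ k) l)) - left_potential mu' 0 ((flip ^^ k) l)) +
        (5 * int (mu'_right ((flip ^^ k) r)) - right_potential mu' 0 ((flip ^^ k) r)))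
      \<le> 85 * weight mu' k (p [i \<rightarrow> i + q])"
    if "maximal q i i l r" for q i l r k
  proof (rule base_cases[OF that])
    note w = mu'_weights[of k]
    fix l r :: side assume r: "r = A \<or> r = B"
    have l: "l = Edge \<or> l = A \<or> l = B \<or> l = C" by (cases l) simp_all
    show "11 * (left_potential mu' k l + right_potential mu' k r +
        (5 * int (mu'_left ((flip ^^ k) l)) - left_potential mu' 0 ((flip ^^ k) l)) +
        (5 * int (mu'_right ((flip ^^ k) r)) - right_potential mu' 0 ((flip ^^ k) r)))
      \<le> 85 * (weight mu' k [x] + weight mu' k [y])" if "follows x y" for x y
    proof -
      have "weight mu' k [T1] + weight mu' k [T2] \<le> weight mu' k [x] + weight mu' k [y]"
        using \<open>follows x y\<close> w by (cases x; cases y) simp_all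
      with w r l show ?thesis
        by - (elim disjE; simp only: simp_thms left_potential.simps right_potential.simps mu'_corrections;
            cases "even k"; cases "k = 0"; simp only: simp_thms if_True if_False ring_distribs add_0_left; linarith)
    qed
    assume l: "l = Edge \<or> l = A"
    show "11 * (left_potential mu' k l + right_potential mu' k r +
        (5 * int (mu'_left ((flip ^^ k) l)) - left_potential mu' 0 ((flip ^^ k) l)) +
        (5 * int (mu'_right ((flip ^^ k) r)) - right_potential mu' 0 ((flip ^^ k) r)))
      \<le> 85 * weight mu' k [T0]"
      using l
    proof (elim disjE)
      assume l: "l = Edge"
      show ?thesis using r unfolding l
        by (elim disjE; simp only: simp_thms left_potential.simps right_potential.simps mu'_corrections; insert w; cases "even k"; simp only: even_Suc if_True if_False not_True_eq_False not_False_eq_True ring_distribs add_0_left; linarith)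
    next
      assume l: "l = A"
      show ?thesis using r unfolding l
        by (elim disjE; simp only: simp_thms left_potential.simps right_potential.simps mu'_corrections; insert w mu'_combinations(1)[of "Suc k", unfolded combination_def weight_Suc]; cases "even k"; simp only: even_Suc if_True if_False not_True_eq_False not_False_eq_True ring_distribs add_0_left; linarith)
    qed
  next
    note w = mu'_weights[of k]
    show "11 * (left_potential mu' k l + right_potential mu' k B +
        (5 * int (mu'_left ((flip ^^ k) l)) - left_potential mu' 0 ((flip ^^ k) l)) +
        (5 * int (mu'_right ((flip ^^ k) B)) - right_potential mu' 0 ((flip ^^ k) B)))
      \<le> 85 * weight mu' k [T1]" if "l = A \<or> l = C" for l
      using that
    proof (elim disjE)
      assume l: "l = A"
      show ?thesis unfolding l left_potential.simps right_potential.simps mu'_corrections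
        using w mu'_combinations(2)[of k, unfolded combination_def]
        by (cases "even k"; simp only: even_Suc if_True if_False not_True_eq_False not_False_eq_True ring_distribs add_0_left; linarith)
    next
      assume l: "l = C"
      show ?thesis
      proof (cases "k = 0")
        case False
        then show ?thesis unfolding l left_potential.simps right_potential.simps mu'_corrections
          using w mu'_combinations(3)[of k, unfolded combination_def, OF False]
          by (cases "even k"; simp only: even_Suc if_True if_False not_True_eq_False not_False_eq_True ring_distribs add_0_left; linarith)
      qed (simp add: l)
    qed
    show "11 * (left_potential mu' k l + right_potential mu' k B +
        (5 * int (mu'_left ((flip ^^ k) l)) - left_potential mu' 0 ((flip ^^ k) l)) +
        (5 * int (mu'_right ((flip ^^ k) B)) - right_potential mu' 0 ((flip ^^ k) B)))
      \<le> 85 * weight mu' k [T2]" if "l = B \<or> l = C" for l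
      using that
    proof (elim disjE)
      assume l: "l = B"
      show ?thesis unfolding l left_potential.simps right_potential.simps mu'_corrections
        using w mu'_combinations(1)[of k, unfolded combination_def]
        by (cases "even k"; simp only: even_Suc if_True if_False not_True_eq_False not_False_eq_True ring_distribs add_0_left; linarith)
    next
      assume l: "l = C"
      show ?thesis
      proof (cases "k = 0")
        case False
        then show ?thesis unfolding l left_potential.simps right_potential.simps mu'_corrections
          using w mu'_combinations(1)[of k, unfolded combination_def]
          by (cases "even k"; simp only: even_Suc if_True if_False not_True_eq_False not_False_eq_True ring_distribs add_0_left; linarith)
      qed (simp add: l)
    qed
  qed simp
qed simp

section \<open>Short factors of the two words\<close>

lemma factors_p_cover_pow: "v \<in> factors p \<Longrightarrow> \<exists>u \<in> factors p. \<exists>a b. (morph phi ^^ k) u = a @ v @ b"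
proof (induction k arbitrary: v)
  case 0
  then have "v \<in> factors p \<and> (morph phi ^^ 0) v = [] @ v @ []" by simp
  then show ?case by blast
next
  case (Suc k)
  obtain u a b where u: "u \<in> factors p" "morph phi u = a @ v @ b" using factors_p_cover[OF Suc.prems] by blast
  obtain u' a' b' where u': "u' \<in> factors p" "(morph phi ^^ k) u' = a' @ u @ b'" using Suc.IH[OF u(1)] by blast
  have "(morph phi ^^ Suc k) u' = (morph phi a' @ a) @ v @ (b @ morph phi b')"
    by (simp add: u'(2) u(2) morph_append)
  with u'(1) show ?case by blast
qed

text \<open>To meet three blocks a word would have to contain the middle one and a letter on either
  side of it, and so be longer than the bound permits.\<close>

lemma factor_in_two_blocks:
  assumes h: "\<And>x. h x \<noteq> []" and v: "v \<in> factors (morph_word h p)" "\<And>x. length v \<le> Suc (length (h x))"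
  shows "\<exists>x y. follows x y \<and> contains v (h x @ h y)"
proof -
  obtain i n where i: "v = morph_word h p [i \<rightarrow> i + n]"
  proof -
    obtain i j where "v = morph_word h p [i \<rightarrow> j]" using v(1) by (auto simp: factors_def)
    then show ?thesis using that[of i "j - i"] by (simp add: subsequence_def) (cases "i \<le> j"; simp)
  qed
  then have n: "length v = n" by simp
  obtain a t where a: "i = pos h a + t" "t < length (h (p a))" using in_block[where h = h] h by blast
  let ?w = "h (p a) @ h (p (Suc a))"
  have "v = take n (drop t ?w)"
  proof (rule nth_equalityI)
    show "length v = length (take n (drop t ?w))" using n v(2)[of "p (Suc a)"] a(2) by simp
    fix s assume s: "s < length v"
    then have "v ! s = morph_word h p (pos h a + (t + s))" using i n a by (simp add: add.assoc)
    also have "\<dots> = ?w ! (t + s)"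
      using s v(2)[of "p (Suc a)"] a(2) h by (intro block_nth_Suc[where h = h]) simp_all
    finally show "v ! s = take n (drop t ?w) ! s" using s n a(2) by (simp del: take_append drop_append)
  qed
  then have "?w = take t ?w @ v @ drop n (drop t ?w)" by (metis append_take_drop_id)
  then show ?thesis unfolding contains_iff using p_follows by blast
qed

text \<open>The images of all adjacent pairs at level \<open>k\<close>. They contain every factor
  that is at most one letter longer than the shortest image of a letter, which makes statements
  about short factors computable.\<close>

definition pair_words :: "(letter \<Rightarrow> 'b list) \<Rightarrow> nat \<Rightarrow> 'b list list" where
  "pair_words g k = map (\<lambda>v. morph g ((morph phi ^^ k) v)) [[T0, T1], [T0, T2], [T1, T0], [T1, T2], [T2, T1]]"

lemma factor_in_pair_words:
  assumes g: "\<And>x. g x \<noteq> []" and v: "v \<in> factors (morph_word g p)"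
    "\<And>x. length v \<le> Suc (length (morph g ((morph phi ^^ k) [x])))"
  shows "list_ex (contains v) (pair_words g k)"
proof -
  \<comment> \<open>The composition of \<open>g\<close> with \<open>k\<close> applications of
    \<open>phi\<close> is read as a single morphism.\<close>
  let ?h = "\<lambda>x. morph g ((morph phi ^^ k) [x])"
  have pair: "morph g ((morph phi ^^ k) [x, y]) = ?h x @ ?h y" for x y
    using morph_pow_append[where h = phi and n = k and u = "[x]" and v = "[y]"] by (simp add: morph_append)
  have h: "morph ?h u = morph g ((morph phi ^^ k) u)" for u
  proof (induction u)
    case Nil
    have "(morph phi ^^ k) [] = []" by (induction k) simp_all
    then show ?case by simp
  next
    case (Cons x u)
    then show ?case using morph_pow_append[where h = phi and n = k and u = "[x]" and v = u] by (simp add: morph_append)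
  qed
  have ne: "?h x \<noteq> []" for x
  proof -
    have "1 \<le> length ((morph phi ^^ k) [x])" using length_phi_pow_ge[where w = "[x]" and n = k] by simp
    also have "\<dots> \<le> length (?h x)" using length_morph_ge[of g] g by blast
    finally show ?thesis by auto
  qed
  obtain u a b where u: "u \<in> factors p" "morph g u = a @ v @ b" using v(1) factors_morph_word[of g v p] g by blast
  obtain u' a' b' where u': "u' \<in> factors p" "(morph phi ^^ k) u' = a' @ u @ b'"
    using factors_p_cover_pow[OF u(1)] by blast
  have "morph ?h u' = (morph g a' @ a) @ v @ (b @ morph g b')"
    unfolding h u'(2) by (simp add: morph_append u(2))
  then have "v \<in> factors (morph_word ?h p)" using factors_morph_word[where h = ?h and v = v and w = p] ne u'(1) by blast
  then obtain x y where xy: "follows x y" "contains v (?h x @ ?h y)"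
    using factor_in_two_blocks[of ?h v] ne v(2) by blast
  then have "morph g ((morph phi ^^ k) [x, y]) \<in> set (pair_words g k)"
    by (cases x; cases y) (simp_all add: pair_words_def)
  then show ?thesis using xy(2) unfolding list_ex_iff pair by blast
qed

lemma pair_words_factors:
  assumes "\<And>x. g x \<noteq> []" "list_ex (contains v) (pair_words g k)" shows "v \<in> factors (morph_word g p)"
proof -
  obtain u a b where "u \<in> factors p" "morph g ((morph phi ^^ k) u) = a @ v @ b"
    using assms(2) factors_p_pair by (auto simp: pair_words_def list_ex_iff contains_iff)
  then show ?thesis using factors_morph_word[of g v p] assms(1) factors_p_pow by blast
qed

fun repetitive :: "nat \<Rightarrow> nat \<Rightarrow> 'a list \<Rightarrow> bool" where
  "repetitive q e [] \<longleftrightarrow> False"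
| "repetitive q e (x # xs) \<longleftrightarrow> agree e (x # xs) (drop q (x # xs)) \<or> repetitive q e xs"

lemma repetitive_append: "repetitive q e v \<Longrightarrow> repetitive q e (u @ v)"
  by (induction u) simp_all

lemma repetitive_if_contains:
  assumes "contains v w" "length v = q + e" "0 < q" "\<And>i. i < e \<Longrightarrow> v ! i = v ! (i + q)"
  shows "repetitive q e w"
proof -
  obtain a b where w: "w = a @ v @ b" using assms(1) unfolding contains_iff by blast
  obtain x xs where x: "v @ b = x # xs" using assms(2,3) by (cases "v @ b") auto
  have "take e (v @ b) = take e (drop q (v @ b))"
    using assms by (intro nth_equalityI) (auto simp: nth_append add.commute)
  then have "agree e (v @ b) (drop q (v @ b))" using assms(2) by (simp add: agree_iff)
  then have "repetitive q e (v @ b)" unfolding x by simp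
  then show ?thesis unfolding w by (rule repetitive_append)
qed

lemma power_plus_free_if_windows:
  assumes "\<And>q i e. 0 < q \<Longrightarrow> i < e \<Longrightarrow> matches w q i e \<Longrightarrow> (e - i) / q \<le> \<alpha> - 1" "1 \<le> \<alpha>"
  shows "power_plus_free \<alpha> (factors w)"
  unfolding power_plus_free_iff
proof (intro ballI allI impI)
  fix v q assume v: "v \<in> factors w" and q: "0 < q" and per: "\<forall>i. i + q < length v \<longrightarrow> v ! i = v ! (i + q)"
  show "length v / q \<le> \<alpha>"
  proof (cases "length v \<le> q")
    case True
    then have "length v / q \<le> 1" using q by simp
    then show ?thesis using assms(2) by linarith
  next
    case False
    obtain i j where v: "v = w [i \<rightarrow> j]" using v by (auto simp: factors_def)
    have "matches w q i (j - q)"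
      unfolding matches_def
    proof (intro allI impI)
      fix s assume s: "i \<le> s \<and> s < j - q"
      moreover have "length v = j - i" using v by simp
      ultimately have "s - i + q < length v" by linarith
      then have "v ! (s - i) = v ! (s - i + q)" using per by blast
      moreover have "v ! (s - i) = w (i + (s - i))" "v ! (s - i + q) = w (i + (s - i + q))"
        unfolding v by (rule subsequence_nth, use s v \<open>s - i + q < length v\<close> in simp)+
      moreover have "i + (s - i + q) = s + q" "i + (s - i) = s" using s by simp_all
      ultimately show "w s = w (s + q)" by (simp only:)
    qed
    moreover have "i < j - q" using False v by simp
    ultimately have "(j - q - i) / q \<le> \<alpha> - 1" using assms(1) q by blast
    moreover have "real (length v) = real (j - q - i) + q" using False v by simp
    ultimately show ?thesis using q by (simp add: field_simps)
  qed
qed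

lemma segment_factor: "w [i \<rightarrow> j] \<in> factors w"
  by (auto simp: factors_def)

text \<open>Every block of \<open>nu\<close> contains exactly one 0, at its beginning.\<close>

lemma nu_cut: "\<not> morph_word nu p j \<longleftrightarrow> (\<exists>n. j = pos nu n)"
proof -
  obtain n t where n: "j = pos nu n + t" "t < length (nu (p n))" using in_block[where h = nu] nu_nonerasing by blast
  have block: "morph_word nu p (pos nu m + s) = nu (p m) ! s" if "s < length (nu (p m))" for m s
    using block_nth[where h = nu and i = s and n = m] nu_nonerasing that by blast
  have *: "\<not> morph_word nu p (pos nu m)" for m using block[of 0 m] by (cases "p m") simp_all
  have "t = 0" if "\<not> morph_word nu p j"
    using that block[of t n] n by (cases "p n"; cases t) (auto simp: less_Suc_eq)
  then show ?thesis using n * by auto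
qed

text \<open>The bound 17 is the length 15 of the longest palindrome plus the two letters of a
  possible extension.\<close>

lemma nu_short: "v \<in> factors (morph_word nu p) \<Longrightarrow> length v \<le> 17 \<Longrightarrow> list_ex (contains v) (pair_words nu 5)"
proof (rule factor_in_pair_words[OF nu_nonerasing])
  fix x assume "length v \<le> 17"
  moreover have "16 \<le> length (morph nu ((morph phi ^^ 5) [x]))" by (cases x) (simp_all add: numeral_eq_Suc)
  ultimately show "length v \<le> Suc (length (morph nu ((morph phi ^^ 5) [x])))" by linarith
qed

lemma nu_window:
  assumes "matches (morph_word nu p) q i e" "0 < q" "i < e"
  shows "2 * (e - i) \<le> 3 * q"
proof (cases "\<exists>j. i \<le> j \<and> j < e \<and> \<not> morph_word nu p j")
  case True
  then obtain j where j: "i \<le> j" "j < e" "\<not> morph_word nu p j" by blast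
  then have "\<not> morph_word nu p (j + q)" using assms(1) by (simp add: matches_def)
  then obtain a b where "j = pos nu a" "j + q = pos nu b" using j(3) nu_cut by metis
  then have "2 * (5 * (int e - int i)) \<le> 15 * int q" using nu.window_bound[OF assms(1,2), of a b] j by simp
  then show ?thesis using assms(3) by presburger
next
  \<comment> \<open>A window without 0 consists of 1s, and 111 is not a factor.\<close>
  case False
  then have T: "morph_word nu p j" if "i \<le> j" "j < e" for j using that by blast
  have "e < i + 3"
  proof (rule ccontr)
    assume "\<not> e < i + 3"
    then have "morph_word nu p [i \<rightarrow> i + 3] = [True, True, True]"
      using T by (simp add: subsequence_def numeral_eq_Suc)
    then have "list_ex (contains [True, True, True]) (pair_words nu 5)"
      using nu_short segment_factor[of "morph_word nu p" i "i + 3"] by simp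
    moreover have "\<not> list_ex (contains [True, True, True]) (pair_words nu 5)" by code_simp
    ultimately show False by simp
  qed
  moreover have "e \<noteq> i + 2" if "q = 1"
  proof
    assume e: "e = i + 2"
    then have "morph_word nu p [i \<rightarrow> i + 3] = [True, True, True]"
      using T[of i] T[of "Suc i"] assms(1) that by (simp add: subsequence_def numeral_eq_Suc matches_def)
    then have "list_ex (contains [True, True, True]) (pair_words nu 5)"
      using nu_short segment_factor[of "morph_word nu p" i "i + 3"] by simp
    moreover have "\<not> list_ex (contains [True, True, True]) (pair_words nu 5)" by code_simp
    ultimately show False by simp
  qed
  ultimately show ?thesis using assms(2,3) by linarith
qed

lemma nu_power_plus_free: "power_plus_free (5/2) (factors (morph_word nu p))"
proof (rule power_plus_free_if_windows)
  fix q i e assume w: "0 < q" "i < e" "matches (morph_word nu p) q i e"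
  then have "2 * (e - i) \<le> 3 * q" using nu_window by blast
  then have "real (2 * (e - i)) \<le> real (3 * q)" by (simp only: of_nat_le_iff)
  then show "(e - i) / q \<le> 5/2 - 1" using w(1) by (simp add: field_simps)
qed simp

text \<open>The values \<open>odd s\<close> spell the marker 0101. Every offset in a block followed
  by its successor is tested.\<close>

lemma mu'_cut:
  assumes "\<And>s. s < 4 \<Longrightarrow> morph_word mu' p (j + s) = odd s"
  shows "\<exists>n. j = pos mu' n"
proof -
  obtain n t where n: "j = pos mu' n + t" "t < length (mu' (p n))" using in_block[where h = mu'] mu'_nonerasing by blast
  have le: "5 \<le> length (mu' x)" for x by (cases x) simp_all
  have "(mu' (p n) @ mu' (p (Suc n))) ! (t + s) = odd s" if "s < 4" for s
    using block_nth_Suc[where h = mu' and i = "t + s" and n = n] mu'_nonerasing that n le[of "p (Suc n)"] assms[of s]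
    by (simp add: add.assoc)
  note odd = this[of 0] this[of 1] this[of 2] this[of 3]
  have "t < 10" using n(2) by (cases "p n") simp_all
  then have "t = 0 \<or> t = 1 \<or> t = 2 \<or> t = 3 \<or> t = 4 \<or> t = 5 \<or> t = 6 \<or> t = 7 \<or> t = 8 \<or> t = 9"
    by presburger
  then have "t = 0" using odd n(2) p_follows[of n]
    by (elim disjE; cases "p n"; cases "p (Suc n)"; simp)
  with n(1) show ?thesis by auto
qed

text \<open>The bound 18 is 7 + 11, the largest sum of period and excess in
  \<open>mu'_not_repetitive\<close>.\<close>

lemma mu'_short: "v \<in> factors (morph_word mu' p) \<Longrightarrow> length v \<le> 18 \<Longrightarrow> list_ex (contains v) (pair_words mu' 3)"
proof (rule factor_in_pair_words[OF mu'_nonerasing])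
  fix x assume "length v \<le> 18"
  moreover have "17 \<le> length (morph mu' ((morph phi ^^ 3) [x]))" by (cases x) (simp_all add: numeral_eq_Suc)
  ultimately show "length v \<le> Suc (length (morph mu' ((morph phi ^^ 3) [x])))" by linarith
qed

lemma mu'_short_window:
  assumes "matches (morph_word mu' p) q i e" "0 < q" "i + s \<le> e" "q + s \<le> 18"
  shows "list_ex (repetitive q s) (pair_words mu' 3)"
proof -
  let ?v = "morph_word mu' p [i \<rightarrow> i + (q + s)]"
  have "list_ex (contains ?v) (pair_words mu' 3)" using mu'_short[OF segment_factor] assms(4) by simp
  moreover have "?v ! j = ?v ! (j + q)" if "j < s" for j
    using assms(1,3) that by (simp add: matches_def add.assoc)
  ultimately show ?thesis using repetitive_if_contains[of ?v _ q s] assms(2) by (auto simp: list_ex_iff)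
qed

text \<open>For each period \<open>q\<close>, the number \<open>s\<close> is the least excess with
  \<open>17 * q < 11 * s\<close>.\<close>

lemma mu'_not_repetitive:
  "list_all (\<lambda>(q, s). \<not> list_ex (repetitive q s) (pair_words mu' 3))
    [(1, 2), (2, 4), (3, 5), (4, 7), (5, 8), (6, 10), (7, 11)]"
  by code_simp

lemma mu'_window:
  assumes "matches (morph_word mu' p) q i e" "0 < q" "i < e"
  shows "11 * (e - i) \<le> 17 * q"
\<comment> \<open>Blocks have at most 10 letters, so some cut lies at most 9 letters behind
  \<open>i\<close>, and 13 letters contain the marker that starts there.\<close>
proof (cases "i + 13 \<le> e")
  case True
  obtain n t where n: "i = pos mu' n + t" "t < length (mu' (p n))" using in_block[where h = mu'] mu'_nonerasing by blast
  define a where "a = (if t = 0 then n else Suc n)"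
  have "length (mu' (p n)) \<le> 10" by (cases "p n") simp_all
  then have a: "i \<le> pos mu' a" "pos mu' a + 4 \<le> e" using n True by (auto simp: a_def pos_Suc)
  have "morph_word mu' p (pos mu' a + q + s) = odd s" if "s < 4" for s
  proof -
    have "s < length (mu' (p a))" using that by (cases "p a") simp_all
    then have "morph_word mu' p (pos mu' a + s) = mu' (p a) ! s"
      using block_nth[where h = mu' and i = s and n = a] mu'_nonerasing by blast
    also have "\<dots> = odd s"
    proof -
      have "s = 0 \<or> s = 1 \<or> s = 2 \<or> s = 3" using that by linarith
      then show ?thesis by (elim disjE; cases "p a") simp_all
    qed
    finally show ?thesis using assms(1) a that by (simp add: matches_def add.commute add.left_commute)
  qed
  then obtain b where "pos mu' a + q = pos mu' b" using mu'_cut by blast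
  then have "11 * (5 * (int e - int i)) \<le> 85 * int q" using mu'.window_bound[OF assms(1,2), of a b] a by simp
  then show ?thesis using assms(3) by presburger
next
  case False
  show ?thesis
  proof (rule ccontr)
    assume long: "\<not> 11 * (e - i) \<le> 17 * q"
    have *: "e < i + s" if "(q, s) \<in> set [(1, 2), (2, 4), (3, 5), (4, 7), (5, 8), (6, 10), (7, 11)]" for s
    proof (rule ccontr)
      assume "\<not> e < i + s"
      moreover have "q + s \<le> 18" using that by auto
      ultimately have "list_ex (repetitive q s) (pair_words mu' 3)"
        using mu'_short_window[OF assms(1,2), of s] by simp
      then show False using mu'_not_repetitive that by (auto simp: list_all_iff)
    qed
    \<comment> \<open>The excess is at most 12, and \<open>11 * 12 < 17 * 8\<close>.\<close>
    have "q = 1 \<or> q = 2 \<or> q = 3 \<or> q = 4 \<or> q = 5 \<or> q = 6 \<or> q = 7" using long False assms(2) by linarith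
    then show False using long assms(3) *[of 2] *[of 4] *[of 5] *[of 7] *[of 8] *[of 10] *[of 11]
      by (elim disjE) simp_all
  qed
qed

lemma mu_power_plus_free: "power_plus_free (28/11) (factors (morph_word mu p))"
  unfolding factors_mu'[symmetric]
proof (rule power_plus_free_if_windows)
  fix q i e assume w: "0 < q" "i < e" "matches (morph_word mu' p) q i e"
  then have "11 * (e - i) \<le> 17 * q" using mu'_window by blast
  then have "real (11 * (e - i)) \<le> real (17 * q)" by (simp only: of_nat_le_iff)
  then show "(e - i) / q \<le> 28/11 - 1" using w(1) by (simp add: field_simps)
qed simp

subsection \<open>Palindromes\<close>

definition palindrome_list :: "'a list list \<Rightarrow> 'a list \<Rightarrow> 'a list list \<Rightarrow> bool" where
  "palindrome_list ws cs qs \<longleftrightarrow> [] \<in> set qs \<and>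
     list_all (\<lambda>c. [c] \<in> set qs) cs \<and> list_all (\<lambda>v. rev v = v \<and> list_ex (contains v) ws) qs \<and>
     list_all (\<lambda>v. list_all (\<lambda>c. c # v @ [c] \<in> set qs \<or> \<not> list_ex (contains (c # v @ [c])) ws) cs) qs"

text \<open>Stripping both end letters from a palindrome leaves a shorter one, so the list is
  complete as soon as no extension by two equal letters leads out of it. Only words two letters
  longer than the listed ones have to be examined, which explains the role of
  \<open>n\<close>.\<close>

lemma palindromes_eq:
  assumes "palindrome_list ws cs qs" "set cs = UNIV"
    and F: "\<And>v. list_ex (contains v) ws \<Longrightarrow> v \<in> F" "\<And>a v b. a @ v @ b \<in> F \<Longrightarrow> v \<in> F"
    and short: "\<And>v. v \<in> F \<Longrightarrow> length v \<le> n \<Longrightarrow> list_ex (contains v) ws" "list_all (\<lambda>v. length v + 2 \<le> n) qs"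
  shows "palindromes F = set qs"
proof
  show "set qs \<subseteq> palindromes F"
    using assms(1) F(1) unfolding palindrome_list_def palindromes_def by (auto simp: list_all_iff)
  have "v \<in> set qs" if "v \<in> F" "rev v = v" for v
    using that
  proof (induction "length v" arbitrary: v rule: less_induct)
    case less
    show ?case
    proof (cases v)
      case Nil
      then show ?thesis using assms(1) by (simp add: palindrome_list_def)
    next
      case (Cons c u)
      show ?thesis
      proof (cases u rule: rev_cases)
        case Nil
        then show ?thesis using Cons assms(1,2) by (simp add: palindrome_list_def list_all_iff)
      next
        case (snoc u' d)
        have "d = c \<and> rev u' = u'" using less.prems(2)[unfolded Cons snoc, simplified] by iprover
        then have v: "v = c # u' @ [c]" "rev u' = u'" unfolding Cons snoc by simp_all
        then have "u' \<in> F" using F(2)[of "[c]" u' "[c]"] less.prems(1) by simp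
        moreover have "length u' < length v" by (simp add: v(1))
        ultimately have u': "u' \<in> set qs" using less.hyps v(2) by blast
        then have "length v \<le> n" using short(2) v(1) by (auto simp: list_all_iff)
        then have "list_ex (contains v) ws" using short(1) less.prems(1) by blast
        moreover have "c \<in> set cs" using assms(2) by simp
        ultimately show ?thesis using assms(1) u' unfolding palindrome_list_def v(1) list_all_iff by blast
      qed
    qed
  qed
  then show "palindromes F \<subseteq> set qs" by (auto simp: palindromes_def)
qed

lemma bool_list_UNIV: "set [False, True] = UNIV"
  by (simp add: UNIV_bool insert_commute)

definition mu_palindromes :: "bool list list" where
  "mu_palindromes = [[], [\<zero>], [\<one>], [\<zero>, \<zero>], [\<one>, \<one>], [\<zero>, \<one>, \<zero>], [\<one>, \<zero>, \<one>], [\<zero>, \<one>, \<one>, \<zero>], [\<one>, \<zero>, \<zero>, \<one>],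
    [\<zero>, \<one>, \<zero>, \<one>, \<zero>], [\<zero>, \<zero>, \<one>, \<one>, \<zero>, \<zero>], [\<zero>, \<one>, \<zero>, \<zero>, \<one>, \<zero>], [\<one>, \<one>, \<zero>, \<zero>, \<one>, \<one>],
    [\<zero>, \<zero>, \<one>, \<zero>, \<one>, \<zero>, \<zero>], [\<zero>, \<one>, \<one>, \<zero>, \<zero>, \<one>, \<one>, \<zero>], [\<one>, \<zero>, \<zero>, \<one>, \<one>, \<zero>, \<zero>, \<one>],
    [\<one>, \<zero>, \<one>, \<zero>, \<zero>, \<one>, \<zero>, \<one>], [\<one>, \<zero>, \<zero>, \<one>, \<zero>, \<one>, \<zero>, \<zero>, \<one>]]"

lemma mu_palindromes: "palindromes (factors (morph_word mu p)) = set mu_palindromes"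
  unfolding factors_mu'[symmetric]
proof (rule palindromes_eq)
  show "palindrome_list (pair_words mu' 3) [False, True] mu_palindromes" by code_simp
  show "list_all (\<lambda>v. length v + 2 \<le> 18) mu_palindromes" by code_simp
  show "v \<in> factors (morph_word mu' p)" if "list_ex (contains v) (pair_words mu' 3)" for v
    using mu'_nonerasing that by (rule pair_words_factors)
  show "v \<in> factors (morph_word mu' p)" if "a @ v @ b \<in> factors (morph_word mu' p)" for a v b
    using that by (rule factors_infix)
qed (rule bool_list_UNIV mu'_short; assumption)+

lemma card_mu_palindromes: "card (palindromes (factors (morph_word mu p))) = 18"
proof -
  have "distinct mu_palindromes" "length mu_palindromes = 18" by code_simp+
  then show ?thesis unfolding mu_palindromes using distinct_card by metis
qed

definition nu_palindromes :: "bool list list" where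
  "nu_palindromes = [[], [\<zero>], [\<one>], [\<zero>, \<zero>], [\<one>, \<one>], [\<zero>, \<one>, \<zero>], [\<one>, \<zero>, \<one>], [\<zero>, \<one>, \<one>, \<zero>], [\<one>, \<zero>, \<zero>, \<one>],
    [\<zero>, \<zero>, \<one>, \<zero>, \<zero>], [\<zero>, \<zero>, \<one>, \<one>, \<zero>, \<zero>], [\<one>, \<one>, \<zero>, \<zero>, \<one>, \<one>], [\<one>, \<zero>, \<zero>, \<one>, \<zero>, \<zero>, \<one>],
    [\<zero>, \<one>, \<one>, \<zero>, \<zero>, \<one>, \<one>, \<zero>], [\<one>, \<zero>, \<zero>, \<one>, \<one>, \<zero>, \<zero>, \<one>], [\<one>, \<one>, \<zero>, \<zero>, \<one>, \<zero>, \<zero>, \<one>, \<one>],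
    [\<zero>, \<one>, \<zero>, \<zero>, \<one>, \<one>, \<zero>, \<zero>, \<one>, \<zero>], [\<zero>, \<one>, \<one>, \<zero>, \<zero>, \<one>, \<zero>, \<zero>, \<one>, \<one>, \<zero>],
    [\<zero>, \<zero>, \<one>, \<one>, \<zero>, \<zero>, \<one>, \<zero>, \<zero>, \<one>, \<one>, \<zero>, \<zero>], [\<one>, \<zero>, \<zero>, \<one>, \<one>, \<zero>, \<zero>, \<one>, \<zero>, \<zero>, \<one>, \<one>, \<zero>, \<zero>, \<one>]]"

lemma nu_palindromes: "palindromes (factors (morph_word nu p)) = set nu_palindromes"
proof (rule palindromes_eq)
  show "palindrome_list (pair_words nu 5) [False, True] nu_palindromes" by code_simp
  show "list_all (\<lambda>v. length v + 2 \<le> 17) nu_palindromes" by code_simp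
  show "v \<in> factors (morph_word nu p)" if "list_ex (contains v) (pair_words nu 5)" for v
    using nu_nonerasing that by (rule pair_words_factors)
  show "v \<in> factors (morph_word nu p)" if "a @ v @ b \<in> factors (morph_word nu p)" for a v b
    using that by (rule factors_infix)
qed (rule bool_list_UNIV nu_short; assumption)+

lemma card_nu_palindromes: "card (palindromes (factors (morph_word nu p))) = 20"
proof -
  have "distinct nu_palindromes" "length nu_palindromes = 20" by code_simp+
  then show ?thesis unfolding nu_palindromes using distinct_card by metis
qed

section \<open>From languages back to infinite words\<close>

lemma mu_bi_infinite:
  assumes "power_free (13/5) (bi_factors x)" "finite (palindromes (bi_factors x))"
    "card (palindromes (bi_factors x)) \<le> 18"
  shows "bi_factors x \<in> {factors (morph_word mu p), factors (complement (morph_word mu p)),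
    left_factors (morph_word mu p), left_factors (complement (morph_word mu p))}"
proof -
  have "bi_factors x \<in> candidates 13 5 18"
    using assms bi_factors_bi_extendable by (simp add: candidates_def)
  then show ?thesis unfolding left_factors_eq factors_complement
    using mu_classification bi_factors_joint by blast
qed

text \<open>Stated for languages, so that it serves right-infinite and bi-infinite recurrent words
  alike.\<close>

lemma nu_irreducible:
  assumes "bi_extendable L" "irreducible_language L" "power_free (28/11) L" "finite (palindromes L)"
    "card (palindromes L) \<le> 20"
  shows "L \<in> {factors (morph_word nu p), factors (complement (morph_word nu p)),
    left_factors (morph_word nu p), left_factors (complement (morph_word nu p))}"
proof -
  have "L \<in> candidates 28 11 20" using assms by (simp add: candidates_def)
  then show ?thesis unfolding left_factors_eq factors_complement
    using nu_classification assms(2) by blast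
qed

theorem theorem7:
  shows
    "(power_plus_free (28/11) (factors (morph_word mu p)) \<and>
      card (palindromes (factors (morph_word mu p))) = 18 \<and>
      (\<forall>x :: int \<Rightarrow> bool.
         power_free (13/5) (bi_factors x) \<and>
         finite (palindromes (bi_factors x)) \<and> card (palindromes (bi_factors x)) \<le> 18 \<longrightarrow>
         bi_factors x \<in>
           {factors (morph_word mu p), factors (complement (morph_word mu p)),
            left_factors (morph_word mu p), left_factors (complement (morph_word mu p))}))
     \<and>
     (power_plus_free (5/2) (factors (morph_word nu p)) \<and>
      card (palindromes (factors (morph_word nu p))) = 20 \<and>
      (\<forall>x :: nat \<Rightarrow> bool.
         recurrent x \<and> power_free (28/11) (factors x) \<and>
         finite (palindromes (factors x)) \<and> card (palindromes (factors x)) \<le> 20 \<longrightarrow>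
         factors x \<in>
           {factors (morph_word nu p), factors (complement (morph_word nu p)),
            left_factors (morph_word nu p), left_factors (complement (morph_word nu p))}) \<and>
      (\<forall>x :: int \<Rightarrow> bool.
         bi_recurrent x \<and> power_free (28/11) (bi_factors x) \<and>
         finite (palindromes (bi_factors x)) \<and> card (palindromes (bi_factors x)) \<le> 20 \<longrightarrow>
         bi_factors x \<in>
           {factors (morph_word nu p), factors (complement (morph_word nu p)),
            left_factors (morph_word nu p), left_factors (complement (morph_word nu p))}))"
proof (intro conjI allI impI)
  show "power_plus_free (28/11) (factors (morph_word mu p))" by (rule mu_power_plus_free)
  show "card (palindromes (factors (morph_word mu p))) = 18" by (rule card_mu_palindromes)
  show "power_plus_free (5/2) (factors (morph_word nu p))" by (rule nu_power_plus_free)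
  show "card (palindromes (factors (morph_word nu p))) = 20" by (rule card_nu_palindromes)
qed (use mu_bi_infinite nu_irreducible recurrent_bi_extendable recurrent_irreducible
    bi_factors_bi_extendable bi_recurrent_irreducible in blast)+

end
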